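(* Let $H_3$ be the three-dimensional Heisenberg group, $E^5\to H_3$ a principal $T^2$-bundle, and let $(g,\sigma,\psi_+,\psi_-)$ be a nearly Kähler structure on $E^5\times(s_0-\varepsilon,s_0+\varepsilon)$, $0<\varepsilon<s_0$, obtained from left-invariant data on $H_3$ as described in the context (left-invariant $\alpha_0,\alpha_1,\alpha_2$ and constant $f>4$, $g_{UU},g_{UV},g_{VV}$ on $H_3$ at $s=s_0$). Put $C:=s_0h(s_0)$. Then there are a basis $\sigma_0,\sigma_1,\sigma_2$ of left-invariant one-forms on $H_3$ with $$d\sigma_0=\sigma_1\wedge\sigma_2,\qquad d\sigma_1=d\sigma_2=0,$$ and a constant matrix in $\mathrm{SL}(2,\mathbb R)$ such that, after replacing $(\vartheta_1,\vartheta_2)$ by its image under this matrix (keeping the notation $\vartheta_1,\vartheta_2$), the structure is given by $$g=\frac{s^2}{9(C^2-s^4)}ds^{\otimes2}+\frac Cs\bigl(\vartheta_1^{\otimes2}+\vartheta_2^{\otimes2}\bigr)+\frac{s^2(C^2-s_0^4)}{16C^4}\Bigl(\Bigl(\tfrac{C^2-s_0^4}{C^2-s^4}\Bigr)^{1/3}\sigma_0^{\otimes2}+\frac Cs\Bigl(\tfrac{C^2-s^4}{C^2-s_0^4}\Bigr)^{1/3}\bigl(\sigma_1^{\otimes2}+\sigma_2^{\otimes2}\bigr)\Bigr),$$ $$\sigma=\frac{s^2}{12C^2}\Bigl(\tfrac{C^2-s_0^4}{C^2-s^4}\Bigr)^{2/3}ds\wedge\sigma_0+s\,\vartheta_1\wedge\vartheta_2+\frac{C^2-s_0^4}{4C^2}\Bigl(\tfrac{C^2-s^4}{C^2-s_0^4}\Bigr)^{2/3}(\vartheta_2\wedge\sigma_1-\vartheta_1\wedge\sigma_2)-\frac{s^3(C^2-s_0^4)}{16C^4}\Bigl(\tfrac{C^2-s^4}{C^2-s_0^4}\Bigr)^{1/3}\sigma_1\wedge\sigma_2,$$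 $$\psi_+=\frac13ds\wedge\Bigl(\vartheta_1\wedge\vartheta_2+\frac{s^3}{4C^2}\Bigl(\tfrac{C^2-s_0^4}{C^2-s^4}\Bigr)^{1/3}(\vartheta_1\wedge\sigma_2-\vartheta_2\wedge\sigma_1)\Bigr)-\frac{C^2-s_0^4}{16C^4}\Bigl(\frac{s^2}{3}\Bigl(\tfrac{C^2-s^4}{C^2-s_0^4}\Bigr)^{1/3}ds\wedge\sigma_1\wedge\sigma_2+Cs\,(\vartheta_1\wedge\sigma_1+\vartheta_2\wedge\sigma_2)\wedge\sigma_0\Bigr),$$ $$\psi_-=\frac{s}{12C}\Bigl(\tfrac{C^2-s_0^4}{C^2-s^4}\Bigr)^{1/3}ds\wedge(\vartheta_1\wedge\sigma_1+\vartheta_2\wedge\sigma_2)+\frac{C^2-s_0^4}{4C^2}\Bigl(\tfrac{C^2-s^4}{C^2-s_0^4}\Bigr)^{1/3}\vartheta_1\wedge\vartheta_2\wedge\sigma_0+\frac{s^2(C^2-s_0^4)}{16C^4}\Bigl(s(\vartheta_1\wedge\sigma_2-\vartheta_2\wedge\sigma_1)-\frac{(C^2-s_0^4)^{1/3}(C^2-s^4)^{2/3}}{4C^2}\sigma_1\wedge\sigma_2\Bigr)\wedge\sigma_0 .$$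
   Context: $H_3$ is the group of real matrices $\begin{pmatrix}1&a&b\\0&1&c\\0&0&1\end{pmatrix}$. Nearly Kähler structure: an $\mathrm{SU}(3)$-structure $(g,J,\psi_{\mathbb C}=\psi_++i\psi_-)$ on a six-manifold with $\sigma=g(J\cdot,\cdot)$, so that pointwise there is an orthonormal basis $\{F_k,JF_k\}_{k=1,2,3}$ with dual basis $\{f_k,Jf_k\}$ ($Jf_k$ dual to $JF_k$) such that $\sigma=\sum_kf_k\wedge Jf_k$, $\psi_{\mathbb C}=(f_1+iJf_1)\wedge(f_2+iJf_2)\wedge(f_3+iJf_3)$, which satisfies $d\sigma=3\psi_+$ and $d\psi_-=-2\sigma\wedge\sigma$. Forms on $H_3$ are identified with their pull-backs. Structures obtained from left-invariant data. At $s=s_0$ one is given a constant $f>4$, a basis of left-invariant one-forms $\alpha_0,\alpha_1,\alpha_2$ on $H_3$ with $d\alpha_0=f\alpha_1\wedge\alpha_2$, $d\alpha_1\wedge\alpha_0=0=d\alpha_2\wedge\alpha_0$, and a constant positive definite matrix $\begin{pmatrix} g_{UU} & g_{UV} \\ g_{UV} & g_{VV} \end{pmatrix}$ with determinant $h(s_0)^2$, $h(s_0)>0$, where $s_0=(1-4/f)^{1/2}h(s_0)$; $E^5\to H_3$ is a principal $T^2$-bundle with a connection one-form $(\vartheta_1,\vartheta_2)$ satisfying $$s_0\,d\vartheta_1=d\alpha_1-\tfrac{3}{h^2-s_0^2}(g_{UV}\alpha_1+g_{VV}\alpha_2)\wedge\alpha_0,\qquad s_0\,d\vartheta_2=d\alpha_2+\tfrac{3}{h^2-s_0^2}(g_{UU}\alpha_1+g_{UV}\alpha_2)\wedge\alpha_0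 .$$ The structure on $E^5\times(s_0-\varepsilon,s_0+\varepsilon)$, with $s$ the coordinate on the interval, is nearly Kähler and is given in terms of smooth $s$-dependent extensions of these data (left-invariant one-forms $\alpha_i$ on $H_3$ forming a basis, functions $g_{UU},g_{UV},g_{VV}$ constant on $H_3$ forming a positive definite matrix with $h^2:=g_{UU}g_{VV}-g_{UV}^2>s^2$, $h>0$, and connection one-forms $(\vartheta_1,\vartheta_2)$ on $E^5$) by $$g=\frac{ds^{\otimes2}}{9(h^2-s^2)}+g_{UU}\vartheta_1^{\otimes2}+g_{VV}\vartheta_2^{\otimes2}+g_{UV}(\vartheta_1\otimes\vartheta_2+\vartheta_2\otimes\vartheta_1)+\frac{1}{h^2-s^2}\Bigl(\alpha_0^{\otimes2}+g_{UU}\alpha_1^{\otimes2}+g_{VV}\alpha_2^{\otimes2}+g_{UV}(\alpha_1\otimes\alpha_2+\alpha_2\otimes\alpha_1)\Bigr),$$ $$\sigma=\frac{1}{3(h^2-s^2)}ds\wedge\alpha_0+s\,\vartheta_1\wedge\vartheta_2-\vartheta_1\wedge\alpha_2+\vartheta_2\wedge\alpha_1-\frac{s}{h^2-s^2}\alpha_1\wedge\alpha_2,$$ $$\psi_+=\frac{1}{3(h^2-s^2)}ds\wedge\Bigl((h^2-s^2)\vartheta_1\wedge\vartheta_2+s(\vartheta_1\wedge\alpha_2-\vartheta_2\wedge\alpha_1)-\alpha_1\wedge\alpha_2\Bigr)-\frac{1}{h^2-s^2}\Bigl(\vartheta_1\wedge(g_{UU}\alpha_1+g_{UV}\alpha_2)+\vartheta_2\wedge(g_{UV}\alpha_1+g_{VV}\alpha_2)\Bigr)\wedge\alpha_0,$$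 $$\psi_-=\frac{1}{3(h^2-s^2)}ds\wedge\Bigl(\vartheta_1\wedge(g_{UU}\alpha_1+g_{UV}\alpha_2)+\vartheta_2\wedge(g_{UV}\alpha_1+g_{VV}\alpha_2)\Bigr)+\frac{1}{h^2-s^2}\Bigl((h^2-s^2)\vartheta_1\wedge\vartheta_2+s(\vartheta_1\wedge\alpha_2-\vartheta_2\wedge\alpha_1)-\alpha_1\wedge\alpha_2\Bigr)\wedge\alpha_0 .$$ *)

theory Defs
  imports "HOL-Analysis.Analysis" "HOL-Library.Function_Algebras"
begin

section \<open>Smooth maps between open subsets of Euclidean spaces\<close>

text \<open>For an open set S and a finite-dimensional domain this is the usual notion of a smooth map:
  all iterated directional derivatives exist and are differentiable, hence continuous, on S.\<close>

coinductive smooth_on :: "'a::euclidean_space set \<Rightarrow> ('a \<Rightarrow> 'b::real_normed_vector) \<Rightarrow> bool"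
  for S :: "'a set" where
  "(\<And>x. x \<in> S \<Longrightarrow> f differentiable (at x)) \<Longrightarrow>
   (\<And>v. smooth_on S (\<lambda>x. frechet_derivative f (at x) v)) \<Longrightarrow> smooth_on S f"


section \<open>Smooth manifolds\<close>

text \<open>A chart is a pair of its domain and its coordinate map; the values of the coordinate map
  outside of the domain are irrelevant. The atlas is not required to be maximal.\<close>

type_synonym ('m, 'v) chart = "'m set \<times> ('m \<Rightarrow> 'v)"

datatype ('m, 'v) manifold = Manifold (mtop: "'m topology") (atlas: "('m, 'v) chart set")

abbreviation points :: "('m, 'v) manifold \<Rightarrow> 'm set" where
  "points M \<equiv> topspace (mtop M)"

abbreviation chart_inv :: "('m, 'v) chart \<Rightarrow> 'v \<Rightarrow> 'm" where
  "chart_inv c \<equiv> inv_into (fst c) (snd c)"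

definition smooth_manifold :: "('m, 'v::euclidean_space) manifold \<Rightarrow> bool" where
  "smooth_manifold M \<longleftrightarrow>
     Hausdorff_space (mtop M) \<and> second_countable (mtop M) \<and>
     (\<Union>c\<in>atlas M. fst c) = points M \<and>
     (\<forall>(U, \<phi>)\<in>atlas M. openin (mtop M) U \<and> open (\<phi> ` U) \<and>
        homeomorphic_map (subtopology (mtop M) U) (top_of_set (\<phi> ` U)) \<phi>) \<and>
     (\<forall>(U, \<phi>)\<in>atlas M. \<forall>(V, \<kappa>)\<in>atlas M. smooth_on (\<phi> ` (U \<inter> V)) (\<kappa> \<circ> chart_inv (U, \<phi>)))"

definition smooth_map ::
  "('m, 'v::euclidean_space) manifold \<Rightarrow> ('n, 'w::euclidean_space) manifold \<Rightarrow> ('m \<Rightarrow> 'n) \<Rightarrow> bool" where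
  "smooth_map M N F \<longleftrightarrow>
     continuous_map (mtop M) (mtop N) F \<and>
     (\<forall>(U, \<phi>)\<in>atlas M. \<forall>(V, \<kappa>)\<in>atlas N.
        smooth_on (\<phi> ` (U \<inter> F -` V)) (\<kappa> \<circ> F \<circ> chart_inv (U, \<phi>)))"

definition diffeomorphism ::
  "('m, 'v::euclidean_space) manifold \<Rightarrow> ('n, 'w::euclidean_space) manifold \<Rightarrow> ('m \<Rightarrow> 'n) \<Rightarrow> bool" where
  "diffeomorphism M N F \<longleftrightarrow>
     bij_betw F (points M) (points N) \<and> smooth_map M N F \<and> smooth_map N M (inv_into (points M) F)"

definition prod_manifold ::
  "('m, 'v) manifold \<Rightarrow> ('n, 'w) manifold \<Rightarrow> ('m \<times> 'n, 'v \<times> 'w) manifold" (infixr "\<times>\<^sub>M\<^sub>f" 80) where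
  "M \<times>\<^sub>M\<^sub>f N = Manifold (prod_topology (mtop M) (mtop N))
     {(U \<times> V, map_prod \<phi> \<kappa>) | U \<phi> V \<kappa>. (U, \<phi>) \<in> atlas M \<and> (V, \<kappa>) \<in> atlas N}"

definition open_submanifold :: "('m, 'v) manifold \<Rightarrow> 'm set \<Rightarrow> ('m, 'v) manifold" where
  "open_submanifold M W = Manifold (subtopology (mtop M) W) {(U \<inter> W, \<phi>) | U \<phi>. (U, \<phi>) \<in> atlas M}"

definition interval :: "real \<Rightarrow> real \<Rightarrow> (real, real) manifold" where
  "interval a b = Manifold (top_of_set {a<..<b}) {({a<..<b}, id)}"


section \<open>Tangent vectors\<close>

text \<open>A tangent vector at p is a derivation acting on the real functions that are smooth near p, in
  coordinates a directional derivative. By convention it is 0 on all other functions, so that equal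
  tangent vectors are equal as HOL functions and the vector space operations are the pointwise
  ones.\<close>

type_synonym 'm tvec = "('m \<Rightarrow> real) \<Rightarrow> real"

definition smooth_at :: "('m, 'v::euclidean_space) manifold \<Rightarrow> 'm \<Rightarrow> ('m \<Rightarrow> real) \<Rightarrow> bool" where
  "smooth_at M p u \<longleftrightarrow> (\<exists>W. openin (mtop M) W \<and> p \<in> W \<and>
     (\<forall>(U, \<phi>)\<in>atlas M. smooth_on (\<phi> ` (U \<inter> W)) (u \<circ> chart_inv (U, \<phi>))))"

definition coord_vec ::
  "('m, 'v::euclidean_space) manifold \<Rightarrow> ('m, 'v) chart \<Rightarrow> 'm \<Rightarrow> 'v \<Rightarrow> 'm tvec" where
  "coord_vec M c p v =
     (\<lambda>u. if smooth_at M p u then frechet_derivative (u \<circ> chart_inv c) (at (snd c p)) v else 0)"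

definition tangent_space :: "('m, 'v::euclidean_space) manifold \<Rightarrow> 'm \<Rightarrow> 'm tvec set" where
  "tangent_space M p = {coord_vec M c p v | c v. c \<in> atlas M \<and> p \<in> fst c}"

text \<open>The components of a tangent vector with respect to a chart; inverse to
  \<^term>\<open>coord_vec M c p\<close>.\<close>

definition vec_components :: "('m, 'v::euclidean_space) chart \<Rightarrow> 'm tvec \<Rightarrow> 'v" where
  "vec_components c X = (\<Sum>b\<in>Basis. X (\<lambda>q. snd c q \<bullet> b) *\<^sub>R b)"

definition pushforward ::
  "('n, 'w::euclidean_space) manifold \<Rightarrow> ('m \<Rightarrow> 'n) \<Rightarrow> 'm \<Rightarrow> 'm tvec \<Rightarrow> 'n tvec" where
  "pushforward N F p X = (\<lambda>u. if smooth_at N (F p) u then X (u \<circ> F) else 0)"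

text \<open>The velocity at time 0 of a curve in M.\<close>

definition velocity :: "('m, 'v::euclidean_space) manifold \<Rightarrow> (real \<Rightarrow> 'm) \<Rightarrow> 'm tvec" where
  "velocity M c = (\<lambda>u. if smooth_at M (c 0) u then deriv (u \<circ> c) 0 else 0)"


section \<open>Covariant tensors and differential forms\<close>

text \<open>A covariant tensor on a vector space with elements of type 'x is encoded as a function of the
  list of its arguments; a tensor of degree k vanishes on lists of length other than k. Since the
  degree can be read off from the list, products need no degree arguments.\<close>

type_synonym ('x, 'k) tensor = "'x list \<Rightarrow> 'k"

type_synonym 'm field = "'m \<Rightarrow> ('m tvec, real) tensor"

definition scale :: "'k::comm_ring_1 \<Rightarrow> ('x, 'k) tensor \<Rightarrow> ('x, 'k) tensor" (infixr "\<odot>" 75) where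
  "c \<odot> a = (\<lambda>Xs. c * a Xs)"

definition tensor_prod ::
  "('x, 'k::comm_ring_1) tensor \<Rightarrow> ('x, 'k) tensor \<Rightarrow> ('x, 'k) tensor" (infixl "\<otimes>" 70) where
  "a \<otimes> b = (\<lambda>Xs. \<Sum>k\<le>length Xs. a (take k Xs) * b (drop k Xs))"

abbreviation tsquare :: "('x, 'k::comm_ring_1) tensor \<Rightarrow> ('x, 'k) tensor" where
  "tsquare a \<equiv> a \<otimes> a"

text \<open>The sum over all shuffles, i.e. without factorials: for one-forms,
  (a \<and> b)(X, Y) = a(X) b(Y) - a(Y) b(X). The sign is that of the shuffle that lists the positions in
  I before the others.\<close>

definition wedge ::
  "('x, 'k::comm_ring_1) tensor \<Rightarrow> ('x, 'k) tensor \<Rightarrow> ('x, 'k) tensor" (infixl "\<^bold>\<and>" 70) where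
  "a \<^bold>\<and> b = (\<lambda>Xs. \<Sum>I\<in>Pow {..<length Xs}.
     (- 1) ^ card {(i, j). i \<in> I \<and> j \<in> {..<length Xs} - I \<and> j < i} * a (nths Xs I) * b (nths Xs (- I)))"

definition lin_comb :: "real \<Rightarrow> 'm tvec \<Rightarrow> real \<Rightarrow> 'm tvec \<Rightarrow> 'm tvec" where
  "lin_comb a X b Y = (\<lambda>u. a * X u + b * Y u)"

definition multilinear_on :: "'m tvec set \<Rightarrow> nat \<Rightarrow> ('m tvec, real) tensor \<Rightarrow> bool" where
  "multilinear_on T k \<omega> \<longleftrightarrow>
     (\<forall>Xs\<in>lists T. length Xs \<noteq> k \<longrightarrow> \<omega> Xs = 0) \<and>
     (\<forall>Xs\<in>lists T. \<forall>Ys\<in>lists T. \<forall>X\<in>T. \<forall>Y\<in>T. \<forall>a b.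
        \<omega> (Xs @ [lin_comb a X b Y] @ Ys) = a * \<omega> (Xs @ [X] @ Ys) + b * \<omega> (Xs @ [Y] @ Ys))"

definition tensor_field :: "('m, 'v::euclidean_space) manifold \<Rightarrow> nat \<Rightarrow> 'm field \<Rightarrow> bool" where
  "tensor_field M k \<omega> \<longleftrightarrow>
     (\<forall>p\<in>points M. multilinear_on (tangent_space M p) k (\<omega> p)) \<and>
     (\<forall>c\<in>atlas M. \<forall>vs. smooth_on (snd c ` fst c)
        (\<lambda>x. \<omega> (chart_inv c x) (map (coord_vec M c (chart_inv c x)) vs)))"

definition diff_form :: "('m, 'v::euclidean_space) manifold \<Rightarrow> nat \<Rightarrow> 'm field \<Rightarrow> bool" where
  "diff_form M k \<omega> \<longleftrightarrow> tensor_field M k \<omega> \<and>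
     (\<forall>p\<in>points M. \<forall>Xs\<in>lists (tangent_space M p). \<not> distinct Xs \<longrightarrow> \<omega> p Xs = 0)"

text \<open>Only the values on tangent vectors are meaningful, so this is the right notion of
  equality.\<close>

definition field_eq :: "('m, 'v::euclidean_space) manifold \<Rightarrow> 'm field \<Rightarrow> 'm field \<Rightarrow> bool" where
  "field_eq M \<omega> \<eta> \<longleftrightarrow> (\<forall>p\<in>points M. \<forall>Xs\<in>lists (tangent_space M p). \<omega> p Xs = \<eta> p Xs)"

definition pullback ::
  "('n, 'w::euclidean_space) manifold \<Rightarrow> ('m \<Rightarrow> 'n) \<Rightarrow> 'n field \<Rightarrow> 'm field" where
  "pullback N F \<omega> = (\<lambda>p Xs. \<omega> (F p) (map (pushforward N F p) Xs))"

text \<open>The differential of a function.\<close>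

definition differential :: "('m \<Rightarrow> real) \<Rightarrow> 'm field" where
  "differential u = (\<lambda>p Xs. case Xs of [X] \<Rightarrow> X u | _ \<Rightarrow> 0)"

text \<open>The exterior derivative, computed at p in some chart around p (for smooth forms on a smooth
  manifold the result does not depend on the chart):
  d \<omega> (v_0, ..., v_k) is the sum over i of (-1)^i D_{v_i} (\<omega> (v_0, ..., v_{i-1}, v_{i+1}, ..., v_k)),
  where the v_j are extended to vector fields with constant components.\<close>

definition ext_deriv :: "('m, 'v::euclidean_space) manifold \<Rightarrow> 'm field \<Rightarrow> 'm field" where
  "ext_deriv M \<omega> = (\<lambda>p Xs.
     let c = (SOME c. c \<in> atlas M \<and> p \<in> fst c);
         vs = map (vec_components c) Xs
     in \<Sum>i<length vs. (- 1) ^ i *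
          frechet_derivative
            (\<lambda>x. \<omega> (chart_inv c x) (map (coord_vec M c (chart_inv c x)) (nths vs (- {i}))))
            (at (snd c p)) (vs ! i))"


section \<open>Nearly Kaehler structures\<close>

definition riemannian_metric :: "('m, 'v::euclidean_space) manifold \<Rightarrow> 'm field \<Rightarrow> bool" where
  "riemannian_metric M g \<longleftrightarrow> tensor_field M 2 g \<and>
     (\<forall>p\<in>points M. \<forall>X\<in>tangent_space M p. \<forall>Y\<in>tangent_space M p. g p [X, Y] = g p [Y, X]) \<and>
     (\<forall>p\<in>points M. \<forall>X\<in>tangent_space M p. X \<noteq> (\<lambda>_. 0) \<longrightarrow> g p [X, X] > 0)"

definition almost_complex_structure ::
  "('m, 'v::euclidean_space) manifold \<Rightarrow> ('m \<Rightarrow> 'm tvec \<Rightarrow> 'm tvec) \<Rightarrow> bool" where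
  "almost_complex_structure M J \<longleftrightarrow>
     (\<forall>p\<in>points M. \<forall>X\<in>tangent_space M p. J p X \<in> tangent_space M p \<and> J p (J p X) = lin_comb (- 1) X 0 X) \<and>
     (\<forall>p\<in>points M. \<forall>X\<in>tangent_space M p. \<forall>Y\<in>tangent_space M p. \<forall>a b.
        J p (lin_comb a X b Y) = lin_comb a (J p X) b (J p Y)) \<and>
     (\<forall>c\<in>atlas M. \<forall>v. smooth_on (snd c ` fst c)
        (\<lambda>x. vec_components c (J (chart_inv c x) (coord_vec M c (chart_inv c x) v))))"

text \<open>F k, J (F k), k = 1, 2, 3, is an orthonormal basis of T with dual basis f k, jf k.\<close>

definition adapted_basis ::
  "'m tvec set \<Rightarrow> ('m tvec, real) tensor \<Rightarrow> ('m tvec \<Rightarrow> 'm tvec) \<Rightarrow> (nat \<Rightarrow> 'm tvec) \<Rightarrow>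
   (nat \<Rightarrow> ('m tvec, real) tensor) \<Rightarrow> (nat \<Rightarrow> ('m tvec, real) tensor) \<Rightarrow> bool" where
  "adapted_basis T g J F f jf \<longleftrightarrow>
     (\<forall>k\<in>{1..3}. F k \<in> T \<and> J (F k) \<in> T) \<and>
     (\<forall>k\<in>{1..3}. \<forall>l\<in>{1..3}.
        g [F k, F l] = of_bool (k = l) \<and> g [J (F k), J (F l)] = of_bool (k = l) \<and> g [F k, J (F l)] = 0) \<and>
     (\<forall>k\<in>{1..3}. multilinear_on T 1 (f k) \<and> multilinear_on T 1 (jf k)) \<and>
     (\<forall>k\<in>{1..3}. \<forall>l\<in>{1..3}.
        f k [F l] = of_bool (k = l) \<and> f k [J (F l)] = 0 \<and>
        jf k [F l] = 0 \<and> jf k [J (F l)] = of_bool (k = l)) \<and>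
     (\<forall>X\<in>T. X = (\<lambda>u. \<Sum>k=1..3. f k [X] * F k u + jf k [X] * J (F k) u))"

definition SU3_structure ::
  "('m, 'v::euclidean_space) manifold \<Rightarrow> 'm field \<Rightarrow> ('m \<Rightarrow> 'm tvec \<Rightarrow> 'm tvec) \<Rightarrow>
   'm field \<Rightarrow> 'm field \<Rightarrow> 'm field \<Rightarrow> bool" where
  "SU3_structure M g J \<sigma> \<psi>p \<psi>m \<longleftrightarrow>
     smooth_manifold M \<and> DIM('v) = 6 \<and>
     riemannian_metric M g \<and> almost_complex_structure M J \<and>
     diff_form M 2 \<sigma> \<and> diff_form M 3 \<psi>p \<and> diff_form M 3 \<psi>m \<and>
     (\<forall>p\<in>points M. \<forall>X\<in>tangent_space M p. \<forall>Y\<in>tangent_space M p. \<sigma> p [X, Y] = g p [J p X, Y]) \<and>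
     (\<forall>p\<in>points M. \<exists>F f jf. adapted_basis (tangent_space M p) (g p) (J p) F f jf \<and>
        (\<forall>Xs\<in>lists (tangent_space M p).
           \<sigma> p Xs = (\<Sum>k=1..3. (f k \<^bold>\<and> jf k) Xs) \<and>
           Complex (\<psi>p p Xs) (\<psi>m p Xs) =
             ((\<lambda>Ys. Complex (f 1 Ys) (jf 1 Ys)) \<^bold>\<and>
              (\<lambda>Ys. Complex (f 2 Ys) (jf 2 Ys)) \<^bold>\<and>
              (\<lambda>Ys. Complex (f 3 Ys) (jf 3 Ys))) Xs))"

definition nearly_Kaehler ::
  "('m, 'v::euclidean_space) manifold \<Rightarrow> 'm field \<Rightarrow> ('m \<Rightarrow> 'm tvec \<Rightarrow> 'm tvec) \<Rightarrow>
   'm field \<Rightarrow> 'm field \<Rightarrow> 'm field \<Rightarrow> bool" where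
  "nearly_Kaehler M g J \<sigma> \<psi>p \<psi>m \<longleftrightarrow>
     SU3_structure M g J \<sigma> \<psi>p \<psi>m \<and>
     field_eq M (ext_deriv M \<sigma>) (\<lambda>p. 3 \<odot> \<psi>p p) \<and>
     field_eq M (ext_deriv M \<psi>m) (\<lambda>p. (- 2) \<odot> (\<sigma> p \<^bold>\<and> \<sigma> p))"


section \<open>The Heisenberg group\<close>

definition heis :: "real \<Rightarrow> real \<Rightarrow> real \<Rightarrow> real^3^3" where
  "heis a b c = vector [vector [1, a, b], vector [0, 1, c], vector [0, 0, 1]]"

definition H3_set :: "(real^3^3) set" where
  "H3_set = {heis a b c | a b c. True}"

definition H3 :: "(real^3^3, real \<times> real \<times> real) manifold" where
  "H3 = Manifold (top_of_set H3_set) {(H3_set, \<lambda>A. (A $ 1 $ 2, A $ 1 $ 3, A $ 2 $ 3))}"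

definition left_invariant :: "(real^3^3) field \<Rightarrow> bool" where
  "left_invariant \<omega> \<longleftrightarrow> diff_form H3 1 \<omega> \<and>
     (\<forall>A\<in>H3_set. field_eq H3 (pullback H3 (\<lambda>B. A ** B) \<omega>) \<omega>)"

definition left_invariant_basis ::
  "(real^3^3) field \<Rightarrow> (real^3^3) field \<Rightarrow> (real^3^3) field \<Rightarrow> bool" where
  "left_invariant_basis b0 b1 b2 \<longleftrightarrow>
     left_invariant b0 \<and> left_invariant b1 \<and> left_invariant b2 \<and>
     (\<forall>\<omega>. left_invariant \<omega> \<longrightarrow>
        (\<exists>!c::real^3. field_eq H3 \<omega> (\<lambda>p. c$1 \<odot> b0 p + c$2 \<odot> b1 p + c$3 \<odot> b2 p)))"


section \<open>Principal torus bundles over the Heisenberg group\<close>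

text \<open>The circle is the unit circle in the complex plane, with the angles as coordinates.\<close>

definition circle :: "(complex, real) manifold" where
  "circle = Manifold (top_of_set (sphere 0 1))
     {(sphere 0 1 - {- cis \<theta>}, \<lambda>z. \<theta> + Arg (z / cis \<theta>)) | \<theta>. True}"

definition T2 :: "(complex \<times> complex, real \<times> real) manifold" where
  "T2 = circle \<times>\<^sub>M\<^sub>f circle"

definition T2_mult :: "complex \<times> complex \<Rightarrow> complex \<times> complex \<Rightarrow> complex \<times> complex" where
  "T2_mult z w = (fst z * fst w, snd z * snd w)"

definition principal_T2_bundle ::
  "('e, 'v::euclidean_space) manifold \<Rightarrow> ('e \<Rightarrow> real^3^3) \<Rightarrow> ('e \<Rightarrow> complex \<times> complex \<Rightarrow> 'e) \<Rightarrow> bool" where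
  "principal_T2_bundle E \<pi> act \<longleftrightarrow>
     smooth_manifold E \<and> smooth_map E H3 \<pi> \<and>
     smooth_map (E \<times>\<^sub>M\<^sub>f T2) E (\<lambda>(p, z). act p z) \<and>
     (\<forall>p\<in>points E. act p (1, 1) = p) \<and>
     (\<forall>p\<in>points E. \<forall>z\<in>points T2. \<forall>w\<in>points T2. act (act p z) w = act p (T2_mult z w)) \<and>
     (\<forall>p\<in>points E. \<forall>z\<in>points T2. \<pi> (act p z) = \<pi> p) \<and>
     (\<forall>x\<in>points H3. \<exists>U \<kappa>. openin (mtop H3) U \<and> x \<in> U \<and>
        diffeomorphism (open_submanifold E (points E \<inter> \<pi> -` U)) (open_submanifold H3 U \<times>\<^sub>M\<^sub>f T2)
          (\<lambda>p. (\<pi> p, \<kappa> p)) \<and>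
        (\<forall>p\<in>points E \<inter> \<pi> -` U. \<forall>z\<in>points T2. \<kappa> (act p z) = T2_mult (\<kappa> p) z))"

text \<open>The Lie algebra of the torus is identified with R x R through the exponential map
  (x, y) \<mapsto> (cis x, cis y). A connection one-form is invariant (the torus is abelian) and
  reproduces the generators of the fundamental vector fields.\<close>

definition connection_form ::
  "('e, 'v::euclidean_space) manifold \<Rightarrow> ('e \<Rightarrow> complex \<times> complex \<Rightarrow> 'e) \<Rightarrow> 'e field \<Rightarrow> 'e field \<Rightarrow> bool" where
  "connection_form E act \<theta>1 \<theta>2 \<longleftrightarrow>
     diff_form E 1 \<theta>1 \<and> diff_form E 1 \<theta>2 \<and>
     (\<forall>z\<in>points T2. field_eq E (pullback E (\<lambda>p. act p z) \<theta>1) \<theta>1 \<and>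
                    field_eq E (pullback E (\<lambda>p. act p z) \<theta>2) \<theta>2) \<and>
     (\<forall>p\<in>points E.
        \<theta>1 p [velocity E (\<lambda>t. act p (cis t, 1))] = 1 \<and> \<theta>1 p [velocity E (\<lambda>t. act p (1, cis t))] = 0 \<and>
        \<theta>2 p [velocity E (\<lambda>t. act p (cis t, 1))] = 0 \<and> \<theta>2 p [velocity E (\<lambda>t. act p (1, cis t))] = 1)"


section \<open>Families of forms depending on the interval coordinate\<close>

text \<open>For a family \<beta> of tensors on N and a map F into N that is defined on the product of a
  manifold with an interval, the tensor on the product whose value at (p, s) is the pull-back
  of \<beta> s.\<close>

definition pullback_family ::
  "('n, 'w::euclidean_space) manifold \<Rightarrow> ('e \<times> real \<Rightarrow> 'n) \<Rightarrow> (real \<Rightarrow> 'n field) \<Rightarrow> ('e \<times> real) field" where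
  "pullback_family N F \<beta> = (\<lambda>q. pullback N F (\<beta> (snd q)) q)"

definition smooth_family ::
  "('m, 'v::euclidean_space) manifold \<Rightarrow> real \<Rightarrow> real \<Rightarrow> nat \<Rightarrow> (real \<Rightarrow> 'm field) \<Rightarrow> bool" where
  "smooth_family M a b k \<beta> \<longleftrightarrow> diff_form (M \<times>\<^sub>M\<^sub>f interval a b) k (pullback_family M fst \<beta>)"

end

theory Submission
  imports Defs
begin

text \<open>
  Evaluated on coordinate vectors at a point, the equations \<open>d\<sigma> = 3 \<psi>\<^sub>+\<close> and \<open>d\<psi>\<^sub>- = - 2 \<sigma> \<and> \<sigma>\<close> are
  algebraic relations between the coefficients of the invariant forms and their derivatives. They give the
  s-derivative of the connection forms as a combination of the invariant forms, so that the curvature, which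
  is horizontal at \<open>s\<^sub>0\<close>, stays horizontal. The remaining relations then say that \<open>\<alpha>\<^sub>1\<close> and \<open>\<alpha>\<^sub>2\<close> are closed, that
  \<open>s h\<close> is constant, and, with \<open>r = ((C\<^sup>2 - s\<^sup>4) / (C\<^sup>2 - s\<^sub>0\<^sup>4))\<^sup>1\<^sup>/\<^sup>3\<close>, that \<open>\<alpha>\<^sub>0 / r\<close>, \<open>\<alpha>\<^sub>1 / r\<^sup>2\<close>, \<open>\<alpha>\<^sub>2 / r\<^sup>2\<close>
  do not depend on s. Comparing the curvature at different s shows that the matrix \<open>s g\<close> is constant as
  well. The Cholesky factor of this matrix, normalised to determinant one, diagonalises the metric, and
  applying it to \<open>(\<alpha>\<^sub>1, \<alpha>\<^sub>2)\<close> yields the invariant basis.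
\<close>

section \<open>Smooth functions\<close>

text \<open>The choice of arguments separates the unknowns. On d/ds and a vertical vector the first
  equation contains no derivative of a connection form along E, so it governs the evolution of the
  connection while nothing is known about its curvature away from \<open>s\<^sub>0\<close>. The
  relations for the curvature and for d\<alpha>0 presuppose horizontality, which is why they can
  only come afterwards. On both vertical vectors the second equation leaves d\<alpha>0 = 4 h^2 /
  (h^2 - s^2) \<alpha>1 \<and> \<alpha>2. Exact invariant two-forms on H3 are multiples of da \<and>
  dc, so \<alpha>1 and \<alpha>2 lie in the span of the closed forms da and dc. The cube roots come
  from s^2 (h^2 - s^2) = Q with Q = C^2 - s^4: the logarithmic derivative of a coefficient of
  \<alpha>0 is Q' / (3 Q), and twice that for \<alpha>1 and \<alpha>2. The factor 4 h^2 / (h^2 -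
  s^2) equals 4 C^2 / Q at \<open>s\<^sub>0\<close>; multiplying the invariant forms by it
  normalises d\<sigma>0 to \<sigma>1 \<and> \<sigma>2, and this is the source of the constants 4 C^2
  and 16 C^4.\<close>

primrec diff_upto :: "nat \<Rightarrow> 'a::euclidean_space set \<Rightarrow> ('a \<Rightarrow> 'b::real_normed_vector) \<Rightarrow> bool" where
  "diff_upto 0 S f \<longleftrightarrow> True"
| "diff_upto (Suc n) S f \<longleftrightarrow> (\<forall>x\<in>S. f differentiable (at x)) \<and>
     (\<forall>v. diff_upto n S (\<lambda>x. frechet_derivative f (at x) v))"

text \<open>Replaces coinduction by induction on the order of differentiation. The derivative of a
  product or a composite is a sum of products, not again a single one, so the closure properties are
  proved for \<open>diff_upto n\<close> by induction and then transferred.\<close>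

lemma smooth_on_iff_diff_upto: "smooth_on S f \<longleftrightarrow> (\<forall>n. diff_upto n S f)"
proof
  assume "smooth_on S f"
  then have "diff_upto n S f" for n
  proof (induction n arbitrary: f)
    case (Suc n)
    from Suc.prems show ?case
      by (cases) (auto intro: Suc.IH)
  qed simp
  then show "\<forall>n. diff_upto n S f" ..
next
  assume "\<forall>n. diff_upto n S f"
  then show "smooth_on S f"
  proof (coinduction arbitrary: f)
    case (smooth_on f)
    have "diff_upto (Suc n) S f" for n
      using smooth_on by blast
    then show ?case by auto
  qed
qed

lemma smooth_on_differentiable: "smooth_on S f \<Longrightarrow> x \<in> S \<Longrightarrow> f differentiable (at x)"
  by (erule smooth_on.cases) auto

lemma smooth_on_derivative: "smooth_on S f \<Longrightarrow> smooth_on S (\<lambda>x. frechet_derivative f (at x) v)"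
  by (erule smooth_on.cases) auto

lemma smooth_on_has_derivative:
  "smooth_on S f \<Longrightarrow> x \<in> S \<Longrightarrow> (f has_derivative frechet_derivative f (at x)) (at x)"
  using smooth_on_differentiable frechet_derivative_works by blast

lemma smooth_on_continuous_on: "smooth_on S f \<Longrightarrow> continuous_on S f"
  by (meson continuous_at_imp_continuous_on differentiable_imp_continuous_within smooth_on_differentiable)

lemma diff_upto_Suc_imp: "diff_upto (Suc n) S f \<Longrightarrow> diff_upto n S f"
  by (induction n arbitrary: f) auto

lemma diff_upto_mono: "diff_upto n S f \<Longrightarrow> T \<subseteq> S \<Longrightarrow> diff_upto n T f"
  by (induction n arbitrary: f) auto

lemma smooth_on_subset: "smooth_on S f \<Longrightarrow> T \<subseteq> S \<Longrightarrow> smooth_on T f"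
  by (auto simp: smooth_on_iff_diff_upto intro: diff_upto_mono)

text \<open>\<open>frechet_derivative\<close> is a choice from all derivatives, hence determined by
  the predicate \<open>has_derivative\<close>, which is local. This is used wherever a coordinate
  formula holds only on the image of a chart.\<close>

lemma frechet_derivative_cong_open:
  assumes "open S" "x \<in> S" "\<And>y. y \<in> S \<Longrightarrow> f y = g y"
  shows "frechet_derivative f (at x) = frechet_derivative g (at x)"
proof -
  have "(f has_derivative D) (at x) \<longleftrightarrow> (g has_derivative D) (at x)" for D
    using assms has_derivative_transform_within_open by metis
  then show ?thesis by (simp add: frechet_derivative_def)
qed

lemma diff_upto_cong:
  assumes "open S"
  shows "(\<And>x. x \<in> S \<Longrightarrow> f x = g x) \<Longrightarrow> diff_upto n S f \<Longrightarrow> diff_upto n S g"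
proof (induction n arbitrary: f g)
  case (Suc n)
  have "g differentiable (at x)" if "x \<in> S" for x
    using Suc.prems that assms by (metis diff_upto.simps(2) differentiable_def has_derivative_transform_within_open)
  moreover have "diff_upto n S (\<lambda>x. frechet_derivative g (at x) v)" for v
  proof (rule Suc.IH)
    show "diff_upto n S (\<lambda>x. frechet_derivative f (at x) v)" using Suc.prems by simp
    show "frechet_derivative f (at x) v = frechet_derivative g (at x) v" if "x \<in> S" for x
      by (simp add: frechet_derivative_cong_open[OF assms that Suc.prems(1)])
  qed
  ultimately show ?case by simp
qed simp

lemma smooth_on_cong:
  "open S \<Longrightarrow> (\<And>x. x \<in> S \<Longrightarrow> f x = g x) \<Longrightarrow> smooth_on S f \<Longrightarrow> smooth_on S g"
  using diff_upto_cong[of S f g] by (auto simp: smooth_on_iff_diff_upto)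

text \<open>Any explicit derivative formula may replace \<open>frechet_derivative\<close>: the two
  agree on S, and S is open, so their further derivatives agree as well.\<close>

lemma diff_upto_SucI:
  assumes "open S" "\<And>x. x \<in> S \<Longrightarrow> (f has_derivative f' x) (at x)"
    and "\<And>v. diff_upto n S (\<lambda>x. f' x v)"
  shows "diff_upto (Suc n) S f"
proof -
  have "f' x v = frechet_derivative f (at x) v" if "x \<in> S" for x v
    using frechet_derivative_at[OF assms(2)[OF that]] by simp
  then have "diff_upto n S (\<lambda>x. frechet_derivative f (at x) v)" for v
    by (rule diff_upto_cong[OF assms(1)]) (use assms(3) in auto)
  then show ?thesis using assms(2) by (auto simp: differentiable_def)
qed

lemma diff_upto_has_derivative:
  "diff_upto (Suc n) S f \<Longrightarrow> x \<in> S \<Longrightarrow> (f has_derivative frechet_derivative f (at x)) (at x)"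
  using frechet_derivative_works by auto

lemma diff_upto_const: "diff_upto n S (\<lambda>x. c)"
  by (induction n arbitrary: c) (auto simp: frechet_derivative_const)

lemma diff_upto_bounded_linear_compose:
  assumes "open S" "bounded_linear L"
  shows "diff_upto n S f \<Longrightarrow> diff_upto n S (\<lambda>x. L (f x))"
proof (induction n arbitrary: f)
  case (Suc n)
  show ?case
    by (rule diff_upto_SucI[OF assms(1), where f'="\<lambda>x v. L (frechet_derivative f (at x) v)"])
       (use Suc.prems in \<open>auto intro: bounded_linear.has_derivative[OF assms(2)]
          diff_upto_has_derivative[OF Suc.prems] Suc.IH simp del: diff_upto.simps(1)\<close>)
qed simp

lemma diff_upto_add:
  assumes "open S"
  shows "diff_upto n S f \<Longrightarrow> diff_upto n S g \<Longrightarrow> diff_upto n S (\<lambda>x. f x + g x)"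
proof (induction n arbitrary: f g)
  case (Suc n)
  show ?case
    by (rule diff_upto_SucI[OF assms(1),
          where f'="\<lambda>x v. frechet_derivative f (at x) v + frechet_derivative g (at x) v"])
       (use Suc.prems in \<open>auto intro!: has_derivative_add diff_upto_has_derivative[OF Suc.prems(1)]
          diff_upto_has_derivative[OF Suc.prems(2)] Suc.IH\<close>)
qed simp

lemma diff_upto_scaleR:
  fixes f :: "'a::euclidean_space \<Rightarrow> real"
  assumes "open S"
  shows "diff_upto n S f \<Longrightarrow> diff_upto n S g \<Longrightarrow> diff_upto n S (\<lambda>x. f x *\<^sub>R g x)"
proof (induction n arbitrary: f g)
  case (Suc n)
  note IH = Suc.IH[OF diff_upto_Suc_imp[OF Suc.prems(1)]] Suc.IH[OF _ diff_upto_Suc_imp[OF Suc.prems(2)]]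
  show ?case
    by (rule diff_upto_SucI[OF assms(1),
          where f'="\<lambda>x v. f x *\<^sub>R frechet_derivative g (at x) v + frechet_derivative f (at x) v *\<^sub>R g x"])
       (use Suc.prems in \<open>auto intro!: has_derivative_scaleR diff_upto_has_derivative[OF Suc.prems(1)]
          diff_upto_has_derivative[OF Suc.prems(2)] diff_upto_add[OF assms] IH\<close>)
qed simp

lemma diff_upto_sum:
  assumes "open S" "\<And>i. i \<in> I \<Longrightarrow> diff_upto n S (f i)"
  shows "diff_upto n S (\<lambda>x. \<Sum>i\<in>I. f i x)"
  using assms(2)
  by (induction I rule: infinite_finite_induct) (auto simp: diff_upto_const intro!: diff_upto_add[OF assms(1)])

lemma diff_upto_compose:
  fixes g :: "'b::euclidean_space \<Rightarrow> 'c::real_normed_vector"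
  assumes "open S" "open T" "f ` S \<subseteq> T"
  shows "diff_upto n S f \<Longrightarrow> diff_upto n T g \<Longrightarrow> diff_upto n S (\<lambda>x. g (f x))"
proof (induction n arbitrary: g)
  case (Suc n)
  \<comment> \<open>The direction \<open>frechet_derivative f (at x) v\<close> varies with x,
    whereas the induction hypothesis covers derivatives of g in fixed directions only. Expanding it
    in \<open>Basis\<close> turns the chain rule into a sum of products.\<close>
  let ?D = "\<lambda>x v. \<Sum>b\<in>Basis. (frechet_derivative f (at x) v \<bullet> b) *\<^sub>R frechet_derivative g (at (f x)) b"
  have der: "((\<lambda>x. g (f x)) has_derivative ?D x) (at x)" if "x \<in> S" for x
  proof -
    have g: "(g has_derivative frechet_derivative g (at (f x))) (at (f x))"
      using diff_upto_has_derivative[OF Suc.prems(2)] that assms(3) by blast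
    have f: "(f has_derivative frechet_derivative f (at x)) (at x)"
      using diff_upto_has_derivative[OF Suc.prems(1)] that by blast
    have "frechet_derivative g (at (f x)) (frechet_derivative f (at x) v) = ?D x v" for v
    proof -
      have "frechet_derivative g (at (f x)) (frechet_derivative f (at x) v) =
        frechet_derivative g (at (f x)) (\<Sum>b\<in>Basis. (frechet_derivative f (at x) v \<bullet> b) *\<^sub>R b)"
        by (simp only: euclidean_representation)
      then show ?thesis
        using has_derivative_linear[OF g] by (simp only: linear_sum linear_cmul o_def)
    qed
    then show ?thesis
      using has_derivative_compose[OF f g] by (simp add: o_def)
  qed
  have "diff_upto n S (\<lambda>x. ?D x v)" for v
  proof (intro diff_upto_sum diff_upto_scaleR assms Suc.IH)
    fix b :: 'b
    show "diff_upto n S f" using Suc.prems diff_upto_Suc_imp by blast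
    show "diff_upto n T (\<lambda>y. frechet_derivative g (at y) b)" using Suc.prems by simp
    have "diff_upto n S (\<lambda>x. frechet_derivative f (at x) v)" using Suc.prems by simp
    then show "diff_upto n S (\<lambda>x. frechet_derivative f (at x) v \<bullet> b)"
      by (rule diff_upto_bounded_linear_compose[OF assms(1) bounded_linear_inner_left])
  qed
  then show ?case by (intro diff_upto_SucI[OF assms(1) der])
qed simp

lemma smooth_on_const: "smooth_on S (\<lambda>x. c)"
  by (simp add: smooth_on_iff_diff_upto diff_upto_const)

lemma smooth_on_bounded_linear_compose:
  "open S \<Longrightarrow> bounded_linear L \<Longrightarrow> smooth_on S f \<Longrightarrow> smooth_on S (\<lambda>x. L (f x))"
  by (simp add: smooth_on_iff_diff_upto diff_upto_bounded_linear_compose)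

lemma smooth_on_add: "open S \<Longrightarrow> smooth_on S f \<Longrightarrow> smooth_on S g \<Longrightarrow> smooth_on S (\<lambda>x. f x + g x)"
  by (simp add: smooth_on_iff_diff_upto diff_upto_add)

lemma smooth_on_scaleR:
  fixes f :: "'a::euclidean_space \<Rightarrow> real"
  shows "open S \<Longrightarrow> smooth_on S f \<Longrightarrow> smooth_on S g \<Longrightarrow> smooth_on S (\<lambda>x. f x *\<^sub>R g x)"
  by (simp add: smooth_on_iff_diff_upto diff_upto_scaleR)

lemma smooth_on_compose:
  fixes g :: "'b::euclidean_space \<Rightarrow> 'c::real_normed_vector"
  shows "open S \<Longrightarrow> open T \<Longrightarrow> f ` S \<subseteq> T \<Longrightarrow> smooth_on S f \<Longrightarrow> smooth_on T g \<Longrightarrow>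
    smooth_on S (\<lambda>x. g (f x))"
  by (simp add: smooth_on_iff_diff_upto diff_upto_compose)

lemma smooth_on_id: "smooth_on S (\<lambda>x. x)"
proof -
  have "diff_upto n S (\<lambda>x. x)" for n
    by (cases n) (auto simp: diff_upto_const frechet_derivative_id differentiable_ident)
  then show ?thesis by (simp add: smooth_on_iff_diff_upto)
qed

lemma smooth_on_bounded_linear:
  assumes "open S" "bounded_linear L"
  shows "smooth_on S L"
  using smooth_on_bounded_linear_compose[OF assms smooth_on_id] .

lemma smooth_on_Pair:
  assumes "open S" "smooth_on S f" "smooth_on S g"
  shows "smooth_on S (\<lambda>x. (f x, g x))"
proof -
  have "smooth_on S (\<lambda>x. (f x, 0) + (0, g x))"
    by (intro smooth_on_add assms smooth_on_bounded_linear_compose[where L="\<lambda>x. (x, 0)"]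
          smooth_on_bounded_linear_compose[where L="\<lambda>x. (0, x)"] bounded_linear_intros)
  then show ?thesis by simp
qed

text \<open>Both mixed derivatives are the limit of the second difference quotient, which by the mean
  value theorem is a value of either of them near the point.\<close>

lemma second_difference_mvt:
  fixes f :: "'a::euclidean_space \<Rightarrow> real"
  assumes h: "h > 0" and f: "smooth_on S f"
    and S: "\<And>a b. a \<in> {0..h} \<Longrightarrow> b \<in> {0..h} \<Longrightarrow> x + a *\<^sub>R v + b *\<^sub>R w \<in> S"
  shows "\<exists>a b. a \<in> {0..h} \<and> b \<in> {0..h} \<and>
    f (x + h *\<^sub>R v + h *\<^sub>R w) - f (x + h *\<^sub>R v) - f (x + h *\<^sub>R w) + f x =
    h\<^sup>2 * frechet_derivative (\<lambda>y. frechet_derivative f (at y) v) (at (x + a *\<^sub>R v + b *\<^sub>R w)) w"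
proof -
  let ?fv = "\<lambda>y. frechet_derivative f (at y) v"
  have df: "((\<lambda>t. f (x + t *\<^sub>R v + b *\<^sub>R w)) has_real_derivative ?fv (x + t *\<^sub>R v + b *\<^sub>R w)) (at t)"
    if "t \<in> {0..h}" "b \<in> {0..h}" for t b
  proof -
    have "((\<lambda>t. x + t *\<^sub>R v + b *\<^sub>R w) has_derivative (\<lambda>r. r *\<^sub>R v)) (at t)"
      by (auto intro!: derivative_eq_intros)
    from has_derivative_compose[OF this smooth_on_has_derivative[OF f S[OF that]]]
    show ?thesis
      using has_derivative_linear[OF smooth_on_has_derivative[OF f S[OF that]]]
      by (simp add: has_field_derivative_def linear_cmul mult_commute_abs)
  qed
  have dfv: "((\<lambda>t. ?fv (x + a *\<^sub>R v + t *\<^sub>R w)) has_real_derivative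
      frechet_derivative ?fv (at (x + a *\<^sub>R v + t *\<^sub>R w)) w) (at t)"
    if "a \<in> {0..h}" "t \<in> {0..h}" for t a
  proof -
    note fv = smooth_on_has_derivative[OF smooth_on_derivative[OF f, of v] S[OF that]]
    have "((\<lambda>t. x + a *\<^sub>R v + t *\<^sub>R w) has_derivative (\<lambda>r. r *\<^sub>R w)) (at t)"
      by (auto intro!: derivative_eq_intros)
    from has_derivative_compose[OF this fv]
    show ?thesis
      using has_derivative_linear[OF fv]
      by (simp add: has_field_derivative_def linear_cmul mult_commute_abs)
  qed
  let ?g = "\<lambda>t. f (x + t *\<^sub>R v + h *\<^sub>R w) - f (x + t *\<^sub>R v + 0 *\<^sub>R w)"
  have "\<exists>z. 0 < z \<and> z < h \<and> ?g h - ?g 0 =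
      (h - 0) * (?fv (x + z *\<^sub>R v + h *\<^sub>R w) - ?fv (x + z *\<^sub>R v + 0 *\<^sub>R w))"
    by (rule MVT2[OF h]) (use h in \<open>auto intro!: DERIV_diff df[where b=h] df[where b=0, simplified]\<close>)
  then obtain a where a: "0 < a" "a < h"
    and ga: "?g h - ?g 0 = h * (?fv (x + a *\<^sub>R v + h *\<^sub>R w) - ?fv (x + a *\<^sub>R v + 0 *\<^sub>R w))" by auto
  have "\<exists>z. 0 < z \<and> z < h \<and> ?fv (x + a *\<^sub>R v + h *\<^sub>R w) - ?fv (x + a *\<^sub>R v + 0 *\<^sub>R w) =
      (h - 0) * frechet_derivative ?fv (at (x + a *\<^sub>R v + z *\<^sub>R w)) w"
    by (rule MVT2[OF h]) (use a in \<open>auto intro!: dfv\<close>)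
  then obtain b where b: "0 < b" "b < h"
    and gb: "?fv (x + a *\<^sub>R v + h *\<^sub>R w) - ?fv (x + a *\<^sub>R v + 0 *\<^sub>R w) =
      h * frechet_derivative ?fv (at (x + a *\<^sub>R v + b *\<^sub>R w)) w" by auto
  show ?thesis
    using a b ga gb by (intro exI[of _ a] exI[of _ b]) (auto simp: power2_eq_square)
qed

lemma symmetric_second_derivative_real:
  fixes f :: "'a::euclidean_space \<Rightarrow> real"
  assumes "open S" and f: "smooth_on S f" and "x \<in> S"
  shows "frechet_derivative (\<lambda>y. frechet_derivative f (at y) v) (at x) w =
    frechet_derivative (\<lambda>y. frechet_derivative f (at y) w) (at x) v" (is "?fvw x = ?fwv x")
proof (rule ccontr)
  assume ne: "?fvw x \<noteq> ?fwv x"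
  define e where "e = \<bar>?fvw x - ?fwv x\<bar> / 2"
  have e: "e > 0" using ne by (simp add: e_def)
  have "continuous_on S ?fvw" "continuous_on S ?fwv"
    by (intro smooth_on_continuous_on smooth_on_derivative f)+
  then have "continuous (at x) ?fvw" "continuous (at x) ?fwv"
    using assms(1,3) by (simp_all add: continuous_on_eq_continuous_at)
  then obtain d1 d2 where d: "d1 > 0" "\<And>y. dist y x < d1 \<Longrightarrow> dist (?fvw y) (?fvw x) < e"
      "d2 > 0" "\<And>y. dist y x < d2 \<Longrightarrow> dist (?fwv y) (?fwv x) < e"
    using e unfolding continuous_at_eps_delta dist_norm by metis
  obtain d3 where d3: "d3 > 0" "ball x d3 \<subseteq> S" using assms(1,3) open_contains_ball by blast
  \<comment> \<open>All points of the parallelogram spanned by h v and h w lie within d / 2 of x,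
    hence in S and within reach of both continuity estimates. The summand 1 keeps N positive when v
    and w vanish.\<close>
  define d where "d = min d1 (min d2 d3)"
  define N where "N = norm v + norm w + 1"
  define h where "h = d / (2 * N)"
  have nv: "N > 0" by (simp add: N_def add_nonneg_pos)
  have d0: "d > 0" using d d3 by (simp add: d_def)
  then have h: "h > 0" using nv by (simp add: h_def)
  have near: "dist (x + a *\<^sub>R v + b *\<^sub>R w) x < d" if "a \<in> {0..h}" "b \<in> {0..h}" for a b
  proof -
    have "norm (a *\<^sub>R v + b *\<^sub>R w) \<le> h * norm v + h * norm w"
      using that by (intro order_trans[OF norm_triangle_ineq] add_mono) (auto intro!: mult_right_mono)
    also have "\<dots> \<le> h * N" using h by (simp add: N_def algebra_simps)
    also have "\<dots> = d / 2" using nv by (simp add: h_def)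
    finally show ?thesis using d0 by (simp add: dist_norm add.assoc)
  qed
  have inS: "x + a *\<^sub>R v + b *\<^sub>R w \<in> S" if "a \<in> {0..h}" "b \<in> {0..h}" for a b
  proof -
    have "dist (x + a *\<^sub>R v + b *\<^sub>R w) x < d3" using near[OF that] by (simp add: d_def)
    then show ?thesis using d3(2) by (auto simp: dist_commute)
  qed
  obtain a b where ab: "a \<in> {0..h}" "b \<in> {0..h}"
    "f (x + h *\<^sub>R v + h *\<^sub>R w) - f (x + h *\<^sub>R v) - f (x + h *\<^sub>R w) + f x = h\<^sup>2 * ?fvw (x + a *\<^sub>R v + b *\<^sub>R w)"
    using second_difference_mvt[OF h f inS] by blast
  have inS': "x + a *\<^sub>R w + b *\<^sub>R v \<in> S" if "a \<in> {0..h}" "b \<in> {0..h}" for a b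
    using inS[OF that(2,1)] by (simp add: ac_simps)
  obtain a' b' where ab': "a' \<in> {0..h}" "b' \<in> {0..h}"
    "f (x + h *\<^sub>R w + h *\<^sub>R v) - f (x + h *\<^sub>R w) - f (x + h *\<^sub>R v) + f x = h\<^sup>2 * ?fwv (x + a' *\<^sub>R w + b' *\<^sub>R v)"
    using second_difference_mvt[OF h f inS'] by blast
  have swap: "x + r *\<^sub>R w + t *\<^sub>R v = x + t *\<^sub>R v + r *\<^sub>R w" for r t :: real by (simp add: ac_simps)
  have "h\<^sup>2 * ?fvw (x + a *\<^sub>R v + b *\<^sub>R w) = h\<^sup>2 * ?fwv (x + b' *\<^sub>R v + a' *\<^sub>R w)"
    using ab(3) ab'(3) unfolding swap by linarith
  then have eq: "?fvw (x + a *\<^sub>R v + b *\<^sub>R w) = ?fwv (x + b' *\<^sub>R v + a' *\<^sub>R w)" using h by simp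
  have "dist (?fvw (x + a *\<^sub>R v + b *\<^sub>R w)) (?fvw x) < e"
    by (rule d) (use near[OF ab(1,2)] in \<open>simp add: d_def\<close>)
  moreover have "dist (?fwv (x + b' *\<^sub>R v + a' *\<^sub>R w)) (?fwv x) < e"
    by (rule d) (use near[OF ab'(2,1)] in \<open>simp add: d_def\<close>)
  moreover have False if "dist m p < \<bar>p - q\<bar> / 2" "dist m q < \<bar>p - q\<bar> / 2" for m p q :: real
    using that by (auto simp: dist_real_def abs_if field_simps split: if_splits)
  ultimately show False unfolding eq e_def by blast
qed

section \<open>Charts and tangent vectors\<close>

text \<open>The chart part of \<open>smooth_manifold\<close>, phrased with \<open>fst c\<close> and
  \<open>snd c\<close>. It is what gets proved for the interval, for \<open>H3\<close> and for
  products.\<close>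

definition charted :: "('m, 'v::euclidean_space) manifold \<Rightarrow> bool" where
  "charted M \<longleftrightarrow> (\<Union>c\<in>atlas M. fst c) = points M \<and>
     (\<forall>c\<in>atlas M. openin (mtop M) (fst c) \<and> open (snd c ` fst c) \<and>
        homeomorphic_map (subtopology (mtop M) (fst c)) (top_of_set (snd c ` fst c)) (snd c)) \<and>
     (\<forall>c\<in>atlas M. \<forall>c'\<in>atlas M. smooth_on (snd c ` (fst c \<inter> fst c')) (snd c' \<circ> chart_inv c))"

lemma smooth_manifold_charted: "smooth_manifold M \<Longrightarrow> charted M"
  unfolding smooth_manifold_def charted_def by (auto simp: split_def)

lemma charted_ex_chart: "charted M \<Longrightarrow> p \<in> points M \<Longrightarrow> \<exists>c\<in>atlas M. p \<in> fst c"
  by (auto simp: charted_def)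

lemma charted_fst_openin: "charted M \<Longrightarrow> c \<in> atlas M \<Longrightarrow> openin (mtop M) (fst c)"
  by (auto simp: charted_def)

lemma charted_in_points: "charted M \<Longrightarrow> c \<in> atlas M \<Longrightarrow> p \<in> fst c \<Longrightarrow> p \<in> points M"
  by (auto simp: charted_def)

lemma charted_open: "charted M \<Longrightarrow> c \<in> atlas M \<Longrightarrow> open (snd c ` fst c)"
  by (auto simp: charted_def)

lemma charted_inj: "charted M \<Longrightarrow> c \<in> atlas M \<Longrightarrow> inj_on (snd c) (fst c)"
proof -
  assume M: "charted M" and c: "c \<in> atlas M"
  then have "homeomorphic_map (subtopology (mtop M) (fst c)) (top_of_set (snd c ` fst c)) (snd c)"
    by (auto simp: charted_def)
  then have "inj_on (snd c) (topspace (subtopology (mtop M) (fst c)))"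
    by (rule homeomorphic_imp_injective_map)
  moreover have "fst c \<subseteq> points M" using M c by (auto simp: charted_def)
  ultimately show ?thesis by (simp add: Int_absorb1)
qed

lemma chart_inv_chart: "charted M \<Longrightarrow> c \<in> atlas M \<Longrightarrow> p \<in> fst c \<Longrightarrow> chart_inv c (snd c p) = p"
  using charted_inj inv_into_f_f by metis

lemma charted_open_image:
  assumes M: "charted M" and c: "c \<in> atlas M" and W: "openin (mtop M) W"
  shows "open (snd c ` (fst c \<inter> W))"
proof -
  have h: "homeomorphic_map (subtopology (mtop M) (fst c)) (top_of_set (snd c ` fst c)) (snd c)"
    and o: "open (snd c ` fst c)" using M c by (auto simp: charted_def)
  have "openin (subtopology (mtop M) (fst c)) (fst c \<inter> W)"
    using W by (metis inf_commute openin_subtopology_Int)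
  then have "openin (top_of_set (snd c ` fst c)) (snd c ` (fst c \<inter> W))"
    using homeomorphic_imp_open_map[OF h] by (simp add: open_map_def)
  then show ?thesis using o openin_open_eq by blast
qed

lemma charted_transition:
  "charted M \<Longrightarrow> c \<in> atlas M \<Longrightarrow> c' \<in> atlas M \<Longrightarrow> smooth_on (snd c ` (fst c \<inter> fst c')) (snd c' \<circ> chart_inv c)"
  by (auto simp: charted_def)

lemma smooth_at_chart:
  "smooth_at M p u \<Longrightarrow> c \<in> atlas M \<Longrightarrow> p \<in> fst c \<Longrightarrow>
    \<exists>W. openin (mtop M) W \<and> p \<in> W \<and> smooth_on (snd c ` (fst c \<inter> W)) (u \<circ> chart_inv c)"
  unfolding smooth_at_def by (metis (no_types, lifting) case_prodE fst_conv snd_conv)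

lemma smooth_at_has_derivative:
  assumes "smooth_at M p u" "c \<in> atlas M" "p \<in> fst c"
  shows "((u \<circ> chart_inv c) has_derivative frechet_derivative (u \<circ> chart_inv c) (at (snd c p))) (at (snd c p))"
proof -
  obtain W where "p \<in> W" "smooth_on (snd c ` (fst c \<inter> W)) (u \<circ> chart_inv c)"
    using smooth_at_chart[OF assms] by blast
  then show ?thesis using assms(3) by (intro smooth_on_has_derivative) auto
qed

text \<open>A tangent vector is 0 by convention on functions that are not smooth near p. This makes
  the coordinate functions legitimate arguments, so that \<open>vec_components\<close> recovers the
  components.\<close>

lemma smooth_at_chart_inner:
  assumes M: "charted M" and c: "c \<in> atlas M" and p: "p \<in> fst c"
  shows "smooth_at M p (\<lambda>q. snd c q \<bullet> b)"
  unfolding smooth_at_def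
proof (intro exI[of _ "fst c"] conjI ballI)
  fix d assume d: "d \<in> atlas M"
  have "smooth_on (snd d ` (fst d \<inter> fst c)) (\<lambda>x. (snd c \<circ> chart_inv d) x \<bullet> b)"
    by (rule smooth_on_bounded_linear_compose[OF charted_open_image[OF M d charted_fst_openin[OF M c]]
        bounded_linear_inner_left charted_transition[OF M d c]])
  then show "case d of (U, \<phi>) \<Rightarrow> smooth_on (\<phi> ` (U \<inter> fst c)) ((\<lambda>q. snd c q \<bullet> b) \<circ> chart_inv (U, \<phi>))"
    by (cases d) (simp add: o_def)
qed (rule charted_fst_openin[OF M c], rule p)

lemma coord_vec_chart_inner:
  assumes M: "charted M" and c: "c \<in> atlas M" and p: "p \<in> fst c"
  shows "coord_vec M c p v (\<lambda>q. snd c q \<bullet> b) = v \<bullet> b"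
proof -
  have "frechet_derivative ((\<lambda>q. snd c q \<bullet> b) \<circ> chart_inv c) (at (snd c p)) =
      frechet_derivative (\<lambda>x. x \<bullet> b) (at (snd c p))"
    by (rule frechet_derivative_cong_open[OF charted_open[OF M c]])
       (use p in \<open>auto simp: chart_inv_chart[OF M c]\<close>)
  also have "\<dots> = (\<lambda>x. x \<bullet> b)"
    by (rule sym, rule frechet_derivative_at) (auto intro!: derivative_eq_intros)
  finally show ?thesis using smooth_at_chart_inner[OF assms] by (simp add: coord_vec_def)
qed

lemma vec_components_coord_vec:
  "charted M \<Longrightarrow> c \<in> atlas M \<Longrightarrow> p \<in> fst c \<Longrightarrow> vec_components c (coord_vec M c p v) = v"
  by (simp add: vec_components_def coord_vec_chart_inner euclidean_representation)

lemma coord_vec_lin_comb: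
  assumes c: "c \<in> atlas M" and p: "p \<in> fst c"
  shows "lin_comb a (coord_vec M c p v) b (coord_vec M c p w) = coord_vec M c p (a *\<^sub>R v + b *\<^sub>R w)"
proof -
  have "linear (frechet_derivative (u \<circ> chart_inv c) (at (snd c p)))" if "smooth_at M p u" for u
    using smooth_at_has_derivative[OF that assms] has_derivative_linear by blast
  then show ?thesis
    by (auto simp: lin_comb_def coord_vec_def linear_add linear_cmul fun_eq_iff)
qed

lemma coord_vec_zero: "c \<in> atlas M \<Longrightarrow> p \<in> fst c \<Longrightarrow> coord_vec M c p 0 = (\<lambda>u. 0)"
  using coord_vec_lin_comb[of c M p 0 0 0 0] by (simp add: lin_comb_def)

lemma coord_vec_in_tangent_space: "c \<in> atlas M \<Longrightarrow> p \<in> fst c \<Longrightarrow> coord_vec M c p v \<in> tangent_space M p"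
  unfolding tangent_space_def by blast

lemma smooth_map_local:
  assumes "smooth_map M N F" "c \<in> atlas M" "c' \<in> atlas N"
  shows "smooth_on (snd c ` (fst c \<inter> F -` fst c')) (snd c' \<circ> F \<circ> chart_inv c)"
  using assms unfolding smooth_map_def by (auto simp: split_def)

lemma smooth_map_in_points: "smooth_map M N F \<Longrightarrow> p \<in> points M \<Longrightarrow> F p \<in> points N"
  by (auto simp: smooth_map_def continuous_map_def)

lemma smooth_map_preimage_openin:
  "smooth_map M N F \<Longrightarrow> openin (mtop N) W \<Longrightarrow> openin (mtop M) (points M \<inter> F -` W)"
  using openin_continuous_map_preimage[of "mtop M" "mtop N" F W]
  by (simp add: smooth_map_def vimage_def Int_def)

lemma smooth_map_local_open:
  assumes M: "charted M" and N: "charted N" and F: "smooth_map M N F"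
    and c: "c \<in> atlas M" and c': "c' \<in> atlas N"
  shows "open (snd c ` (fst c \<inter> F -` fst c'))"
proof -
  have "fst c \<inter> F -` fst c' = fst c \<inter> (points M \<inter> F -` fst c')"
    using charted_in_points[OF M c] by auto
  then show ?thesis
    using charted_open_image[OF M c smooth_map_preimage_openin[OF F charted_fst_openin[OF N c']]] by simp
qed

lemma smooth_at_compose:
  assumes M: "charted M" and N: "charted N" and F: "smooth_map M N F"
    and p: "p \<in> points M" and u: "smooth_at N (F p) u"
  shows "smooth_at M p (u \<circ> F)"
proof -
  obtain c' where c': "c' \<in> atlas N" "F p \<in> fst c'"
    using charted_ex_chart[OF N smooth_map_in_points[OF F p]] by blast
  obtain W where W: "openin (mtop N) W" "F p \<in> W" "smooth_on (snd c' ` (fst c' \<inter> W)) (u \<circ> chart_inv c')"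
    using smooth_at_chart[OF u c'] by blast
  let ?W = "points M \<inter> F -` (fst c' \<inter> W)"
  have oW: "openin (mtop M) ?W"
    by (intro smooth_map_preimage_openin[OF F] openin_Int charted_fst_openin[OF N] c' W)
  have "smooth_on (snd c ` (fst c \<inter> ?W)) (u \<circ> F \<circ> chart_inv c)" if c: "c \<in> atlas M" for c
  proof -
    have o: "open (snd c ` (fst c \<inter> ?W))" by (rule charted_open_image[OF M c oW])
    have sub: "snd c ` (fst c \<inter> ?W) \<subseteq> snd c ` (fst c \<inter> F -` fst c')" by auto
    have "smooth_on (snd c ` (fst c \<inter> ?W)) (\<lambda>x. (u \<circ> chart_inv c') ((snd c' \<circ> F \<circ> chart_inv c) x))"
      by (rule smooth_on_compose[OF o charted_open_image[OF N c'(1) W(1)] _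
            smooth_on_subset[OF smooth_map_local[OF F c c'(1)] sub] W(3)])
         (auto simp: chart_inv_chart[OF M c])
    then show ?thesis
      by (rule smooth_on_cong[OF o, rotated])
         (auto simp: chart_inv_chart[OF M c] chart_inv_chart[OF N c'(1)])
  qed
  then show ?thesis
    unfolding smooth_at_def using oW p c' W by (intro exI[of _ ?W]) auto
qed

text \<open>The chain rule for u composed with F, in the charts c and c'. Functions u that are not
  smooth near F p form a separate case, where both sides are 0 by convention.\<close>

lemma pushforward_coord_vec:
  assumes M: "charted M" and N: "charted N" and F: "smooth_map M N F"
    and c: "c \<in> atlas M" "p \<in> fst c" and c': "c' \<in> atlas N" "F p \<in> fst c'"
  shows "pushforward N F p (coord_vec M c p v) =
    coord_vec N c' (F p) (frechet_derivative (snd c' \<circ> F \<circ> chart_inv c) (at (snd c p)) v)"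
proof
  fix u
  let ?G = "snd c' \<circ> F \<circ> chart_inv c"
  have p: "p \<in> points M" using charted_in_points[OF M c] .
  show "pushforward N F p (coord_vec M c p v) u = coord_vec N c' (F p) (frechet_derivative ?G (at (snd c p)) v) u"
  proof (cases "smooth_at N (F p) u")
    case True
    have G: "(?G has_derivative frechet_derivative ?G (at (snd c p))) (at (snd c p))"
      by (rule smooth_on_has_derivative[OF smooth_map_local[OF F c(1) c'(1)]]) (use c c' in auto)
    have "((u \<circ> chart_inv c') has_derivative frechet_derivative (u \<circ> chart_inv c') (at (snd c' (F p)))) (at (?G (snd c p)))"
      using smooth_at_has_derivative[OF True c'] chart_inv_chart[OF M c] by simp
    from has_derivative_compose[OF G this]
    have D: "((\<lambda>x. (u \<circ> chart_inv c') (?G x)) has_derivative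
      (\<lambda>v. frechet_derivative (u \<circ> chart_inv c') (at (snd c' (F p))) (frechet_derivative ?G (at (snd c p)) v))) (at (snd c p))" .
    have "((u \<circ> F \<circ> chart_inv c) has_derivative
      (\<lambda>v. frechet_derivative (u \<circ> chart_inv c') (at (snd c' (F p))) (frechet_derivative ?G (at (snd c p)) v))) (at (snd c p))"
      by (rule has_derivative_transform_within_open[OF D smooth_map_local_open[OF M N F c(1) c'(1)]])
         (use c c' in \<open>auto simp: chart_inv_chart[OF M c(1)] chart_inv_chart[OF N c'(1)]\<close>)
    then have "frechet_derivative (u \<circ> F \<circ> chart_inv c) (at (snd c p)) =
      (\<lambda>v. frechet_derivative (u \<circ> chart_inv c') (at (snd c' (F p))) (frechet_derivative ?G (at (snd c p)) v))"
      by (rule frechet_derivative_at[symmetric])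
    then show ?thesis
      using True smooth_at_compose[OF M N F p True] by (simp add: pushforward_def coord_vec_def)
  qed (simp add: pushforward_def coord_vec_def)
qed

text \<open>\<open>tangent_space\<close> collects vectors from all charts around p. A change of
  charts is \<open>pushforward_coord_vec\<close> for the identity map, so a single chart already
  yields all of them.\<close>

lemma tangent_space_eq:
  assumes M: "charted M" and c: "c \<in> atlas M" "p \<in> fst c"
  shows "tangent_space M p = range (coord_vec M c p)"
proof
  have id: "smooth_map M M (\<lambda>x. x)"
    using charted_transition[OF M]
    by (auto simp: smooth_map_def o_def vimage_def split_def)
  show "tangent_space M p \<subseteq> range (coord_vec M c p)"
  proof
    fix X assume "X \<in> tangent_space M p"
    then obtain d v where d: "d \<in> atlas M" "p \<in> fst d" and X: "X = coord_vec M d p v"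
      by (auto simp: tangent_space_def)
    have "pushforward M (\<lambda>x. x) p X = X"
      by (auto simp: X pushforward_def coord_vec_def o_def fun_eq_iff)
    then show "X \<in> range (coord_vec M c p)"
      using pushforward_coord_vec[OF M M id d, of c v] c by (metis X rangeI)
  qed
qed (use c in \<open>auto simp: coord_vec_in_tangent_space\<close>)

lemma pushforward_in_tangent_space:
  assumes M: "charted M" and N: "charted N" and F: "smooth_map M N F"
    and p: "p \<in> points M" and X: "X \<in> tangent_space M p"
  shows "pushforward N F p X \<in> tangent_space N (F p)"
proof -
  obtain c v where c: "c \<in> atlas M" "p \<in> fst c" and X: "X = coord_vec M c p v"
    using X by (auto simp: tangent_space_def)
  obtain c' where c': "c' \<in> atlas N" "F p \<in> fst c'"
    using charted_ex_chart[OF N smooth_map_in_points[OF F p]] by blast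
  show ?thesis
    unfolding X pushforward_coord_vec[OF M N F c c'] by (rule coord_vec_in_tangent_space[OF c'])
qed

lemma tangent_space_nonsmooth: "X \<in> tangent_space M p \<Longrightarrow> \<not> smooth_at M p u \<Longrightarrow> X u = 0"
  by (auto simp: tangent_space_def coord_vec_def)

lemma pushforward_compose:
  assumes "charted M" "charted N" "smooth_map N P G" "charted P" "F p \<in> points N" 
  shows "pushforward P G (F p) (pushforward N F p X) = pushforward P (G \<circ> F) p X"
  using smooth_at_compose[OF assms(2,4,3,5)] by (auto simp: pushforward_def o_assoc fun_eq_iff)

text \<open>Exposes the chart that \<open>ext_deriv\<close> picks by choice. For the forms on M the
  nearly Kaehler equations are evaluated in that very chart.\<close>

lemma ext_deriv_coord_vec:
  assumes M: "charted M" and p: "p \<in> points M"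
  obtains c where "c \<in> atlas M" "p \<in> fst c"
    and "\<And>\<omega> vs. ext_deriv M \<omega> p (map (coord_vec M c p) vs) = (\<Sum>i<length vs. (- 1) ^ i *
          frechet_derivative
            (\<lambda>x. \<omega> (chart_inv c x) (map (coord_vec M c (chart_inv c x)) (nths vs (- {i}))))
            (at (snd c p)) (vs ! i))"
proof -
  define c where "c = (SOME c. c \<in> atlas M \<and> p \<in> fst c)"
  have c: "c \<in> atlas M \<and> p \<in> fst c"
    unfolding c_def using someI_ex charted_ex_chart[OF M p] by (metis (mono_tags, lifting))
  have "map (vec_components c) (map (coord_vec M c p) vs) = vs" for vs
    using c by (induction vs) (auto simp: vec_components_coord_vec[OF M])
  then show ?thesis
    using c by (intro that[of c])
      (auto simp: ext_deriv_def Let_def c_def[symmetric] vec_components_coord_vec[OF M])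
qed

section \<open>Products with an interval\<close>

definition prod_chart :: "('m, 'v) chart \<Rightarrow> ('n, 'w) chart \<Rightarrow> ('m \<times> 'n, 'v \<times> 'w) chart" where
  "prod_chart c d = (fst c \<times> fst d, map_prod (snd c) (snd d))"

lemma atlas_prod_manifold:
  "e \<in> atlas (M \<times>\<^sub>M\<^sub>f N) \<longleftrightarrow> (\<exists>c\<in>atlas M. \<exists>d\<in>atlas N. e = prod_chart c d)"
  by (simp add: prod_manifold_def prod_chart_def Bex_def split_paired_Ex) blast

lemma mtop_prod_manifold [simp]: "mtop (M \<times>\<^sub>M\<^sub>f N) = prod_topology (mtop M) (mtop N)"
  by (simp add: prod_manifold_def)

lemma fst_prod_chart [simp]: "fst (prod_chart c d) = fst c \<times> fst d"
  and snd_prod_chart [simp]: "snd (prod_chart c d) = map_prod (snd c) (snd d)"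
  by (simp_all add: prod_chart_def)

lemma chart_inv_prod_chart:
  assumes "charted M" "charted N" "c \<in> atlas M" "d \<in> atlas N"
    and "x \<in> snd c ` fst c" "y \<in> snd d ` fst d"
  shows "inv_into (fst c \<times> fst d) (map_prod (snd c) (snd d)) (x, y) = (chart_inv c x, chart_inv d y)"
proof -
  obtain p q where "p \<in> fst c" "q \<in> fst d" "x = snd c p" "y = snd d q" using assms by auto
  moreover have "inj_on (map_prod (snd c) (snd d)) (fst c \<times> fst d)"
    using charted_inj[OF assms(1,3)] charted_inj[OF assms(2,4)] by (rule map_prod_inj_on)
  then have "inv_into (fst c \<times> fst d) (map_prod (snd c) (snd d)) (map_prod (snd c) (snd d) (p, q)) = (p, q)"
    using \<open>p \<in> fst c\<close> \<open>q \<in> fst d\<close> by (intro inv_into_f_f) auto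
  ultimately show ?thesis
    using assms by (simp add: chart_inv_chart)
qed

lemma charted_prod_manifold:
  assumes M: "charted M" and N: "charted N"
  shows "charted (M \<times>\<^sub>M\<^sub>f N)"
  unfolding charted_def
proof (intro conjI ballI)
  show "(\<Union>c\<in>atlas (M \<times>\<^sub>M\<^sub>f N). fst c) = points (M \<times>\<^sub>M\<^sub>f N)"
  proof -
    have "(\<Union>c\<in>atlas (M \<times>\<^sub>M\<^sub>f N). fst c) = (\<Union>c\<in>atlas M. fst c) \<times> (\<Union>d\<in>atlas N. fst d)"
    proof (intro equalityI subsetI)
      fix x assume "x \<in> (\<Union>c\<in>atlas M. fst c) \<times> (\<Union>d\<in>atlas N. fst d)"
      then obtain c d where "c \<in> atlas M" "d \<in> atlas N" "fst x \<in> fst c" "snd x \<in> fst d" by auto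
      then show "x \<in> (\<Union>c\<in>atlas (M \<times>\<^sub>M\<^sub>f N). fst c)"
        by (intro UN_I[of "prod_chart c d"]) (auto simp: atlas_prod_manifold mem_Times_iff)
    next
      fix x assume "x \<in> (\<Union>c\<in>atlas (M \<times>\<^sub>M\<^sub>f N). fst c)"
      then obtain c d where "c \<in> atlas M" "d \<in> atlas N" "x \<in> fst (prod_chart c d)"
        by (metis UN_E atlas_prod_manifold)
      then show "x \<in> (\<Union>c\<in>atlas M. fst c) \<times> (\<Union>d\<in>atlas N. fst d)"
        unfolding fst_prod_chart by blast
    qed
    then show ?thesis using M N by (simp add: charted_def)
  qed
next
  fix e assume "e \<in> atlas (M \<times>\<^sub>M\<^sub>f N)"
  then obtain c d where c: "c \<in> atlas M" and d: "d \<in> atlas N" and e: "e = prod_chart c d"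
    by (auto simp: atlas_prod_manifold)
  show "openin (mtop (M \<times>\<^sub>M\<^sub>f N)) (fst e)"
    using charted_fst_openin[OF M c] charted_fst_openin[OF N d] by (simp add: e openin_prod_Times_iff)
  have im: "snd e ` fst e = (snd c ` fst c) \<times> (snd d ` fst d)"
    by (simp add: e map_prod_surj_on)
  show "open (snd e ` fst e)"
    unfolding im by (intro open_Times charted_open[OF M c] charted_open[OF N d])
  obtain c' where c': "homeomorphic_maps (subtopology (mtop M) (fst c)) (top_of_set (snd c ` fst c)) (snd c) c'"
    using M c by (auto simp: charted_def homeomorphic_map_maps)
  obtain d' where d': "homeomorphic_maps (subtopology (mtop N) (fst d)) (top_of_set (snd d ` fst d)) (snd d) d'"
    using N d by (auto simp: charted_def homeomorphic_map_maps)
  have "homeomorphic_maps (prod_topology (subtopology (mtop M) (fst c)) (subtopology (mtop N) (fst d)))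
     (prod_topology (top_of_set (snd c ` fst c)) (top_of_set (snd d ` fst d)))
     (\<lambda>(x, y). (snd c x, snd d y)) (\<lambda>(x, y). (c' x, d' y))"
    using c' d' by (simp only: homeomorphic_maps_prod simp_thms)
  then show "homeomorphic_map (subtopology (mtop (M \<times>\<^sub>M\<^sub>f N)) (fst e)) (top_of_set (snd e ` fst e)) (snd e)"
    unfolding homeomorphic_map_maps im by (auto simp: e subtopology_Times map_prod_def)
  fix e' assume "e' \<in> atlas (M \<times>\<^sub>M\<^sub>f N)"
  then obtain c' d' where c': "c' \<in> atlas M" and d': "d' \<in> atlas N" and e': "e' = prod_chart c' d'"
    by (auto simp: atlas_prod_manifold)
  let ?A = "snd c ` (fst c \<inter> fst c')" and ?B = "snd d ` (fst d \<inter> fst d')"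
  have A: "open ?A" and B: "open ?B"
    using charted_open_image[OF M c charted_fst_openin[OF M c']]
      charted_open_image[OF N d charted_fst_openin[OF N d']] by auto
  have "snd e ` (fst e \<inter> fst e') = ?A \<times> ?B"
    by (simp add: e e' Times_Int_Times map_prod_surj_on)
  moreover have "smooth_on (?A \<times> ?B) (\<lambda>x. ((snd c' \<circ> chart_inv c) (fst x), (snd d' \<circ> chart_inv d) (snd x)))"
    by (intro smooth_on_Pair open_Times A B
          smooth_on_compose[OF open_Times[OF A B] A _ _ charted_transition[OF M c c']]
          smooth_on_compose[OF open_Times[OF A B] B _ _ charted_transition[OF N d d']]
          smooth_on_bounded_linear bounded_linear_fst bounded_linear_snd) auto
  then have "smooth_on (?A \<times> ?B) (snd e' \<circ> chart_inv e)"
    by (rule smooth_on_cong[OF open_Times[OF A B], rotated])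
       (auto simp: e e' chart_inv_prod_chart[OF M N c d] o_def)
  ultimately show "smooth_on (snd e ` (fst e \<inter> fst e')) (snd e' \<circ> chart_inv e)" by simp
qed

lemma smooth_map_fst:
  assumes M: "charted M" and N: "charted N"
  shows "smooth_map (M \<times>\<^sub>M\<^sub>f N) M fst"
proof -
  have "smooth_on (snd e ` (fst e \<inter> fst -` fst c')) (snd c' \<circ> fst \<circ> chart_inv e)"
    if e: "e \<in> atlas (M \<times>\<^sub>M\<^sub>f N)" and c': "c' \<in> atlas M" for e c'
  proof -
    obtain c d where c: "c \<in> atlas M" and d: "d \<in> atlas N" and e: "e = prod_chart c d"
      using e by (auto simp: atlas_prod_manifold)
    let ?A = "snd c ` (fst c \<inter> fst c')" and ?B = "snd d ` fst d"
    have A: "open ?A" and B: "open ?B"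
      using charted_open_image[OF M c charted_fst_openin[OF M c']] charted_open[OF N d] by auto
    have "fst c \<times> fst d \<inter> fst -` fst c' = (fst c \<inter> fst c') \<times> fst d" by auto
    then have "snd e ` (fst e \<inter> fst -` fst c') = ?A \<times> ?B"
      by (simp add: e map_prod_surj_on)
    moreover have "smooth_on (?A \<times> ?B) (\<lambda>x. (snd c' \<circ> chart_inv c) (fst x))"
      by (intro smooth_on_compose[OF open_Times[OF A B] A _ _ charted_transition[OF M c c']]
          smooth_on_bounded_linear bounded_linear_fst open_Times A B) auto
    then have "smooth_on (?A \<times> ?B) (snd c' \<circ> fst \<circ> chart_inv e)"
      by (rule smooth_on_cong[OF open_Times[OF A B], rotated])
         (auto simp: e chart_inv_prod_chart[OF M N c d] o_def)
    ultimately show ?thesis by simp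
  qed
  then show ?thesis
    by (auto simp: smooth_map_def split_def continuous_map_fst)
qed

lemma frechet_derivative_fst_chart:
  assumes M: "charted M" and N: "charted N" and c: "c \<in> atlas M" "p \<in> fst c" and d: "d \<in> atlas N" "q \<in> fst d"
  shows "frechet_derivative (snd c \<circ> fst \<circ> chart_inv (prod_chart c d)) (at (snd c p, snd d q)) = fst"
proof -
  have "frechet_derivative (snd c \<circ> fst \<circ> chart_inv (prod_chart c d)) (at (snd c p, snd d q)) =
    frechet_derivative fst (at (snd c p, snd d q))"
    by (rule frechet_derivative_cong_open[where S="(snd c ` fst c) \<times> (snd d ` fst d)"])
       (use c d in \<open>auto intro!: open_Times charted_open[OF M c(1)] charted_open[OF N d(1)]
          simp: chart_inv_prod_chart[OF M N c(1) d(1)] chart_inv_chart[OF M c(1)] chart_inv_chart[OF N d(1)]\<close>)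
  also have "\<dots> = fst"
    by (rule sym, rule frechet_derivative_at) (rule bounded_linear_imp_has_derivative[OF bounded_linear_fst])
  finally show ?thesis .
qed

lemma pushforward_fst_coord_vec:
  assumes M: "charted M" and N: "charted N" and c: "c \<in> atlas M" "p \<in> fst c" and d: "d \<in> atlas N" "q \<in> fst d"
  shows "pushforward M fst (p, q) (coord_vec (M \<times>\<^sub>M\<^sub>f N) (prod_chart c d) (p, q) w) = coord_vec M c p (fst w)"
  using pushforward_coord_vec[OF charted_prod_manifold[OF M N] M smooth_map_fst[OF M N], of "prod_chart c d" "(p, q)" c w]
    c d frechet_derivative_fst_chart[OF M N c d]
  by (auto simp: atlas_prod_manifold)

definition interval_chart :: "real \<Rightarrow> real \<Rightarrow> (real, real) chart" where
  "interval_chart a b = ({a<..<b}, id)"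

lemma atlas_interval: "atlas (interval a b) = {interval_chart a b}"
  by (simp add: interval_def interval_chart_def)

lemma chart_inv_interval: "x \<in> {a<..<b} \<Longrightarrow> chart_inv (interval_chart a b) x = x"
  using inv_into_f_f[of id "{a<..<b}" x] by (simp add: interval_chart_def)

lemma fst_interval_chart [simp]: "fst (interval_chart a b) = {a<..<b}"
  and snd_interval_chart [simp]: "snd (interval_chart a b) = id"
  by (simp_all add: interval_chart_def)

lemma points_interval [simp]: "points (interval a b) = {a<..<b}"
  by (simp add: interval_def)

lemma mtop_interval: "mtop (interval a b) = top_of_set {a<..<b}"
  by (simp add: interval_def)

lemma charted_interval: "charted (interval a b)"
proof -
  have "smooth_on {a<..<b} (chart_inv (interval_chart a b))"
    by (rule smooth_on_cong[OF _ _ smooth_on_id]) (auto simp: chart_inv_interval)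
  moreover have "subtopology (top_of_set {a<..<b}) {a<..<b} = top_of_set {a<..<b}"
    by (simp add: subtopology_subtopology)
  ultimately show ?thesis
    unfolding charted_def atlas_interval mtop_interval
    by simp
qed

text \<open>The exterior derivative of a one-form \<beta> on a vector space, evaluated on the
  constant fields v and w.\<close>

definition d1 :: "('a::euclidean_space \<Rightarrow> 'a \<Rightarrow> real) \<Rightarrow> 'a \<Rightarrow> 'a \<Rightarrow> 'a \<Rightarrow> real" where
  "d1 \<beta> x v w = frechet_derivative (\<lambda>y. \<beta> y w) (at x) v - frechet_derivative (\<lambda>y. \<beta> y v) (at x) w"

lemma d1_cong:
  assumes "open S" "x \<in> S" "\<And>y v. y \<in> S \<Longrightarrow> \<beta> y v = \<gamma> y v"
  shows "d1 \<beta> x = d1 \<gamma> x"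
proof -
  have "frechet_derivative (\<lambda>y. \<beta> y w) (at x) = frechet_derivative (\<lambda>y. \<gamma> y w) (at x)" for w
    by (rule frechet_derivative_cong_open[OF assms(1,2)]) (use assms(3) in auto)
  then show ?thesis by (simp add: d1_def fun_eq_iff)
qed

lemma symmetric_second_derivative:
  fixes G :: "'a::euclidean_space \<Rightarrow> 'b::euclidean_space"
  assumes S: "open S" and G: "smooth_on S G" and x: "x \<in> S"
  shows "frechet_derivative (\<lambda>y. frechet_derivative G (at y) v) (at x) w =
    frechet_derivative (\<lambda>y. frechet_derivative G (at y) w) (at x) v"
proof -
  have inner1: "frechet_derivative (\<lambda>y. F y \<bullet> b) (at y) = (\<lambda>v. frechet_derivative F (at y) v \<bullet> b)"
    if "smooth_on S F" "y \<in> S" for F :: "'a \<Rightarrow> 'b" and y b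
    by (rule sym, rule frechet_derivative_at)
       (rule bounded_linear.has_derivative[OF bounded_linear_inner_left smooth_on_has_derivative[OF that]])
  have inner2: "frechet_derivative (\<lambda>y. frechet_derivative (\<lambda>y. G y \<bullet> b) (at y) v) (at x) w =
      frechet_derivative (\<lambda>y. frechet_derivative G (at y) v) (at x) w \<bullet> b" for v w b
  proof -
    have "frechet_derivative (\<lambda>y. frechet_derivative (\<lambda>y. G y \<bullet> b) (at y) v) (at x) =
        frechet_derivative (\<lambda>y. frechet_derivative G (at y) v \<bullet> b) (at x)"
      by (rule frechet_derivative_cong_open[OF S x]) (simp add: inner1[OF G])
    then show ?thesis by (simp add: inner1[OF smooth_on_derivative[OF G] x])
  qed
  have "smooth_on S (\<lambda>y. G y \<bullet> b)" for b
    by (rule smooth_on_bounded_linear_compose[OF S bounded_linear_inner_left G])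
  from symmetric_second_derivative_real[OF S this x, of _ v w, unfolded inner2]
  show ?thesis by (rule euclidean_eqI)
qed

text \<open>The second derivatives of G cancel by symmetry, which is why exterior differentiation
  commutes with pull-back. Linearity of \<beta> is available on open sets only, so expansions in
  \<open>Basis\<close> are transferred to \<beta> near the point in question.\<close>

lemma d1_pullback:
  fixes G :: "'a::euclidean_space \<Rightarrow> 'b::euclidean_space"
  assumes S: "open S" and G: "smooth_on S G" and x: "x \<in> S"
    and lin: "\<And>y. y \<in> S \<Longrightarrow> linear (\<beta> (G y))" and linx: "\<And>z. z \<in> T \<Longrightarrow> linear (\<beta> z)" "open T" "G x \<in> T"
    and diff: "\<And>b. (\<lambda>z. \<beta> z b) differentiable (at (G x))"
  shows "d1 (\<lambda>y v. \<beta> (G y) (frechet_derivative G (at y) v)) x v w =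
    d1 \<beta> (G x) (frechet_derivative G (at x) v) (frechet_derivative G (at x) w)"
proof -
  let ?G' = "\<lambda>y v. frechet_derivative G (at y) v"
  let ?D = "\<lambda>b. frechet_derivative (\<lambda>z. \<beta> z b) (at (G x))"
  have rep: "L v = (\<Sum>b\<in>Basis. (v \<bullet> b) *\<^sub>R L b)" if "linear L" for L :: "'b \<Rightarrow> real" and v
  proof -
    have "L v = L (\<Sum>b\<in>Basis. (v \<bullet> b) *\<^sub>R b)" by (simp only: euclidean_representation)
    then show ?thesis using that by (simp only: linear_sum linear_cmul o_def)
  qed
  have D: "((\<lambda>z. \<beta> z b) has_derivative ?D b) (at (G x))" for b
    using diff frechet_derivative_works by blast
  \<comment> \<open>Differentiation in the base point preserves linearity in the vector argument;
    this recombines the sum that the product rule leaves below.\<close>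
  have Dw: "?D w u = (\<Sum>b\<in>Basis. (w \<bullet> b) * ?D b u)" for w u
  proof -
    have "((\<lambda>z. \<Sum>b\<in>Basis. (w \<bullet> b) * \<beta> z b) has_derivative (\<lambda>u. \<Sum>b\<in>Basis. (w \<bullet> b) * ?D b u)) (at (G x))"
      by (intro has_derivative_sum has_derivative_mult_right D)
    then have "((\<lambda>z. \<beta> z w) has_derivative (\<lambda>u. \<Sum>b\<in>Basis. (w \<bullet> b) * ?D b u)) (at (G x))"
      by (rule has_derivative_transform_within_open[OF _ linx(2,3)])
         (rule rep[OF linx(1), symmetric, unfolded real_scaleR_def])
    from frechet_derivative_at[OF this, symmetric] show ?thesis by (simp only:)
  qed
  have der: "frechet_derivative (\<lambda>y. \<beta> (G y) (?G' y w)) (at x) v =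
      ?D (?G' x w) (?G' x v) + \<beta> (G x) (frechet_derivative (\<lambda>y. ?G' y w) (at x) v)" for v w
  proof -
    have 1: "((\<lambda>y. \<beta> (G y) b) has_derivative (\<lambda>v. ?D b (?G' x v))) (at x)" for b
      by (rule has_derivative_compose[OF smooth_on_has_derivative[OF G x] D])
    have 2: "((\<lambda>y. ?G' y w \<bullet> b) has_derivative (\<lambda>v. frechet_derivative (\<lambda>y. ?G' y w) (at x) v \<bullet> b)) (at x)" for b
      by (rule bounded_linear.has_derivative[OF bounded_linear_inner_left
            smooth_on_has_derivative[OF smooth_on_derivative[OF G] x]])
    have "((\<lambda>y. \<Sum>b\<in>Basis. (?G' y w \<bullet> b) * \<beta> (G y) b) has_derivative
        (\<lambda>v. \<Sum>b\<in>Basis. (?G' x w \<bullet> b) * ?D b (?G' x v) +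
           (frechet_derivative (\<lambda>y. ?G' y w) (at x) v \<bullet> b) * \<beta> (G x) b)) (at x)"
      by (intro has_derivative_sum has_derivative_mult 1 2)
    then have "((\<lambda>y. \<beta> (G y) (?G' y w)) has_derivative
        (\<lambda>v. \<Sum>b\<in>Basis. (?G' x w \<bullet> b) * ?D b (?G' x v) +
           (frechet_derivative (\<lambda>y. ?G' y w) (at x) v \<bullet> b) * \<beta> (G x) b)) (at x)"
      by (rule has_derivative_transform_within_open[OF _ S x])
         (rule rep[OF lin, symmetric, unfolded real_scaleR_def])
    from frechet_derivative_at[OF this, symmetric]
    have "frechet_derivative (\<lambda>y. \<beta> (G y) (?G' y w)) (at x) v = (\<Sum>b\<in>Basis. (?G' x w \<bullet> b) * ?D b (?G' x v) +
           (frechet_derivative (\<lambda>y. ?G' y w) (at x) v \<bullet> b) * \<beta> (G x) b)"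
      by (simp only:)
    also have "\<dots> = ?D (?G' x w) (?G' x v) + \<beta> (G x) (frechet_derivative (\<lambda>y. ?G' y w) (at x) v)"
      using Dw[of "?G' x w" "?G' x v"] rep[OF lin[OF x], of "frechet_derivative (\<lambda>y. ?G' y w) (at x) v"]
      by (simp only: sum.distrib real_scaleR_def)
    finally show ?thesis .
  qed
  show ?thesis
    unfolding d1_def der symmetric_second_derivative[OF S G x, of v w] by simp
qed

section \<open>One-forms in a chart\<close>

text \<open>The coordinate expression of a one-form as a function of point and vector, the format on
  which \<open>d1\<close> operates.\<close>

definition loc1 :: "('m, 'v::euclidean_space) manifold \<Rightarrow> ('m, 'v) chart \<Rightarrow> 'm field \<Rightarrow> 'v \<Rightarrow> 'v \<Rightarrow> real" where
  "loc1 N c \<omega> y v = \<omega> (chart_inv c y) [coord_vec N c (chart_inv c y) v]"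

lemma multilinear_on_lin_comb1:
  "multilinear_on T 1 \<omega> \<Longrightarrow> X \<in> T \<Longrightarrow> Y \<in> T \<Longrightarrow> \<omega> [lin_comb a X b Y] = a * \<omega> [X] + b * \<omega> [Y]"
  unfolding multilinear_on_def by (metis append_Nil append_Nil2 lists.Nil)

lemma diff_form_multilinear: "diff_form N k \<omega> \<Longrightarrow> p \<in> points N \<Longrightarrow> multilinear_on (tangent_space N p) k (\<omega> p)"
  by (simp add: diff_form_def tensor_field_def)

lemma diff_form1_linear:
  assumes "diff_form N 1 \<omega>" "charted N" "c \<in> atlas N" "p \<in> fst c"
  shows "linear (\<lambda>v. \<omega> p [coord_vec N c p v])"
proof -
  have 1: "\<omega> p [coord_vec N c p (a *\<^sub>R v + b *\<^sub>R w)] = a * \<omega> p [coord_vec N c p v] + b * \<omega> p [coord_vec N c p w]" for a b v w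
    unfolding coord_vec_lin_comb[OF assms(3,4), symmetric]
    by (rule multilinear_on_lin_comb1[OF diff_form_multilinear[OF assms(1)]])
       (rule charted_in_points[OF assms(2-4)] coord_vec_in_tangent_space[OF assms(3,4)])+
  show ?thesis
    by (rule linearI) (use 1[of 1 _ 1] 1[of _ _ 0 0] in auto)
qed

lemma loc1_linear:
  assumes "diff_form N 1 \<omega>" "charted N" "c \<in> atlas N" "y \<in> snd c ` fst c"
  shows "linear (loc1 N c \<omega> y)"
  using diff_form1_linear[OF assms(1-3), of "chart_inv c y"] assms(4) inv_into_into
  by (metis (no_types, lifting) ext loc1_def)

lemma loc1_smooth:
  assumes "diff_form N 1 \<omega>" "c \<in> atlas N"
  shows "smooth_on (snd c ` fst c) (\<lambda>y. loc1 N c \<omega> y v)"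
proof -
  have "smooth_on (snd c ` fst c) (\<lambda>x. \<omega> (chart_inv c x) (map (coord_vec N c (chart_inv c x)) [v]))"
    using assms unfolding diff_form_def tensor_field_def by blast
  then show ?thesis by (simp add: loc1_def)
qed

text \<open>With this rule simplification deletes the entry at position i and so evaluates the
  summands of \<open>ext_deriv\<close> on explicit lists of vectors.\<close>

lemma nths_Cons_compl: "nths (x # xs) (- {i}) = (if i = 0 then xs else x # nths xs (- {i - 1}))"
proof (cases i)
  case 0
  have "{j. Suc j \<in> - {0}} = UNIV" by auto
  then show ?thesis using 0 by (simp add: nths_Cons nths_all)
next
  case (Suc k)
  have "{j. Suc j \<in> - {Suc k}} = - {k}" by auto
  then show ?thesis using Suc by (simp add: nths_Cons)
qed

lemma loc1_pullback:
  assumes M: "charted M" and N: "charted N" and F: "smooth_map M N F"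
    and c: "c \<in> atlas M" and c': "c' \<in> atlas N" and y: "y \<in> snd c ` (fst c \<inter> F -` fst c')"
  shows "loc1 M c (pullback N F \<omega>) y v =
    loc1 N c' \<omega> ((snd c' \<circ> F \<circ> chart_inv c) y) (frechet_derivative (snd c' \<circ> F \<circ> chart_inv c) (at y) v)"
proof -
  obtain p where p: "p \<in> fst c" "F p \<in> fst c'" "y = snd c p" using y by auto
  show ?thesis
    using pushforward_coord_vec[OF M N F c p(1) c' p(2)]
    by (simp add: loc1_def pullback_def p(3) chart_inv_chart[OF M c p(1)] chart_inv_chart[OF N c' p(2)])
qed

lemma smooth_map_ident: "charted M \<Longrightarrow> smooth_map M M (\<lambda>x. x)"
  using charted_transition[of M] by (auto simp: smooth_map_def o_def vimage_def split_def)

lemma pushforward_ident: "X \<in> tangent_space M p \<Longrightarrow> pushforward M (\<lambda>x. x) p X = X"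
  by (auto simp: pushforward_def o_def fun_eq_iff tangent_space_nonsmooth)

text \<open>The chart chosen in the definition of \<^const>\<open>ext_deriv\<close> is irrelevant: a change of charts is the
  case of the identity map in \<open>d1_pullback\<close>.\<close>

lemma ext_deriv1:
  assumes N: "charted N" and \<omega>: "diff_form N 1 \<omega>" and c: "c \<in> atlas N" "p \<in> fst c"
  shows "ext_deriv N \<omega> p [coord_vec N c p v, coord_vec N c p w] = d1 (loc1 N c \<omega>) (snd c p) v w"
proof -
  have p: "p \<in> points N" using charted_in_points[OF N c] .
  obtain c' where c': "c' \<in> atlas N" "p \<in> fst c'"
    and e: "\<And>\<omega> vs. ext_deriv N \<omega> p (map (coord_vec N c' p) vs) = (\<Sum>i<length vs. (- 1) ^ i *
          frechet_derivative
            (\<lambda>x. \<omega> (chart_inv c' x) (map (coord_vec N c' (chart_inv c' x)) (nths vs (- {i}))))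
            (at (snd c' p)) (vs ! i))"
    using ext_deriv_coord_vec[OF N p] by blast
  have e2: "ext_deriv N \<omega> p [coord_vec N c' p v, coord_vec N c' p w] = d1 (loc1 N c' \<omega>) (snd c' p) v w" for v w
    using e[of \<omega> "[v, w]"] by (simp add: nths_Cons_compl d1_def loc1_def lessThan_Suc)
  let ?G = "snd c' \<circ> (\<lambda>x. x) \<circ> chart_inv c"
  let ?G' = "frechet_derivative ?G (at (snd c p))"
  let ?S = "snd c ` (fst c \<inter> (\<lambda>x. x) -` fst c')"
  \<comment> \<open>The identity map pushes a tangent vector forward to itself, so its components in
    the two charts are related by the derivative of the coordinate change.\<close>
  have cv: "coord_vec N c p v = coord_vec N c' p (?G' v)" for v
    using pushforward_coord_vec[OF N N smooth_map_ident[OF N] c c', of v]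
      pushforward_ident[OF coord_vec_in_tangent_space[OF c]] by metis
  have G: "smooth_on ?S ?G" by (rule smooth_map_local[OF smooth_map_ident[OF N] c(1) c'(1)])
  have S: "open ?S" by (rule smooth_map_local_open[OF N N smooth_map_ident[OF N] c(1) c'(1)])
  have pS: "snd c p \<in> ?S" using c c' by auto
  have Gp: "?G (snd c p) = snd c' p" by (simp add: chart_inv_chart[OF N c])
  have GS: "?G y \<in> snd c' ` fst c'" if "y \<in> ?S" for y
    using that by (auto simp: chart_inv_chart[OF N c(1)])
  have "d1 (loc1 N c \<omega>) (snd c p) v w = d1 (\<lambda>y v. loc1 N c' \<omega> (?G y) (frechet_derivative ?G (at y) v)) (snd c p) v w"
  proof (rule fun_cong[OF fun_cong[OF d1_cong[OF S pS]]])
    fix y v assume y: "y \<in> ?S"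
    have "loc1 N c (pullback N (\<lambda>x. x) \<omega>) y v = loc1 N c \<omega> y v"
    proof -
      have "chart_inv c y \<in> fst c" using y by (auto simp: chart_inv_chart[OF N c(1)])
      from pushforward_ident[OF coord_vec_in_tangent_space[OF c(1) this]]
      show ?thesis by (simp add: loc1_def pullback_def)
    qed
    then show "loc1 N c \<omega> y v = loc1 N c' \<omega> (?G y) (frechet_derivative ?G (at y) v)"
      using loc1_pullback[OF N N smooth_map_ident[OF N] c(1) c'(1) y, of \<omega> v] by simp
  qed
  also have "\<dots> = d1 (loc1 N c' \<omega>) (?G (snd c p)) (?G' v) (?G' w)"
  proof (rule d1_pullback[OF S G pS])
    show "linear (loc1 N c' \<omega> (?G y))" if "y \<in> ?S" for y
      by (rule loc1_linear[OF \<omega> N c'(1) GS[OF that]])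
    show "linear (loc1 N c' \<omega> z)" if "z \<in> snd c' ` fst c'" for z
      by (rule loc1_linear[OF \<omega> N c'(1) that])
    show "open (snd c' ` fst c')" by (rule charted_open[OF N c'(1)])
    show "?G (snd c p) \<in> snd c' ` fst c'" using GS pS by blast
    then show "(\<lambda>z. loc1 N c' \<omega> z b) differentiable at (?G (snd c p))" for b
      by (rule smooth_on_differentiable[OF loc1_smooth[OF \<omega> c'(1)]])
  qed
  also have "\<dots> = ext_deriv N \<omega> p [coord_vec N c p v, coord_vec N c p w]"
    unfolding Gp cv e2 ..
  finally show ?thesis by (rule sym)
qed


section \<open>Left-invariant one-forms on the Heisenberg group\<close>

definition H3_chart :: "(real^3^3, real \<times> real \<times> real) chart" where
  "H3_chart = (H3_set, \<lambda>A. (A $ 1 $ 2, A $ 1 $ 3, A $ 2 $ 3))"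

lemma heis_nth [simp]:
  "heis a b c $ 1 $ 1 = 1" "heis a b c $ 1 $ 2 = a" "heis a b c $ 1 $ 3 = b"
  "heis a b c $ 2 $ 1 = 0" "heis a b c $ 2 $ 2 = 1" "heis a b c $ 2 $ 3 = c"
  "heis a b c $ 3 $ 1 = 0" "heis a b c $ 3 $ 2 = 0" "heis a b c $ 3 $ 3 = 1"
  by (simp_all add: heis_def)

lemma heis_mult: "heis a b c ** heis a' b' c' = heis (a + a') (b' + a * c' + b) (c + c')"
  by (simp add: vec_eq_iff forall_3 matrix_matrix_mult_def sum_3)

lemma heis_in_H3_set [simp]: "heis a b c \<in> H3_set"
  by (auto simp: H3_set_def)

lemma atlas_H3: "atlas H3 = {H3_chart}"
  by (simp add: H3_def H3_chart_def)

lemma H3_chart_in_atlas [simp]: "H3_chart \<in> atlas H3"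
  by (simp add: atlas_H3)

lemma points_H3 [simp]: "points H3 = H3_set"
  by (simp add: H3_def)

lemma mtop_H3: "mtop H3 = top_of_set H3_set"
  by (simp add: H3_def)

lemma fst_H3_chart [simp]: "fst H3_chart = H3_set"
  by (simp add: H3_chart_def)

lemma snd_H3_chart [simp]: "snd H3_chart (heis a b c) = (a, b, c)"
  by (simp add: H3_chart_def)

lemma snd_H3_chart_image [simp]: "snd H3_chart ` H3_set = UNIV"
proof -
  have "x \<in> snd H3_chart ` H3_set" for x
    by (cases x) (metis heis_in_H3_set image_eqI snd_H3_chart)
  then show ?thesis by auto
qed

lemma inj_on_H3_chart: "inj_on (snd H3_chart) H3_set"
  by (auto simp: inj_on_def H3_set_def)

lemma chart_inv_H3 [simp]: "inv_into H3_set (snd H3_chart) (a, b, c) = heis a b c"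
  using inv_into_f_f[OF inj_on_H3_chart heis_in_H3_set[of a b c]] by simp

text \<open>\<open>heis\<close> is affine in its three entries. Its continuity is the inverse
  direction of the homeomorphism given by \<open>H3_chart\<close>.\<close>

lemma continuous_on_heis: "continuous_on S (\<lambda>x. heis (fst x) (fst (snd x)) (snd (snd x)))"
proof -
  have eq: "(\<lambda>x. heis (fst x) (fst (snd x)) (snd (snd x))) = (\<lambda>x. mat 1 + fst x *\<^sub>R (heis 1 0 0 - mat 1) +
      fst (snd x) *\<^sub>R (heis 0 1 0 - mat 1) + snd (snd x) *\<^sub>R (heis 0 0 1 - mat 1))"
    by (rule ext) (simp add: vec_eq_iff forall_3 mat_def)
  show ?thesis
    unfolding eq by (intro continuous_intros)
qed

lemma charted_H3: "charted H3"
proof -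
  have "homeomorphic_maps (top_of_set H3_set) euclidean (snd H3_chart)
      (\<lambda>x. heis (fst x) (fst (snd x)) (snd (snd x)))"
    unfolding homeomorphic_maps_def
  proof (intro conjI ballI)
    show "continuous_map (top_of_set H3_set) euclidean (snd H3_chart)"
      unfolding H3_chart_def snd_conv continuous_map_iff_continuous by (intro continuous_intros)
    show "continuous_map euclidean (top_of_set H3_set) (\<lambda>x. heis (fst x) (fst (snd x)) (snd (snd x)))"
      by (simp add: continuous_map_in_subtopology continuous_on_heis)
  qed (auto simp: H3_set_def)
  then have h: "homeomorphic_map (top_of_set H3_set) euclidean (snd H3_chart)"
    unfolding homeomorphic_map_maps by blast
  have "snd H3_chart (inv_into H3_set (snd H3_chart) x) = x" for x
    by (cases x) auto
  then have "smooth_on UNIV (snd H3_chart \<circ> inv_into H3_set (snd H3_chart))"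
    by (simp add: o_def smooth_on_id)
  then show ?thesis
    unfolding charted_def atlas_H3 mtop_H3
    using h by (simp add: subtopology_subtopology)
qed

lemma smooth_map_left_mult: "smooth_map H3 H3 (\<lambda>B. heis a b c ** B)"
proof -
  have "continuous_on H3_set (\<lambda>B. heis a b c ** B)"
    unfolding matrix_matrix_mult_def by (intro continuous_intros)
  moreover have "heis a b c ** B \<in> H3_set" if "B \<in> H3_set" for B
  proof -
    obtain a' b' c' where "B = heis a' b' c'" using \<open>B \<in> H3_set\<close> by (auto simp: H3_set_def)
    then show ?thesis by (simp add: heis_mult)
  qed
  moreover from this have "H3_set \<inter> (\<lambda>B. heis a b c ** B) -` H3_set = H3_set" by auto
  moreover have "smooth_on UNIV (\<lambda>x. (a, b, c) + (fst x, fst (snd x) + a * snd (snd x), snd (snd x)))"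
    by (intro smooth_on_add smooth_on_const smooth_on_bounded_linear bounded_linear_intros open_UNIV)
  then have "smooth_on UNIV (snd H3_chart \<circ> (\<lambda>B. heis a b c ** B) \<circ> inv_into H3_set (snd H3_chart))"
    by (rule smooth_on_cong[OF open_UNIV, rotated]) (auto simp: heis_mult)
  ultimately show ?thesis
    by (auto simp: smooth_map_def mtop_H3 atlas_H3 split_def continuous_map_in_subtopology)
qed

abbreviation H3_vec :: "real^3^3 \<Rightarrow> real \<times> real \<times> real \<Rightarrow> (real^3^3) tvec" where
  "H3_vec \<equiv> coord_vec H3 H3_chart"

lemma pushforward_left_mult:
  "pushforward H3 (\<lambda>B. heis a b c ** B) (heis a' b' c') (H3_vec (heis a' b' c') (v1, v2, v3)) =
    H3_vec (heis a b c ** heis a' b' c') (v1, v2 + a * v3, v3)"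
proof -
  have 1: "((\<lambda>x. (a, b, c) + (fst x, fst (snd x) + a * snd (snd x), snd (snd x)))
    has_derivative (\<lambda>x. (fst x, fst (snd x) + a * snd (snd x), snd (snd x)))) (at x)" for x
    by (auto intro!: derivative_eq_intros)
  have 2: "snd H3_chart \<circ> (\<lambda>B. heis a b c ** B) \<circ> inv_into H3_set (snd H3_chart) =
      (\<lambda>x. (a, b, c) + (fst x, fst (snd x) + a * snd (snd x), snd (snd x)))"
    by (auto simp: heis_mult)
  have "frechet_derivative (snd H3_chart \<circ> (\<lambda>B. heis a b c ** B) \<circ> inv_into H3_set (snd H3_chart)) (at x) =
      (\<lambda>x. (fst x, fst (snd x) + a * snd (snd x), snd (snd x)))" for x
    unfolding 2 by (rule frechet_derivative_at[OF 1, symmetric])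
  then show ?thesis
    using pushforward_coord_vec[OF charted_H3 charted_H3 smooth_map_left_mult H3_chart_in_atlas _ H3_chart_in_atlas,
        of "heis a' b' c'" a b c "(v1, v2, v3)"]
    by (simp add: heis_mult)
qed

text \<open>The coefficients of a left-invariant one-form with respect to
  da, dc, db - a dc in the coordinates of \<^const>\<open>heis\<close>.\<close>

definition lc1 :: "(real^3^3) field \<Rightarrow> real" where
  "lc1 \<omega> = \<omega> (heis 0 0 0) [H3_vec (heis 0 0 0) (1, 0, 0)]"
definition lc2 :: "(real^3^3) field \<Rightarrow> real" where
  "lc2 \<omega> = \<omega> (heis 0 0 0) [H3_vec (heis 0 0 0) (0, 0, 1)]"
definition lc3 :: "(real^3^3) field \<Rightarrow> real" where
  "lc3 \<omega> = \<omega> (heis 0 0 0) [H3_vec (heis 0 0 0) (0, 1, 0)]"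

lemma left_invariant_diff_form: "left_invariant \<omega> \<Longrightarrow> diff_form H3 1 \<omega>"
  by (simp add: left_invariant_def)

text \<open>Invariance reduces the value at \<open>heis a b c\<close> to one at the identity. Left
  translation by \<open>heis a b c\<close> maps the components (v1, v2, v3) at the identity to (v1,
  v2 + a v3, v3), so the vector to be taken there has the middle component v2 - a v3.\<close>

lemma left_invariant_value:
  assumes "left_invariant \<omega>"
  shows "\<omega> (heis a b c) [H3_vec (heis a b c) (v1, v2, v3)] =
    lc1 \<omega> * v1 + lc2 \<omega> * v3 + lc3 \<omega> * (v2 - a * v3)"
proof -
  let ?X = "H3_vec (heis 0 0 0) (v1, v2 - a * v3, v3)"
  let ?L = "\<lambda>v. \<omega> (heis 0 0 0) [H3_vec (heis 0 0 0) v]"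
  have L: "linear ?L"
    by (rule diff_form1_linear[OF left_invariant_diff_form[OF assms] charted_H3 H3_chart_in_atlas]) simp
  have "?X \<in> tangent_space H3 (heis 0 0 0)" by (intro coord_vec_in_tangent_space) auto
  then have "pullback H3 (\<lambda>B. heis a b c ** B) \<omega> (heis 0 0 0) [?X] = \<omega> (heis 0 0 0) [?X]"
    using assms by (simp add: left_invariant_def field_eq_def)
  moreover have "heis a b c ** heis 0 0 0 = heis a b c" by (simp add: heis_mult)
  ultimately have "\<omega> (heis a b c) [H3_vec (heis a b c) (v1, v2, v3)] = ?L (v1, v2 - a * v3, v3)"
    by (simp add: pullback_def pushforward_left_mult)
  also have "(v1, v2 - a * v3, v3) = v1 *\<^sub>R (1, 0, 0) + v3 *\<^sub>R (0, 0, 1) + (v2 - a * v3) *\<^sub>R (0, 1, 0)" by simp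
  also have "?L \<dots> = v1 *\<^sub>R ?L (1, 0, 0) + v3 *\<^sub>R ?L (0, 0, 1) + (v2 - a * v3) *\<^sub>R ?L (0, 1, 0)"
    by (simp only: linear_add[OF L] linear_cmul[OF L])
  finally show ?thesis by (simp add: lc1_def lc2_def lc3_def)
qed

section \<open>Low-degree products of covariant tensors\<close>

text \<open>\<open>wedge\<close> and \<open>tensor_prod\<close> sum over splittings of the argument
  list into parts of any length. This predicate discards those of the wrong lengths. It concerns
  lists of vectors in T only, since values elsewhere carry no meaning.\<close>

definition of_degree :: "'x set \<Rightarrow> nat \<Rightarrow> ('x, real) tensor \<Rightarrow> bool" where
  "of_degree T k a \<longleftrightarrow> (\<forall>Xs\<in>lists T. length Xs \<noteq> k \<longrightarrow> a Xs = 0)"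

lemma of_degreeD: "of_degree T k a \<Longrightarrow> Xs \<in> lists T \<Longrightarrow> length Xs \<noteq> k \<Longrightarrow> a Xs = 0"
  by (simp add: of_degree_def)

lemma multilinear_on_of_degree: "multilinear_on T k a \<Longrightarrow> of_degree T k a"
  by (simp add: multilinear_on_def of_degree_def)

lemma of_degree_scale: "of_degree T k a \<Longrightarrow> of_degree T k (c \<odot> a)"
  by (simp add: of_degree_def scale_def)

lemma of_degree_add: "of_degree T k a \<Longrightarrow> of_degree T k b \<Longrightarrow> of_degree T k (a + b)"
  by (simp add: of_degree_def)

lemma of_degree_diff: "of_degree T k a \<Longrightarrow> of_degree T k b \<Longrightarrow> of_degree T k (a - b)"
  by (simp add: of_degree_def)

lemma nths_in_lists: "Xs \<in> lists T \<Longrightarrow> nths Xs I \<in> lists T"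
  using set_nths_subset by (fastforce simp: lists_eq_set)

text \<open>A nonzero summand needs k positions in I and l positions outside, and these two sets
  partition all positions.\<close>

lemma of_degree_wedge:
  assumes a: "of_degree T k a" and b: "of_degree T l b"
  shows "of_degree T (k + l) (a \<^bold>\<and> b)"
  unfolding of_degree_def
proof (intro ballI impI)
  fix Xs assume Xs: "Xs \<in> lists T" and len: "length Xs \<noteq> k + l"
  have "a (nths Xs I) * b (nths Xs (- I)) = 0" if "I \<in> Pow {..<length Xs}" for I
  proof (rule ccontr)
    assume "a (nths Xs I) * b (nths Xs (- I)) \<noteq> 0"
    then have "length (nths Xs I) = k" "length (nths Xs (- I)) = l"
      using of_degreeD[OF a nths_in_lists[OF Xs]] of_degreeD[OF b nths_in_lists[OF Xs]] by auto
    moreover have "{i. i < length Xs \<and> i \<in> I} \<union> {i. i < length Xs \<and> i \<in> - I} = {..<length Xs}" by auto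
    then have "card {i. i < length Xs \<and> i \<in> I} + card {i. i < length Xs \<and> i \<in> - I} = length Xs"
      by (subst card_Un_disjoint[symmetric]) auto
    ultimately show False using len by (simp add: length_nths)
  qed
  then show "(a \<^bold>\<and> b) Xs = 0"
    unfolding wedge_def by (intro sum.neutral) (auto simp: mult.assoc)
qed

lemma of_degree_tensor_prod:
  assumes a: "of_degree T k a" and b: "of_degree T l b"
  shows "of_degree T (k + l) (a \<otimes> b)"
  unfolding of_degree_def
proof (intro ballI impI)
  fix Xs assume Xs: "Xs \<in> lists T" and len: "length Xs \<noteq> k + l"
  have "a (take n Xs) * b (drop n Xs) = 0" if "n \<le> length Xs" for n
  proof (rule ccontr)
    assume "a (take n Xs) * b (drop n Xs) \<noteq> 0"
    moreover have "take n Xs \<in> lists T" "drop n Xs \<in> lists T"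
      using Xs set_take_subset[of n Xs] set_drop_subset[of n Xs] by (auto simp: lists_eq_set)
    ultimately have "length (take n Xs) = k" "length (drop n Xs) = l"
      using of_degreeD[OF a, of "take n Xs"] of_degreeD[OF b, of "drop n Xs"]
      by (auto simp del: length_take length_drop)
    then show False using len that by simp
  qed
  then show "(a \<otimes> b) Xs = 0"
    unfolding tensor_prod_def by (intro sum.neutral) auto
qed

text \<open>Splits a sum over subsets by membership of x; used repeatedly, it enumerates the index
  sets in \<open>wedge\<close>.\<close>

lemma sum_Pow_insert:
  assumes "finite A" "x \<notin> A"
  shows "sum f (Pow (insert x A)) = (\<Sum>I\<in>Pow A. f I + f (insert x I))"
proof -
  have "inj_on (insert x) (Pow A)" using assms(2) by (auto simp: inj_on_def)
  moreover have "Pow A \<inter> insert x ` Pow A = {}" using assms(2) by auto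
  ultimately show ?thesis
    using assms(1) by (simp add: Pow_insert sum.union_disjoint sum.reindex sum.distrib)
qed

lemma card_inversions:
  assumes "finite I" "finite J"
  shows "card {(i, j). i \<in> I \<and> j \<in> J \<and> j < i} = (\<Sum>i\<in>I. \<Sum>j\<in>J. of_bool ((j::nat) < i))"
proof -
  have "{(i, j). i \<in> I \<and> j \<in> J \<and> j < i} = (SIGMA i:I. {j \<in> J. j < i})" by auto
  then have "card {(i, j). i \<in> I \<and> j \<in> J \<and> j < i} = (\<Sum>i\<in>I. card {j \<in> J. j < i})"
    using assms by (simp add: card_SigmaI)
  then show ?thesis
    using assms by (simp add: of_bool_def sum.If_cases Int_def)
qed

text \<open>The number of inversions in the sign becomes a double sum, which simplification can
  evaluate for explicit index sets.\<close>

lemma wedge_eq: "(a \<^bold>\<and> b) Xs = (\<Sum>I\<in>Pow {..<length Xs}.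
    (- 1) ^ (\<Sum>i\<in>I. \<Sum>j\<in>{..<length Xs} - I. of_bool (j < i)) * a (nths Xs I) * b (nths Xs (- I)))"
  unfolding wedge_def
proof (rule sum.cong)
  fix I assume "I \<in> Pow {..<length Xs}"
  then have "finite I" using finite_subset by blast
  from card_inversions[OF this, of "{..<length Xs} - I"]
  show "(- 1) ^ card {(i, j). i \<in> I \<and> j \<in> {..<length Xs} - I \<and> j < i} * a (nths Xs I) * b (nths Xs (- I)) =
      (- 1) ^ (\<Sum>i\<in>I. \<Sum>j\<in>{..<length Xs} - I. of_bool (j < i)) * a (nths Xs I) * b (nths Xs (- I))"
    by (simp only: finite_Diff finite_lessThan)
qed simp

lemmas wedge_expand = sum_Pow_insert nths_def insert_Diff_if

lemma wedge_2:
  assumes "of_degree T 1 a" "of_degree T 1 b" "X \<in> T" "Y \<in> T"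
  shows "(a \<^bold>\<and> b) [X, Y] = a [X] * b [Y] - a [Y] * b [X]"
proof -
  have [simp]: "a [] = 0" "b [] = 0" using assms by (auto simp: of_degree_def)
  have l: "{..<length [X, Y]} = {0, 1}" by auto
  show ?thesis
    unfolding wedge_eq l by (simp add: wedge_expand)
qed

lemma wedge_3_12:
  assumes "of_degree T 1 a" "of_degree T 2 b" "X \<in> T" "Y \<in> T" "Z \<in> T"
  shows "(a \<^bold>\<and> b) [X, Y, Z] = a [X] * b [Y, Z] - a [Y] * b [X, Z] + a [Z] * b [X, Y]"
proof -
  have [simp]: "a [] = 0" "b [] = 0" "x \<in> T \<Longrightarrow> b [x] = 0" "x \<in> T \<Longrightarrow> y \<in> T \<Longrightarrow> a [x, y] = 0" for x y
    using assms by (auto simp: of_degree_def)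
  have l: "{..<length [X, Y, Z]} = {0, 1, 2}" by auto
  show ?thesis
    unfolding wedge_eq l using assms(3-) by (simp add: wedge_expand)
qed

lemma wedge_3_21:
  assumes "of_degree T 2 a" "of_degree T 1 b" "X \<in> T" "Y \<in> T" "Z \<in> T"
  shows "(a \<^bold>\<and> b) [X, Y, Z] = a [X, Y] * b [Z] - a [X, Z] * b [Y] + a [Y, Z] * b [X]"
proof -
  have [simp]: "a [] = 0" "b [] = 0" "x \<in> T \<Longrightarrow> a [x] = 0" "x \<in> T \<Longrightarrow> y \<in> T \<Longrightarrow> b [x, y] = 0" for x y
    using assms by (auto simp: of_degree_def)
  have l: "{..<length [X, Y, Z]} = {0, 1, 2}" by auto
  show ?thesis
    unfolding wedge_eq l using assms(3-) by (simp add: wedge_expand)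
qed

lemma wedge_4_22:
  assumes "of_degree T 2 a" "of_degree T 2 b" "X \<in> T" "Y \<in> T" "Z \<in> T" "W \<in> T"
  shows "(a \<^bold>\<and> b) [X, Y, Z, W] = a [X, Y] * b [Z, W] - a [X, Z] * b [Y, W] + a [X, W] * b [Y, Z]
    + a [Y, Z] * b [X, W] - a [Y, W] * b [X, Z] + a [Z, W] * b [X, Y]"
proof -
  have [simp]: "a [] = 0" "b [] = 0" "x \<in> T \<Longrightarrow> a [x] = 0" "x \<in> T \<Longrightarrow> b [x] = 0"
    "x \<in> T \<Longrightarrow> y \<in> T \<Longrightarrow> z \<in> T \<Longrightarrow> b [x, y, z] = 0" for x y z
    using assms by (auto simp: of_degree_def)
  have l: "{..<length [X, Y, Z, W]} = {0, 1, 2, 3}" by auto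
  show ?thesis
    unfolding wedge_eq l using assms(3-) by (simp add: wedge_expand)
qed

lemma tensor_prod_2:
  assumes "of_degree T 1 a" "of_degree T 1 b" "X \<in> T" "Y \<in> T"
  shows "(a \<otimes> b) [X, Y] = a [X] * b [Y]"
proof -
  have [simp]: "a [] = 0" "b [] = 0" using assms by (auto simp: of_degree_def)
  have l: "{..length [X, Y]} = {0, 1, 2}" by auto
  show ?thesis
    unfolding tensor_prod_def l by simp
qed


section \<open>Velocities of vertical curves\<close>

text \<open>The chain rule for u along \<gamma>. Continuity of \<gamma> at 0, expressed by the open
  sets of M, keeps the curve inside the chart for small t.\<close>

lemma velocity_eq_coord_vec:
  assumes c: "c \<in> atlas M" "\<gamma> 0 \<in> fst c" and M: "charted M"
    and cont: "\<And>W. openin (mtop M) W \<Longrightarrow> \<gamma> 0 \<in> W \<Longrightarrow> \<forall>\<^sub>F t in nhds 0. \<gamma> t \<in> W"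
    and der: "((\<lambda>t. snd c (\<gamma> t)) has_derivative (\<lambda>t. t *\<^sub>R d)) (at 0)"
  shows "velocity M \<gamma> = coord_vec M c (\<gamma> 0) d"
proof
  fix u
  show "velocity M \<gamma> u = coord_vec M c (\<gamma> 0) d u"
  proof (cases "smooth_at M (\<gamma> 0) u")
    case True
    let ?D = "frechet_derivative (u \<circ> chart_inv c) (at (snd c (\<gamma> 0)))"
    note D = smooth_at_has_derivative[OF True c]
    have "((\<lambda>t. (u \<circ> chart_inv c) (snd c (\<gamma> t))) has_derivative (\<lambda>t. ?D (t *\<^sub>R d))) (at 0)"
      by (rule has_derivative_compose[OF der D])
    then have D1: "((\<lambda>t. (u \<circ> chart_inv c) (snd c (\<gamma> t))) has_derivative (\<lambda>t. ?D (t *\<^sub>R d))) (at 0)" .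
    obtain S where S: "open S" "0 \<in> S" "\<And>t. t \<in> S \<Longrightarrow> \<gamma> t \<in> fst c"
      using cont[OF charted_fst_openin[OF M c(1)] c(2)] unfolding eventually_nhds by blast
    have "((u \<circ> \<gamma>) has_derivative (\<lambda>t. ?D (t *\<^sub>R d))) (at 0)"
      by (rule has_derivative_transform_within_open[OF D1 S(1,2)]) (simp add: chart_inv_chart[OF M c(1) S(3)])
    moreover have "(\<lambda>t. ?D (t *\<^sub>R d)) = times (?D d)"
      using has_derivative_linear[OF D] by (auto simp: linear_cmul)
    ultimately have "((u \<circ> \<gamma>) has_real_derivative ?D d) (at 0)"
      by (simp add: has_field_derivative_def)
    from DERIV_imp_deriv[OF this] show ?thesis using True by (simp add: velocity_def coord_vec_def)
  qed (simp add: velocity_def coord_vec_def)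
qed

text \<open>The member \<theta> = 0 of the atlas of \<open>circle\<close>. It contains cis t for
  small t and returns t there.\<close>

definition circle_chart :: "(complex, real) chart" where
  "circle_chart = (sphere 0 1 - {- 1}, Arg)"

lemma circle_chart_in_atlas: "circle_chart \<in> atlas circle"
  by (auto simp: circle_def circle_chart_def intro!: exI[of _ 0])

lemma cis_in_circle_chart: "\<bar>t\<bar> < pi \<Longrightarrow> cis t \<in> fst circle_chart"
proof -
  assume t: "\<bar>t\<bar> < pi"
  then have "Arg (cis t) = t" by (intro Arg_cis) auto
  moreover have "Arg (- 1) = pi" using Arg_cis[of pi] by simp
  ultimately have "cis t \<noteq> - 1" using t by auto
  then show ?thesis by (auto simp: circle_chart_def)
qed

lemma circle_chart_cis: "\<bar>t\<bar> < pi \<Longrightarrow> snd circle_chart (cis t) = t"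
  using Arg_cis[of t] by (simp add: circle_chart_def abs_less_iff)

lemma inj_on_circle_chart: "inj_on (snd circle_chart) (fst circle_chart)"
proof (rule inj_onI)
  fix z w assume "z \<in> fst circle_chart" "w \<in> fst circle_chart" "snd circle_chart z = snd circle_chart w"
  then have "z \<noteq> 0" "w \<noteq> 0" "sgn z = z" "sgn w = w" "Arg z = Arg w"
    by (auto simp: circle_chart_def sgn_eq)
  then show "z = w" using cis_Arg by metis
qed

lemma prod_chart_in_atlas:
  "c \<in> atlas M \<Longrightarrow> d \<in> atlas N \<Longrightarrow> prod_chart c d \<in> atlas (M \<times>\<^sub>M\<^sub>f N)"
  unfolding atlas_prod_manifold by blast

text \<open>Near t = 0 the curve in the product of E and the torus is affine in a product chart, and
  the action is smooth; so the orbit is differentiable in a chart of E and its velocity is a tangent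
  vector. It is vertical because \<pi> is constant on orbits. The values (1, 0) and (0, 1) of (a, b)
  give the two fundamental fields.\<close>

lemma vertical_velocity:
  assumes P: "principal_T2_bundle E \<pi> act" and p: "p \<in> points E"
  shows "velocity E (\<lambda>t. act p (cis (a * t), cis (b * t))) \<in> tangent_space E p"
    and "pushforward H3 \<pi> p (velocity E (\<lambda>t. act p (cis (a * t), cis (b * t)))) = (\<lambda>u. 0)"
proof -
  let ?act = "\<lambda>(p, z). act p z" and ?z = "\<lambda>t. (cis (a * t), cis (b * t))"
  let ?\<gamma> = "\<lambda>t. act p (?z t)"
  have E: "charted E" and act: "smooth_map (E \<times>\<^sub>M\<^sub>f T2) E ?act"
    using P smooth_manifold_charted by (auto simp: principal_T2_bundle_def)
  have g0: "?\<gamma> 0 = p" using P p by (simp add: principal_T2_bundle_def)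
  have zT: "?z t \<in> points T2" for t by (simp add: T2_def circle_def)
  obtain c where c: "c \<in> atlas E" "p \<in> fst c" using charted_ex_chart[OF E p] by blast
  have cz: "continuous_map euclideanreal (mtop circle) (\<lambda>t. cis (r * t))" for r
    by (simp add: circle_def continuous_map_in_subtopology) (intro continuous_intros)
  have "continuous_map euclideanreal (mtop (E \<times>\<^sub>M\<^sub>f T2)) (\<lambda>t. (p, ?z t))"
    unfolding T2_def mtop_prod_manifold by (intro continuous_map_pairedI cz) (use p in simp)
  then have cont: "continuous_map euclideanreal (mtop E) ?\<gamma>"
    using act continuous_map_compose[of euclideanreal "mtop (E \<times>\<^sub>M\<^sub>f T2)" "\<lambda>t. (p, ?z t)" "mtop E" ?act]
    by (simp add: smooth_map_def o_def)
  have ev: "\<forall>\<^sub>F t in nhds 0. ?\<gamma> t \<in> W" if "openin (mtop E) W" "?\<gamma> 0 \<in> W" for W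
  proof -
    have "open {t. ?\<gamma> t \<in> W}"
      using openin_continuous_map_preimage[OF cont that(1)] by simp
    from eventually_nhds_in_open[OF this, of 0] show ?thesis using that(2) by simp
  qed
  let ?e = "prod_chart c (prod_chart circle_chart circle_chart)"
  let ?F = "snd c \<circ> ?act \<circ> chart_inv ?e"
  have e: "?e \<in> atlas (E \<times>\<^sub>M\<^sub>f T2)"
    unfolding T2_def by (intro prod_chart_in_atlas c circle_chart_in_atlas)
  have inv: "chart_inv ?e (snd c p, a * t, b * t) = (p, ?z t)" if "\<bar>a * t\<bar> < pi \<and> \<bar>b * t\<bar> < pi" for t
  proof -
    have "inj_on (snd ?e) (fst ?e)"
      unfolding fst_prod_chart snd_prod_chart
      by (intro map_prod_inj_on inj_on_circle_chart charted_inj[OF E c(1)])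
    moreover have "(p, ?z t) \<in> fst ?e" using c that by (simp add: cis_in_circle_chart)
    moreover have "snd ?e (p, ?z t) = (snd c p, a * t, b * t)" using that by (simp add: circle_chart_cis)
    ultimately show ?thesis using inv_into_f_f by metis
  qed
  have "(p, ?z 0) \<in> fst ?e \<inter> ?act -` fst c"
    using c g0 cis_in_circle_chart[of 0] by simp
  moreover have "snd ?e (p, ?z 0) = (snd c p, 0, 0)" using circle_chart_cis[of 0] by simp
  ultimately have "(snd c p, 0, 0) \<in> snd ?e ` (fst ?e \<inter> ?act -` fst c)" by (metis image_eqI)
  then have F: "(?F has_derivative frechet_derivative ?F (at (snd c p, 0, 0))) (at (snd c p, 0, 0))"
    by (rule smooth_on_has_derivative[OF smooth_map_local[OF act e c(1)]])
  have "((\<lambda>t. (snd c p, a * t, b * t)) has_derivative (\<lambda>t. (0, a * t, b * t))) (at 0)"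
    by (auto intro!: derivative_eq_intros)
  from has_derivative_compose[OF this, of ?F] F
  have "((\<lambda>t. ?F (snd c p, a * t, b * t)) has_derivative
      (\<lambda>t. frechet_derivative ?F (at (snd c p, 0, 0)) (0, a * t, b * t))) (at 0)" by simp
  moreover have "(\<lambda>t. frechet_derivative ?F (at (snd c p, 0, 0)) (0, a * t, b * t)) =
      (\<lambda>t. t *\<^sub>R frechet_derivative ?F (at (snd c p, 0, 0)) (0, a, b))"
    using linear_cmul[OF has_derivative_linear[OF F], of _ "(0, a, b)"] by (simp add: mult.commute)
  ultimately have "((\<lambda>t. ?F (snd c p, a * t, b * t)) has_derivative
      (\<lambda>t. t *\<^sub>R frechet_derivative ?F (at (snd c p, 0, 0)) (0, a, b))) (at 0)" by simp
  then have der: "((\<lambda>t. snd c (?\<gamma> t)) has_derivative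
      (\<lambda>t. t *\<^sub>R frechet_derivative ?F (at (snd c p, 0, 0)) (0, a, b))) (at 0)"
  proof (rule has_derivative_transform_within_open)
    \<comment> \<open>For these t both angles lie strictly between -pi and pi, where the circle
      charts invert cis.\<close>
    show "open {t. \<bar>a * t\<bar> < pi \<and> \<bar>b * t\<bar> < pi}"
      by (intro open_Collect_conj open_Collect_less continuous_intros)
    show "?F (snd c p, a * t, b * t) = snd c (?\<gamma> t)" if "t \<in> {t. \<bar>a * t\<bar> < pi \<and> \<bar>b * t\<bar> < pi}" for t
      using inv[of t] that by simp
  qed simp
  have "?\<gamma> 0 \<in> fst c" using g0 c by simp
  from velocity_eq_coord_vec[of c E ?\<gamma>, OF c(1) this E ev der]
  show "velocity E ?\<gamma> \<in> tangent_space E p"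
    using coord_vec_in_tangent_space[OF c] g0 by simp
  show "pushforward H3 \<pi> p (velocity E ?\<gamma>) = (\<lambda>u. 0)"
  proof
    fix u :: "real^3^3 \<Rightarrow> real"
    have "\<pi> (?\<gamma> t) = \<pi> p" for t using P p zT by (simp add: principal_T2_bundle_def)
    then have "(u \<circ> \<pi>) \<circ> ?\<gamma> = (\<lambda>t. u (\<pi> p))" by auto
    then show "pushforward H3 \<pi> p (velocity E ?\<gamma>) u = 0"
      by (simp add: pushforward_def velocity_def)
  qed
qed

section \<open>The nearly Kaehler equations at a point\<close>

text \<open>\<open>W2\<close> and \<open>W3\<close> are the wedge products of two and three
  one-forms, these being plain functions on vectors instead of functions on lists.\<close>

definition W2 :: "('v \<Rightarrow> real) \<Rightarrow> ('v \<Rightarrow> real) \<Rightarrow> 'v \<Rightarrow> 'v \<Rightarrow> real" where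
  "W2 a b u v = a u * b v - a v * b u"

definition W3 :: "('v \<Rightarrow> real) \<Rightarrow> ('v \<Rightarrow> real) \<Rightarrow> ('v \<Rightarrow> real) \<Rightarrow> 'v \<Rightarrow> 'v \<Rightarrow> 'v \<Rightarrow> real" where
  "W3 a b c u v w = a u * W2 b c v w - a v * W2 b c u w + a w * W2 b c u v"

lemma W2_has_derivative:
  assumes "\<And>v. ((\<lambda>z. a z v) has_derivative (\<lambda>x. a' x v)) (at z)"
    and "\<And>v. ((\<lambda>z. b z v) has_derivative (\<lambda>x. b' x v)) (at z)"
  shows "((\<lambda>z. W2 (a z) (b z) u v) has_derivative (\<lambda>x. W2 (a' x) (b z) u v + W2 (a z) (b' x) u v)) (at z)"
  unfolding W2_def
  by (rule has_derivative_eq_rhs,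
      (rule has_derivative_add has_derivative_diff has_derivative_mult assms)+)
     (simp add: algebra_simps)

lemma W3_has_derivative:
  assumes "\<And>v. ((\<lambda>z. a z v) has_derivative (\<lambda>x. a' x v)) (at z)"
    and "\<And>v. ((\<lambda>z. b z v) has_derivative (\<lambda>x. b' x v)) (at z)"
    and "\<And>v. ((\<lambda>z. c z v) has_derivative (\<lambda>x. c' x v)) (at z)"
  shows "((\<lambda>z. W3 (a z) (b z) (c z) u v w) has_derivative
    (\<lambda>x. W3 (a' x) (b z) (c z) u v w + W3 (a z) (b' x) (c z) u v w + W3 (a z) (b z) (c' x) u v w)) (at z)"
  unfolding W3_def
  by (rule has_derivative_eq_rhs,
      (rule has_derivative_add has_derivative_diff has_derivative_mult W2_has_derivative assms)+)
     (simp add: algebra_simps)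

text \<open>\<open>sig\<close>, \<open>psip\<close> and \<open>psim\<close> are the given
  expressions for \<sigma>, \<psi>+ and \<psi>- with D for h^2 - s^2, S for ds, P1, P2 for the
  connection forms and A0, A1, A2 for the invariant forms. Being explicit formulas in function
  values, they can be differentiated and simplified directly.\<close>

definition sig :: "real \<Rightarrow> real \<Rightarrow> ('v \<Rightarrow> real) \<Rightarrow> ('v \<Rightarrow> real) \<Rightarrow> ('v \<Rightarrow> real) \<Rightarrow> ('v \<Rightarrow> real) \<Rightarrow>
    ('v \<Rightarrow> real) \<Rightarrow> ('v \<Rightarrow> real) \<Rightarrow> 'v \<Rightarrow> 'v \<Rightarrow> real" where
  "sig s D S P1 P2 A0 A1 A2 u v =
     1 / (3 * D) * W2 S A0 u v + s * W2 P1 P2 u v - W2 P1 A2 u v + W2 P2 A1 u v - s / D * W2 A1 A2 u v"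

definition psip :: "real \<Rightarrow> real \<Rightarrow> real \<Rightarrow> real \<Rightarrow> real \<Rightarrow> ('v \<Rightarrow> real) \<Rightarrow> ('v \<Rightarrow> real) \<Rightarrow> ('v \<Rightarrow> real) \<Rightarrow>
    ('v \<Rightarrow> real) \<Rightarrow> ('v \<Rightarrow> real) \<Rightarrow> ('v \<Rightarrow> real) \<Rightarrow> 'v \<Rightarrow> 'v \<Rightarrow> 'v \<Rightarrow> real" where
  "psip s D gUU gUV gVV S P1 P2 A0 A1 A2 u v w =
     1 / (3 * D) * (D * W3 S P1 P2 u v w + s * (W3 S P1 A2 u v w - W3 S P2 A1 u v w) - W3 S A1 A2 u v w)
     - 1 / D * (gUU * W3 P1 A1 A0 u v w + gUV * W3 P1 A2 A0 u v w
                + gUV * W3 P2 A1 A0 u v w + gVV * W3 P2 A2 A0 u v w)"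

definition psim :: "real \<Rightarrow> real \<Rightarrow> real \<Rightarrow> real \<Rightarrow> real \<Rightarrow> ('v \<Rightarrow> real) \<Rightarrow> ('v \<Rightarrow> real) \<Rightarrow> ('v \<Rightarrow> real) \<Rightarrow>
    ('v \<Rightarrow> real) \<Rightarrow> ('v \<Rightarrow> real) \<Rightarrow> ('v \<Rightarrow> real) \<Rightarrow> 'v \<Rightarrow> 'v \<Rightarrow> 'v \<Rightarrow> real" where
  "psim s D gUU gUV gVV S P1 P2 A0 A1 A2 u v w =
     1 / (3 * D) * (gUU * W3 S P1 A1 u v w + gUV * W3 S P1 A2 u v w
                    + gUV * W3 S P2 A1 u v w + gVV * W3 S P2 A2 u v w)
     + 1 / D * (D * W3 P1 P2 A0 u v w + s * (W3 P1 A2 A0 u v w - W3 P2 A1 A0 u v w) - W3 A1 A2 A0 u v w)"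

text \<open>The derivatives of these expressions along a vector x; S x is the component of x in the
  direction of the interval, along which alone the coefficients vary.\<close>

definition dsig where
  "dsig s D D' S P1 P2 A0 A1 A2 P1' P2' A0' A1' A2' x u v =
     - (D' * S x) / (3 * D\<^sup>2) * W2 S A0 u v + 1 / (3 * D) * W2 S (A0' x) u v
     + S x * W2 P1 P2 u v + s * (W2 (P1' x) P2 u v + W2 P1 (P2' x) u v)
     - (W2 (P1' x) A2 u v + W2 P1 (A2' x) u v) + (W2 (P2' x) A1 u v + W2 P2 (A1' x) u v)
     - ((1 / D - s * D' / D\<^sup>2) * S x * W2 A1 A2 u v
        + s / D * (W2 (A1' x) A2 u v + W2 A1 (A2' x) u v :: real))"

definition dW3 where
  "dW3 a b c a' b' c' x u v w = (W3 (a' x) b c u v w + W3 a (b' x) c u v w + W3 a b (c' x) u v w :: real)"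

definition dpsim where
  "dpsim s D D' gUU gUV gVV gUU' gUV' gVV' S P1 P2 A0 A1 A2 P1' P2' A0' A1' A2' x u v w =
     - (D' * S x) / (3 * D\<^sup>2) * (gUU * W3 S P1 A1 u v w + gUV * W3 S P1 A2 u v w
                    + gUV * W3 S P2 A1 u v w + gVV * W3 S P2 A2 u v w)
     + S x / (3 * D) * (gUU' * W3 S P1 A1 u v w + gUV' * W3 S P1 A2 u v w
                    + gUV' * W3 S P2 A1 u v w + gVV' * W3 S P2 A2 u v w)
     + 1 / (3 * D) * (gUU * dW3 S P1 A1 (\<lambda>x u. 0) P1' A1' x u v w
                    + gUV * dW3 S P1 A2 (\<lambda>x u. 0) P1' A2' x u v w
                    + gUV * dW3 S P2 A1 (\<lambda>x u. 0) P2' A1' x u v w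
                    + gVV * dW3 S P2 A2 (\<lambda>x u. 0) P2' A2' x u v w)
     + dW3 P1 P2 A0 P1' P2' A0' x u v w
     + (1 / D - s * D' / D\<^sup>2) * S x * (W3 P1 A2 A0 u v w - W3 P2 A1 A0 u v w)
     + s / D * (dW3 P1 A2 A0 P1' A2' A0' x u v w - dW3 P2 A1 A0 P2' A1' A0' x u v w)
     + D' * S x / D\<^sup>2 * W3 A1 A2 A0 u v w - 1 / D * (dW3 A1 A2 A0 A1' A2' A0' x u v w :: real)"

lemma sig_has_derivative:
  fixes z0 :: "'a::real_normed_vector"
  assumes hs: "(s has_derivative S) (at z0)" "(D has_derivative (\<lambda>x. D' * S x)) (at z0)"
    and D0: "D z0 \<noteq> 0"
    and hf:
      "\<And>v. ((\<lambda>z. P1 z v) has_derivative (\<lambda>x. P1' x v)) (at z0)"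
      "\<And>v. ((\<lambda>z. P2 z v) has_derivative (\<lambda>x. P2' x v)) (at z0)"
      "\<And>v. ((\<lambda>z. A0 z v) has_derivative (\<lambda>x. A0' x v)) (at z0)"
      "\<And>v. ((\<lambda>z. A1 z v) has_derivative (\<lambda>x. A1' x v)) (at z0)"
      "\<And>v. ((\<lambda>z. A2 z v) has_derivative (\<lambda>x. A2' x v)) (at z0)"
  shows "((\<lambda>z. sig (s z) (D z) S (P1 z) (P2 z) (A0 z) (A1 z) (A2 z) u v) has_derivative
    (\<lambda>x. dsig (s z0) (D z0) D' S (P1 z0) (P2 z0) (A0 z0) (A1 z0) (A2 z0) P1' P2' A0' A1' A2' x u v)) (at z0)"
proof -
  have D0': "3 * D z0 \<noteq> 0" "D z0 \<noteq> 0" using D0 by auto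
  have S: "((\<lambda>z. S v) has_derivative (\<lambda>x. (\<lambda>x u. 0) x v)) (at z0)" for v by simp
  show ?thesis
    unfolding sig_def
    by (rule has_derivative_eq_rhs,
        (rule has_derivative_add has_derivative_diff W2_has_derivative W3_has_derivative hs hf S
          has_derivative_mult has_derivative_divide D0' has_derivative_const)+,
        rule ext)
      (use D0 in \<open>simp add: dsig_def W2_def divide_simps power2_eq_square, simp add: algebra_simps\<close>)
qed

lemma psim_has_derivative:
  fixes z0 :: "'a::real_normed_vector"
  assumes hs: "(s has_derivative S) (at z0)" "(D has_derivative (\<lambda>x. D' * S x)) (at z0)"
      "(gUU has_derivative (\<lambda>x. gUU' * S x)) (at z0)" "(gUV has_derivative (\<lambda>x. gUV' * S x)) (at z0)"
      "(gVV has_derivative (\<lambda>x. gVV' * S x)) (at z0)"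
    and D0: "D z0 \<noteq> 0"
    and hf:
      "\<And>v. ((\<lambda>z. P1 z v) has_derivative (\<lambda>x. P1' x v)) (at z0)"
      "\<And>v. ((\<lambda>z. P2 z v) has_derivative (\<lambda>x. P2' x v)) (at z0)"
      "\<And>v. ((\<lambda>z. A0 z v) has_derivative (\<lambda>x. A0' x v)) (at z0)"
      "\<And>v. ((\<lambda>z. A1 z v) has_derivative (\<lambda>x. A1' x v)) (at z0)"
      "\<And>v. ((\<lambda>z. A2 z v) has_derivative (\<lambda>x. A2' x v)) (at z0)"
  shows "((\<lambda>z. psim (s z) (D z) (gUU z) (gUV z) (gVV z) S (P1 z) (P2 z) (A0 z) (A1 z) (A2 z) u v w) has_derivative
    (\<lambda>x. dpsim (s z0) (D z0) D' (gUU z0) (gUV z0) (gVV z0) gUU' gUV' gVV' S (P1 z0) (P2 z0) (A0 z0) (A1 z0) (A2 z0)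
      P1' P2' A0' A1' A2' x u v w)) (at z0)"
proof -
  have D0': "3 * D z0 \<noteq> 0" "D z0 \<noteq> 0" using D0 by auto
  have S: "((\<lambda>z. S v) has_derivative (\<lambda>x. (\<lambda>x u. 0) x v)) (at z0)" for v by simp
  show ?thesis
    unfolding psim_def
    by (rule has_derivative_eq_rhs,
        (rule has_derivative_add has_derivative_diff W2_has_derivative W3_has_derivative hs hf S
          has_derivative_mult has_derivative_divide D0' has_derivative_const)+,
        rule ext)
      (use D0 in \<open>simp add: dpsim_def dW3_def divide_simps power2_eq_square, simp add: algebra_simps\<close>)
qed

text \<open>The data at a point of the total space in a chart: e is the coordinate vector of the interval, H its
  complement, U1 and U2 span the vertical vectors, and V1, V2, V3 are horizontal lifts of the frame dual
  to N1, N2, N3. In P1', ..., A2' the first argument is the direction of differentiation, whereas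
  D', gUU', ..., m23' are derivatives with respect to s.\<close>

locale nk_point =
  fixes e U1 U2 V1 V2 V3 :: 'v and H :: "'v set"
    and S P1 P2 A0 A1 A2 N1 N2 N3 :: "'v \<Rightarrow> real" and P1' P2' A0' A1' A2' :: "'v \<Rightarrow> 'v \<Rightarrow> real"
    and s D D' gUU gUV gVV gUU' gUV' gVV' :: real
    and m01 m02 m03 m11 m12 m13 m21 m22 m23 m01' m02' m03' m11' m12' m13' m21' m22' m23' :: real
  assumes s: "s > 0" and D: "D > 0"
    and H: "U1 \<in> H" "U2 \<in> H" "V1 \<in> H" "V2 \<in> H" "V3 \<in> H"
    and e: "S e = 1" "P1 e = 0" "P2 e = 0" "N1 e = 0" "N2 e = 0" "N3 e = 0"
    and SH: "\<And>v. v \<in> H \<Longrightarrow> S v = 0"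
    and TU: "P1 U1 = 1" "P1 U2 = 0" "P2 U1 = 0" "P2 U2 = 1"
    and NU: "N1 U1 = 0" "N2 U1 = 0" "N3 U1 = 0" "N1 U2 = 0" "N2 U2 = 0" "N3 U2 = 0"
    and TV: "P1 V1 = 0" "P1 V2 = 0" "P1 V3 = 0" "P2 V1 = 0" "P2 V2 = 0" "P2 V3 = 0"
    and NV: "N1 V1 = 1" "N1 V2 = 0" "N1 V3 = 0" "N2 V1 = 0" "N2 V2 = 1" "N2 V3 = 0"
      "N3 V1 = 0" "N3 V2 = 0" "N3 V3 = 1"
    and A: "\<And>v. A0 v = m01 * N1 v + m02 * N2 v + m03 * N3 v"
      "\<And>v. A1 v = m11 * N1 v + m12 * N2 v + m13 * N3 v"
      "\<And>v. A2 v = m21 * N1 v + m22 * N2 v + m23 * N3 v"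
    and A': "\<And>v. A0' e v = m01' * N1 v + m02' * N2 v + m03' * N3 v"
      "\<And>v. A1' e v = m11' * N1 v + m12' * N2 v + m13' * N3 v"
      "\<And>v. A2' e v = m21' * N1 v + m22' * N2 v + m23' * N3 v"
    and A'e: "\<And>v. A0' v e = 0" "\<And>v. A1' v e = 0" "\<And>v. A2' v e = 0"
    and T'e: "\<And>v. P1' v e = 0" "\<And>v. P2' v e = 0"
    and T'U: "P1' e U1 = 0" "P1' e U2 = 0" "P2' e U1 = 0" "P2' e U2 = 0"
    and dA: "\<And>v w. v \<in> H \<Longrightarrow> w \<in> H \<Longrightarrow> A0' v w = A0' w v - m03 * W2 N1 N2 v w"
      "\<And>v w. v \<in> H \<Longrightarrow> w \<in> H \<Longrightarrow> A1' v w = A1' w v - m13 * W2 N1 N2 v w"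
      "\<And>v w. v \<in> H \<Longrightarrow> w \<in> H \<Longrightarrow> A2' v w = A2' w v - m23 * W2 N1 N2 v w"
    and d_sig: "\<And>u v w. dsig s D D' S P1 P2 A0 A1 A2 P1' P2' A0' A1' A2' u v w
        - dsig s D D' S P1 P2 A0 A1 A2 P1' P2' A0' A1' A2' v u w
        + dsig s D D' S P1 P2 A0 A1 A2 P1' P2' A0' A1' A2' w u v
      = 3 * psip s D gUU gUV gVV S P1 P2 A0 A1 A2 u v w"
    and d_psim: "\<And>u v w r. dpsim s D D' gUU gUV gVV gUU' gUV' gVV' S P1 P2 A0 A1 A2 P1' P2' A0' A1' A2' u v w r
        - dpsim s D D' gUU gUV gVV gUU' gUV' gVV' S P1 P2 A0 A1 A2 P1' P2' A0' A1' A2' v u w r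
        + dpsim s D D' gUU gUV gVV gUU' gUV' gVV' S P1 P2 A0 A1 A2 P1' P2' A0' A1' A2' w u v r
        - dpsim s D D' gUU gUV gVV gUU' gUV' gVV' S P1 P2 A0 A1 A2 P1' P2' A0' A1' A2' r u v w
      = - 4 * (sig s D S P1 P2 A0 A1 A2 u v * sig s D S P1 P2 A0 A1 A2 w r
             - sig s D S P1 P2 A0 A1 A2 u w * sig s D S P1 P2 A0 A1 A2 v r
             + sig s D S P1 P2 A0 A1 A2 u r * sig s D S P1 P2 A0 A1 A2 v w)"
begin

lemma A_e: "A0 e = 0" "A1 e = 0" "A2 e = 0" by (simp_all add: A e)

lemma A_U: "A0 U1 = 0" "A1 U1 = 0" "A2 U1 = 0" "A0 U2 = 0" "A1 U2 = 0" "A2 U2 = 0"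
  by (simp_all add: A NU)

lemma A'_eU: "A0' e U1 = 0" "A1' e U1 = 0" "A2' e U1 = 0" "A0' e U2 = 0" "A1' e U2 = 0" "A2' e U2 = 0"
  by (simp_all add: A' NU)

lemma dA_U:
  assumes "v \<in> H"
  shows "A0' U1 v = A0' v U1" "A1' U1 v = A1' v U1" "A2' U1 v = A2' v U1"
    "A0' U2 v = A0' v U2" "A1' U2 v = A1' v U2" "A2' U2 v = A2' v U2"
  using dA(1)[OF H(1) assms] dA(1)[OF H(2) assms] dA(2)[OF H(1) assms] dA(2)[OF H(2) assms]
    dA(3)[OF H(1) assms] dA(3)[OF H(2) assms] by (simp_all add: W2_def NU)

lemmas point_simps = e TU NU A_e A_U A'_eU A'e T'e T'U

text \<open>This is d\<sigma> = 3 \<psi>+ on e, U1 and v. The terms with derivatives along E either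
  vanish or are derivatives of \<alpha>0 that cancel by \<open>dA_U\<close>, so the curvature of the
  connection does not enter. \<open>P1'_e\<close> results from U2 in the same way.\<close>

lemma P2'_e:
  assumes "v \<in> H"
  shows "s * P2' e v = A2' e v + s / D * A2 v"
proof -
  have "S v = 0" "S U1 = 0" using SH assms H by auto
  then show ?thesis
    using d_sig[of e U1 v] dA_U(1)[OF assms] D
    by (simp add: dsig_def psip_def W2_def W3_def point_simps) (simp add: field_simps)
qed

lemma P1'_e:
  assumes "v \<in> H"
  shows "s * P1' e v = A1' e v + s / D * A1 v"
proof -
  have "S v = 0" "S U2 = 0" using SH assms H by auto
  then show ?thesis
    using d_sig[of e U2 v] dA_U(4)[OF assms] D
    by (simp add: dsig_def psip_def W2_def W3_def point_simps) (simp add: field_simps)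
qed

end

text \<open>\<open>hor\<close> says that the curvature of the connection is horizontal, \<open>det\<close> that the invariant one-forms
  are linearly independent.\<close>

locale nk_point_horizontal = nk_point +
  assumes hor: "\<And>v. v \<in> H \<Longrightarrow> P1' U1 v = P1' v U1" "\<And>v. v \<in> H \<Longrightarrow> P1' U2 v = P1' v U2"
      "\<And>v. v \<in> H \<Longrightarrow> P2' U1 v = P2' v U1" "\<And>v. v \<in> H \<Longrightarrow> P2' U2 v = P2' v U2"
    and det: "m01 * (m12 * m23 - m13 * m22) - m02 * (m11 * m23 - m13 * m21) + m03 * (m11 * m22 - m12 * m21) \<noteq> 0"
begin

lemma SU: "S U1 = 0" "S U2 = 0" "S V1 = 0" "S V2 = 0" "S V3 = 0"
  using SH H by auto

lemma A_V: "A0 V1 = m01" "A0 V2 = m02" "A0 V3 = m03" "A1 V1 = m11" "A1 V2 = m12" "A1 V3 = m13"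
    "A2 V1 = m21" "A2 V2 = m22" "A2 V3 = m23"
  by (simp_all add: A NV)

lemma A'_eV: "A0' e V1 = m01'" "A0' e V2 = m02'" "A0' e V3 = m03'" "A1' e V1 = m11'" "A1' e V2 = m12'" "A1' e V3 = m13'"
    "A2' e V1 = m21'" "A2' e V2 = m22'" "A2' e V3 = m23'"
  by (simp_all add: A' NV)

text \<open>With U1 and U2 among the arguments the equation for d\<psi>- leaves d\<alpha>0, which is
  -m03 N1 \<and> N2 by \<open>dA\<close>. As D + s^2 = h^2, the result says d\<alpha>0 = 4 h^2 /
  (h^2 - s^2) \<alpha>1 \<and> \<alpha>2.\<close>

lemma dA0:
  assumes "v \<in> H" "w \<in> H"
  shows "D * m03 * W2 N1 N2 v w = - 4 * (D + s\<^sup>2) * W2 A1 A2 v w"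
proof -
  have "S v = 0" "S w = 0" using SH assms by auto
  then have "m03 * W2 N1 N2 v w = - 4 * (W2 A1 A2 v w + s * s / D * W2 A1 A2 v w)"
    using d_psim[of U1 U2 v w] D dA(1)[OF assms(2,1)] hor[OF assms(1)] hor[OF assms(2)]
      dA_U[OF assms(1)] dA_U[OF assms(2)] hor(1,3)[OF H(2)] dA_U(1-3)[OF H(2)]
    by (simp add: dpsim_def sig_def dW3_def W2_def W3_def point_simps SU)
       (simp add: algebra_simps add_divide_distrib diff_divide_distrib power2_eq_square)
  then show ?thesis using D by (simp add: field_simps power2_eq_square)
qed

lemma h2_pos: "D + s\<^sup>2 > 0"
  using D by (simp add: add_pos_nonneg)

lemma m03_eq: "D * m03 = - 4 * (D + s\<^sup>2) * (m11 * m22 - m12 * m21)"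
  using dA0[OF H(3,4)] by (simp add: W2_def NV A_V algebra_simps)

lemma minors: "m11 * m23 = m13 * m21" "m12 * m23 = m13 * m22"
proof -
  have "4 * (D + s\<^sup>2) * (m11 * m23 - m13 * m21) = 0" "4 * (D + s\<^sup>2) * (m12 * m23 - m13 * m22) = 0"
    using dA0[OF H(3,5)] dA0[OF H(4,5)] by (simp_all add: W2_def NV A_V algebra_simps)
  then show "m11 * m23 = m13 * m21" "m12 * m23 = m13 * m22" using h2_pos by auto
qed

text \<open>By \<open>minors\<close> only the last term survives when \<open>det\<close> is expanded
  along the coefficients of \<alpha>0.\<close>

lemma minor_nonzero: "m11 * m22 - m12 * m21 \<noteq> 0"
  using det minors m03_eq D by auto

lemma m03_nonzero: "m03 \<noteq> 0"
  using minor_nonzero m03_eq h2_pos by auto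

text \<open>\<alpha>1 \<and> \<alpha>2 is a nonzero multiple of N1 \<and> N2, so \<alpha>1 and
  \<alpha>2 lie in the span of N1 and N2. Both of these are closed, whence
  \<open>dA_closed\<close>.\<close>

lemma m_3_zero: "m13 = 0" "m23 = 0"
proof -
  have "m23 * (m11 * m22 - m12 * m21) = 0" "m13 * (m11 * m22 - m12 * m21) = 0"
    using minors by algebra+
  then show "m13 = 0" "m23 = 0" using minor_nonzero by auto
qed

lemma dA_closed:
  assumes "v \<in> H" "w \<in> H"
  shows "A1' v w = A1' w v" "A2' v w = A2' w v"
  using dA(2,3)[OF assms] by (simp_all add: m_3_zero)

text \<open>On U2 and two further vectors d\<sigma> = 3 \<psi>+ gives the curvature of \<theta>1 at
  the current s, in the shape prescribed at \<open>s\<^sub>0\<close> but with d\<alpha>1 = 0.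
  \<open>dP2\<close> comes from U1 in the same way.\<close>

lemma dP1:
  assumes "v \<in> H" "w \<in> H"
  shows "s * D * (P1' v w - P1' w v) = - 3 * (gUV * W2 A1 A0 v w + gVV * W2 A2 A0 v w)"
proof -
  have "S v = 0" "S w = 0" using SH assms by auto
  then have "s * (P1' v w - P1' w v) = - 3 / D * (gUV * W2 A1 A0 v w + gVV * W2 A2 A0 v w)"
    using d_sig[of U2 v w] D dA_closed[OF assms] hor[OF assms(1)] hor[OF assms(2)]
      dA_U[OF assms(1)] dA_U[OF assms(2)]
    by (simp add: dsig_def psip_def W2_def W3_def point_simps SU)
       (simp add: algebra_simps add_divide_distrib diff_divide_distrib power2_eq_square)
  then show ?thesis using D by (simp add: field_simps)
qed

lemma dP2:
  assumes "v \<in> H" "w \<in> H"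
  shows "s * D * (P2' v w - P2' w v) = 3 * (gUU * W2 A1 A0 v w + gUV * W2 A2 A0 v w)"
proof -
  have "S v = 0" "S w = 0" using SH assms by auto
  then have "s * (P2' v w - P2' w v) = 3 / D * (gUU * W2 A1 A0 v w + gUV * W2 A2 A0 v w)"
    using d_sig[of U1 v w] D dA_closed[OF assms] hor[OF assms(1)] hor[OF assms(2)]
      dA_U[OF assms(1)] dA_U[OF assms(2)]
    by (simp add: dsig_def psip_def W2_def W3_def point_simps SU)
       (simp add: algebra_simps add_divide_distrib diff_divide_distrib power2_eq_square)
  then show ?thesis using D by (simp add: field_simps)
qed

text \<open>On e, U1, U2 and v the left side retains the s-derivative of \<alpha>0 from the term
  \<theta>1 \<and> \<theta>2 \<and> \<alpha>0 of \<psi>-. On the right, \<sigma> \<and> \<sigma>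
  retains the product of s \<theta>1 \<and> \<theta>2 with ds \<and> \<alpha>0 / (3 D).\<close>

lemma A0'_e:
  assumes "v \<in> H"
  shows "3 * D * A0' e v = - 4 * s * A0 v"
proof -
  have "S v = 0" using SH assms by auto
  then show ?thesis
    using d_psim[of e U1 U2 v] D hor[OF assms] hor(1,3)[OF H(2)]
      dA_U[OF assms] dA_U(1-3)[OF H(2)] s
    by (simp add: dpsim_def sig_def dW3_def W2_def W3_def point_simps SU)
       (simp add: field_simps)
qed

text \<open>The equation for d\<psi>- is taken on e, U2 (for \<alpha>1) or U1 (for \<alpha>2), v and
  V3. Among the invariant forms only \<alpha>0 is nonzero on V3. Substituting the known
  s-derivatives of \<theta>1, \<theta>2 and \<alpha>0 leaves an equation multiplied by m03, which is
  nonzero. The premises on m13' and m23' concern the behaviour in s and cannot be read off at a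
  single point.\<close>

lemma A_e_relation:
  assumes m: "m13' = 0" "m23' = 0" and v: "v \<in> H" and Pv: "P1 v = 0" "P2 v = 0"
  shows "A1' e v / s + s / D * A1' e v + (2 / D - s * D' / D\<^sup>2 - 4 * s\<^sup>2 / (3 * D\<^sup>2) - 4 / (3 * D)) * A1 v = 0"
    "A2' e v / s + s / D * A2' e v + (2 / D - s * D' / D\<^sup>2 - 4 * s\<^sup>2 / (3 * D\<^sup>2) - 4 / (3 * D)) * A2 v = 0"
proof -
  have Sv: "S v = 0" using SH v by auto
  have P': "P1' e v = A1' e v / s + A1 v / D" "P2' e v = A2' e v / s + A2 v / D"
    using P1'_e[OF v] P2'_e[OF v] s D by (auto simp: field_simps)
  have P'3: "P1' e V3 = 0" "P2' e V3 = 0"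
    using P1'_e[OF H(5)] P2'_e[OF H(5)] s D by (auto simp: A_V A'_eV m m_3_zero)
  have A0'3: "A0' e V3 = - 4 * s / (3 * D) * m03"
    using A0'_e[OF H(5)] D by (simp add: A_V field_simps)
  note facts = dA_closed[OF H(5) v] dA_U[OF H(5)] dA_U[OF v] hor[OF H(5)] hor[OF v]
  have Q1: "P1' e v * m03 - P1' e V3 * A0 v + (1 / D - s * D' / D\<^sup>2) * (A1 v * m03)
    + s / D * (A1' e v * m03 + A1 v * A0' e V3) = 4 / (3 * D) * (A1 v * m03)"
    using d_psim[of e U2 v V3] facts
    by (simp add: dpsim_def sig_def dW3_def W2_def W3_def point_simps SU Sv TV Pv A_V(3,6,9) A'_eV(6,9) m m_3_zero)
      (simp add: algebra_simps add_divide_distrib diff_divide_distrib power2_eq_square)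
  have "m03 * (A1' e v / s + s / D * A1' e v +
      (2 / D - s * D' / D\<^sup>2 - 4 * s\<^sup>2 / (3 * D\<^sup>2) - 4 / (3 * D)) * A1 v) = 0"
  proof -
    have "m03 * (A1' e v / s + s / D * A1' e v +
        (2 / D - s * D' / D\<^sup>2 - 4 * s\<^sup>2 / (3 * D\<^sup>2) - 4 / (3 * D)) * A1 v) =
      (A1' e v / s + A1 v / D) * m03 - 0 * A0 v + (1 / D - s * D' / D\<^sup>2) * (A1 v * m03)
      + s / D * (A1' e v * m03 + A1 v * (- 4 * s / (3 * D) * m03)) - 4 / (3 * D) * (A1 v * m03)"
      using D s by (simp add: divide_simps power2_eq_square) (simp add: algebra_simps)
    then show ?thesis using Q1 unfolding P' P'3 A0'3 by simp
  qed
  then show "A1' e v / s + s / D * A1' e v +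
      (2 / D - s * D' / D\<^sup>2 - 4 * s\<^sup>2 / (3 * D\<^sup>2) - 4 / (3 * D)) * A1 v = 0"
    using m03_nonzero by simp
  have Q2: "P2' e v * m03 - P2' e V3 * A0 v + (1 / D - s * D' / D\<^sup>2) * (A2 v * m03)
    + s / D * (A2' e v * m03 + A2 v * A0' e V3) = 4 / (3 * D) * (A2 v * m03)"
    using d_psim[of e U1 v V3] facts
    by (simp add: dpsim_def sig_def dW3_def W2_def W3_def point_simps SU Sv TV Pv A_V(3,6,9) A'_eV(6,9) m m_3_zero)
      (simp add: algebra_simps add_divide_distrib diff_divide_distrib power2_eq_square)
  have "m03 * (A2' e v / s + s / D * A2' e v +
      (2 / D - s * D' / D\<^sup>2 - 4 * s\<^sup>2 / (3 * D\<^sup>2) - 4 / (3 * D)) * A2 v) = 0"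
  proof -
    have "m03 * (A2' e v / s + s / D * A2' e v +
        (2 / D - s * D' / D\<^sup>2 - 4 * s\<^sup>2 / (3 * D\<^sup>2) - 4 / (3 * D)) * A2 v) =
      (A2' e v / s + A2 v / D) * m03 - 0 * A0 v + (1 / D - s * D' / D\<^sup>2) * (A2 v * m03)
      + s / D * (A2' e v * m03 + A2 v * (- 4 * s / (3 * D) * m03)) - 4 / (3 * D) * (A2 v * m03)"
      using D s by (simp add: divide_simps power2_eq_square) (simp add: algebra_simps)
    then show ?thesis using Q2 unfolding P' P'3 A0'3 by simp
  qed
  then show "A2' e v / s + s / D * A2' e v +
      (2 / D - s * D' / D\<^sup>2 - 4 * s\<^sup>2 / (3 * D\<^sup>2) - 4 / (3 * D)) * A2 v = 0"
    using m03_nonzero by simp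
qed

text \<open>The component of d\<sigma> = 3 \<psi>+ on e, V1 and V2. The right side m03 / (3 D) stems
  from d\<alpha>0 in the differential of ds \<and> \<alpha>0 / (3 D). Together with
  \<open>A_e_relation\<close> this determines D'.\<close>

lemma minor_relation:
  "(1 / s + s / D) * (m11' * m22 + m11 * m22' - m12' * m21 - m12 * m21')
    + (2 / D - s * D' / D\<^sup>2) * (m11 * m22 - m12 * m21) = m03 / (3 * D)"
proof -
  have P': "P1' e w = A1' e w / s + A1 w / D" "P2' e w = A2' e w / s + A2 w / D" if "w \<in> H" for w
    using P1'_e[OF that] P2'_e[OF that] s D by (auto simp: field_simps)
  have Q: "- (P1' e V1 * m22 - P1' e V2 * m21) + (P2' e V1 * m12 - P2' e V2 * m11)
      - ((1 / D - s * D' / D\<^sup>2) * (m11 * m22 - m12 * m21)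
         + s / D * (m11' * m22 + m11 * m22' - m12' * m21 - m12 * m21')) + m03 / (3 * D)
    = - (m11 * m22 - m12 * m21) / D"
    using d_sig[of e V1 V2] dA(1)[OF H(3,4)]
    by (simp add: dsig_def psip_def W2_def W3_def point_simps SU TV NV A_V A'_eV)
      (simp add: algebra_simps add_divide_distrib diff_divide_distrib power2_eq_square)
  have "(1 / s + s / D) * (m11' * m22 + m11 * m22' - m12' * m21 - m12 * m21')
    + (2 / D - s * D' / D\<^sup>2) * (m11 * m22 - m12 * m21) - m03 / (3 * D) =
    - (- ((m11' / s + m11 / D) * m22 - (m12' / s + m12 / D) * m21) + ((m21' / s + m21 / D) * m12 - (m22' / s + m22 / D) * m11)
      - ((1 / D - s * D' / D\<^sup>2) * (m11 * m22 - m12 * m21)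
         + s / D * (m11' * m22 + m11 * m22' - m12' * m21 - m12 * m21')) + m03 / (3 * D)
      - (- (m11 * m22 - m12 * m21) / D))"
    using D s by (simp add: divide_simps power2_eq_square) (simp add: algebra_simps)
  then show ?thesis
    using Q unfolding P'[OF H(3)] P'[OF H(4)] A_V A'_eV by simp
qed

text \<open>The first equation says that D s^2 + s^4, that is h^2 s^2, is constant.\<close>

lemma coefficient_derivatives:
  assumes m: "m13' = 0" "m23' = 0"
  shows "s * D' = - 2 * D - 4 * s\<^sup>2"
    and "3 * D * m01' = - 4 * s * m01" "3 * D * m02' = - 4 * s * m02" "3 * D * m03' = - 4 * s * m03"
    and "3 * D * m11' = - 8 * s * m11" "3 * D * m12' = - 8 * s * m12"
    and "3 * D * m21' = - 8 * s * m21" "3 * D * m22' = - 8 * s * m22"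
proof -
  let ?\<delta> = "m11 * m22 - m12 * m21"
  let ?k = "1 / s + s / D"
  \<comment> \<open>X - Y is the factor in \<open>A_e_relation\<close>. Y collects the contributions
    of the s-derivative of \<alpha>0 and of \<sigma> \<and> \<sigma>; X contains D'.\<close>
  define X where "X = 2 / D - s * D' / D\<^sup>2"
  define Y where "Y = 4 * s\<^sup>2 / (3 * D\<^sup>2) + 4 / (3 * D)"
  have Y: "Y = 4 * (D + s\<^sup>2) / (3 * D\<^sup>2)"
    using D by (simp add: Y_def divide_simps power2_eq_square)
  have r: "?k * m11' + (X - Y) * m11 = 0" "?k * m12' + (X - Y) * m12 = 0"
    "?k * m21' + (X - Y) * m21 = 0" "?k * m22' + (X - Y) * m22 = 0"
    using A_e_relation[OF m H(3) TV(1,4)] A_e_relation[OF m H(4) TV(2,5)]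
    by (simp_all add: A_V A'_eV X_def Y_def algebra_simps)
  \<comment> \<open>All four entries obey the same linear equation, so their determinant obeys it
    with twice the factor.\<close>
  have k\<delta>: "k * (m11' * m22 + m11 * m22' - m12' * m21 - m12 * m21') = - 2 * (X - Y) * ?\<delta>" if
    "k * m11' + (X - Y) * m11 = 0" "k * m12' + (X - Y) * m12 = 0"
    "k * m21' + (X - Y) * m21 = 0" "k * m22' + (X - Y) * m22 = 0" for k
    using that by algebra
  have "?k * (m11' * m22 + m11 * m22' - m12' * m21 - m12 * m21') + X * ?\<delta> = m03 / (3 * D)"
    using minor_relation unfolding X_def .
  then have "- 2 * (X - Y) * ?\<delta> + X * ?\<delta> = m03 / (3 * D)"
    unfolding k\<delta>[OF r] .
  then have "(2 * Y - X) * ?\<delta> = m03 / (3 * D)"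
    by (simp only: algebra_simps)
  also have "m03 / (3 * D) = - Y * ?\<delta>"
  proof -
    have "m03 / (3 * D) = D * m03 / (3 * D\<^sup>2)" using D by (simp add: power2_eq_square)
    then show ?thesis
      unfolding m03_eq Y by (simp add: algebra_simps diff_divide_distrib add_divide_distrib)
  qed
  \<comment> \<open>The derivative of the minor has been eliminated between the two relations for
    it. As the minor is nonzero, X = 3 Y remains, which is the differential equation for D.\<close>
  finally have "(X - 3 * Y) * ?\<delta> = 0" by algebra
  then have XY: "X = 3 * Y" using minor_nonzero by simp
  have "X * D\<^sup>2 = 2 * D - s * D'" "3 * Y * D\<^sup>2 = 4 * s\<^sup>2 + 4 * D"
    using D by (simp_all add: X_def Y field_simps power2_eq_square)
  with XY show "s * D' = - 2 * D - 4 * s\<^sup>2" by simp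
  show "3 * D * m01' = - 4 * s * m01" "3 * D * m02' = - 4 * s * m02" "3 * D * m03' = - 4 * s * m03"
    using A0'_e[OF H(3)] A0'_e[OF H(4)] A0'_e[OF H(5)] by (simp_all add: A_V A'_eV)
  have k: "?k * (s * D) = D + s\<^sup>2" "2 * Y * (s * D) = 8 * s / (3 * D) * (D + s\<^sup>2)"
    using D s by (simp_all add: Y field_simps power2_eq_square)
  have *: "3 * D * m' = - 8 * s * m" if "?k * m' + (X - Y) * m = 0" for m m'
  proof -
    have "(?k * m' + 2 * Y * m) * (s * D) = 0" using that by (simp add: XY)
    then have "?k * (s * D) * m' + 2 * Y * (s * D) * m = 0" by (simp only: ring_distribs mult_ac)
    then have "(D + s\<^sup>2) * (m' + 8 * s / (3 * D) * m) = 0" unfolding k by (simp add: algebra_simps)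
    then have "m' + 8 * s / (3 * D) * m = 0" using h2_pos by simp
    then show ?thesis using D by (simp add: field_simps)
  qed
  show "3 * D * m11' = - 8 * s * m11" "3 * D * m12' = - 8 * s * m12"
    "3 * D * m21' = - 8 * s * m21" "3 * D * m22' = - 8 * s * m22"
    by (rule *[OF r(1)], rule *[OF r(2)], rule *[OF r(3)], rule *[OF r(4)])
qed

end

section \<open>Families of invariant forms\<close>

text \<open>\<open>smooth_family\<close> means smoothness of the pull-back to the product with the
  interval. Evaluating that form on vectors (v, 0) gives joint smoothness in the point and in
  s.\<close>

lemma smooth_family_loc1:
  assumes N: "charted N" and c: "c \<in> atlas N" and \<beta>: "smooth_family N a b 1 \<beta>"
  shows "smooth_on ((snd c ` fst c) \<times> {a<..<b}) (\<lambda>z. loc1 N c (\<beta> (snd z)) (fst z) v)"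
proof -
  let ?I = "interval a b" and ?e = "prod_chart c (interval_chart a b)"
  have e: "?e \<in> atlas (N \<times>\<^sub>M\<^sub>f ?I)" by (intro prod_chart_in_atlas c) (simp add: atlas_interval)
  have im: "snd ?e ` fst ?e = (snd c ` fst c) \<times> {a<..<b}" by (simp add: map_prod_surj_on)
  have "smooth_on ((snd c ` fst c) \<times> {a<..<b}) (\<lambda>z. loc1 (N \<times>\<^sub>M\<^sub>f ?I) ?e (pullback_family N fst \<beta>) z (v, 0))"
    using loc1_smooth[OF \<beta>[unfolded smooth_family_def] e] unfolding im .
  then show ?thesis
  proof (rule smooth_on_cong[rotated 2])
    show "open ((snd c ` fst c) \<times> {a<..<b})" by (intro open_Times charted_open[OF N c]) simp
    fix z assume "z \<in> (snd c ` fst c) \<times> {a<..<b}"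
    then obtain p s where p: "p \<in> fst c" and s: "s \<in> {a<..<b}" and z: "z = (snd c p, s)" by auto
    have inv: "chart_inv ?e z = (p, s)"
      using chart_inv_prod_chart[OF N charted_interval c, of "interval_chart a b" a b] p s
      by (simp add: z atlas_interval chart_inv_chart[OF N c] chart_inv_interval del: fst_interval_chart)
         (simp add: chart_inv_interval chart_inv_chart[OF N c])
    show "loc1 (N \<times>\<^sub>M\<^sub>f ?I) ?e (pullback_family N fst \<beta>) z (v, 0) = loc1 N c (\<beta> (snd z)) (fst z) v"
      using pushforward_fst_coord_vec[OF N charted_interval c p, of "interval_chart a b" a b s "(v, 0)"] s inv
      by (simp add: loc1_def pullback_family_def pullback_def z atlas_interval chart_inv_chart[OF N c p])
  qed
qed

lemma smooth_on_slice:
  assumes "open A" "open B" "smooth_on (A \<times> B) f" "x \<in> A"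
  shows "smooth_on B (\<lambda>s. f (x, s))"
  by (rule smooth_on_compose[OF assms(2) open_Times[OF assms(1,2)] _ _ assms(3)])
    (use assms in \<open>auto intro!: smooth_on_Pair smooth_on_const smooth_on_id\<close>)

lemma smooth_family_left_coefficients:
  assumes "smooth_family H3 a b 1 \<alpha>"
  shows "smooth_on {a<..<b} (\<lambda>s. lc1 (\<alpha> s))" "smooth_on {a<..<b} (\<lambda>s. lc2 (\<alpha> s))" "smooth_on {a<..<b} (\<lambda>s. lc3 (\<alpha> s))"
proof -
  have *: "smooth_on {a<..<b} (\<lambda>s. loc1 H3 H3_chart (\<alpha> s) (0, 0, 0) v)" for v
    using smooth_on_slice[OF _ _ smooth_family_loc1[OF charted_H3 H3_chart_in_atlas assms, of v], of "(0, 0, 0)"] by simp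
  show "smooth_on {a<..<b} (\<lambda>s. lc1 (\<alpha> s))" "smooth_on {a<..<b} (\<lambda>s. lc2 (\<alpha> s))" "smooth_on {a<..<b} (\<lambda>s. lc3 (\<alpha> s))"
    using *[of "(1, 0, 0)"] *[of "(0, 0, 1)"] *[of "(0, 1, 0)"] by (simp_all add: loc1_def lc1_def lc2_def lc3_def)
qed

text \<open>The pull-backs of da, dc and db - a dc under \<open>\<pi>\<close>.\<close>

definition eta1 :: "('e \<Rightarrow> real^3^3) \<Rightarrow> 'e \<Rightarrow> 'e tvec \<Rightarrow> real" where
  "eta1 \<pi> p X = fst (vec_components H3_chart (pushforward H3 \<pi> p X))"
definition eta2 :: "('e \<Rightarrow> real^3^3) \<Rightarrow> 'e \<Rightarrow> 'e tvec \<Rightarrow> real" where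
  "eta2 \<pi> p X = snd (snd (vec_components H3_chart (pushforward H3 \<pi> p X)))"
definition eta3 :: "('e \<Rightarrow> real^3^3) \<Rightarrow> 'e \<Rightarrow> 'e tvec \<Rightarrow> real" where
  "eta3 \<pi> p X = fst (snd (vec_components H3_chart (pushforward H3 \<pi> p X))) - \<pi> p $ 1 $ 2 * eta2 \<pi> p X"

lemma tangent_H3_cases:
  assumes "Y \<in> tangent_space H3 A" "A \<in> H3_set"
  obtains a b c v1 v2 v3 where "A = heis a b c" "Y = H3_vec (heis a b c) (v1, v2, v3)"
proof -
  obtain v where "Y = H3_vec A v" using assms by (auto simp: tangent_space_def atlas_H3)
  moreover obtain a b c where "A = heis a b c" using assms by (auto simp: H3_set_def)
  ultimately show ?thesis using that by (cases v) auto
qed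

lemma left_invariant_eta:
  assumes E: "charted E" and \<pi>: "smooth_map E H3 \<pi>" and \<omega>: "left_invariant \<omega>"
    and p: "p \<in> points E" and X: "X \<in> tangent_space E p"
  shows "\<omega> (\<pi> p) [pushforward H3 \<pi> p X] = lc1 \<omega> * eta1 \<pi> p X + lc2 \<omega> * eta2 \<pi> p X + lc3 \<omega> * eta3 \<pi> p X"
proof -
  have "\<pi> p \<in> H3_set" using smooth_map_in_points[OF \<pi> p] by simp
  then obtain a b c v1 v2 v3 where *: "\<pi> p = heis a b c" "pushforward H3 \<pi> p X = H3_vec (heis a b c) (v1, v2, v3)"
    using tangent_H3_cases pushforward_in_tangent_space[OF E charted_H3 \<pi> p X] by metis
  have "vec_components H3_chart (H3_vec (heis a b c) (v1, v2, v3)) = (v1, v2, v3)"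
    by (rule vec_components_coord_vec[OF charted_H3]) auto
  then show ?thesis
    using left_invariant_value[OF \<omega>] by (simp add: * eta1_def eta2_def eta3_def)
qed

lemma eta_zero:
  assumes "pushforward H3 \<pi> p X = (\<lambda>u. 0)"
  shows "eta1 \<pi> p X = 0" "eta2 \<pi> p X = 0" "eta3 \<pi> p X = 0"
proof -
  have "vec_components H3_chart (\<lambda>u. 0) = 0" by (simp add: vec_components_def)
  then show "eta1 \<pi> p X = 0" "eta2 \<pi> p X = 0" "eta3 \<pi> p X = 0"
    by (simp_all add: eta1_def eta2_def eta3_def assms)
qed

definition eta_loc :: "('e \<Rightarrow> real^3^3) \<Rightarrow> ('e, 'v::euclidean_space) chart \<Rightarrow> 'v \<Rightarrow> real \<times> real \<times> real" where
  "eta_loc \<pi> c = snd H3_chart \<circ> \<pi> \<circ> chart_inv c"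

lemma eta_loc_smooth:
  assumes E: "charted E" and \<pi>: "smooth_map E H3 \<pi>" and c: "c \<in> atlas E"
  shows "smooth_on (snd c ` fst c) (eta_loc \<pi> c)"
proof -
  have "fst c \<inter> \<pi> -` fst H3_chart = fst c"
    using smooth_map_in_points[OF \<pi>] charted_in_points[OF E c] by auto
  then show ?thesis
    using smooth_map_local[OF \<pi> c H3_chart_in_atlas] by (simp add: eta_loc_def)
qed

lemma eta_coord_vec:
  assumes E: "charted E" and \<pi>: "smooth_map E H3 \<pi>" and c: "c \<in> atlas E" and y: "y \<in> snd c ` fst c"
  shows "eta1 \<pi> (chart_inv c y) (coord_vec E c (chart_inv c y) v) = fst (frechet_derivative (eta_loc \<pi> c) (at y) v)" (is ?A)
    and "eta2 \<pi> (chart_inv c y) (coord_vec E c (chart_inv c y) v) = snd (snd (frechet_derivative (eta_loc \<pi> c) (at y) v))" (is ?B)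
    and "eta3 \<pi> (chart_inv c y) (coord_vec E c (chart_inv c y) v) = fst (snd (frechet_derivative (eta_loc \<pi> c) (at y) v))
      - fst (eta_loc \<pi> c y) * snd (snd (frechet_derivative (eta_loc \<pi> c) (at y) v))" (is ?C)
proof -
  obtain p where p: "p \<in> fst c" and y: "y = snd c p" using y by auto
  have inv: "chart_inv c y = p" by (simp add: y chart_inv_chart[OF E c p])
  have pp: "\<pi> p \<in> fst H3_chart" using smooth_map_in_points[OF \<pi> charted_in_points[OF E c p]] by simp
  have "vec_components H3_chart (pushforward H3 \<pi> p (coord_vec E c p v)) = frechet_derivative (eta_loc \<pi> c) (at y) v"
    unfolding pushforward_coord_vec[OF E charted_H3 \<pi> c p H3_chart_in_atlas pp] eta_loc_def y
    by (rule vec_components_coord_vec[OF charted_H3 H3_chart_in_atlas pp])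
  then show ?A ?B ?C
    unfolding inv by (simp_all add: eta1_def eta2_def eta3_def eta_loc_def inv H3_chart_def)
qed

lemma eta_smooth:
  assumes E: "charted E" and \<pi>: "smooth_map E H3 \<pi>" and c: "c \<in> atlas E"
  shows "smooth_on (snd c ` fst c) (\<lambda>y. eta1 \<pi> (chart_inv c y) (coord_vec E c (chart_inv c y) v))"
    and "smooth_on (snd c ` fst c) (\<lambda>y. eta2 \<pi> (chart_inv c y) (coord_vec E c (chart_inv c y) v))"
    and "smooth_on (snd c ` fst c) (\<lambda>y. eta3 \<pi> (chart_inv c y) (coord_vec E c (chart_inv c y) v))"
proof -
  have o: "open (snd c ` fst c)" by (rule charted_open[OF E c])
  note G = eta_loc_smooth[OF assms]
  note G' = smooth_on_derivative[OF G, of v]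
  have 1: "smooth_on (snd c ` fst c) (\<lambda>y. fst (frechet_derivative (eta_loc \<pi> c) (at y) v))"
    by (rule smooth_on_bounded_linear_compose[OF o bounded_linear_fst G'])
  have 2: "smooth_on (snd c ` fst c) (\<lambda>y. snd (snd (frechet_derivative (eta_loc \<pi> c) (at y) v)))"
    by (intro smooth_on_bounded_linear_compose[OF o bounded_linear_snd] G')
  have 3: "smooth_on (snd c ` fst c) (\<lambda>y. fst (snd (frechet_derivative (eta_loc \<pi> c) (at y) v)) +
      ((- fst (eta_loc \<pi> c y)) *\<^sub>R snd (snd (frechet_derivative (eta_loc \<pi> c) (at y) v))))"
    by (intro smooth_on_add smooth_on_scaleR o 2 smooth_on_bounded_linear_compose[OF o bounded_linear_minus[OF bounded_linear_ident]]
        smooth_on_bounded_linear_compose[OF o bounded_linear_fst] smooth_on_bounded_linear_compose[OF o bounded_linear_snd] G G')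
  show "smooth_on (snd c ` fst c) (\<lambda>y. eta1 \<pi> (chart_inv c y) (coord_vec E c (chart_inv c y) v))"
    by (rule smooth_on_cong[OF o _ 1]) (simp add: eta_coord_vec[OF assms])
  show "smooth_on (snd c ` fst c) (\<lambda>y. eta2 \<pi> (chart_inv c y) (coord_vec E c (chart_inv c y) v))"
    by (rule smooth_on_cong[OF o _ 2]) (simp add: eta_coord_vec[OF assms])
  show "smooth_on (snd c ` fst c) (\<lambda>y. eta3 \<pi> (chart_inv c y) (coord_vec E c (chart_inv c y) v))"
    by (rule smooth_on_cong[OF o _ 3]) (simp add: eta_coord_vec[OF assms])
qed

text \<open>On H3 the forms da and dc are closed and d(db - a dc) = - da \<and> dc. These relations
  are carried to E by \<open>d1_pullback\<close> along \<open>eta_loc\<close>, the coordinate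
  expression of \<pi>.\<close>

lemma d1_eta:
  assumes E: "charted E" and \<pi>: "smooth_map E H3 \<pi>" and c: "c \<in> atlas E" and x: "x \<in> snd c ` fst c"
  defines "N1 \<equiv> \<lambda>y v. eta1 \<pi> (chart_inv c y) (coord_vec E c (chart_inv c y) v)"
    and "N2 \<equiv> \<lambda>y v. eta2 \<pi> (chart_inv c y) (coord_vec E c (chart_inv c y) v)"
    and "N3 \<equiv> \<lambda>y v. eta3 \<pi> (chart_inv c y) (coord_vec E c (chart_inv c y) v)"
  shows "d1 N1 x v w = 0" "d1 N2 x v w = 0" "d1 N3 x v w = - W2 (N1 x) (N2 x) v w"
proof -
  have o: "open (snd c ` fst c)" by (rule charted_open[OF E c])
  let ?G = "eta_loc \<pi> c" let ?G' = "\<lambda>y. frechet_derivative ?G (at y)"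
  note G = eta_loc_smooth[OF E \<pi> c]
  have lin: "linear (\<lambda>u::real \<times> real \<times> real. fst u)" "linear (\<lambda>u::real \<times> real \<times> real. snd (snd u))"
    "linear (\<lambda>u::real \<times> real \<times> real. fst (snd u) - a * snd (snd u))" for a
    by (auto intro!: linearI simp: algebra_simps)
  have der: "((\<lambda>z::real \<times> real \<times> real. fst (snd u) - fst z * snd (snd u)) has_derivative (\<lambda>z. - fst z * snd (snd u))) (at z)" for u z
    by (auto intro!: derivative_eq_intros)
  have fd: "frechet_derivative (\<lambda>z::real \<times> real \<times> real. fst (snd u) - fst z * snd (snd u)) (at z) = (\<lambda>z. - fst z * snd (snd u))" for u z
    by (rule frechet_derivative_at[OF der, symmetric])
  have "d1 N1 x v w = d1 (\<lambda>y v. fst (?G' y v)) x v w"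
    unfolding N1_def by (rule fun_cong[OF fun_cong[OF d1_cong[OF o x]]]) (simp add: eta_coord_vec[OF E \<pi> c])
  also have "\<dots> = d1 (\<lambda>z u. fst u) (?G x) (?G' x v) (?G' x w)"
    by (rule d1_pullback[OF o G x, where \<beta>="\<lambda>z u. fst u" and T=UNIV]) (auto simp: lin)
  finally show "d1 N1 x v w = 0" by (simp add: d1_def frechet_derivative_const)
  have "d1 N2 x v w = d1 (\<lambda>y v. snd (snd (?G' y v))) x v w"
    unfolding N2_def by (rule fun_cong[OF fun_cong[OF d1_cong[OF o x]]]) (simp add: eta_coord_vec[OF E \<pi> c])
  also have "\<dots> = d1 (\<lambda>z u. snd (snd u)) (?G x) (?G' x v) (?G' x w)"
    by (rule d1_pullback[OF o G x, where \<beta>="\<lambda>z u. snd (snd u)" and T=UNIV]) (auto simp: lin)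
  finally show "d1 N2 x v w = 0" by (simp add: d1_def frechet_derivative_const)
  have "d1 N3 x v w = d1 (\<lambda>y v. fst (snd (?G' y v)) - fst (?G y) * snd (snd (?G' y v))) x v w"
    unfolding N3_def by (rule fun_cong[OF fun_cong[OF d1_cong[OF o x]]]) (simp add: eta_coord_vec[OF E \<pi> c])
  also have "\<dots> = d1 (\<lambda>z u. fst (snd u) - fst z * snd (snd u)) (?G x) (?G' x v) (?G' x w)"
  proof (rule d1_pullback[OF o G x, where \<beta>="\<lambda>z u. fst (snd u) - fst z * snd (snd u)" and T=UNIV])
    show "(\<lambda>z. fst (snd b) - fst z * snd (snd b)) differentiable (at (?G x))" for b
      using der unfolding differentiable_def by blast
  qed (auto simp: lin)
  also have "\<dots> = - W2 (N1 x) (N2 x) v w"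
    by (simp add: d1_def fd W2_def N1_def N2_def eta_coord_vec[OF E \<pi> c x])
  finally show "d1 N3 x v w = - W2 (N1 x) (N2 x) v w" .
qed

section \<open>The geometric hypotheses and the given forms on tangent vectors\<close>

locale nearly_Kaehler_over_H3 =
  fixes E :: "('e, real^5) manifold"
    and \<pi> :: "'e \<Rightarrow> real^3^3"
    and act :: "'e \<Rightarrow> complex \<times> complex \<Rightarrow> 'e"
    and s\<^sub>0 \<epsilon> :: real
    and \<alpha>0 \<alpha>1 \<alpha>2 :: "real \<Rightarrow> (real^3^3) field"
    and gUU gUV gVV h :: "real \<Rightarrow> real"
    and \<theta>1 \<theta>2 :: "real \<Rightarrow> 'e field"
    and g \<sigma> \<psi>p \<psi>m :: "('e \<times> real) field"
    and M :: "('e \<times> real, (real^5) \<times> real) manifold"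
    and D :: "real \<Rightarrow> real"
    and ds t1 t2 a0 a1 a2 :: "('e \<times> real) field"
    and J :: "'e \<times> real \<Rightarrow> ('e \<times> real) tvec \<Rightarrow> ('e \<times> real) tvec"
  assumes principal: "principal_T2_bundle E \<pi> act"
    and eps: "0 < \<epsilon>" "\<epsilon> < s\<^sub>0"
    and alpha_basis: "\<And>s. s \<in> {s\<^sub>0-\<epsilon><..<s\<^sub>0+\<epsilon>} \<Longrightarrow> left_invariant_basis (\<alpha>0 s) (\<alpha>1 s) (\<alpha>2 s)"
    and alpha_smooth: "smooth_family H3 (s\<^sub>0-\<epsilon>) (s\<^sub>0+\<epsilon>) 1 \<alpha>0"
      "smooth_family H3 (s\<^sub>0-\<epsilon>) (s\<^sub>0+\<epsilon>) 1 \<alpha>1"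
      "smooth_family H3 (s\<^sub>0-\<epsilon>) (s\<^sub>0+\<epsilon>) 1 \<alpha>2"
    and g_smooth: "smooth_on {s\<^sub>0-\<epsilon><..<s\<^sub>0+\<epsilon>} gUU" "smooth_on {s\<^sub>0-\<epsilon><..<s\<^sub>0+\<epsilon>} gUV"
      "smooth_on {s\<^sub>0-\<epsilon><..<s\<^sub>0+\<epsilon>} gVV"
    and g_pos_def: "\<And>s x y. s \<in> {s\<^sub>0-\<epsilon><..<s\<^sub>0+\<epsilon>} \<Longrightarrow> (x, y) \<noteq> (0, 0) \<Longrightarrow>
      gUU s * x\<^sup>2 + 2 * gUV s * x * y + gVV s * y\<^sup>2 > 0"
    and h: "\<And>s. s \<in> {s\<^sub>0-\<epsilon><..<s\<^sub>0+\<epsilon>} \<Longrightarrow> h s > 0"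
      "\<And>s. s \<in> {s\<^sub>0-\<epsilon><..<s\<^sub>0+\<epsilon>} \<Longrightarrow> (h s)\<^sup>2 = gUU s * gVV s - (gUV s)\<^sup>2"
      "\<And>s. s \<in> {s\<^sub>0-\<epsilon><..<s\<^sub>0+\<epsilon>} \<Longrightarrow> (h s)\<^sup>2 > s\<^sup>2"
    and theta_connection: "\<And>s. s \<in> {s\<^sub>0-\<epsilon><..<s\<^sub>0+\<epsilon>} \<Longrightarrow> connection_form E act (\<theta>1 s) (\<theta>2 s)"
    and theta_smooth: "smooth_family E (s\<^sub>0-\<epsilon>) (s\<^sub>0+\<epsilon>) 1 \<theta>1"
      "smooth_family E (s\<^sub>0-\<epsilon>) (s\<^sub>0+\<epsilon>) 1 \<theta>2"
    and initial_theta: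
      "field_eq E (\<lambda>p. s\<^sub>0 \<odot> ext_deriv E (\<theta>1 s\<^sub>0) p)
        (pullback H3 \<pi> (\<lambda>x. ext_deriv H3 (\<alpha>1 s\<^sub>0) x
           - (3 / ((h s\<^sub>0)\<^sup>2 - s\<^sub>0\<^sup>2)) \<odot> ((gUV s\<^sub>0 \<odot> \<alpha>1 s\<^sub>0 x + gVV s\<^sub>0 \<odot> \<alpha>2 s\<^sub>0 x) \<^bold>\<and> \<alpha>0 s\<^sub>0 x)))"
      "field_eq E (\<lambda>p. s\<^sub>0 \<odot> ext_deriv E (\<theta>2 s\<^sub>0) p)
        (pullback H3 \<pi> (\<lambda>x. ext_deriv H3 (\<alpha>2 s\<^sub>0) x
           + (3 / ((h s\<^sub>0)\<^sup>2 - s\<^sub>0\<^sup>2)) \<odot> ((gUU s\<^sub>0 \<odot> \<alpha>1 s\<^sub>0 x + gUV s\<^sub>0 \<odot> \<alpha>2 s\<^sub>0 x) \<^bold>\<and> \<alpha>0 s\<^sub>0 x)))"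
    and M: "M = E \<times>\<^sub>M\<^sub>f interval (s\<^sub>0-\<epsilon>) (s\<^sub>0+\<epsilon>)"
    and D: "D = (\<lambda>s. (h s)\<^sup>2 - s\<^sup>2)"
    and ds: "ds = differential snd"
    and t: "t1 = pullback_family E fst \<theta>1" "t2 = pullback_family E fst \<theta>2"
    and a: "a0 = pullback_family H3 (\<pi> \<circ> fst) \<alpha>0"
      "a1 = pullback_family H3 (\<pi> \<circ> fst) \<alpha>1"
      "a2 = pullback_family H3 (\<pi> \<circ> fst) \<alpha>2"
    and nearly_Kaehler: "nearly_Kaehler M g J \<sigma> \<psi>p \<psi>m"
    and g_eq: "field_eq M g (\<lambda>q. let s = snd q in
      (1 / (9 * D s)) \<odot> tsquare (ds q)
      + gUU s \<odot> tsquare (t1 q) + gVV s \<odot> tsquare (t2 q) + gUV s \<odot> (t1 q \<otimes> t2 q + t2 q \<otimes> t1 q)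
      + (1 / D s) \<odot> (tsquare (a0 q) + gUU s \<odot> tsquare (a1 q) + gVV s \<odot> tsquare (a2 q)
                    + gUV s \<odot> (a1 q \<otimes> a2 q + a2 q \<otimes> a1 q)))"
    and sigma_eq: "field_eq M \<sigma> (\<lambda>q. let s = snd q in
      (1 / (3 * D s)) \<odot> (ds q \<^bold>\<and> a0 q) + s \<odot> (t1 q \<^bold>\<and> t2 q) - t1 q \<^bold>\<and> a2 q + t2 q \<^bold>\<and> a1 q - (s / D s) \<odot> (a1 q \<^bold>\<and> a2 q))"
    and psip_eq: "field_eq M \<psi>p (\<lambda>q. let s = snd q in
      (1 / (3 * D s)) \<odot> (ds q \<^bold>\<and> (D s \<odot> (t1 q \<^bold>\<and> t2 q) + s \<odot> (t1 q \<^bold>\<and> a2 q - t2 q \<^bold>\<and> a1 q) - a1 q \<^bold>\<and> a2 q))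
      - (1 / D s) \<odot> ((t1 q \<^bold>\<and> (gUU s \<odot> a1 q + gUV s \<odot> a2 q) + t2 q \<^bold>\<and> (gUV s \<odot> a1 q + gVV s \<odot> a2 q)) \<^bold>\<and> a0 q))"
    and psim_eq: "field_eq M \<psi>m (\<lambda>q. let s = snd q in
      (1 / (3 * D s)) \<odot> (ds q \<^bold>\<and> (t1 q \<^bold>\<and> (gUU s \<odot> a1 q + gUV s \<odot> a2 q) + t2 q \<^bold>\<and> (gUV s \<odot> a1 q + gVV s \<odot> a2 q)))
      + (1 / D s) \<odot> ((D s \<odot> (t1 q \<^bold>\<and> t2 q) + s \<odot> (t1 q \<^bold>\<and> a2 q - t2 q \<^bold>\<and> a1 q) - a1 q \<^bold>\<and> a2 q) \<^bold>\<and> a0 q))"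
begin

abbreviation "I \<equiv> {s\<^sub>0-\<epsilon><..<s\<^sub>0+\<epsilon>}"

lemma charted_E: "charted E" and smooth_pi: "smooth_map E H3 \<pi>"
  using principal smooth_manifold_charted by (auto simp: principal_T2_bundle_def)

lemma s_pos: "s \<in> I \<Longrightarrow> s > 0" and s0_in: "s\<^sub>0 \<in> I"
  using eps by auto

lemma D_pos: "s \<in> I \<Longrightarrow> D s > 0"
  using h(3) by (simp add: D)

lemma alpha_invariant: "s \<in> I \<Longrightarrow> left_invariant (\<alpha>0 s)" "s \<in> I \<Longrightarrow> left_invariant (\<alpha>1 s)" "s \<in> I \<Longrightarrow> left_invariant (\<alpha>2 s)"
  using alpha_basis by (auto simp: left_invariant_basis_def)

end

lemma scale_apply: "(c \<odot> a) Xs = c * a Xs"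
  by (simp add: scale_def)

lemma of_degree_pullback:
  assumes "of_degree T k \<omega>" "\<And>X. X \<in> S \<Longrightarrow> F X \<in> T"
  shows "of_degree S k (\<lambda>Xs. \<omega> (map F Xs))"
  unfolding of_degree_def
proof (intro ballI impI)
  fix Xs assume "Xs \<in> lists S" "length Xs \<noteq> k"
  then show "\<omega> (map F Xs) = 0"
    by (intro of_degreeD[OF assms(1)]) (use assms(2) in auto)
qed

context nearly_Kaehler_over_H3
begin

abbreviation ech :: "('e, real^5) chart \<Rightarrow> ('e \<times> real, (real^5) \<times> real) chart" where
  "ech c \<equiv> prod_chart c (interval_chart (s\<^sub>0-\<epsilon>) (s\<^sub>0+\<epsilon>))"

lemma charted_M: "charted M"
  unfolding M by (rule charted_prod_manifold[OF charted_E charted_interval])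

lemma points_M: "points M = points E \<times> I"
  by (simp add: M)

lemma ech_in_atlas: "c \<in> atlas E \<Longrightarrow> ech c \<in> atlas M"
  unfolding M by (intro prod_chart_in_atlas) (auto simp: atlas_interval)

lemma atlas_M_cases: "e \<in> atlas M \<Longrightarrow> \<exists>c\<in>atlas E. e = ech c"
  unfolding M atlas_prod_manifold by (simp add: atlas_interval)

lemma interval_chart_in_atlas: "interval_chart (s\<^sub>0-\<epsilon>) (s\<^sub>0+\<epsilon>) \<in> atlas (interval (s\<^sub>0-\<epsilon>) (s\<^sub>0+\<epsilon>))"
  by (simp add: atlas_interval)

lemma ech_inv:
  assumes "c \<in> atlas E" "y \<in> snd c ` fst c" "s \<in> I"
  shows "chart_inv (ech c) (y, s) = (chart_inv c y, s)"
proof -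
  have "s \<in> snd (interval_chart (s\<^sub>0-\<epsilon>) (s\<^sub>0+\<epsilon>)) ` fst (interval_chart (s\<^sub>0-\<epsilon>) (s\<^sub>0+\<epsilon>))"
    using assms(3) by simp
  from chart_inv_prod_chart[OF charted_E charted_interval assms(1) interval_chart_in_atlas assms(2) this]
  show ?thesis unfolding fst_prod_chart snd_prod_chart chart_inv_interval[OF assms(3)] .
qed

lemma smooth_fst: "smooth_map M E fst"
  unfolding M by (rule smooth_map_fst[OF charted_E charted_interval])

lemma pushforward_fst:
  assumes "c \<in> atlas E" "p \<in> fst c" "s \<in> I"
  shows "pushforward E fst (p, s) (coord_vec M (ech c) (p, s) w) = coord_vec E c p (fst w)"
  unfolding M by (rule pushforward_fst_coord_vec[OF charted_E charted_interval assms(1,2) interval_chart_in_atlas])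
    (use assms in auto)

lemma pushforward_pi_fst:
  assumes "p \<in> points E"
  shows "pushforward H3 (\<pi> \<circ> fst) (p, s) X = pushforward H3 \<pi> p (pushforward E fst (p, s) X)"
  using pushforward_compose[OF charted_M charted_E smooth_pi charted_H3, of fst "(p, s)" X] assms by simp

lemma t_value: "t1 (p, s) [X] = \<theta>1 s p [pushforward E fst (p, s) X]" "t2 (p, s) [X] = \<theta>2 s p [pushforward E fst (p, s) X]"
  by (simp_all add: t pullback_family_def pullback_def)

text \<open>The pull-back of \<alpha> s to E, split into coefficients that depend on s alone and
  one-forms that depend on the point alone, so that differentiation in s acts on the coefficients
  only.\<close>

definition comb :: "(real \<Rightarrow> (real^3^3) field) \<Rightarrow> real \<Rightarrow> 'e \<Rightarrow> 'e tvec \<Rightarrow> real" where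
  "comb \<alpha> s p Y = lc1 (\<alpha> s) * eta1 \<pi> p Y + lc2 (\<alpha> s) * eta2 \<pi> p Y + lc3 (\<alpha> s) * eta3 \<pi> p Y"

lemma a_value:
  assumes "p \<in> points E" "s \<in> I" "X \<in> tangent_space M (p, s)"
  shows "a0 (p, s) [X] = comb \<alpha>0 s p (pushforward E fst (p, s) X)"
    "a1 (p, s) [X] = comb \<alpha>1 s p (pushforward E fst (p, s) X)"
    "a2 (p, s) [X] = comb \<alpha>2 s p (pushforward E fst (p, s) X)"
proof -
  have "(p, s) \<in> points M" using assms by (simp add: points_M)
  from pushforward_in_tangent_space[OF charted_M charted_E smooth_fst this assms(3)]
  have Y: "pushforward E fst (p, s) X \<in> tangent_space E p" by simp
  show "a0 (p, s) [X] = comb \<alpha>0 s p (pushforward E fst (p, s) X)"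
    "a1 (p, s) [X] = comb \<alpha>1 s p (pushforward E fst (p, s) X)"
    "a2 (p, s) [X] = comb \<alpha>2 s p (pushforward E fst (p, s) X)"
    using left_invariant_eta[OF charted_E smooth_pi alpha_invariant(1)[OF assms(2)] assms(1) Y]
      left_invariant_eta[OF charted_E smooth_pi alpha_invariant(2)[OF assms(2)] assms(1) Y]
      left_invariant_eta[OF charted_E smooth_pi alpha_invariant(3)[OF assms(2)] assms(1) Y]
    by (simp_all add: a pullback_family_def pullback_def pushforward_pi_fst[OF assms(1)] comb_def)
qed

lemma ds_value:
  assumes "c \<in> atlas E" "p \<in> fst c" "s \<in> I"
  shows "ds (p, s) [coord_vec M (ech c) (p, s) w] = snd w"
proof -
  have "(\<lambda>q. snd (ech c) q \<bullet> (0, 1)) = snd"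
    by (auto simp: inner_prod_def)
  then show ?thesis
    using coord_vec_chart_inner[OF charted_M ech_in_atlas[OF assms(1)], of "(p, s)" w "(0, 1)"] assms
    by (simp add: ds differential_def inner_prod_def)
qed

lemma theta_form: "s \<in> I \<Longrightarrow> diff_form E 1 (\<theta>1 s)" "s \<in> I \<Longrightarrow> diff_form E 1 (\<theta>2 s)"
  using theta_connection by (auto simp: connection_form_def)

lemma of_degree_1:
  assumes "p \<in> points E" "s \<in> I"
  shows "of_degree (tangent_space M (p, s)) 1 (ds (p, s))"
    "of_degree (tangent_space M (p, s)) 1 (t1 (p, s))" "of_degree (tangent_space M (p, s)) 1 (t2 (p, s))"
    "of_degree (tangent_space M (p, s)) 1 (a0 (p, s))" "of_degree (tangent_space M (p, s)) 1 (a1 (p, s))"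
    "of_degree (tangent_space M (p, s)) 1 (a2 (p, s))"
proof -
  have q: "(p, s) \<in> points M" using assms by (simp add: points_M)
  show "of_degree (tangent_space M (p, s)) 1 (ds (p, s))"
    by (auto simp: of_degree_def ds differential_def split: list.splits)
  have E: "pushforward E fst (p, s) X \<in> tangent_space E p" if "X \<in> tangent_space M (p, s)" for X
    using pushforward_in_tangent_space[OF charted_M charted_E smooth_fst q that] by simp
  have H: "pushforward H3 (\<pi> \<circ> fst) (p, s) X \<in> tangent_space H3 (\<pi> p)" if "X \<in> tangent_space M (p, s)" for X
    unfolding pushforward_pi_fst[OF assms(1)]
    by (rule pushforward_in_tangent_space[OF charted_E charted_H3 smooth_pi assms(1) E[OF that]])
  have th: "of_degree (tangent_space M (p, s)) 1 (pullback_family E fst \<theta> (p, s))" if "diff_form E 1 (\<theta> s)" for \<theta>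
    using of_degree_pullback[OF multilinear_on_of_degree[OF diff_form_multilinear[OF that assms(1)]] E]
    by (simp add: pullback_family_def pullback_def)
  have al: "of_degree (tangent_space M (p, s)) 1 (pullback_family H3 (\<pi> \<circ> fst) \<alpha> (p, s))" if "diff_form H3 1 (\<alpha> s)" for \<alpha>
    using of_degree_pullback[OF multilinear_on_of_degree[OF diff_form_multilinear[OF that smooth_map_in_points[OF smooth_pi assms(1)]]] H]
    by (simp add: pullback_family_def pullback_def)
  show "of_degree (tangent_space M (p, s)) 1 (t1 (p, s))" "of_degree (tangent_space M (p, s)) 1 (t2 (p, s))"
    unfolding t by (rule th, rule theta_form, rule assms(2))+
  show "of_degree (tangent_space M (p, s)) 1 (a0 (p, s))" "of_degree (tangent_space M (p, s)) 1 (a1 (p, s))"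
    "of_degree (tangent_space M (p, s)) 1 (a2 (p, s))"
    unfolding a by (rule al, rule left_invariant_diff_form, rule alpha_invariant, rule assms(2))+
qed

lemma sigma_value:
  assumes p: "p \<in> points E" "s \<in> I" and X: "X \<in> tangent_space M (p, s)" "Y \<in> tangent_space M (p, s)"
  shows "\<sigma> (p, s) [X, Y] = sig s (D s) (\<lambda>X. ds (p, s) [X]) (\<lambda>X. t1 (p, s) [X]) (\<lambda>X. t2 (p, s) [X])
    (\<lambda>X. a0 (p, s) [X]) (\<lambda>X. a1 (p, s) [X]) (\<lambda>X. a2 (p, s) [X]) X Y"
proof -
  have q: "(p, s) \<in> points M" using p by (simp add: points_M)
  note w = wedge_2[OF of_degree_1(1)[OF p] of_degree_1(4)[OF p] X] wedge_2[OF of_degree_1(2)[OF p] of_degree_1(3)[OF p] X]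
    wedge_2[OF of_degree_1(2)[OF p] of_degree_1(6)[OF p] X] wedge_2[OF of_degree_1(3)[OF p] of_degree_1(5)[OF p] X]
    wedge_2[OF of_degree_1(5)[OF p] of_degree_1(6)[OF p] X]
  have "[X, Y] \<in> lists (tangent_space M (p, s))" using X by simp
  from sigma_eq[unfolded field_eq_def, rule_format, OF q this]
  show ?thesis
    by (simp add: Let_def scale_apply w sig_def W2_def)
qed

lemma two_forms:
  assumes p: "p \<in> points E" "s \<in> I"
  shows "of_degree (tangent_space M (p, s)) 2 (D s \<odot> (t1 (p, s) \<^bold>\<and> t2 (p, s))
      + s \<odot> (t1 (p, s) \<^bold>\<and> a2 (p, s) - t2 (p, s) \<^bold>\<and> a1 (p, s)) - a1 (p, s) \<^bold>\<and> a2 (p, s))"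
    "of_degree (tangent_space M (p, s)) 2 (t1 (p, s) \<^bold>\<and> (gUU s \<odot> a1 (p, s) + gUV s \<odot> a2 (p, s))
      + t2 (p, s) \<^bold>\<and> (gUV s \<odot> a1 (p, s) + gVV s \<odot> a2 (p, s)))"
    "of_degree (tangent_space M (p, s)) 1 (gUU s \<odot> a1 (p, s) + gUV s \<odot> a2 (p, s))"
    "of_degree (tangent_space M (p, s)) 1 (gUV s \<odot> a1 (p, s) + gVV s \<odot> a2 (p, s))"
proof -
  let ?T = "tangent_space M (p, s)"
  note o = of_degree_1[OF p]
  have w: "of_degree ?T 2 (a \<^bold>\<and> b)" if "of_degree ?T 1 a" "of_degree ?T 1 b" for a b
    using of_degree_wedge[OF that] by (simp add: numeral_2_eq_2)
  show 1: "of_degree ?T 1 (gUU s \<odot> a1 (p, s) + gUV s \<odot> a2 (p, s))" "of_degree ?T 1 (gUV s \<odot> a1 (p, s) + gVV s \<odot> a2 (p, s))"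
    by (intro of_degree_add of_degree_scale o)+
  show "of_degree ?T 2 (D s \<odot> (t1 (p, s) \<^bold>\<and> t2 (p, s))
      + s \<odot> (t1 (p, s) \<^bold>\<and> a2 (p, s) - t2 (p, s) \<^bold>\<and> a1 (p, s)) - a1 (p, s) \<^bold>\<and> a2 (p, s))"
    by (intro of_degree_add of_degree_diff of_degree_scale w o)
  show "of_degree ?T 2 (t1 (p, s) \<^bold>\<and> (gUU s \<odot> a1 (p, s) + gUV s \<odot> a2 (p, s))
      + t2 (p, s) \<^bold>\<and> (gUV s \<odot> a1 (p, s) + gVV s \<odot> a2 (p, s)))"
    by (intro of_degree_add w o 1)
qed

lemma psi_value:
  assumes p: "p \<in> points E" "s \<in> I"
    and X: "X \<in> tangent_space M (p, s)" "Y \<in> tangent_space M (p, s)" "Z \<in> tangent_space M (p, s)"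
  shows "\<psi>p (p, s) [X, Y, Z] = psip s (D s) (gUU s) (gUV s) (gVV s) (\<lambda>X. ds (p, s) [X]) (\<lambda>X. t1 (p, s) [X]) (\<lambda>X. t2 (p, s) [X])
      (\<lambda>X. a0 (p, s) [X]) (\<lambda>X. a1 (p, s) [X]) (\<lambda>X. a2 (p, s) [X]) X Y Z"
    and "\<psi>m (p, s) [X, Y, Z] = psim s (D s) (gUU s) (gUV s) (gVV s) (\<lambda>X. ds (p, s) [X]) (\<lambda>X. t1 (p, s) [X]) (\<lambda>X. t2 (p, s) [X])
      (\<lambda>X. a0 (p, s) [X]) (\<lambda>X. a1 (p, s) [X]) (\<lambda>X. a2 (p, s) [X]) X Y Z"
proof -
  have q: "(p, s) \<in> points M" using p by (simp add: points_M)
  note o = of_degree_1[OF p] and oo = two_forms[OF p]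
  note w = wedge_3_12[OF o(1) oo(1) X] wedge_3_12[OF o(1) oo(2) X] wedge_3_21[OF oo(1) o(4) X] wedge_3_21[OF oo(2) o(4) X]
  note w1 = wedge_2[OF o(2) o(3)] wedge_2[OF o(2) o(6)] wedge_2[OF o(3) o(5)] wedge_2[OF o(5) o(6)]
    wedge_2[OF o(2) oo(3)] wedge_2[OF o(3) oo(4)]
  have l: "[X, Y, Z] \<in> lists (tangent_space M (p, s))" using X by simp
  have D: "D s \<noteq> 0" using D_pos[OF p(2)] by simp
  show "\<psi>p (p, s) [X, Y, Z] = psip s (D s) (gUU s) (gUV s) (gVV s) (\<lambda>X. ds (p, s) [X]) (\<lambda>X. t1 (p, s) [X]) (\<lambda>X. t2 (p, s) [X])
      (\<lambda>X. a0 (p, s) [X]) (\<lambda>X. a1 (p, s) [X]) (\<lambda>X. a2 (p, s) [X]) X Y Z"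
    unfolding psip_eq[unfolded field_eq_def, rule_format, OF q l]
    using D by (simp add: Let_def scale_apply w) (simp add: w1 X scale_apply psip_def W2_def W3_def, simp add: algebra_simps add_divide_distrib diff_divide_distrib)
  show "\<psi>m (p, s) [X, Y, Z] = psim s (D s) (gUU s) (gUV s) (gVV s) (\<lambda>X. ds (p, s) [X]) (\<lambda>X. t1 (p, s) [X]) (\<lambda>X. t2 (p, s) [X])
      (\<lambda>X. a0 (p, s) [X]) (\<lambda>X. a1 (p, s) [X]) (\<lambda>X. a2 (p, s) [X]) X Y Z"
    unfolding psim_eq[unfolded field_eq_def, rule_format, OF q l]
    using D by (simp add: Let_def scale_apply w) (simp add: w1 X scale_apply psim_def W2_def W3_def, simp add: algebra_simps add_divide_distrib diff_divide_distrib)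
qed

text \<open>Together with the positivity of g this shows that the six one-forms have no common
  nonzero kernel vector; \<open>frame\<close> uses it in this way.\<close>

lemma g_value:
  assumes p: "p \<in> points E" "s \<in> I" and X: "X \<in> tangent_space M (p, s)"
    and z: "ds (p, s) [X] = 0" "t1 (p, s) [X] = 0" "t2 (p, s) [X] = 0" "a0 (p, s) [X] = 0" "a1 (p, s) [X] = 0" "a2 (p, s) [X] = 0"
  shows "g (p, s) [X, X] = 0"
proof -
  have q: "(p, s) \<in> points M" using p by (simp add: points_M)
  note o = of_degree_1[OF p]
  have l: "[X, X] \<in> lists (tangent_space M (p, s))" using X by simp
  show ?thesis
    unfolding g_eq[unfolded field_eq_def, rule_format, OF q l]
    by (simp add: Let_def scale_apply tensor_prod_2[OF o(1) o(1) X X] tensor_prod_2[OF o(2) o(2) X X] tensor_prod_2[OF o(3) o(3) X X]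
        tensor_prod_2[OF o(4) o(4) X X] tensor_prod_2[OF o(5) o(5) X X] tensor_prod_2[OF o(6) o(6) X X]
        tensor_prod_2[OF o(2) o(3) X X] tensor_prod_2[OF o(3) o(2) X X] tensor_prod_2[OF o(5) o(6) X X] tensor_prod_2[OF o(6) o(5) X X] z)
qed

text \<open>The six terms of a wedge product of two-forms coincide in pairs here. With the factor -2
  of the second equation this yields the constant -4 in its local form.\<close>

lemma sigma_wedge_value:
  assumes p: "p \<in> points E" "s \<in> I" and X: "X \<in> tangent_space M (p, s)" "Y \<in> tangent_space M (p, s)"
    "Z \<in> tangent_space M (p, s)" "W \<in> tangent_space M (p, s)"
  shows "(\<sigma> (p, s) \<^bold>\<and> \<sigma> (p, s)) [X, Y, Z, W] = 2 * (\<sigma> (p, s) [X, Y] * \<sigma> (p, s) [Z, W]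
    - \<sigma> (p, s) [X, Z] * \<sigma> (p, s) [Y, W] + \<sigma> (p, s) [X, W] * \<sigma> (p, s) [Y, Z])"
proof -
  have q: "(p, s) \<in> points M" using p by (simp add: points_M)
  have "diff_form M 2 \<sigma>" using nearly_Kaehler by (simp add: nearly_Kaehler_def SU3_structure_def)
  from multilinear_on_of_degree[OF diff_form_multilinear[OF this q]]
  have o: "of_degree (tangent_space M (p, s)) 2 (\<sigma> (p, s))" .
  show ?thesis unfolding wedge_4_22[OF o o X] by (simp add: algebra_simps)
qed

text \<open>The fundamental vectors of the action do not involve s, so one pair serves every
  connection of the family.\<close>

lemma vertical:
  assumes "p \<in> points E"
  obtains u1 u2 where "u1 \<in> tangent_space E p" "u2 \<in> tangent_space E p"
    "pushforward H3 \<pi> p u1 = (\<lambda>u. 0)" "pushforward H3 \<pi> p u2 = (\<lambda>u. 0)"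
    "\<And>s. s \<in> I \<Longrightarrow> \<theta>1 s p [u1] = 1" "\<And>s. s \<in> I \<Longrightarrow> \<theta>2 s p [u1] = 0"
    "\<And>s. s \<in> I \<Longrightarrow> \<theta>1 s p [u2] = 0" "\<And>s. s \<in> I \<Longrightarrow> \<theta>2 s p [u2] = 1"
proof -
  have c: "\<theta>1 s p [velocity E (\<lambda>t. act p (cis t, 1))] = 1" "\<theta>1 s p [velocity E (\<lambda>t. act p (1, cis t))] = 0"
        "\<theta>2 s p [velocity E (\<lambda>t. act p (cis t, 1))] = 0" "\<theta>2 s p [velocity E (\<lambda>t. act p (1, cis t))] = 1"
    if "s \<in> I" for s
    using theta_connection[OF that] assms unfolding connection_form_def by blast+
  show ?thesis
    using vertical_velocity[OF principal assms, of 1 0] vertical_velocity[OF principal assms, of 0 1] c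
    by (intro that[of "velocity E (\<lambda>t. act p (cis t, 1))" "velocity E (\<lambda>t. act p (1, cis t))"]) simp_all
qed

text \<open>A dimension count: the two connection forms and the three pulled-back forms map the
  five-dimensional tangent space injectively, since a common kernel vector would have length zero
  for g. Hence the map is onto and a dual frame exists.\<close>

lemma frame:
  assumes p: "p \<in> points E" "s \<in> I"
  obtains v1 v2 v3 where "v1 \<in> tangent_space E p" "v2 \<in> tangent_space E p" "v3 \<in> tangent_space E p"
    "\<theta>1 s p [v1] = 0" "\<theta>1 s p [v2] = 0" "\<theta>1 s p [v3] = 0" "\<theta>2 s p [v1] = 0" "\<theta>2 s p [v2] = 0" "\<theta>2 s p [v3] = 0"
    "eta1 \<pi> p v1 = 1" "eta1 \<pi> p v2 = 0" "eta1 \<pi> p v3 = 0"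
    "eta2 \<pi> p v1 = 0" "eta2 \<pi> p v2 = 1" "eta2 \<pi> p v3 = 0"
    "eta3 \<pi> p v1 = 0" "eta3 \<pi> p v2 = 0" "eta3 \<pi> p v3 = 1"
proof -
  obtain c where c: "c \<in> atlas E" "p \<in> fst c" using charted_ex_chart[OF charted_E p(1)] by blast
  let ?X = "coord_vec E c p" and ?y = "snd c p"
  have inv: "chart_inv c ?y = p" and y: "?y \<in> snd c ` fst c" using c by (auto simp: chart_inv_chart[OF charted_E])
  note eta = eta_coord_vec[OF charted_E smooth_pi c(1) y, unfolded inv]
  have G: "linear (frechet_derivative (eta_loc \<pi> c) (at ?y))"
    using has_derivative_linear[OF smooth_on_has_derivative[OF eta_loc_smooth[OF charted_E smooth_pi c(1)] y]] .
  let ?L = "\<lambda>v. (\<theta>1 s p [?X v], \<theta>2 s p [?X v], eta1 \<pi> p (?X v), eta2 \<pi> p (?X v), eta3 \<pi> p (?X v))"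
  have th: "linear (\<lambda>v. \<theta>1 s p [?X v])" "linear (\<lambda>v. \<theta>2 s p [?X v])"
    by (rule diff_form1_linear[OF theta_form(1)[OF p(2)] charted_E c], rule diff_form1_linear[OF theta_form(2)[OF p(2)] charted_E c])
  have L: "linear ?L"
    unfolding eta using G
    by (intro linearI) (auto simp: linear_add[OF th(1)] linear_add[OF th(2)] linear_cmul[OF th(1)] linear_cmul[OF th(2)]
        linear_add linear_cmul algebra_simps)
  have "inj ?L"
  proof (rule linear_injective_0[OF L, THEN iffD2], intro allI impI)
    fix v assume v0: "?L v = 0"
    \<comment> \<open>The lift of v to M with vanishing ds component; then all six one-forms vanish
      on it.\<close>
    let ?Z = "coord_vec M (ech c) (p, s) (v, 0)"
    have q: "(p, s) \<in> points M" "(p, s) \<in> fst (ech c)" using p c by (simp_all add: points_M)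
    have Z: "?Z \<in> tangent_space M (p, s)" by (rule coord_vec_in_tangent_space[OF ech_in_atlas[OF c(1)] q(2)])
    have "g (p, s) [?Z, ?Z] = 0"
      using v0 by (intro g_value[OF p Z])
        (simp_all add: ds_value[OF c p(2)] t_value a_value[OF p Z] pushforward_fst[OF c p(2)] comb_def prod_eq_iff)
    moreover have "riemannian_metric M g" using nearly_Kaehler by (simp add: nearly_Kaehler_def SU3_structure_def)
    ultimately have "?Z = (\<lambda>_. 0)"
      using q(1) Z unfolding riemannian_metric_def by (metis less_irrefl)
    then have "vec_components (ech c) ?Z = 0" by (simp add: vec_components_def)
    then show "v = 0"
      using vec_components_coord_vec[OF charted_M ech_in_atlas[OF c(1)] q(2), of "(v, 0)"] by (simp add: prod_eq_iff)
  qed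
  then have "surj ?L"
    by (intro linear_injective_imp_surjective[OF L]) simp_all
  then have ex: "\<exists>w. ?L w = x" for x unfolding surj_def by metis
  obtain w1 where w1: "?L w1 = (0, 0, 1, 0, 0)" using ex by blast
  obtain w2 where w2: "?L w2 = (0, 0, 0, 1, 0)" using ex by blast
  obtain w3 where w3: "?L w3 = (0, 0, 0, 0, 1)" using ex by blast
  show ?thesis
    by (rule that[of "?X w1" "?X w2" "?X w3"])
      (use w1 w2 w3 in \<open>simp_all only: prod.inject coord_vec_in_tangent_space[OF c]\<close>)
qed


section \<open>The structure in a product chart\<close>

definition P :: "(real \<Rightarrow> 'e field) \<Rightarrow> ('e, real^5) chart \<Rightarrow> (real^5) \<times> real \<Rightarrow> (real^5) \<times> real \<Rightarrow> real" where
  "P \<theta> c z w = loc1 E c (\<theta> (snd z)) (fst z) (fst w)"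

definition A :: "(real \<Rightarrow> (real^3^3) field) \<Rightarrow> ('e, real^5) chart \<Rightarrow> (real^5) \<times> real \<Rightarrow> (real^5) \<times> real \<Rightarrow> real" where
  "A \<alpha> c z w = comb \<alpha> (snd z) (chart_inv c (fst z)) (coord_vec E c (chart_inv c (fst z)) (fst w))"

definition N1 :: "('e, real^5) chart \<Rightarrow> real^5 \<Rightarrow> real^5 \<Rightarrow> real" where
  "N1 c y v = eta1 \<pi> (chart_inv c y) (coord_vec E c (chart_inv c y) v)"
definition N2 :: "('e, real^5) chart \<Rightarrow> real^5 \<Rightarrow> real^5 \<Rightarrow> real" where
  "N2 c y v = eta2 \<pi> (chart_inv c y) (coord_vec E c (chart_inv c y) v)"
definition N3 :: "('e, real^5) chart \<Rightarrow> real^5 \<Rightarrow> real^5 \<Rightarrow> real" where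
  "N3 c y v = eta3 \<pi> (chart_inv c y) (coord_vec E c (chart_inv c y) v)"

text \<open>The derivative of \<open>A\<close> written out by the product rule, with the
  contributions of s and of the point kept apart. \<open>P\<close> has no such splitting, so
  \<open>P'\<close> stays a \<open>frechet_derivative\<close>.\<close>

definition A' :: "(real \<Rightarrow> (real^3^3) field) \<Rightarrow> ('e, real^5) chart \<Rightarrow> (real^5) \<times> real \<Rightarrow> (real^5) \<times> real \<Rightarrow> (real^5) \<times> real \<Rightarrow> real" where
  "A' \<alpha> c z u w =
     snd u * deriv (\<lambda>s. lc1 (\<alpha> s)) (snd z) * N1 c (fst z) (fst w) + lc1 (\<alpha> (snd z)) * frechet_derivative (\<lambda>y. N1 c y (fst w)) (at (fst z)) (fst u)
   + (snd u * deriv (\<lambda>s. lc2 (\<alpha> s)) (snd z) * N2 c (fst z) (fst w) + lc2 (\<alpha> (snd z)) * frechet_derivative (\<lambda>y. N2 c y (fst w)) (at (fst z)) (fst u))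
   + (snd u * deriv (\<lambda>s. lc3 (\<alpha> s)) (snd z) * N3 c (fst z) (fst w) + lc3 (\<alpha> (snd z)) * frechet_derivative (\<lambda>y. N3 c y (fst w)) (at (fst z)) (fst u))"

definition P' :: "(real \<Rightarrow> 'e field) \<Rightarrow> ('e, real^5) chart \<Rightarrow> (real^5) \<times> real \<Rightarrow> (real^5) \<times> real \<Rightarrow> (real^5) \<times> real \<Rightarrow> real" where
  "P' \<theta> c z u w = frechet_derivative (\<lambda>z. P \<theta> c z w) (at z) u"

abbreviation Z :: "('e, real^5) chart \<Rightarrow> ((real^5) \<times> real) set" where
  "Z c \<equiv> (snd c ` fst c) \<times> I"

lemma open_Z: "c \<in> atlas E \<Longrightarrow> open (Z c)"
  by (intro open_Times charted_open[OF charted_E]) auto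

lemma coefficient_derivative:
  assumes "smooth_family H3 (s\<^sub>0-\<epsilon>) (s\<^sub>0+\<epsilon>) 1 \<alpha>" "s \<in> I"
  shows "((\<lambda>s. lc1 (\<alpha> s)) has_real_derivative deriv (\<lambda>s. lc1 (\<alpha> s)) s) (at s)"
    "((\<lambda>s. lc2 (\<alpha> s)) has_real_derivative deriv (\<lambda>s. lc2 (\<alpha> s)) s) (at s)"
    "((\<lambda>s. lc3 (\<alpha> s)) has_real_derivative deriv (\<lambda>s. lc3 (\<alpha> s)) s) (at s)"
  using smooth_family_left_coefficients[OF assms(1)] smooth_on_differentiable assms(2)
  by (meson DERIV_deriv_iff_real_differentiable)+

lemma DERIV_snd:
  assumes "(f has_real_derivative d) (at (snd z))"
  shows "((\<lambda>z. f (snd z)) has_derivative (\<lambda>u. snd u * d)) (at z)"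
  using has_derivative_compose[OF bounded_linear_imp_has_derivative[OF bounded_linear_snd] assms[unfolded has_field_derivative_def]]
  by (simp add: mult.commute)

lemma N_has_derivative:
  assumes "c \<in> atlas E" "z \<in> Z c"
  shows "((\<lambda>z. N1 c (fst z) v) has_derivative (\<lambda>u. frechet_derivative (\<lambda>y. N1 c y v) (at (fst z)) (fst u))) (at z)"
    "((\<lambda>z. N2 c (fst z) v) has_derivative (\<lambda>u. frechet_derivative (\<lambda>y. N2 c y v) (at (fst z)) (fst u))) (at z)"
    "((\<lambda>z. N3 c (fst z) v) has_derivative (\<lambda>u. frechet_derivative (\<lambda>y. N3 c y v) (at (fst z)) (fst u))) (at z)"
proof -
  have z: "fst z \<in> snd c ` fst c" using assms(2) by auto
  note f = bounded_linear_imp_has_derivative[OF bounded_linear_fst]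
  note s = eta_smooth[OF charted_E smooth_pi assms(1), of v, folded N1_def N2_def N3_def]
  show "((\<lambda>z. N1 c (fst z) v) has_derivative (\<lambda>u. frechet_derivative (\<lambda>y. N1 c y v) (at (fst z)) (fst u))) (at z)"
    by (rule has_derivative_compose[OF f smooth_on_has_derivative[OF s(1) z]])
  show "((\<lambda>z. N2 c (fst z) v) has_derivative (\<lambda>u. frechet_derivative (\<lambda>y. N2 c y v) (at (fst z)) (fst u))) (at z)"
    by (rule has_derivative_compose[OF f smooth_on_has_derivative[OF s(2) z]])
  show "((\<lambda>z. N3 c (fst z) v) has_derivative (\<lambda>u. frechet_derivative (\<lambda>y. N3 c y v) (at (fst z)) (fst u))) (at z)"
    by (rule has_derivative_compose[OF f smooth_on_has_derivative[OF s(3) z]])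
qed

lemma A_eq: "A \<alpha> c z w = lc1 (\<alpha> (snd z)) * N1 c (fst z) (fst w) + lc2 (\<alpha> (snd z)) * N2 c (fst z) (fst w)
    + lc3 (\<alpha> (snd z)) * N3 c (fst z) (fst w)"
  by (simp add: A_def comb_def N1_def N2_def N3_def)

lemma A_has_derivative:
  assumes c: "c \<in> atlas E" and z: "z \<in> Z c" and \<alpha>: "smooth_family H3 (s\<^sub>0-\<epsilon>) (s\<^sub>0+\<epsilon>) 1 \<alpha>"
  shows "((\<lambda>z. A \<alpha> c z w) has_derivative (\<lambda>u. A' \<alpha> c z u w)) (at z)"
proof -
  have "snd z \<in> I" using z by auto
  note d = coefficient_derivative[OF \<alpha> this]
  show ?thesis
    unfolding A_eq A'_def
    by (rule has_derivative_eq_rhs,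
        (rule has_derivative_add has_derivative_mult DERIV_snd d N_has_derivative[OF c z])+)
       (simp add: algebra_simps)
qed

lemma P_smooth:
  assumes c: "c \<in> atlas E" and \<theta>: "smooth_family E (s\<^sub>0-\<epsilon>) (s\<^sub>0+\<epsilon>) 1 \<theta>"
  shows "smooth_on (Z c) (\<lambda>z. P \<theta> c z w)"
  unfolding P_def by (rule smooth_family_loc1[OF charted_E c \<theta>])

lemma P_has_derivative:
  assumes c: "c \<in> atlas E" and z: "z \<in> Z c" and \<theta>: "smooth_family E (s\<^sub>0-\<epsilon>) (s\<^sub>0+\<epsilon>) 1 \<theta>"
  shows "((\<lambda>z. P \<theta> c z w) has_derivative (\<lambda>u. P' \<theta> c z u w)) (at z)"
  unfolding P'_def by (rule smooth_on_has_derivative[OF P_smooth[OF c \<theta>] z])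

lemma g_derivative:
  assumes "s \<in> I"
  shows "(gUU has_real_derivative deriv gUU s) (at s)" "(gUV has_real_derivative deriv gUV s) (at s)"
    "(gVV has_real_derivative deriv gVV s) (at s)" "(D has_real_derivative deriv D s) (at s)"
proof -
  show g: "(gUU has_real_derivative deriv gUU s) (at s)" "(gUV has_real_derivative deriv gUV s) (at s)"
    "(gVV has_real_derivative deriv gVV s) (at s)"
    using g_smooth smooth_on_differentiable assms by (meson DERIV_deriv_iff_real_differentiable)+
  \<comment> \<open>D is differentiable because h^2 is the determinant of the metric coefficients
    throughout the interval.\<close>
  have "((\<lambda>s. gUU s * gVV s - gUV s * gUV s - s * s) has_real_derivative
      (deriv gUU s * gVV s + deriv gVV s * gUU s) - (deriv gUV s * gUV s + deriv gUV s * gUV s) - (1 * s + 1 * s)) (at s)"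
    by (intro DERIV_diff DERIV_mult g DERIV_ident)
  then have "(D has_real_derivative
      (deriv gUU s * gVV s + deriv gVV s * gUU s) - (deriv gUV s * gUV s + deriv gUV s * gUV s) - (1 * s + 1 * s)) (at s)"
    by (rule has_field_derivative_transform_within_open[where S=I])
       (use assms h(2) in \<open>auto simp: D power2_eq_square\<close>)
  then show "(D has_real_derivative deriv D s) (at s)"
    using DERIV_imp_deriv by fastforce
qed

lemma values_in_chart:
  assumes c: "c \<in> atlas E" and p: "p \<in> fst c" and s: "s \<in> I"
  defines "z \<equiv> (snd c p, s)" and "X \<equiv> coord_vec M (ech c) (p, s)"
  shows "X w \<in> tangent_space M (p, s)" "ds (p, s) [X w] = snd w" "t1 (p, s) [X w] = P \<theta>1 c z w" "t2 (p, s) [X w] = P \<theta>2 c z w"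
    "a0 (p, s) [X w] = A \<alpha>0 c z w" "a1 (p, s) [X w] = A \<alpha>1 c z w" "a2 (p, s) [X w] = A \<alpha>2 c z w"
proof -
  have inv: "chart_inv c (snd c p) = p" by (rule chart_inv_chart[OF charted_E c p])
  have pp: "p \<in> points E" by (rule charted_in_points[OF charted_E c p])
  show X: "X w \<in> tangent_space M (p, s)"
    unfolding X_def by (rule coord_vec_in_tangent_space[OF ech_in_atlas[OF c]]) (use p s in simp)
  show "ds (p, s) [X w] = snd w" unfolding X_def by (rule ds_value[OF c p s])
  show "t1 (p, s) [X w] = P \<theta>1 c z w" "t2 (p, s) [X w] = P \<theta>2 c z w"
    unfolding t_value X_def pushforward_fst[OF c p s] by (simp_all add: P_def loc1_def z_def inv)
  show "a0 (p, s) [X w] = A \<alpha>0 c z w" "a1 (p, s) [X w] = A \<alpha>1 c z w" "a2 (p, s) [X w] = A \<alpha>2 c z w"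
    using a_value[OF pp s X] unfolding X_def pushforward_fst[OF c p s] by (simp_all add: A_def z_def inv)
qed

definition sigl :: "('e, real^5) chart \<Rightarrow> (real^5) \<times> real \<Rightarrow> (real^5) \<times> real \<Rightarrow> (real^5) \<times> real \<Rightarrow> real" where
  "sigl c z = sig (snd z) (D (snd z)) snd (P \<theta>1 c z) (P \<theta>2 c z) (A \<alpha>0 c z) (A \<alpha>1 c z) (A \<alpha>2 c z)"

definition psipl :: "('e, real^5) chart \<Rightarrow> (real^5) \<times> real \<Rightarrow> (real^5) \<times> real \<Rightarrow> (real^5) \<times> real \<Rightarrow> (real^5) \<times> real \<Rightarrow> real" where
  "psipl c z = psip (snd z) (D (snd z)) (gUU (snd z)) (gUV (snd z)) (gVV (snd z)) snd (P \<theta>1 c z) (P \<theta>2 c z) (A \<alpha>0 c z) (A \<alpha>1 c z) (A \<alpha>2 c z)"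

definition psiml :: "('e, real^5) chart \<Rightarrow> (real^5) \<times> real \<Rightarrow> (real^5) \<times> real \<Rightarrow> (real^5) \<times> real \<Rightarrow> (real^5) \<times> real \<Rightarrow> real" where
  "psiml c z = psim (snd z) (D (snd z)) (gUU (snd z)) (gUV (snd z)) (gVV (snd z)) snd (P \<theta>1 c z) (P \<theta>2 c z) (A \<alpha>0 c z) (A \<alpha>1 c z) (A \<alpha>2 c z)"

lemma forms_in_chart:
  assumes c: "c \<in> atlas E" and p: "p \<in> fst c" and s: "s \<in> I"
  defines "z \<equiv> (snd c p, s)" and "X \<equiv> coord_vec M (ech c) (p, s)"
  shows "\<sigma> (p, s) [X u, X v] = sigl c z u v" "\<psi>p (p, s) [X u, X v, X w] = psipl c z u v w"
    "\<psi>m (p, s) [X u, X v, X w] = psiml c z u v w"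
proof -
  have pp: "p \<in> points E" by (rule charted_in_points[OF charted_E c p])
  note v = values_in_chart[OF c p s, folded z_def X_def]
  show "\<sigma> (p, s) [X u, X v] = sigl c z u v" "\<psi>p (p, s) [X u, X v, X w] = psipl c z u v w"
    "\<psi>m (p, s) [X u, X v, X w] = psiml c z u v w"
    by (simp_all add: sigma_value[OF pp s v(1) v(1)] psi_value[OF pp s v(1) v(1) v(1)] sigl_def psipl_def psiml_def
        sig_def psip_def psim_def W2_def W3_def v z_def)
qed

lemma forms_in_chart_inv:
  assumes c: "c \<in> atlas E" and z: "z \<in> Z c"
  defines "X \<equiv> coord_vec M (ech c) (chart_inv (ech c) z)"
  shows "\<sigma> (chart_inv (ech c) z) [X u, X v] = sigl c z u v"
    "\<psi>m (chart_inv (ech c) z) [X u, X v, X w] = psiml c z u v w"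
proof -
  obtain p s where p: "p \<in> fst c" and s: "s \<in> I" and z: "z = (snd c p, s)" using z by auto
  have "chart_inv (ech c) z = (p, s)"
    unfolding z using ech_inv[OF c _ s, of "snd c p"] p by (simp add: chart_inv_chart[OF charted_E c])
  then show "\<sigma> (chart_inv (ech c) z) [X u, X v] = sigl c z u v"
    "\<psi>m (chart_inv (ech c) z) [X u, X v, X w] = psiml c z u v w"
    unfolding X_def using forms_in_chart[OF c p s] by (simp_all only: z)
qed

text \<open>The chart is the one chosen by \<open>ext_deriv\<close> and is therefore obtained, not
  given. Every chart of M is a product chart, and its factor on E is returned.\<close>

lemma local_equations:
  assumes p: "p \<in> points E" and s: "s \<in> I"
  obtains c where "c \<in> atlas E" "p \<in> fst c"
    "\<And>u v w. frechet_derivative (\<lambda>z. sigl c z v w) (at (snd c p, s)) u - frechet_derivative (\<lambda>z. sigl c z u w) (at (snd c p, s)) v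
      + frechet_derivative (\<lambda>z. sigl c z u v) (at (snd c p, s)) w = 3 * psipl c (snd c p, s) u v w"
    "\<And>u v w r. frechet_derivative (\<lambda>z. psiml c z v w r) (at (snd c p, s)) u - frechet_derivative (\<lambda>z. psiml c z u w r) (at (snd c p, s)) v
      + frechet_derivative (\<lambda>z. psiml c z u v r) (at (snd c p, s)) w - frechet_derivative (\<lambda>z. psiml c z u v w) (at (snd c p, s)) r
      = - 4 * (sigl c (snd c p, s) u v * sigl c (snd c p, s) w r - sigl c (snd c p, s) u w * sigl c (snd c p, s) v r
         + sigl c (snd c p, s) u r * sigl c (snd c p, s) v w)"
proof -
  have q: "(p, s) \<in> points M" using p s by (simp add: points_M)
  obtain e where e: "e \<in> atlas M" "(p, s) \<in> fst e"
    and ex: "\<And>\<omega> vs. ext_deriv M \<omega> (p, s) (map (coord_vec M e (p, s)) vs) = (\<Sum>i<length vs. (- 1) ^ i *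
          frechet_derivative
            (\<lambda>x. \<omega> (chart_inv e x) (map (coord_vec M e (chart_inv e x)) (nths vs (- {i}))))
            (at (snd e (p, s))) (vs ! i))"
    using ext_deriv_coord_vec[OF charted_M q] by blast
  obtain c where c: "c \<in> atlas E" and ec: "e = ech c" using atlas_M_cases[OF e(1)] by blast
  have pc: "p \<in> fst c" using e(2) by (simp add: ec)
  let ?z = "(snd c p, s)" and ?X = "coord_vec M (ech c) (p, s)"
  have ez: "snd e (p, s) = ?z" by (simp add: ec)
  have zZ: "?z \<in> Z c" using pc s by simp
  have X: "?X w \<in> tangent_space M (p, s)" for w by (rule values_in_chart(1)[OF c pc s])
  note cong = frechet_derivative_cong_open[OF open_Z[OF c] zZ]
  \<comment> \<open>Inside the derivative the forms may be replaced by their coordinate expressions,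
    since both agree on the open set \<open>Z c\<close>.\<close>
  have s1: "frechet_derivative (\<lambda>z. \<sigma> (chart_inv e z) (map (coord_vec M e (chart_inv e z)) [v, w])) (at ?z)
     = frechet_derivative (\<lambda>z. sigl c z v w) (at ?z)" for v w
    by (rule cong) (use forms_in_chart_inv(1)[OF c] in \<open>simp add: ec\<close>)
  have s2: "frechet_derivative (\<lambda>z. \<psi>m (chart_inv e z) (map (coord_vec M e (chart_inv e z)) [u, v, w])) (at ?z)
     = frechet_derivative (\<lambda>z. psiml c z u v w) (at ?z)" for u v w
    by (rule cong) (use forms_in_chart_inv(2)[OF c] in \<open>simp add: ec\<close>)
  have nK: "field_eq M (ext_deriv M \<sigma>) (\<lambda>p. 3 \<odot> \<psi>p p)" "field_eq M (ext_deriv M \<psi>m) (\<lambda>p. (- 2) \<odot> (\<sigma> p \<^bold>\<and> \<sigma> p))"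
    using nearly_Kaehler by (simp_all add: nearly_Kaehler_def)
  show ?thesis
  proof (rule that[OF c pc])
    fix u v w
    have "map ?X [u, v, w] \<in> lists (tangent_space M (p, s))" using X by simp
    then have "ext_deriv M \<sigma> (p, s) (map ?X [u, v, w]) = 3 * \<psi>p (p, s) (map ?X [u, v, w])"
      using nK(1) q by (simp only: field_eq_def scale_apply)
    then show "frechet_derivative (\<lambda>z. sigl c z v w) (at ?z) u - frechet_derivative (\<lambda>z. sigl c z u w) (at ?z) v
      + frechet_derivative (\<lambda>z. sigl c z u v) (at ?z) w = 3 * psipl c ?z u v w"
      unfolding ex[of \<sigma> "[u, v, w]", unfolded ec, folded ec] 
      using forms_in_chart(2)[OF c pc s, of u v w] ex[of \<sigma> "[u, v, w]"]
      by (simp add: ec[symmetric] ez lessThan_Suc nths_Cons_compl s1[simplified])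
  next
    fix u v w r
    have "map ?X [u, v, w, r] \<in> lists (tangent_space M (p, s))" using X by simp
    then have "ext_deriv M \<psi>m (p, s) (map ?X [u, v, w, r]) = - 2 * (\<sigma> (p, s) \<^bold>\<and> \<sigma> (p, s)) (map ?X [u, v, w, r])"
      using nK(2) q by (simp only: field_eq_def scale_apply)
    then show "frechet_derivative (\<lambda>z. psiml c z v w r) (at ?z) u - frechet_derivative (\<lambda>z. psiml c z u w r) (at ?z) v
      + frechet_derivative (\<lambda>z. psiml c z u v r) (at ?z) w - frechet_derivative (\<lambda>z. psiml c z u v w) (at ?z) r
      = - 4 * (sigl c ?z u v * sigl c ?z w r - sigl c ?z u w * sigl c ?z v r + sigl c ?z u r * sigl c ?z v w)"
      using forms_in_chart(1)[OF c pc s] ex[of \<psi>m "[u, v, w, r]"] sigma_wedge_value[OF p s X X X X]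
      by (simp add: ec[symmetric] ez lessThan_Suc nths_Cons_compl s2[simplified])
  qed
qed

end

lemma frechet_derivative_zero_on:
  assumes "open S" "x \<in> S" "\<And>y. y \<in> S \<Longrightarrow> f y = 0"
  shows "frechet_derivative f (at x) v = 0"
proof -
  have "frechet_derivative f (at x) = frechet_derivative (\<lambda>y. 0) (at x)"
    by (rule frechet_derivative_cong_open[OF assms(1,2)]) (simp add: assms(3))
  then show ?thesis by (simp add: frechet_derivative_const)
qed

section \<open>The local data satisfy the pointwise equations\<close>

context nearly_Kaehler_over_H3
begin

lemma N_linear:
  assumes "c \<in> atlas E" "y \<in> snd c ` fst c"
  shows "linear (N1 c y)" "linear (N2 c y)" "linear (N3 c y)"
proof -
  have G: "linear (frechet_derivative (eta_loc \<pi> c) (at y))"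
    by (rule has_derivative_linear[OF smooth_on_has_derivative[OF eta_loc_smooth[OF charted_E smooth_pi assms(1)] assms(2)]])
  note e = eta_coord_vec[OF charted_E smooth_pi assms, folded N1_def N2_def N3_def]
  show "linear (N1 c y)" "linear (N2 c y)" "linear (N3 c y)"
    by (intro linearI; simp add: e linear_add[OF G] linear_cmul[OF G] algebra_simps)+
qed

lemma dN:
  assumes c: "c \<in> atlas E" and y: "y \<in> snd c ` fst c"
  shows "frechet_derivative (\<lambda>y. N1 c y w) (at y) v = frechet_derivative (\<lambda>y. N1 c y v) (at y) w"
    "frechet_derivative (\<lambda>y. N2 c y w) (at y) v = frechet_derivative (\<lambda>y. N2 c y v) (at y) w"
    "frechet_derivative (\<lambda>y. N3 c y w) (at y) v = frechet_derivative (\<lambda>y. N3 c y v) (at y) w - W2 (N1 c y) (N2 c y) v w"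
  using d1_eta[OF charted_E smooth_pi c y, of v w, folded N1_def N2_def N3_def] by (simp_all add: d1_def)

text \<open>Together with \<open>P'_slice\<close> this splits \<open>P'\<close> into the
  s-derivative of \<theta> and the exterior derivative of \<theta> at fixed s.\<close>

lemma P'_time:
  assumes c: "c \<in> atlas E" and y: "y \<in> snd c ` fst c" and s: "s \<in> I" and \<theta>: "smooth_family E (s\<^sub>0-\<epsilon>) (s\<^sub>0+\<epsilon>) 1 \<theta>"
  shows "((\<lambda>s. P \<theta> c (y, s) w) has_real_derivative P' \<theta> c (y, s) (0, 1) w) (at s)"
proof -
  have z: "(y, s) \<in> Z c" using y s by simp
  note D = P_has_derivative[OF c z \<theta>, of w]
  have 1: "((\<lambda>s. (y, s)) has_derivative (\<lambda>r. (0, r))) (at s)"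
    by (auto intro!: derivative_eq_intros)
  from has_derivative_compose[OF 1 D]
  have "((\<lambda>s. P \<theta> c (y, s) w) has_derivative (\<lambda>r. P' \<theta> c (y, s) (0, r) w)) (at s)" .
  moreover have "(\<lambda>r. P' \<theta> c (y, s) (0, r) w) = times (P' \<theta> c (y, s) (0, 1) w)"
  proof (rule ext)
    show "P' \<theta> c (y, s) (0, r) w = P' \<theta> c (y, s) (0, 1) w * r" for r
      using linear_cmul[OF has_derivative_linear[OF D], of r "(0, 1)"] by (simp add: mult.commute)
  qed
  ultimately show ?thesis by (simp only: has_field_derivative_def)
qed

lemma P'_slice:
  assumes c: "c \<in> atlas E" and y: "y \<in> snd c ` fst c" and s: "s \<in> I" and \<theta>: "smooth_family E (s\<^sub>0-\<epsilon>) (s\<^sub>0+\<epsilon>) 1 \<theta>"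
  shows "P' \<theta> c (y, s) (v, 0) (w, 0) - P' \<theta> c (y, s) (w, 0) (v, 0) = d1 (loc1 E c (\<theta> s)) y v w"
proof -
  have z: "(y, s) \<in> Z c" using y s by simp
  have "frechet_derivative (\<lambda>y. loc1 E c (\<theta> s) y w) (at y) v = P' \<theta> c (y, s) (v, 0) (w, 0)" for v w
  proof -
    have 1: "((\<lambda>y. (y, s)) has_derivative (\<lambda>v. (v, 0))) (at y)"
      by (auto intro!: derivative_eq_intros)
    from has_derivative_compose[OF 1 P_has_derivative[OF c z \<theta>, of "(w, 0)"]]
    have "((\<lambda>y. loc1 E c (\<theta> s) y w) has_derivative (\<lambda>v. P' \<theta> c (y, s) (v, 0) (w, 0))) (at y)"
      by (simp add: P_def)
    from frechet_derivative_at[OF this, symmetric] show ?thesis by (simp only:)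
  qed
  then show ?thesis by (simp add: d1_def)
qed

lemma dsig_eq:
  assumes c: "c \<in> atlas E" and z: "z \<in> Z c"
  shows "frechet_derivative (\<lambda>z. sigl c z v w) (at z) u = dsig (snd z) (D (snd z)) (deriv D (snd z)) snd
    (P \<theta>1 c z) (P \<theta>2 c z) (A \<alpha>0 c z) (A \<alpha>1 c z) (A \<alpha>2 c z)
    (P' \<theta>1 c z) (P' \<theta>2 c z) (A' \<alpha>0 c z) (A' \<alpha>1 c z) (A' \<alpha>2 c z) u v w"
proof -
  have s: "snd z \<in> I" using z by auto
  have "D (snd z) \<noteq> 0" using D_pos[OF s] by simp
  moreover have "((\<lambda>z. D (snd z)) has_derivative (\<lambda>u. deriv D (snd z) * snd u)) (at z)"
    using DERIV_snd[OF g_derivative(4)[OF s]] by (simp only: mult.commute)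
  ultimately have "((\<lambda>z. sigl c z v w) has_derivative (\<lambda>u. dsig (snd z) (D (snd z)) (deriv D (snd z)) snd
    (P \<theta>1 c z) (P \<theta>2 c z) (A \<alpha>0 c z) (A \<alpha>1 c z) (A \<alpha>2 c z)
    (P' \<theta>1 c z) (P' \<theta>2 c z) (A' \<alpha>0 c z) (A' \<alpha>1 c z) (A' \<alpha>2 c z) u v w)) (at z)"
    unfolding sigl_def
    by (intro sig_has_derivative bounded_linear_imp_has_derivative[OF bounded_linear_snd]
        P_has_derivative[OF c z] A_has_derivative[OF c z] theta_smooth alpha_smooth)
  from frechet_derivative_at[OF this, symmetric] show ?thesis by (simp only:)
qed

lemma dpsim_eq:
  assumes c: "c \<in> atlas E" and z: "z \<in> Z c"
  shows "frechet_derivative (\<lambda>z. psiml c z v w r) (at z) u = dpsim (snd z) (D (snd z)) (deriv D (snd z))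
    (gUU (snd z)) (gUV (snd z)) (gVV (snd z)) (deriv gUU (snd z)) (deriv gUV (snd z)) (deriv gVV (snd z)) snd
    (P \<theta>1 c z) (P \<theta>2 c z) (A \<alpha>0 c z) (A \<alpha>1 c z) (A \<alpha>2 c z)
    (P' \<theta>1 c z) (P' \<theta>2 c z) (A' \<alpha>0 c z) (A' \<alpha>1 c z) (A' \<alpha>2 c z) u v w r"
proof -
  have s: "snd z \<in> I" using z by auto
  have "D (snd z) \<noteq> 0" using D_pos[OF s] by simp
  moreover have "((\<lambda>z. D (snd z)) has_derivative (\<lambda>u. deriv D (snd z) * snd u)) (at z)"
    "((\<lambda>z. gUU (snd z)) has_derivative (\<lambda>u. deriv gUU (snd z) * snd u)) (at z)"
    "((\<lambda>z. gUV (snd z)) has_derivative (\<lambda>u. deriv gUV (snd z) * snd u)) (at z)"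
    "((\<lambda>z. gVV (snd z)) has_derivative (\<lambda>u. deriv gVV (snd z) * snd u)) (at z)"
    using g_derivative[OF s, THEN DERIV_snd] by (simp_all only: mult.commute)
  ultimately have "((\<lambda>z. psiml c z v w r) has_derivative (\<lambda>u. dpsim (snd z) (D (snd z)) (deriv D (snd z))
    (gUU (snd z)) (gUV (snd z)) (gVV (snd z)) (deriv gUU (snd z)) (deriv gUV (snd z)) (deriv gVV (snd z)) snd
    (P \<theta>1 c z) (P \<theta>2 c z) (A \<alpha>0 c z) (A \<alpha>1 c z) (A \<alpha>2 c z)
    (P' \<theta>1 c z) (P' \<theta>2 c z) (A' \<alpha>0 c z) (A' \<alpha>1 c z) (A' \<alpha>2 c z) u v w r)) (at z)"
    unfolding psiml_def
    by (intro psim_has_derivative bounded_linear_imp_has_derivative[OF bounded_linear_snd]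
        P_has_derivative[OF c z] A_has_derivative[OF c z] theta_smooth alpha_smooth)
  from frechet_derivative_at[OF this, symmetric] show ?thesis by (simp only:)
qed

text \<open>Naming the instance at (p, s), with H the vectors tangent to E, allows chart and frame
  to be obtained existentially and the locale to be instantiated afterwards.\<close>

definition point_data where
  "point_data c U1 U2 V1 V2 V3 p s \<longleftrightarrow> nk_point (0, 1) (U1, 0) (U2, 0) (V1, 0) (V2, 0) (V3, 0) {w. snd w = 0} snd
    (P \<theta>1 c (snd c p, s)) (P \<theta>2 c (snd c p, s)) (A \<alpha>0 c (snd c p, s)) (A \<alpha>1 c (snd c p, s)) (A \<alpha>2 c (snd c p, s))
    (\<lambda>w. N1 c (snd c p) (fst w)) (\<lambda>w. N2 c (snd c p) (fst w)) (\<lambda>w. N3 c (snd c p) (fst w))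
    (P' \<theta>1 c (snd c p, s)) (P' \<theta>2 c (snd c p, s)) (A' \<alpha>0 c (snd c p, s)) (A' \<alpha>1 c (snd c p, s)) (A' \<alpha>2 c (snd c p, s))
    s (D s) (deriv D s) (gUU s) (gUV s) (gVV s) (deriv gUU s) (deriv gUV s) (deriv gVV s)
    (lc1 (\<alpha>0 s)) (lc2 (\<alpha>0 s)) (lc3 (\<alpha>0 s)) (lc1 (\<alpha>1 s)) (lc2 (\<alpha>1 s)) (lc3 (\<alpha>1 s)) (lc1 (\<alpha>2 s)) (lc2 (\<alpha>2 s)) (lc3 (\<alpha>2 s))
    (deriv (\<lambda>s. lc1 (\<alpha>0 s)) s) (deriv (\<lambda>s. lc2 (\<alpha>0 s)) s) (deriv (\<lambda>s. lc3 (\<alpha>0 s)) s)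
    (deriv (\<lambda>s. lc1 (\<alpha>1 s)) s) (deriv (\<lambda>s. lc2 (\<alpha>1 s)) s) (deriv (\<lambda>s. lc3 (\<alpha>1 s)) s)
    (deriv (\<lambda>s. lc1 (\<alpha>2 s)) s) (deriv (\<lambda>s. lc2 (\<alpha>2 s)) s) (deriv (\<lambda>s. lc3 (\<alpha>2 s)) s)"

text \<open>U1 and U2 come from \<open>vertical\<close> and serve all s. V1, V2, V3 come from
  \<open>frame\<close> and are horizontal for the connection at this s; nothing is claimed for them
  at other values of s.\<close>

lemma point:
  assumes p: "p \<in> points E" and s: "s \<in> I"
  obtains c U1 U2 V1 V2 V3 where "c \<in> atlas E" "p \<in> fst c" "point_data c U1 U2 V1 V2 V3 p s"
    "pushforward H3 \<pi> p (coord_vec E c p U1) = (\<lambda>u. 0)" "pushforward H3 \<pi> p (coord_vec E c p U2) = (\<lambda>u. 0)"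
proof -
  obtain c where c: "c \<in> atlas E" "p \<in> fst c"
    and eq1: "\<And>u v w. frechet_derivative (\<lambda>z. sigl c z v w) (at (snd c p, s)) u - frechet_derivative (\<lambda>z. sigl c z u w) (at (snd c p, s)) v
      + frechet_derivative (\<lambda>z. sigl c z u v) (at (snd c p, s)) w = 3 * psipl c (snd c p, s) u v w"
    and eq2: "\<And>u v w r. frechet_derivative (\<lambda>z. psiml c z v w r) (at (snd c p, s)) u - frechet_derivative (\<lambda>z. psiml c z u w r) (at (snd c p, s)) v
      + frechet_derivative (\<lambda>z. psiml c z u v r) (at (snd c p, s)) w - frechet_derivative (\<lambda>z. psiml c z u v w) (at (snd c p, s)) r
      = - 4 * (sigl c (snd c p, s) u v * sigl c (snd c p, s) w r - sigl c (snd c p, s) u w * sigl c (snd c p, s) v r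
         + sigl c (snd c p, s) u r * sigl c (snd c p, s) v w)"
    using local_equations[OF p s] by blast
  let ?y = "snd c p" let ?z = "(snd c p, s)" let ?X = "coord_vec E c p"
  have y: "?y \<in> snd c ` fst c" and inv: "chart_inv c ?y = p" using c by (auto simp: chart_inv_chart[OF charted_E])
  have z: "?z \<in> Z c" using y s by simp
  have range: "tangent_space E p = range ?X" by (rule tangent_space_eq[OF charted_E c])
  obtain u1 u2 where u: "u1 \<in> tangent_space E p" "u2 \<in> tangent_space E p"
    "pushforward H3 \<pi> p u1 = (\<lambda>u. 0)" "pushforward H3 \<pi> p u2 = (\<lambda>u. 0)"
    "\<And>s. s \<in> I \<Longrightarrow> \<theta>1 s p [u1] = 1" "\<And>s. s \<in> I \<Longrightarrow> \<theta>2 s p [u1] = 0"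
    "\<And>s. s \<in> I \<Longrightarrow> \<theta>1 s p [u2] = 0" "\<And>s. s \<in> I \<Longrightarrow> \<theta>2 s p [u2] = 1"
    using vertical[OF p] by blast
  obtain v1 v2 v3 where v: "v1 \<in> tangent_space E p" "v2 \<in> tangent_space E p" "v3 \<in> tangent_space E p"
    "\<theta>1 s p [v1] = 0" "\<theta>1 s p [v2] = 0" "\<theta>1 s p [v3] = 0" "\<theta>2 s p [v1] = 0" "\<theta>2 s p [v2] = 0" "\<theta>2 s p [v3] = 0"
    "eta1 \<pi> p v1 = 1" "eta1 \<pi> p v2 = 0" "eta1 \<pi> p v3 = 0"
    "eta2 \<pi> p v1 = 0" "eta2 \<pi> p v2 = 1" "eta2 \<pi> p v3 = 0"
    "eta3 \<pi> p v1 = 0" "eta3 \<pi> p v2 = 0" "eta3 \<pi> p v3 = 1"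
    using frame[OF p s] by blast
  obtain U1 U2 where U: "u1 = ?X U1" "u2 = ?X U2" using u(1,2) unfolding range by blast
  obtain V1 V2 V3 where V: "v1 = ?X V1" "v2 = ?X V2" "v3 = ?X V3" using v(1,2,3) unfolding range by blast
  have Pv: "P \<theta> c (?y, r) w = \<theta> r p [?X (fst w)]" for \<theta> r w by (simp add: P_def loc1_def inv)
  have Nv: "N1 c ?y w = eta1 \<pi> p (?X w)" "N2 c ?y w = eta2 \<pi> p (?X w)" "N3 c ?y w = eta3 \<pi> p (?X w)" for w
    by (simp_all add: N1_def N2_def N3_def inv)
  have N0: "N1 c y 0 = 0" "N2 c y 0 = 0" "N3 c y 0 = 0" if "y \<in> snd c ` fst c" for y
    using N_linear[OF c(1) that] by (simp_all add: linear_0)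
  have o: "open (snd c ` fst c)" by (rule charted_open[OF charted_E c(1)])
  have dN0: "frechet_derivative (\<lambda>y. N1 c y 0) (at ?y) w = 0" "frechet_derivative (\<lambda>y. N2 c y 0) (at ?y) w = 0"
    "frechet_derivative (\<lambda>y. N3 c y 0) (at ?y) w = 0" for w
    by (rule frechet_derivative_zero_on[OF o y], rule N0, assumption)+
  have dNe: "frechet_derivative (\<lambda>y. N1 c y w) (at ?y) 0 = 0" "frechet_derivative (\<lambda>y. N2 c y w) (at ?y) 0 = 0"
    "frechet_derivative (\<lambda>y. N3 c y w) (at ?y) 0 = 0" for w
    using eta_smooth[OF charted_E smooth_pi c(1), of w, folded N1_def N2_def N3_def]
    by (simp_all add: linear_0[OF has_derivative_linear[OF smooth_on_has_derivative[OF _ y]]])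
  have P0: "P \<theta>1 c z (0, r) = 0" "P \<theta>2 c z (0, r) = 0" if "z \<in> Z c" for z r
  proof -
    have "snd z \<in> I" "fst z \<in> snd c ` fst c" using that by auto
    from linear_0[OF loc1_linear[OF theta_form(1)[OF this(1)] charted_E c(1) this(2)]]
      linear_0[OF loc1_linear[OF theta_form(2)[OF this(1)] charted_E c(1) this(2)]]
    show "P \<theta>1 c z (0, r) = 0" "P \<theta>2 c z (0, r) = 0" by (simp_all add: P_def)
  qed
  have P'e: "P' \<theta>1 c ?z w (0, r) = 0" "P' \<theta>2 c ?z w (0, r) = 0" for w r
    unfolding P'_def by (rule frechet_derivative_zero_on[OF open_Z[OF c(1)] z], rule P0, assumption)+
  \<comment> \<open>\<theta> takes the same value k on a vertical vector for all s, so its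
    s-derivative there is zero.\<close>
  have P'U: "P' \<theta> c ?z (0, 1) (w, 0) = 0"
    if "smooth_family E (s\<^sub>0-\<epsilon>) (s\<^sub>0+\<epsilon>) 1 \<theta>" "\<And>s. s \<in> I \<Longrightarrow> \<theta> s p [?X w] = k" for \<theta> w k
  proof -
    have "((\<lambda>s. k) has_real_derivative P' \<theta> c ?z (0, 1) (w, 0)) (at s)"
      by (rule has_field_derivative_transform_within_open[OF P'_time[OF c(1) y s that(1)], where S=I])
        (use s that(2) in \<open>auto simp: Pv\<close>)
    from DERIV_unique[OF this DERIV_const] show ?thesis .
  qed
  note eq1' = eq1[unfolded dsig_eq[OF c(1) z] psipl_def, unfolded snd_conv]
  note eq2' = eq2[unfolded dpsim_eq[OF c(1) z] sigl_def, unfolded snd_conv]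
  have "point_data c U1 U2 V1 V2 V3 p s"
    unfolding point_data_def
  proof (rule nk_point.intro)
    show "s > 0" "D s > 0" using s_pos D_pos s by auto
    show "P \<theta>1 c ?z (0, 1) = 0" "P \<theta>2 c ?z (0, 1) = 0" using P0[OF z] by auto
    show "P \<theta>1 c ?z (U1, 0) = 1" "P \<theta>1 c ?z (U2, 0) = 0" "P \<theta>2 c ?z (U1, 0) = 0" "P \<theta>2 c ?z (U2, 0) = 1"
      using u(5-8)[OF s] by (simp_all add: Pv U)
    show "P \<theta>1 c ?z (V1, 0) = 0" "P \<theta>1 c ?z (V2, 0) = 0" "P \<theta>1 c ?z (V3, 0) = 0"
      "P \<theta>2 c ?z (V1, 0) = 0" "P \<theta>2 c ?z (V2, 0) = 0" "P \<theta>2 c ?z (V3, 0) = 0"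
      using v(4-9) by (simp_all add: Pv V)
    show "N1 c ?y (fst (U1, 0::real)) = 0" "N2 c ?y (fst (U1, 0::real)) = 0" "N3 c ?y (fst (U1, 0::real)) = 0"
      "N1 c ?y (fst (U2, 0::real)) = 0" "N2 c ?y (fst (U2, 0::real)) = 0" "N3 c ?y (fst (U2, 0::real)) = 0"
      using eta_zero[OF u(3)] eta_zero[OF u(4)] by (simp_all add: Nv U)
    show "N1 c ?y (fst (V1, 0::real)) = 1" "N1 c ?y (fst (V2, 0::real)) = 0" "N1 c ?y (fst (V3, 0::real)) = 0"
      "N2 c ?y (fst (V1, 0::real)) = 0" "N2 c ?y (fst (V2, 0::real)) = 1" "N2 c ?y (fst (V3, 0::real)) = 0"
      "N3 c ?y (fst (V1, 0::real)) = 0" "N3 c ?y (fst (V2, 0::real)) = 0" "N3 c ?y (fst (V3, 0::real)) = 1"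
      using v(10-18) by (simp_all add: Nv V)
    show "N1 c ?y (fst (0, 1::real)) = 0" "N2 c ?y (fst (0, 1::real)) = 0" "N3 c ?y (fst (0, 1::real)) = 0"
      using N0[OF y] by simp_all
    show "P' \<theta>1 c ?z w (0, 1) = 0" "P' \<theta>2 c ?z w (0, 1) = 0" for w by (rule P'e)+
    show "P' \<theta>1 c ?z (0, 1) (U1, 0) = 0" "P' \<theta>1 c ?z (0, 1) (U2, 0) = 0"
      "P' \<theta>2 c ?z (0, 1) (U1, 0) = 0" "P' \<theta>2 c ?z (0, 1) (U2, 0) = 0"
      using P'U[OF theta_smooth(1) u(5)[unfolded U]] P'U[OF theta_smooth(1) u(7)[unfolded U]]
        P'U[OF theta_smooth(2) u(6)[unfolded U]] P'U[OF theta_smooth(2) u(8)[unfolded U]] by auto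
    fix v w :: "(real^5) \<times> real"
    show "A \<alpha>0 c ?z v = lc1 (\<alpha>0 s) * N1 c ?y (fst v) + lc2 (\<alpha>0 s) * N2 c ?y (fst v) + lc3 (\<alpha>0 s) * N3 c ?y (fst v)"
      "A \<alpha>1 c ?z v = lc1 (\<alpha>1 s) * N1 c ?y (fst v) + lc2 (\<alpha>1 s) * N2 c ?y (fst v) + lc3 (\<alpha>1 s) * N3 c ?y (fst v)"
      "A \<alpha>2 c ?z v = lc1 (\<alpha>2 s) * N1 c ?y (fst v) + lc2 (\<alpha>2 s) * N2 c ?y (fst v) + lc3 (\<alpha>2 s) * N3 c ?y (fst v)"
      by (simp_all add: A_eq)
    show "A' \<alpha>0 c ?z (0, 1) v = deriv (\<lambda>s. lc1 (\<alpha>0 s)) s * N1 c ?y (fst v) + deriv (\<lambda>s. lc2 (\<alpha>0 s)) s * N2 c ?y (fst v) + deriv (\<lambda>s. lc3 (\<alpha>0 s)) s * N3 c ?y (fst v)"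
      "A' \<alpha>1 c ?z (0, 1) v = deriv (\<lambda>s. lc1 (\<alpha>1 s)) s * N1 c ?y (fst v) + deriv (\<lambda>s. lc2 (\<alpha>1 s)) s * N2 c ?y (fst v) + deriv (\<lambda>s. lc3 (\<alpha>1 s)) s * N3 c ?y (fst v)"
      "A' \<alpha>2 c ?z (0, 1) v = deriv (\<lambda>s. lc1 (\<alpha>2 s)) s * N1 c ?y (fst v) + deriv (\<lambda>s. lc2 (\<alpha>2 s)) s * N2 c ?y (fst v) + deriv (\<lambda>s. lc3 (\<alpha>2 s)) s * N3 c ?y (fst v)"
      by (simp_all add: A'_def dNe)
    show "A' \<alpha>0 c ?z v (0, 1) = 0" "A' \<alpha>1 c ?z v (0, 1) = 0" "A' \<alpha>2 c ?z v (0, 1) = 0"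
      by (simp_all add: A'_def dN0 N0[OF y])
    assume vw: "v \<in> {w. snd w = 0}" "w \<in> {w. snd w = 0}"
    have dA: "A' \<alpha> c ?z v w = A' \<alpha> c ?z w v - lc3 (\<alpha> s) * W2 (\<lambda>w. N1 c ?y (fst w)) (\<lambda>w. N2 c ?y (fst w)) v w" for \<alpha>
      using vw by (simp add: A'_def W2_def dN[OF c(1) y, of "fst w" "fst v"] algebra_simps)
    show "A' \<alpha>0 c ?z v w = A' \<alpha>0 c ?z w v - lc3 (\<alpha>0 s) * W2 (\<lambda>w. N1 c ?y (fst w)) (\<lambda>w. N2 c ?y (fst w)) v w"
      "A' \<alpha>1 c ?z v w = A' \<alpha>1 c ?z w v - lc3 (\<alpha>1 s) * W2 (\<lambda>w. N1 c ?y (fst w)) (\<lambda>w. N2 c ?y (fst w)) v w"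
      "A' \<alpha>2 c ?z v w = A' \<alpha>2 c ?z w v - lc3 (\<alpha>2 s) * W2 (\<lambda>w. N1 c ?y (fst w)) (\<lambda>w. N2 c ?y (fst w)) v w"
      by (rule dA)+
  qed (rule eq1' eq2' | simp)+
  from that[OF c this u(3,4)[unfolded U]] show ?thesis .
qed

end

lemma d1_zero_left:
  assumes N: "charted N" and \<omega>: "diff_form N 1 \<omega>" and c: "c \<in> atlas N" and y: "y \<in> snd c ` fst c"
  shows "d1 (loc1 N c \<omega>) y 0 w = 0"
proof -
  have "frechet_derivative (\<lambda>y. loc1 N c \<omega> y w) (at y) 0 = 0"
    by (rule linear_0[OF has_derivative_linear[OF smooth_on_has_derivative[OF loc1_smooth[OF \<omega> c] y]]])
  moreover have "frechet_derivative (\<lambda>y. loc1 N c \<omega> y 0) (at y) w = 0"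
    by (rule frechet_derivative_zero_on[OF charted_open[OF N c] y]) (rule linear_0[OF loc1_linear[OF \<omega> N c]])
  ultimately show ?thesis by (simp add: d1_def)
qed

text \<open>Vertical vectors of E are pushed forward to the zero vector of H3; this is what makes a
  pulled-back exterior derivative horizontal.\<close>

lemma ext_deriv1_zero:
  assumes N: "charted N" and \<omega>: "diff_form N 1 \<omega>" and p: "p \<in> points N" and Y: "Y \<in> tangent_space N p"
  shows "ext_deriv N \<omega> p [\<lambda>u. 0, Y] = 0"
proof -
  obtain c where c: "c \<in> atlas N" "p \<in> fst c" using charted_ex_chart[OF N p] by blast
  then obtain w where "Y = coord_vec N c p w" using Y tangent_space_eq[OF N c] by blast
  then show ?thesis
    using ext_deriv1[OF N \<omega> c, of 0 w] d1_zero_left[OF N \<omega> c(1)] c(2) by (simp add: coord_vec_zero[OF c])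
qed

text \<open>\<open>left_invariant_basis\<close> is formulated by unique expansions. A singular
  coefficient matrix would give the zero form a second, nontrivial expansion.\<close>

lemma left_invariant_basis_det:
  assumes "left_invariant_basis b0 b1 b2"
  shows "lc1 b0 * (lc2 b1 * lc3 b2 - lc3 b1 * lc2 b2) - lc2 b0 * (lc1 b1 * lc3 b2 - lc3 b1 * lc1 b2)
    + lc3 b0 * (lc1 b1 * lc2 b2 - lc2 b1 * lc1 b2) \<noteq> 0"
proof
  assume det0: "lc1 b0 * (lc2 b1 * lc3 b2 - lc3 b1 * lc2 b2) - lc2 b0 * (lc1 b1 * lc3 b2 - lc3 b1 * lc1 b2)
    + lc3 b0 * (lc1 b1 * lc2 b2 - lc2 b1 * lc1 b2) = 0"
  have b: "left_invariant b0" "left_invariant b1" "left_invariant b2"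
    and ex1: "\<And>\<omega>. left_invariant \<omega> \<Longrightarrow> \<exists>!c::real^3. field_eq H3 \<omega> (\<lambda>p. c$1 \<odot> b0 p + c$2 \<odot> b1 p + c$3 \<odot> b2 p)"
    using assms by (auto simp: left_invariant_basis_def)
  let ?A = "vector [vector [lc1 b0, lc1 b1, lc1 b2], vector [lc2 b0, lc2 b1, lc2 b2], vector [lc3 b0, lc3 b1, lc3 b2]] :: real^3^3"
  have "det ?A = 0" using det0 by (simp add: det_3 algebra_simps)
  then have "\<not> (\<exists>B. B ** ?A = mat 1)" using invertible_det_nz invertible_left_inverse by metis
  then obtain x where x: "x \<noteq> 0" "?A *v x = 0" unfolding matrix_left_invertible_ker by blast
  then have k: "lc1 b0 * x$1 + lc1 b1 * x$2 + lc1 b2 * x$3 = 0" "lc2 b0 * x$1 + lc2 b1 * x$2 + lc2 b2 * x$3 = 0"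
    "lc3 b0 * x$1 + lc3 b1 * x$2 + lc3 b2 * x$3 = 0"
    by (simp_all add: vec_eq_iff forall_3 matrix_vector_mult_def sum_3)
  let ?o = "\<lambda>p Xs. 0 :: real"
  have zero: "left_invariant ?o"
    by (auto simp: left_invariant_def diff_form_def tensor_field_def multilinear_on_def smooth_on_const field_eq_def pullback_def)
  have "field_eq H3 ?o (\<lambda>p. x$1 \<odot> b0 p + x$2 \<odot> b1 p + x$3 \<odot> b2 p)"
    unfolding field_eq_def
  proof (intro ballI)
    fix p Xs assume p: "p \<in> points H3" and Xs: "Xs \<in> lists (tangent_space H3 p)"
    have "x$1 * b0 p Xs + x$2 * b1 p Xs + x$3 * b2 p Xs = 0"
    proof (cases "length Xs = 1")
      case True
      then obtain X where X: "Xs = [X]" "X \<in> tangent_space H3 p" using Xs by (cases Xs) auto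
      obtain a b' c v1 v2 v3 where *: "p = heis a b' c" "X = H3_vec (heis a b' c) (v1, v2, v3)"
        using tangent_H3_cases[OF X(2)] p unfolding points_H3 by metis
      have "x$1 * b0 p Xs + x$2 * b1 p Xs + x$3 * b2 p Xs =
        (lc1 b0 * x$1 + lc1 b1 * x$2 + lc1 b2 * x$3) * v1 + (lc2 b0 * x$1 + lc2 b1 * x$2 + lc2 b2 * x$3) * v3
        + (lc3 b0 * x$1 + lc3 b1 * x$2 + lc3 b2 * x$3) * (v2 - a * v3)"
        by (simp add: X(1) * left_invariant_value[OF b(1)] left_invariant_value[OF b(2)] left_invariant_value[OF b(3)] algebra_simps)
      then show ?thesis by (simp only: k)
    next
      case False
      then have "b0 p Xs = 0" "b1 p Xs = 0" "b2 p Xs = 0"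
        using b[THEN left_invariant_diff_form] diff_form_multilinear[OF _ p] Xs
        by (auto simp: multilinear_on_def)
      then show ?thesis by simp
    qed
    then show "0 = (x$1 \<odot> b0 p + x$2 \<odot> b1 p + x$3 \<odot> b2 p) Xs" by (simp add: scale_apply)
  qed
  moreover have "field_eq H3 ?o (\<lambda>p. (0::real^3)$1 \<odot> b0 p + (0::real^3)$2 \<odot> b1 p + (0::real^3)$3 \<odot> b2 p)"
    by (simp add: field_eq_def scale_apply)
  ultimately show False using ex1[OF zero] x(1) by blast
qed

section \<open>Evolution of the connection forms and persistence of horizontal curvature\<close>

context nearly_Kaehler_over_H3
begin

text \<open>The coefficients of the s-derivatives of the connection forms, read off from \<open>P1'_e\<close> and \<open>P2'_e\<close>.\<close>

definition k1 where "k1 \<alpha> s = (deriv (\<lambda>s. lc1 (\<alpha> s)) s + s / D s * lc1 (\<alpha> s)) / s" for \<alpha> :: "real \<Rightarrow> (real^3^3) field"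
definition k2 where "k2 \<alpha> s = (deriv (\<lambda>s. lc2 (\<alpha> s)) s + s / D s * lc2 (\<alpha> s)) / s" for \<alpha> :: "real \<Rightarrow> (real^3^3) field"
definition k3 where "k3 \<alpha> s = (deriv (\<lambda>s. lc3 (\<alpha> s)) s + s / D s * lc3 (\<alpha> s)) / s" for \<alpha> :: "real \<Rightarrow> (real^3^3) field"

text \<open>Follows from \<open>P1'_e\<close> and \<open>P2'_e\<close>, which are available before
  horizontality is. The coefficients depend on s alone, and this makes the difference of two
  connections of the family a combination of \<open>eta1\<close>, \<open>eta2\<close>,
  \<open>eta3\<close> with coefficients that are constant on E.\<close>

lemma theta_evolution:
  assumes p: "p \<in> points E" and s: "s \<in> I" and X: "X \<in> tangent_space E p"
  shows "((\<lambda>s. \<theta>1 s p [X]) has_real_derivative k1 \<alpha>1 s * eta1 \<pi> p X + k2 \<alpha>1 s * eta2 \<pi> p X + k3 \<alpha>1 s * eta3 \<pi> p X) (at s)"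
    "((\<lambda>s. \<theta>2 s p [X]) has_real_derivative k1 \<alpha>2 s * eta1 \<pi> p X + k2 \<alpha>2 s * eta2 \<pi> p X + k3 \<alpha>2 s * eta3 \<pi> p X) (at s)"
proof -
  obtain c U1 U2 V1 V2 V3 where c: "c \<in> atlas E" "p \<in> fst c" and pd: "point_data c U1 U2 V1 V2 V3 p s"
    using point[OF p s] by metis
  interpret np: nk_point "(0, 1)" "(U1, 0)" "(U2, 0)" "(V1, 0)" "(V2, 0)" "(V3, 0)" "{w. snd w = 0}" snd
    "P \<theta>1 c (snd c p, s)" "P \<theta>2 c (snd c p, s)" "A \<alpha>0 c (snd c p, s)" "A \<alpha>1 c (snd c p, s)" "A \<alpha>2 c (snd c p, s)"
    "\<lambda>w. N1 c (snd c p) (fst w)" "\<lambda>w. N2 c (snd c p) (fst w)" "\<lambda>w. N3 c (snd c p) (fst w)"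
    "P' \<theta>1 c (snd c p, s)" "P' \<theta>2 c (snd c p, s)" "A' \<alpha>0 c (snd c p, s)" "A' \<alpha>1 c (snd c p, s)" "A' \<alpha>2 c (snd c p, s)"
    s "D s" "deriv D s" "gUU s" "gUV s" "gVV s" "deriv gUU s" "deriv gUV s" "deriv gVV s"
    "lc1 (\<alpha>0 s)" "lc2 (\<alpha>0 s)" "lc3 (\<alpha>0 s)" "lc1 (\<alpha>1 s)" "lc2 (\<alpha>1 s)" "lc3 (\<alpha>1 s)" "lc1 (\<alpha>2 s)" "lc2 (\<alpha>2 s)" "lc3 (\<alpha>2 s)"
    "deriv (\<lambda>s. lc1 (\<alpha>0 s)) s" "deriv (\<lambda>s. lc2 (\<alpha>0 s)) s" "deriv (\<lambda>s. lc3 (\<alpha>0 s)) s"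
    "deriv (\<lambda>s. lc1 (\<alpha>1 s)) s" "deriv (\<lambda>s. lc2 (\<alpha>1 s)) s" "deriv (\<lambda>s. lc3 (\<alpha>1 s)) s"
    "deriv (\<lambda>s. lc1 (\<alpha>2 s)) s" "deriv (\<lambda>s. lc2 (\<alpha>2 s)) s" "deriv (\<lambda>s. lc3 (\<alpha>2 s)) s"
    using pd unfolding point_data_def .
  obtain v where X: "X = coord_vec E c p v" using X tangent_space_eq[OF charted_E c] by blast
  have y: "snd c p \<in> snd c ` fst c" and inv: "chart_inv c (snd c p) = p" using c by (auto simp: chart_inv_chart[OF charted_E])
  have Pv: "P \<theta> c (snd c p, r) (v, 0) = \<theta> r p [X]" for \<theta> r by (simp add: P_def loc1_def inv X)
  have Nv: "N1 c (snd c p) v = eta1 \<pi> p X" "N2 c (snd c p) v = eta2 \<pi> p X" "N3 c (snd c p) v = eta3 \<pi> p X"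
    by (simp_all add: N1_def N2_def N3_def inv X)
  have vH: "(v, 0) \<in> {w. snd w = 0}" by simp
  have sk: "s * k1 \<alpha> s = deriv (\<lambda>s. lc1 (\<alpha> s)) s + s / D s * lc1 (\<alpha> s)" "s * k2 \<alpha> s = deriv (\<lambda>s. lc2 (\<alpha> s)) s + s / D s * lc2 (\<alpha> s)"
    "s * k3 \<alpha> s = deriv (\<lambda>s. lc3 (\<alpha> s)) s + s / D s * lc3 (\<alpha> s)" for \<alpha>
    using s_pos[OF s] by (simp_all add: k1_def k2_def k3_def)
  have cancel: "P' = k1 \<alpha> s * eta1 \<pi> p X + k2 \<alpha> s * eta2 \<pi> p X + k3 \<alpha> s * eta3 \<pi> p X"
    if "s * P' = deriv (\<lambda>s. lc1 (\<alpha> s)) s * N1 c (snd c p) (fst (v, 0::real)) + deriv (\<lambda>s. lc2 (\<alpha> s)) s * N2 c (snd c p) (fst (v, 0::real))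
        + deriv (\<lambda>s. lc3 (\<alpha> s)) s * N3 c (snd c p) (fst (v, 0::real))
      + s / D s * (lc1 (\<alpha> (snd (snd c p, s))) * N1 c (fst (snd c p, s)) (fst (v, 0::real)) + lc2 (\<alpha> (snd (snd c p, s))) * N2 c (fst (snd c p, s)) (fst (v, 0::real))
        + lc3 (\<alpha> (snd (snd c p, s))) * N3 c (fst (snd c p, s)) (fst (v, 0::real)))" for \<alpha> P'
  proof -
    have "s * (k1 \<alpha> s * eta1 \<pi> p X + k2 \<alpha> s * eta2 \<pi> p X + k3 \<alpha> s * eta3 \<pi> p X) =
      (s * k1 \<alpha> s) * eta1 \<pi> p X + (s * k2 \<alpha> s) * eta2 \<pi> p X + (s * k3 \<alpha> s) * eta3 \<pi> p X"
      by (simp only: distrib_left mult.assoc)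
    also have "\<dots> = s * P'" unfolding that fst_conv snd_conv Nv sk by (simp only: ring_distribs mult.assoc ac_simps)
    finally show ?thesis using s_pos[OF s] by simp
  qed
  have "P' \<theta>1 c (snd c p, s) (0, 1) (v, 0) = k1 \<alpha>1 s * eta1 \<pi> p X + k2 \<alpha>1 s * eta2 \<pi> p X + k3 \<alpha>1 s * eta3 \<pi> p X"
    by (rule cancel[OF np.P1'_e[OF vH, unfolded np.A' A_eq]])
  then show "((\<lambda>s. \<theta>1 s p [X]) has_real_derivative k1 \<alpha>1 s * eta1 \<pi> p X + k2 \<alpha>1 s * eta2 \<pi> p X + k3 \<alpha>1 s * eta3 \<pi> p X) (at s)"
    using P'_time[OF c(1) y s theta_smooth(1), of "(v, 0)"] by (simp add: Pv)
  have "P' \<theta>2 c (snd c p, s) (0, 1) (v, 0) = k1 \<alpha>2 s * eta1 \<pi> p X + k2 \<alpha>2 s * eta2 \<pi> p X + k3 \<alpha>2 s * eta3 \<pi> p X"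
    by (rule cancel[OF np.P2'_e[OF vH, unfolded np.A' A_eq]])
  then show "((\<lambda>s. \<theta>2 s p [X]) has_real_derivative k1 \<alpha>2 s * eta1 \<pi> p X + k2 \<alpha>2 s * eta2 \<pi> p X + k3 \<alpha>2 s * eta3 \<pi> p X) (at s)"
    using P'_time[OF c(1) y s theta_smooth(2), of "(v, 0)"] by (simp add: Pv)
qed

lemma constant_on_I:
  assumes "\<And>s. s \<in> I \<Longrightarrow> (f has_real_derivative 0) (at s)" "s \<in> I" "r \<in> I"
  shows "f s = f r"
proof -
  have "\<exists>c. \<forall>x\<in>I. f x = c"
    by (rule has_field_derivative_zero_constant) (use assms(1) in \<open>auto intro: has_field_derivative_at_within\<close>)
  then show ?thesis using assms(2,3) by metis
qed

text \<open>The coefficient functions are read off at one point p0 on a frame rather than obtained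
  by integrating \<open>k1\<close>, \<open>k2\<close>, \<open>k3\<close>. What \<theta> has on X
  beyond the matching combination of its values at p0 has derivative zero in s. If \<alpha> has no
  third coefficient on the interval, then \<open>k3\<close> vanishes and with it n3.\<close>

lemma theta_difference:
  assumes p0: "p0 \<in> points E"
    and ev: "\<And>p s X. p \<in> points E \<Longrightarrow> s \<in> I \<Longrightarrow> X \<in> tangent_space E p \<Longrightarrow>
      ((\<lambda>s. \<theta> s p [X]) has_real_derivative k1 \<alpha> s * eta1 \<pi> p X + k2 \<alpha> s * eta2 \<pi> p X + k3 \<alpha> s * eta3 \<pi> p X) (at s)"
  shows "\<exists>n1 n2 n3. (\<forall>p\<in>points E. \<forall>s\<in>I. \<forall>X\<in>tangent_space E p.
      \<theta> s p [X] = \<theta> s\<^sub>0 p [X] + n1 s * eta1 \<pi> p X + n2 s * eta2 \<pi> p X + n3 s * eta3 \<pi> p X) \<and>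
    ((\<forall>s\<in>I. lc3 (\<alpha> s) = 0) \<longrightarrow> (\<forall>s\<in>I. n3 s = 0))"
proof -
  obtain v1 v2 v3 where v: "v1 \<in> tangent_space E p0" "v2 \<in> tangent_space E p0" "v3 \<in> tangent_space E p0"
    "eta1 \<pi> p0 v1 = 1" "eta1 \<pi> p0 v2 = 0" "eta1 \<pi> p0 v3 = 0"
    "eta2 \<pi> p0 v1 = 0" "eta2 \<pi> p0 v2 = 1" "eta2 \<pi> p0 v3 = 0"
    "eta3 \<pi> p0 v1 = 0" "eta3 \<pi> p0 v2 = 0" "eta3 \<pi> p0 v3 = 1"
    using frame[OF p0 s0_in] by metis
  let ?n = "\<lambda>v s. \<theta> s p0 [v] - \<theta> s\<^sub>0 p0 [v]"
  note d1 = ev[OF p0 _ v(1)] and d2 = ev[OF p0 _ v(2)] and d3 = ev[OF p0 _ v(3)]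
  show ?thesis
  proof (rule exI[of _ "?n v1"], rule exI[of _ "?n v2"], rule exI[of _ "?n v3"], intro conjI ballI impI)
    fix p s X assume p: "p \<in> points E" and s: "s \<in> I" and X: "X \<in> tangent_space E p"
    let ?f = "\<lambda>s. \<theta> s p [X] - (eta1 \<pi> p X * \<theta> s p0 [v1] + eta2 \<pi> p X * \<theta> s p0 [v2] + eta3 \<pi> p X * \<theta> s p0 [v3])"
    have "?f s = ?f s\<^sub>0"
    proof (rule constant_on_I[OF _ s s0_in])
      fix s assume s: "s \<in> I"
      have "(?f has_real_derivative (k1 \<alpha> s * eta1 \<pi> p X + k2 \<alpha> s * eta2 \<pi> p X + k3 \<alpha> s * eta3 \<pi> p X)
        - (eta1 \<pi> p X * (k1 \<alpha> s * eta1 \<pi> p0 v1 + k2 \<alpha> s * eta2 \<pi> p0 v1 + k3 \<alpha> s * eta3 \<pi> p0 v1)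
         + eta2 \<pi> p X * (k1 \<alpha> s * eta1 \<pi> p0 v2 + k2 \<alpha> s * eta2 \<pi> p0 v2 + k3 \<alpha> s * eta3 \<pi> p0 v2)
         + eta3 \<pi> p X * (k1 \<alpha> s * eta1 \<pi> p0 v3 + k2 \<alpha> s * eta2 \<pi> p0 v3 + k3 \<alpha> s * eta3 \<pi> p0 v3))) (at s)"
        by (intro DERIV_diff DERIV_add DERIV_cmult ev[OF p s X] d1[OF s] d2[OF s] d3[OF s])
      then show "(?f has_real_derivative 0) (at s)" by (simp add: v algebra_simps)
    qed
    then show "\<theta> s p [X] = \<theta> s\<^sub>0 p [X] + ?n v1 s * eta1 \<pi> p X + ?n v2 s * eta2 \<pi> p X + ?n v3 s * eta3 \<pi> p X"
      by (simp add: algebra_simps)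
  next
    fix s assume lc3': "\<forall>s\<in>I. lc3 (\<alpha> s) = 0" and s: "s \<in> I"
    have lc3: "\<And>s. s \<in> I \<Longrightarrow> lc3 (\<alpha> s) = 0" using lc3' by blast
    have "deriv (\<lambda>s. lc3 (\<alpha> s)) s = 0" if "s \<in> I" for s
    proof -
      have "((\<lambda>s. lc3 (\<alpha> s)) has_real_derivative 0) (at s)"
        by (rule has_field_derivative_transform_within_open[OF DERIV_const[of 0], where S=I]) (use lc3 that in auto)
      then show ?thesis by (rule DERIV_imp_deriv)
    qed
    then have "((\<lambda>s. \<theta> s p0 [v3]) has_real_derivative 0) (at s)" if "s \<in> I" for s
      using d3[OF that] lc3[OF that] that by (simp add: v k3_def)
    from constant_on_I[OF this s s0_in] show "?n v3 s = 0" by simp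
  qed
qed

text \<open>The right sides of the initial equations are pulled back from H3, so they vanish as soon
  as one argument is pushed forward to zero.\<close>

lemma theta_initial_horizontal:
  assumes p: "p \<in> points E" and X: "X \<in> tangent_space E p" "pushforward H3 \<pi> p X = (\<lambda>u. 0)" and Y: "Y \<in> tangent_space E p"
  shows "ext_deriv E (\<theta>1 s\<^sub>0) p [X, Y] = 0" "ext_deriv E (\<theta>2 s\<^sub>0) p [X, Y] = 0"
proof -
  let ?Y = "pushforward H3 \<pi> p Y" and ?T = "tangent_space H3 (\<pi> p)" and ?o = "(\<lambda>u. 0) :: (real^3^3) tvec"
  have \<pi>p: "\<pi> p \<in> points H3" by (rule smooth_map_in_points[OF smooth_pi p])
  have Y': "?Y \<in> ?T" by (rule pushforward_in_tangent_space[OF charted_E charted_H3 smooth_pi p Y])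
  have o: "?o \<in> ?T" using pushforward_in_tangent_space[OF charted_E charted_H3 smooth_pi p X(1)] X(2) by simp
  have l: "[X, Y] \<in> lists (tangent_space E p)" using X Y by simp
  note f = alpha_invariant[OF s0_in, THEN left_invariant_diff_form]
  have od: "of_degree ?T 1 (\<alpha>0 s\<^sub>0 (\<pi> p))" "of_degree ?T 1 (\<alpha>1 s\<^sub>0 (\<pi> p))" "of_degree ?T 1 (\<alpha>2 s\<^sub>0 (\<pi> p))"
    using diff_form_multilinear[OF f(1) \<pi>p] diff_form_multilinear[OF f(2) \<pi>p] diff_form_multilinear[OF f(3) \<pi>p]
    by (auto intro: multilinear_on_of_degree)
  have z: "\<omega> (\<pi> p) [?o] = 0" if "diff_form H3 1 \<omega>" for \<omega>
    using multilinear_on_lin_comb1[OF diff_form_multilinear[OF that \<pi>p] o o, of 0 0] by (simp add: lin_comb_def)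
  have w: "((a \<odot> \<alpha>1 s\<^sub>0 (\<pi> p) + b \<odot> \<alpha>2 s\<^sub>0 (\<pi> p)) \<^bold>\<and> \<alpha>0 s\<^sub>0 (\<pi> p)) [?o, ?Y] = 0" for a b
    using wedge_2[OF of_degree_add[OF of_degree_scale[OF od(2)] of_degree_scale[OF od(3)]] od(1) o Y', of a b]
    by (simp add: scale_apply z[OF f(1)] z[OF f(2)] z[OF f(3)])
  have d: "ext_deriv H3 (\<alpha>1 s\<^sub>0) (\<pi> p) [?o, ?Y] = 0" "ext_deriv H3 (\<alpha>2 s\<^sub>0) (\<pi> p) [?o, ?Y] = 0"
    by (rule ext_deriv1_zero[OF charted_H3 f(2) \<pi>p Y'], rule ext_deriv1_zero[OF charted_H3 f(3) \<pi>p Y'])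
  have "s\<^sub>0 \<noteq> 0" using s_pos[OF s0_in] by simp
  then show "ext_deriv E (\<theta>1 s\<^sub>0) p [X, Y] = 0" "ext_deriv E (\<theta>2 s\<^sub>0) p [X, Y] = 0"
    using initial_theta[unfolded field_eq_def, THEN bspec, OF p, THEN bspec, OF l]
    by (simp_all add: pullback_def scale_apply X(2) d w)
qed

text \<open>In the difference of the connections the terms with \<open>eta1\<close> and
  \<open>eta2\<close> are closed, and the differential of \<open>eta3\<close> is minus the wedge
  product of these two, so only n3 contributes.\<close>

lemma theta_ext_deriv:
  assumes ev: "\<forall>p\<in>points E. \<forall>s\<in>I. \<forall>X\<in>tangent_space E p.
      \<theta> s p [X] = \<theta> s\<^sub>0 p [X] + n1 s * eta1 \<pi> p X + n2 s * eta2 \<pi> p X + n3 s * eta3 \<pi> p X"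
    and form': "\<forall>s\<in>I. diff_form E 1 (\<theta> s)"
    and c: "c \<in> atlas E" "p \<in> fst c" and s: "s \<in> I"
  shows "d1 (loc1 E c (\<theta> s)) (snd c p) v w =
    ext_deriv E (\<theta> s\<^sub>0) p [coord_vec E c p v, coord_vec E c p w] - n3 s * W2 (N1 c (snd c p)) (N2 c (snd c p)) v w"
proof -
  have form: "diff_form E 1 (\<theta> s)" if "s \<in> I" for s using form' that by blast
  let ?S = "snd c ` fst c" and ?y = "snd c p"
  have o: "open ?S" by (rule charted_open[OF charted_E c(1)])
  have y: "?y \<in> ?S" using c by simp
  have eq: "loc1 E c (\<theta> s) y v = loc1 E c (\<theta> s\<^sub>0) y v + n1 s * N1 c y v + n2 s * N2 c y v + n3 s * N3 c y v"
    if "y \<in> ?S" for y v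
  proof -
    have "chart_inv c y \<in> fst c" using that by (auto simp: chart_inv_chart[OF charted_E c(1)])
    then show ?thesis
      using ev[rule_format, OF charted_in_points[OF charted_E c(1)] s coord_vec_in_tangent_space[OF c(1)]]
      by (simp add: loc1_def N1_def N2_def N3_def)
  qed
  note D0 = smooth_on_has_derivative[OF loc1_smooth[OF form[OF s0_in] c(1)] y]
  note DN = smooth_on_has_derivative[OF eta_smooth(1)[OF charted_E smooth_pi c(1), folded N1_def] y]
    smooth_on_has_derivative[OF eta_smooth(2)[OF charted_E smooth_pi c(1), folded N2_def] y]
    smooth_on_has_derivative[OF eta_smooth(3)[OF charted_E smooth_pi c(1), folded N3_def] y]
  have fd: "frechet_derivative (\<lambda>y. loc1 E c (\<theta> s) y v) (at ?y) w =
      frechet_derivative (\<lambda>y. loc1 E c (\<theta> s\<^sub>0) y v) (at ?y) w + n1 s * frechet_derivative (\<lambda>y. N1 c y v) (at ?y) w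
      + n2 s * frechet_derivative (\<lambda>y. N2 c y v) (at ?y) w + n3 s * frechet_derivative (\<lambda>y. N3 c y v) (at ?y) w" for v w
  proof -
    have "frechet_derivative (\<lambda>y. loc1 E c (\<theta> s) y v) (at ?y) =
      frechet_derivative (\<lambda>y. loc1 E c (\<theta> s\<^sub>0) y v + n1 s * N1 c y v + n2 s * N2 c y v + n3 s * N3 c y v) (at ?y)"
      by (rule frechet_derivative_cong_open[OF o y eq])
    also have "\<dots> = (\<lambda>w. frechet_derivative (\<lambda>y. loc1 E c (\<theta> s\<^sub>0) y v) (at ?y) w + n1 s * frechet_derivative (\<lambda>y. N1 c y v) (at ?y) w
      + n2 s * frechet_derivative (\<lambda>y. N2 c y v) (at ?y) w + n3 s * frechet_derivative (\<lambda>y. N3 c y v) (at ?y) w)"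
      by (rule frechet_derivative_at[symmetric]) (intro has_derivative_add has_derivative_mult_right D0 DN)
    finally show ?thesis by (simp only:)
  qed
  show ?thesis
    unfolding ext_deriv1[OF charted_E form[OF s0_in] c]
    unfolding d1_def fd by (simp add: dN[OF c(1) y, of w v] algebra_simps)
qed


definition horizontal_data where
  "horizontal_data c U1 U2 V1 V2 V3 p s \<longleftrightarrow> nk_point_horizontal (0, 1) (U1, 0) (U2, 0) (V1, 0) (V2, 0) (V3, 0) {w. snd w = 0} snd
    (P \<theta>1 c (snd c p, s)) (P \<theta>2 c (snd c p, s)) (A \<alpha>0 c (snd c p, s)) (A \<alpha>1 c (snd c p, s)) (A \<alpha>2 c (snd c p, s))
    (\<lambda>w. N1 c (snd c p) (fst w)) (\<lambda>w. N2 c (snd c p) (fst w)) (\<lambda>w. N3 c (snd c p) (fst w))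
    (P' \<theta>1 c (snd c p, s)) (P' \<theta>2 c (snd c p, s)) (A' \<alpha>0 c (snd c p, s)) (A' \<alpha>1 c (snd c p, s)) (A' \<alpha>2 c (snd c p, s))
    s (D s) (deriv D s) (gUU s) (gUV s) (gVV s) (deriv gUU s) (deriv gUV s) (deriv gVV s)
    (lc1 (\<alpha>0 s)) (lc2 (\<alpha>0 s)) (lc3 (\<alpha>0 s)) (lc1 (\<alpha>1 s)) (lc2 (\<alpha>1 s)) (lc3 (\<alpha>1 s)) (lc1 (\<alpha>2 s)) (lc2 (\<alpha>2 s)) (lc3 (\<alpha>2 s))
    (deriv (\<lambda>s. lc1 (\<alpha>0 s)) s) (deriv (\<lambda>s. lc2 (\<alpha>0 s)) s) (deriv (\<lambda>s. lc3 (\<alpha>0 s)) s)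
    (deriv (\<lambda>s. lc1 (\<alpha>1 s)) s) (deriv (\<lambda>s. lc2 (\<alpha>1 s)) s) (deriv (\<lambda>s. lc3 (\<alpha>1 s)) s)
    (deriv (\<lambda>s. lc1 (\<alpha>2 s)) s) (deriv (\<lambda>s. lc2 (\<alpha>2 s)) s) (deriv (\<lambda>s. lc3 (\<alpha>2 s)) s)"

lemma theta_form': "\<forall>s\<in>I. diff_form E 1 (\<theta>1 s)" "\<forall>s\<in>I. diff_form E 1 (\<theta>2 s)"
  using theta_form by auto

lemma theta_differences:
  assumes "p0 \<in> points E"
  shows "\<exists>n1 n2 n3. (\<forall>p\<in>points E. \<forall>s\<in>I. \<forall>X\<in>tangent_space E p.
      \<theta>1 s p [X] = \<theta>1 s\<^sub>0 p [X] + n1 s * eta1 \<pi> p X + n2 s * eta2 \<pi> p X + n3 s * eta3 \<pi> p X) \<and>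
    ((\<forall>s\<in>I. lc3 (\<alpha>1 s) = 0) \<longrightarrow> (\<forall>s\<in>I. n3 s = 0))"
   "\<exists>n1 n2 n3. (\<forall>p\<in>points E. \<forall>s\<in>I. \<forall>X\<in>tangent_space E p.
      \<theta>2 s p [X] = \<theta>2 s\<^sub>0 p [X] + n1 s * eta1 \<pi> p X + n2 s * eta2 \<pi> p X + n3 s * eta3 \<pi> p X) \<and>
    ((\<forall>s\<in>I. lc3 (\<alpha>2 s) = 0) \<longrightarrow> (\<forall>s\<in>I. n3 s = 0))"
  by (rule theta_difference[OF assms], rule theta_evolution(1), assumption+)
    (rule theta_difference[OF assms], rule theta_evolution(2), assumption+)

text \<open>The curvature at s differs from that at \<open>s\<^sub>0\<close> by a multiple of N1
  \<and> N2. Both are zero when one argument is vertical, so horizontality at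
  \<open>s\<^sub>0\<close> persists.\<close>

lemma point_horizontal:
  assumes p: "p \<in> points E" and s: "s \<in> I"
  obtains c U1 U2 V1 V2 V3 where "c \<in> atlas E" "p \<in> fst c" "horizontal_data c U1 U2 V1 V2 V3 p s"
proof -
  obtain c U1 U2 V1 V2 V3 where c: "c \<in> atlas E" "p \<in> fst c" and pd: "point_data c U1 U2 V1 V2 V3 p s"
    and U: "pushforward H3 \<pi> p (coord_vec E c p U1) = (\<lambda>u. 0)" "pushforward H3 \<pi> p (coord_vec E c p U2) = (\<lambda>u. 0)"
    using point[OF p s] by metis
  have y: "snd c p \<in> snd c ` fst c" and inv: "chart_inv c (snd c p) = p" using c by (auto simp: chart_inv_chart[OF charted_E])
  have hor: "P' \<theta> c (snd c p, s) (U, 0) v = P' \<theta> c (snd c p, s) v (U, 0)"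
    if \<theta>: "smooth_family E (s\<^sub>0-\<epsilon>) (s\<^sub>0+\<epsilon>) 1 \<theta>" "\<forall>s\<in>I. diff_form E 1 (\<theta> s)"
      "\<exists>n1 n2 n3. (\<forall>p\<in>points E. \<forall>s\<in>I. \<forall>X\<in>tangent_space E p.
        \<theta> s p [X] = \<theta> s\<^sub>0 p [X] + n1 s * eta1 \<pi> p X + n2 s * eta2 \<pi> p X + n3 s * eta3 \<pi> p X) \<and> Q n3"
      "\<forall>Y\<in>tangent_space E p. ext_deriv E (\<theta> s\<^sub>0) p [coord_vec E c p U, Y] = 0"
      and U: "pushforward H3 \<pi> p (coord_vec E c p U) = (\<lambda>u. 0)" and v: "v \<in> {w. snd w = 0}"
    for \<theta> U v and Q :: "(real \<Rightarrow> real) \<Rightarrow> bool"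
  proof -
    obtain n1 n2 n3 where n: "\<forall>p\<in>points E. \<forall>s\<in>I. \<forall>X\<in>tangent_space E p.
      \<theta> s p [X] = \<theta> s\<^sub>0 p [X] + n1 s * eta1 \<pi> p X + n2 s * eta2 \<pi> p X + n3 s * eta3 \<pi> p X"
      using \<theta>(3) by blast
    have vv: "v = (fst v, 0)" using v by (simp add: prod_eq_iff)
    have "N1 c (snd c p) U = 0" "N2 c (snd c p) U = 0"
      using eta_zero[OF U] by (simp_all add: N1_def N2_def inv)
    then have "d1 (loc1 E c (\<theta> s)) (snd c p) U (fst v) = 0"
      using theta_ext_deriv[OF n \<theta>(2) c s, of U "fst v"] \<theta>(4)[rule_format, OF coord_vec_in_tangent_space[OF c]] by (simp add: W2_def)
    then have "P' \<theta> c (snd c p, s) (U, 0) (fst v, 0) - P' \<theta> c (snd c p, s) (fst v, 0) (U, 0) = 0"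
      unfolding P'_slice[OF c(1) y s \<theta>(1)] .
    then show ?thesis using vv by simp
  qed
  have ini: "\<forall>Y\<in>tangent_space E p. ext_deriv E (\<theta>1 s\<^sub>0) p [coord_vec E c p U, Y] = 0"
    "\<forall>Y\<in>tangent_space E p. ext_deriv E (\<theta>2 s\<^sub>0) p [coord_vec E c p U, Y] = 0"
    if "pushforward H3 \<pi> p (coord_vec E c p U) = (\<lambda>u. 0)" for U
    using theta_initial_horizontal[OF p coord_vec_in_tangent_space[OF c] that] by auto
  have "horizontal_data c U1 U2 V1 V2 V3 p s"
    unfolding horizontal_data_def
  proof (intro nk_point_horizontal.intro nk_point_horizontal_axioms.intro)
    fix v :: "(real^5) \<times> real" assume v: "v \<in> {w. snd w = 0}"
    show "P' \<theta>1 c (snd c p, s) (U1, 0) v = P' \<theta>1 c (snd c p, s) v (U1, 0)"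
      by (rule hor[OF theta_smooth(1) theta_form'(1) theta_differences(1)[OF p] ini(1)[OF U(1)] U(1) v])
    show "P' \<theta>1 c (snd c p, s) (U2, 0) v = P' \<theta>1 c (snd c p, s) v (U2, 0)"
      by (rule hor[OF theta_smooth(1) theta_form'(1) theta_differences(1)[OF p] ini(1)[OF U(2)] U(2) v])
    show "P' \<theta>2 c (snd c p, s) (U1, 0) v = P' \<theta>2 c (snd c p, s) v (U1, 0)"
      by (rule hor[OF theta_smooth(2) theta_form'(2) theta_differences(2)[OF p] ini(2)[OF U(1)] U(1) v])
    show "P' \<theta>2 c (snd c p, s) (U2, 0) v = P' \<theta>2 c (snd c p, s) v (U2, 0)"
      by (rule hor[OF theta_smooth(2) theta_form'(2) theta_differences(2)[OF p] ini(2)[OF U(2)] U(2) v])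
  qed (rule pd[unfolded point_data_def] left_invariant_basis_det[OF alpha_basis[OF s]])+
  from that[OF c this] show ?thesis .
qed

lemma lc3_zero:
  assumes "p \<in> points E" "s \<in> I"
  shows "lc3 (\<alpha>1 s) = 0" "lc3 (\<alpha>2 s) = 0"
    and "D s * lc3 (\<alpha>0 s) = - 4 * (D s + s\<^sup>2) * (lc1 (\<alpha>1 s) * lc2 (\<alpha>2 s) - lc2 (\<alpha>1 s) * lc1 (\<alpha>2 s))"
    and "lc1 (\<alpha>1 s) * lc2 (\<alpha>2 s) - lc2 (\<alpha>1 s) * lc1 (\<alpha>2 s) \<noteq> 0" "lc3 (\<alpha>0 s) \<noteq> 0"
proof -
  obtain c U1 U2 V1 V2 V3 where "horizontal_data c U1 U2 V1 V2 V3 p s"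
    using point_horizontal[OF assms] by metis
  note np = this[unfolded horizontal_data_def]
  show "lc3 (\<alpha>1 s) = 0" "lc3 (\<alpha>2 s) = 0" by (rule nk_point_horizontal.m_3_zero[OF np])+
  show "D s * lc3 (\<alpha>0 s) = - 4 * (D s + s\<^sup>2) * (lc1 (\<alpha>1 s) * lc2 (\<alpha>2 s) - lc2 (\<alpha>1 s) * lc1 (\<alpha>2 s))"
    by (rule nk_point_horizontal.m03_eq[OF np])
  show "lc1 (\<alpha>1 s) * lc2 (\<alpha>2 s) - lc2 (\<alpha>1 s) * lc1 (\<alpha>2 s) \<noteq> 0" "lc3 (\<alpha>0 s) \<noteq> 0"
    by (rule nk_point_horizontal.minor_nonzero[OF np], rule nk_point_horizontal.m03_nonzero[OF np])
qed

text \<open>The third coefficients of \<alpha>1 and \<alpha>2 vanish on the whole interval, hence so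
  do their derivatives. This is the premise that \<open>coefficient_derivatives\<close> could not
  establish at a single point.\<close>

lemma coefficient_equations:
  assumes p: "p \<in> points E" and s: "s \<in> I"
  shows "s * deriv D s = - 2 * D s - 4 * s\<^sup>2"
    and "3 * D s * deriv (\<lambda>s. lc1 (\<alpha>0 s)) s = - 4 * s * lc1 (\<alpha>0 s)" "3 * D s * deriv (\<lambda>s. lc2 (\<alpha>0 s)) s = - 4 * s * lc2 (\<alpha>0 s)"
      "3 * D s * deriv (\<lambda>s. lc3 (\<alpha>0 s)) s = - 4 * s * lc3 (\<alpha>0 s)"
    and "3 * D s * deriv (\<lambda>s. lc1 (\<alpha>1 s)) s = - 8 * s * lc1 (\<alpha>1 s)" "3 * D s * deriv (\<lambda>s. lc2 (\<alpha>1 s)) s = - 8 * s * lc2 (\<alpha>1 s)"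
    and "3 * D s * deriv (\<lambda>s. lc1 (\<alpha>2 s)) s = - 8 * s * lc1 (\<alpha>2 s)" "3 * D s * deriv (\<lambda>s. lc2 (\<alpha>2 s)) s = - 8 * s * lc2 (\<alpha>2 s)"
proof -
  obtain c U1 U2 V1 V2 V3 where "horizontal_data c U1 U2 V1 V2 V3 p s"
    using point_horizontal[OF assms] by metis
  note np = this[unfolded horizontal_data_def]
  have z: "deriv f s = 0" if "\<And>s. s \<in> I \<Longrightarrow> f s = 0" for f
    by (rule DERIV_imp_deriv, rule has_field_derivative_transform_within_open[OF DERIV_const[of 0], where S=I])
      (use s that in auto)
  have m: "deriv (\<lambda>s. lc3 (\<alpha>1 s)) s = 0" "deriv (\<lambda>s. lc3 (\<alpha>2 s)) s = 0"
    by (rule z, rule lc3_zero(1)[OF p], assumption) (rule z, rule lc3_zero(2)[OF p], assumption)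
  note r = nk_point_horizontal.coefficient_derivatives[OF np m]
  show "s * deriv D s = - 2 * D s - 4 * s\<^sup>2"
    "3 * D s * deriv (\<lambda>s. lc1 (\<alpha>0 s)) s = - 4 * s * lc1 (\<alpha>0 s)" "3 * D s * deriv (\<lambda>s. lc2 (\<alpha>0 s)) s = - 4 * s * lc2 (\<alpha>0 s)"
      "3 * D s * deriv (\<lambda>s. lc3 (\<alpha>0 s)) s = - 4 * s * lc3 (\<alpha>0 s)"
    "3 * D s * deriv (\<lambda>s. lc1 (\<alpha>1 s)) s = - 8 * s * lc1 (\<alpha>1 s)" "3 * D s * deriv (\<lambda>s. lc2 (\<alpha>1 s)) s = - 8 * s * lc2 (\<alpha>1 s)"
    "3 * D s * deriv (\<lambda>s. lc1 (\<alpha>2 s)) s = - 8 * s * lc1 (\<alpha>2 s)" "3 * D s * deriv (\<lambda>s. lc2 (\<alpha>2 s)) s = - 8 * s * lc2 (\<alpha>2 s)"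
    by (rule r)+
qed

text \<open>Since \<alpha>1 and \<alpha>2 have no third coefficient, n3 = 0 and the curvature at s
  is the one at \<open>s\<^sub>0\<close>. The curvature equation at s thus acquires a left side
  whose two-form is independent of s, which allows metrics at different s to be compared.\<close>

lemma curvature:
  assumes p: "p \<in> points E" and s: "s \<in> I" and X: "X \<in> tangent_space E p" and Y: "Y \<in> tangent_space E p"
  shows "s * D s * ext_deriv E (\<theta>1 s\<^sub>0) p [X, Y] =
      - 3 * (gUV s * W2 (comb \<alpha>1 s p) (comb \<alpha>0 s p) X Y + gVV s * W2 (comb \<alpha>2 s p) (comb \<alpha>0 s p) X Y)"
    and "s * D s * ext_deriv E (\<theta>2 s\<^sub>0) p [X, Y] =
      3 * (gUU s * W2 (comb \<alpha>1 s p) (comb \<alpha>0 s p) X Y + gUV s * W2 (comb \<alpha>2 s p) (comb \<alpha>0 s p) X Y)"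
proof -
  obtain c U1 U2 V1 V2 V3 where c: "c \<in> atlas E" "p \<in> fst c" and "horizontal_data c U1 U2 V1 V2 V3 p s"
    using point_horizontal[OF p s] by metis
  note np = this(3)[unfolded horizontal_data_def]
  have y: "snd c p \<in> snd c ` fst c" and inv: "chart_inv c (snd c p) = p" using c by (auto simp: chart_inv_chart[OF charted_E])
  obtain v w where v: "X = coord_vec E c p v" and w: "Y = coord_vec E c p w"
    using X Y tangent_space_eq[OF charted_E c] by blast
  have H: "(v, 0) \<in> {w. snd w = 0}" "(w, 0) \<in> {w. snd w = 0}" by auto
  have Av: "A \<alpha> c (snd c p, s) (u, 0) = comb \<alpha> s p (coord_vec E c p u)" for \<alpha> u
    by (simp add: A_def inv)
  obtain n1 n2 n3 where n: "\<forall>p\<in>points E. \<forall>s\<in>I. \<forall>X\<in>tangent_space E p.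
      \<theta>1 s p [X] = \<theta>1 s\<^sub>0 p [X] + n1 s * eta1 \<pi> p X + n2 s * eta2 \<pi> p X + n3 s * eta3 \<pi> p X"
    and n3: "(\<forall>s\<in>I. lc3 (\<alpha>1 s) = 0) \<longrightarrow> (\<forall>s\<in>I. n3 s = 0)"
    using theta_differences(1)[OF p] by blast
  obtain n1' n2' n3' where n': "\<forall>p\<in>points E. \<forall>s\<in>I. \<forall>X\<in>tangent_space E p.
      \<theta>2 s p [X] = \<theta>2 s\<^sub>0 p [X] + n1' s * eta1 \<pi> p X + n2' s * eta2 \<pi> p X + n3' s * eta3 \<pi> p X"
    and n3': "(\<forall>s\<in>I. lc3 (\<alpha>2 s) = 0) \<longrightarrow> (\<forall>s\<in>I. n3' s = 0)"
    using theta_differences(2)[OF p] by blast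
  have "n3 s = 0" "n3' s = 0" using n3 n3' lc3_zero[OF p] s by auto
  then have e: "ext_deriv E (\<theta>1 s\<^sub>0) p [X, Y] = P' \<theta>1 c (snd c p, s) (v, 0) (w, 0) - P' \<theta>1 c (snd c p, s) (w, 0) (v, 0)"
    "ext_deriv E (\<theta>2 s\<^sub>0) p [X, Y] = P' \<theta>2 c (snd c p, s) (v, 0) (w, 0) - P' \<theta>2 c (snd c p, s) (w, 0) (v, 0)"
    using theta_ext_deriv[where \<theta>=\<theta>1, OF n theta_form'(1) c s, of v w] theta_ext_deriv[where \<theta>=\<theta>2, OF n' theta_form'(2) c s, of v w]
    by (simp_all add: P'_slice[OF c(1) y s theta_smooth(1)] P'_slice[OF c(1) y s theta_smooth(2)] v w)
  show "s * D s * ext_deriv E (\<theta>1 s\<^sub>0) p [X, Y] =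
      - 3 * (gUV s * W2 (comb \<alpha>1 s p) (comb \<alpha>0 s p) X Y + gVV s * W2 (comb \<alpha>2 s p) (comb \<alpha>0 s p) X Y)"
    unfolding e nk_point_horizontal.dP1[OF np H] by (simp add: W2_def Av v w)
  show "s * D s * ext_deriv E (\<theta>2 s\<^sub>0) p [X, Y] =
      3 * (gUU s * W2 (comb \<alpha>1 s p) (comb \<alpha>0 s p) X Y + gUV s * W2 (comb \<alpha>2 s p) (comb \<alpha>0 s p) X Y)"
    unfolding e nk_point_horizontal.dP2[OF np H] by (simp add: W2_def Av v w)
qed

end

section \<open>Change of the invariant basis\<close>

lemma left_invariant_lin_comb:
  assumes "left_invariant \<omega>" "left_invariant \<eta>"
  shows "left_invariant (\<lambda>p. a \<odot> \<omega> p + b \<odot> \<eta> p)"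
proof -
  have f: "diff_form H3 1 \<omega>" "diff_form H3 1 \<eta>" using assms by (auto simp: left_invariant_def)
  have m: "multilinear_on (tangent_space H3 p) 1 (a \<odot> \<omega> p + b \<odot> \<eta> p)" if "p \<in> points H3" for p
    using diff_form_multilinear[OF f(1) that] diff_form_multilinear[OF f(2) that]
    unfolding multilinear_on_def by (auto simp: scale_apply algebra_simps)
  have s: "smooth_on (snd c ` fst c) (\<lambda>x. (a \<odot> \<omega> (chart_inv c x) + b \<odot> \<eta> (chart_inv c x)) (map (coord_vec H3 c (chart_inv c x)) vs))"
    if c: "c \<in> atlas H3" for c vs
  proof -
    have o: "open (snd c ` fst c)" by (rule charted_open[OF charted_H3 c])
    have "smooth_on (snd c ` fst c) (\<lambda>x. \<omega> (chart_inv c x) (map (coord_vec H3 c (chart_inv c x)) vs))"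
      "smooth_on (snd c ` fst c) (\<lambda>x. \<eta> (chart_inv c x) (map (coord_vec H3 c (chart_inv c x)) vs))"
      using f c unfolding diff_form_def tensor_field_def by blast+
    then have "smooth_on (snd c ` fst c) (\<lambda>x. a *\<^sub>R \<omega> (chart_inv c x) (map (coord_vec H3 c (chart_inv c x)) vs)
      + b *\<^sub>R \<eta> (chart_inv c x) (map (coord_vec H3 c (chart_inv c x)) vs))"
      by (intro smooth_on_add smooth_on_bounded_linear_compose[OF o bounded_linear_scaleR_right] o)
    then show ?thesis by (simp add: scale_apply)
  qed
  have d: "(a \<odot> \<omega> p + b \<odot> \<eta> p) Xs = 0" if "p \<in> points H3" "Xs \<in> lists (tangent_space H3 p)" "\<not> distinct Xs" for p Xs
    using f that unfolding diff_form_def by (simp add: scale_apply)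
  have i: "field_eq H3 (pullback H3 (\<lambda>B. A ** B) (\<lambda>p. a \<odot> \<omega> p + b \<odot> \<eta> p)) (\<lambda>p. a \<odot> \<omega> p + b \<odot> \<eta> p)" if "A \<in> H3_set" for A
    using assms that unfolding left_invariant_def field_eq_def pullback_def by (simp add: scale_apply)
  show ?thesis
    unfolding left_invariant_def diff_form_def tensor_field_def using m s d i by blast
qed

text \<open>The coordinates in the two triples are related by a triangular linear map, which is
  bijective because k is nonzero and x z = 1. Unique expansions are carried over along it.\<close>

lemma left_invariant_basis_transform:
  assumes b: "left_invariant_basis a0 a1 a2" and k: "k \<noteq> 0" and xz: "x * z = 1"
  shows "left_invariant_basis (\<lambda>p. k \<odot> a0 p) (\<lambda>p. (k * x) \<odot> a1 p + (k * y) \<odot> a2 p) (\<lambda>p. (k * z) \<odot> a2 p)"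
proof -
  have li: "left_invariant a0" "left_invariant a1" "left_invariant a2"
    using b by (auto simp: left_invariant_basis_def)
  have x: "x \<noteq> 0" "z \<noteq> 0" using xz by auto
  have single: "(\<lambda>p. c \<odot> a p) = (\<lambda>p. c \<odot> a p + 0 \<odot> a p)" for c :: real and a :: "(real^3^3) field"
    by (auto simp: fun_eq_iff scale_apply)
  have 1: "left_invariant (\<lambda>p. k \<odot> a0 p)" "left_invariant (\<lambda>p. (k * z) \<odot> a2 p)"
    by (subst single, rule left_invariant_lin_comb, rule li, rule li)+
  have "\<exists>!c::real^3. field_eq H3 \<omega> (\<lambda>p. c$1 \<odot> (k \<odot> a0 p) + c$2 \<odot> ((k * x) \<odot> a1 p + (k * y) \<odot> a2 p) + c$3 \<odot> ((k * z) \<odot> a2 p))"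
    if \<omega>: "left_invariant \<omega>" for \<omega>
  proof -
    let ?old = "\<lambda>c::real^3. field_eq H3 \<omega> (\<lambda>p. c$1 \<odot> a0 p + c$2 \<odot> a1 p + c$3 \<odot> a2 p)"
    let ?T = "\<lambda>c::real^3. vector [k * c$1, k * x * c$2, k * (y * c$2 + z * c$3)] :: real^3"
    have new: "field_eq H3 \<omega> (\<lambda>p. c$1 \<odot> (k \<odot> a0 p) + c$2 \<odot> ((k * x) \<odot> a1 p + (k * y) \<odot> a2 p) + c$3 \<odot> ((k * z) \<odot> a2 p))
        \<longleftrightarrow> ?old (?T c)" for c :: "real^3"
    proof -
      have "c$1 \<odot> (k \<odot> a0 p) + c$2 \<odot> ((k * x) \<odot> a1 p + (k * y) \<odot> a2 p) + c$3 \<odot> ((k * z) \<odot> a2 p) =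
        (?T c)$1 \<odot> a0 p + (?T c)$2 \<odot> a1 p + (?T c)$3 \<odot> a2 p" for p
        by (auto simp: fun_eq_iff scale_apply algebra_simps)
      then show ?thesis by (simp only:)
    qed
    have "\<exists>!c. ?old c" using b \<omega> unfolding left_invariant_basis_def by blast
    then obtain c where c1: "?old c" and c2: "\<forall>d. ?old d \<longrightarrow> d = c" by (rule ex1E)
    note c = c1 c2[rule_format]
    \<comment> \<open>The solution of \<open>?T d = c\<close> by forward substitution; the third
      coordinate uses the value of the second.\<close>
    let ?d = "vector [c$1 / k, c$2 / (k * x), (c$3 - c$2 * y / x) / (k * z)] :: real^3"
    have Td: "?T ?d = c"
      using k x by (simp add: vec_eq_iff forall_3) (simp add: field_simps)
    show ?thesis
    proof (rule ex1I[of _ ?d])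
      show "field_eq H3 \<omega> (\<lambda>p. ?d$1 \<odot> (k \<odot> a0 p) + ?d$2 \<odot> ((k * x) \<odot> a1 p + (k * y) \<odot> a2 p) + ?d$3 \<odot> ((k * z) \<odot> a2 p))"
        unfolding new Td by (rule c(1))
      fix e :: "real^3" assume "field_eq H3 \<omega> (\<lambda>p. e$1 \<odot> (k \<odot> a0 p) + e$2 \<odot> ((k * x) \<odot> a1 p + (k * y) \<odot> a2 p) + e$3 \<odot> ((k * z) \<odot> a2 p))"
      then have "?T e = c" unfolding new by (rule c(2))
      then have eqs: "c$1 = k * e$1" "c$2 = k * x * e$2" "c$3 = k * (y * e$2 + z * e$3)" by (auto simp: vec_eq_iff forall_3)
      show "e = ?d" unfolding vec_eq_iff forall_3 vector_3 eqs using k x by (simp add: field_simps)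
    qed
  qed
  then show ?thesis
    unfolding left_invariant_basis_def using 1 left_invariant_lin_comb[OF li(2,3)] by blast
qed

text \<open>In the coordinates (a, b, c) the only coefficient of \<omega> that is not constant is
  that of dc, which contains -a times \<open>lc3 \<omega>\<close>.\<close>

lemma left_invariant_ext_deriv:
  assumes \<omega>: "left_invariant \<omega>" and p: "p \<in> H3_set"
  shows "ext_deriv H3 \<omega> p [H3_vec p v, H3_vec p w] = - lc3 \<omega> * (fst v * snd (snd w) - fst w * snd (snd v))"
proof -
  have c: "H3_chart \<in> atlas H3" "p \<in> fst H3_chart" using p by simp_all
  have l: "loc1 H3 H3_chart \<omega> y v = lc1 \<omega> * fst v + lc2 \<omega> * snd (snd v) + lc3 \<omega> * (fst (snd v) - fst y * snd (snd v))" for y v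
    using left_invariant_value[OF \<omega>] by (cases y; cases v) (simp add: loc1_def)
  have "((\<lambda>y. loc1 H3 H3_chart \<omega> y v) has_derivative (\<lambda>u. - lc3 \<omega> * (fst u * snd (snd v)))) (at y)" for y v
    unfolding l by (auto intro!: derivative_eq_intros)
  from frechet_derivative_at[OF this, symmetric]
  show ?thesis
    unfolding ext_deriv1[OF charted_H3 left_invariant_diff_form[OF \<omega>] c] d1_def by (simp add: algebra_simps)
qed

text \<open>\<open>field_eq\<close> compares forms on argument lists of every length, and this
  settles the lengths other than the degree: deleting one of n vectors leaves n - 1, on which a
  k-form vanishes unless n = k + 1.\<close>

lemma ext_deriv_of_degree:
  assumes N: "charted N" and \<omega>: "diff_form N k \<omega>" and p: "p \<in> points N"
  shows "of_degree (tangent_space N p) (Suc k) (ext_deriv N \<omega> p)"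
  unfolding of_degree_def
proof (intro ballI impI)
  fix Xs assume Xs: "Xs \<in> lists (tangent_space N p)" and len: "length Xs \<noteq> Suc k"
  obtain c where c: "c \<in> atlas N" "p \<in> fst c"
    and e: "\<And>\<omega> vs. ext_deriv N \<omega> p (map (coord_vec N c p) vs) = (\<Sum>i<length vs. (- 1) ^ i *
          frechet_derivative
            (\<lambda>x. \<omega> (chart_inv c x) (map (coord_vec N c (chart_inv c x)) (nths vs (- {i}))))
            (at (snd c p)) (vs ! i))"
    using ext_deriv_coord_vec[OF N p] by blast
  have "Xs \<in> map (coord_vec N c p) ` lists UNIV"
    using Xs unfolding tangent_space_eq[OF N c] by (simp add: lists_image)
  then obtain vs where vs: "Xs = map (coord_vec N c p) vs" by blast
  have z: "\<omega> (chart_inv c y) (map (coord_vec N c (chart_inv c y)) (nths vs (- {i}))) = 0" if "i < length vs" "y \<in> snd c ` fst c" for i y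
  proof (rule of_degreeD)
    have q: "chart_inv c y \<in> fst c" using that(2) by (rule inv_into_into)
    show "of_degree (tangent_space N (chart_inv c y)) k (\<omega> (chart_inv c y))"
      by (rule multilinear_on_of_degree[OF diff_form_multilinear[OF \<omega> charted_in_points[OF N c(1) q]]])
    show "map (coord_vec N c (chart_inv c y)) (nths vs (- {i})) \<in> lists (tangent_space N (chart_inv c y))"
      using coord_vec_in_tangent_space[OF c(1) q] by auto
    have "{j. j < length vs \<and> j \<in> - {i}} = {..<length vs} - {i}" by auto
    then have "length (nths vs (- {i})) = length vs - 1" using that(1) by (simp add: length_nths)
    then show "length (map (coord_vec N c (chart_inv c y)) (nths vs (- {i}))) \<noteq> k"
      using len that(1) vs by auto
  qed
  have y: "snd c p \<in> snd c ` fst c" using c by simp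
  show "ext_deriv N \<omega> p Xs = 0"
    unfolding vs e
  proof (rule sum.neutral, intro ballI)
    fix i assume "i \<in> {..<length vs}"
    then have "frechet_derivative (\<lambda>x. \<omega> (chart_inv c x) (map (coord_vec N c (chart_inv c x)) (nths vs (- {i})))) (at (snd c p)) (vs ! i) = 0"
      by (intro frechet_derivative_zero_on[OF charted_open[OF N c(1)] y] z) auto
    then show "(- 1) ^ i * frechet_derivative (\<lambda>x. \<omega> (chart_inv c x) (map (coord_vec N c (chart_inv c x)) (nths vs (- {i})))) (at (snd c p)) (vs ! i) = 0"
      by simp
  qed
qed

lemma field_eq_by_degree:
  assumes "\<And>p. p \<in> points N \<Longrightarrow> of_degree (tangent_space N p) k (\<omega> p)" "\<And>p. p \<in> points N \<Longrightarrow> of_degree (tangent_space N p) k (\<eta> p)"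
    and "\<And>p Xs. p \<in> points N \<Longrightarrow> Xs \<in> lists (tangent_space N p) \<Longrightarrow> length Xs = k \<Longrightarrow> \<omega> p Xs = \<eta> p Xs"
  shows "field_eq N \<omega> \<eta>"
  unfolding field_eq_def by (metis assms of_degreeD)

lemma left_invariant_H3_vec:
  assumes "left_invariant \<omega>" "lc3 \<omega> = 0" "p \<in> H3_set"
  shows "\<omega> p [H3_vec p v] = lc1 \<omega> * fst v + lc2 \<omega> * snd (snd v)"
  using assms left_invariant_value[OF assms(1)] by (cases v) (auto simp: H3_set_def)

text \<open>All two-forms involved are multiples of da \<and> dc. The sign in the last premise is
  that of d(db - a dc) = - da \<and> dc.\<close>

lemma structure_equations:
  assumes "left_invariant \<sigma>0" "left_invariant \<sigma>1" "left_invariant \<sigma>2"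
    and "lc3 \<sigma>1 = 0" "lc3 \<sigma>2 = 0" "lc3 \<sigma>0 = - (lc1 \<sigma>1 * lc2 \<sigma>2 - lc2 \<sigma>1 * lc1 \<sigma>2)"
  shows "field_eq H3 (ext_deriv H3 \<sigma>0) (\<lambda>p. \<sigma>1 p \<^bold>\<and> \<sigma>2 p)"
    "field_eq H3 (ext_deriv H3 \<sigma>1) (\<lambda>p. 0)" "field_eq H3 (ext_deriv H3 \<sigma>2) (\<lambda>p. 0)"
proof -
  have f: "diff_form H3 1 \<sigma>0" "diff_form H3 1 \<sigma>1" "diff_form H3 1 \<sigma>2"
    using assms(1-3) left_invariant_diff_form by auto
  have two: "\<exists>v w. Xs = [H3_vec p v, H3_vec p w]" if Xs: "Xs \<in> lists (tangent_space H3 p)" and len: "length Xs = 2" for p Xs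
  proof -
    obtain X Y where XY: "Xs = [X, Y]" using len by (auto simp: numeral_2_eq_2 length_Suc_conv)
    then have "X \<in> tangent_space H3 p" "Y \<in> tangent_space H3 p" using Xs by auto
    then show ?thesis unfolding XY tangent_space_def atlas_H3 by blast
  qed
  have od: "of_degree (tangent_space H3 p) 2 (ext_deriv H3 \<omega> p)" if "diff_form H3 1 \<omega>" "p \<in> points H3" for \<omega> p
    using ext_deriv_of_degree[OF charted_H3 that] by (simp add: numeral_2_eq_2)
  have o1: "of_degree (tangent_space H3 p) 1 (\<sigma>1 p)" "of_degree (tangent_space H3 p) 1 (\<sigma>2 p)" if "p \<in> points H3" for p
    using diff_form_multilinear[OF f(2) that] diff_form_multilinear[OF f(3) that] multilinear_on_of_degree by auto
  have T: "H3_vec p v \<in> tangent_space H3 p" if "p \<in> points H3" for p v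
    by (rule coord_vec_in_tangent_space) (use that in auto)
  show "field_eq H3 (ext_deriv H3 \<sigma>0) (\<lambda>p. \<sigma>1 p \<^bold>\<and> \<sigma>2 p)"
  proof (rule field_eq_by_degree[where k=2, OF od[OF f(1)]])
    fix p assume p: "p \<in> points H3"
    show "of_degree (tangent_space H3 p) 2 (\<sigma>1 p \<^bold>\<and> \<sigma>2 p)"
      using of_degree_wedge[OF o1[OF p]] by (simp add: numeral_2_eq_2)
    fix Xs assume "Xs \<in> lists (tangent_space H3 p)" "length Xs = 2"
    then obtain v w where Xs: "Xs = [H3_vec p v, H3_vec p w]" using two by blast
    show "ext_deriv H3 \<sigma>0 p Xs = (\<sigma>1 p \<^bold>\<and> \<sigma>2 p) Xs"
      unfolding Xs wedge_2[OF o1[OF p] T[OF p] T[OF p]] using p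
      by (simp add: left_invariant_ext_deriv[OF assms(1)] left_invariant_H3_vec[OF assms(2,4)] left_invariant_H3_vec[OF assms(3,5)]
          assms(6) algebra_simps)
  qed
  have closed: "field_eq H3 (ext_deriv H3 \<omega>) (\<lambda>p. 0)" if "left_invariant \<omega>" "lc3 \<omega> = 0" for \<omega>
  proof (rule field_eq_by_degree[where k=2, OF od[OF left_invariant_diff_form[OF that(1)]]])
    fix p assume p: "p \<in> points H3"
    show "of_degree (tangent_space H3 p) 2 0" by (simp add: of_degree_def)
    fix Xs assume "Xs \<in> lists (tangent_space H3 p)" "length Xs = 2"
    then obtain v w where Xs: "Xs = [H3_vec p v, H3_vec p w]" using two by blast
    show "ext_deriv H3 \<omega> p Xs = 0 Xs" unfolding Xs using p by (simp add: left_invariant_ext_deriv[OF that(1)] that(2))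
  qed
  show "field_eq H3 (ext_deriv H3 \<sigma>1) (\<lambda>p. 0)" "field_eq H3 (ext_deriv H3 \<sigma>2) (\<lambda>p. 0)"
    by (rule closed[OF assms(2,4)], rule closed[OF assms(3,5)])
qed

section \<open>Solution of the evolution equations\<close>

context nearly_Kaehler_over_H3
begin

text \<open>A local trivialisation near the identity of H3 is onto, so the fibre there has a point.
  The coefficient equations are derived at points of E, and this supplies one for statements about
  functions of s alone.\<close>

lemma E_nonempty: "\<exists>p. p \<in> points E"
proof -
  have "heis 0 0 0 \<in> points H3" by simp
  then obtain U \<kappa> where U: "heis 0 0 0 \<in> U" "openin (mtop H3) U"
    and "diffeomorphism (open_submanifold E (points E \<inter> \<pi> -` U)) (open_submanifold H3 U \<times>\<^sub>M\<^sub>f T2) (\<lambda>p. (\<pi> p, \<kappa> p))"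
    using principal unfolding principal_T2_bundle_def by blast
  then have "bij_betw (\<lambda>p. (\<pi> p, \<kappa> p)) (points (open_submanifold E (points E \<inter> \<pi> -` U))) (points (open_submanifold H3 U \<times>\<^sub>M\<^sub>f T2))"
    by (simp only: diffeomorphism_def)
  moreover have "(heis 0 0 0, (1, 1)) \<in> points (open_submanifold H3 U \<times>\<^sub>M\<^sub>f T2)"
    using U by (simp add: open_submanifold_def T2_def circle_def mtop_H3)
  ultimately have "(heis 0 0 0, (1, 1)) \<in> (\<lambda>p. (\<pi> p, \<kappa> p)) ` points (open_submanifold E (points E \<inter> \<pi> -` U))"
    by (simp only: bij_betw_def)
  then show ?thesis by (auto simp: open_submanifold_def)
qed

definition C where "C = s\<^sub>0 * h s\<^sub>0"

text \<open>Equal to s^2 times D s once s h = C is known, see \<open>D_eq\<close>. Its derivative -4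
  s^3 makes the evolution equations solvable by powers of Q.\<close>

definition Q where "Q s = C\<^sup>2 - s ^ 4"

lemma h_eq: "s \<in> I \<Longrightarrow> s * h s = C"
proof -
  assume s: "s \<in> I"
  obtain p where p: "p \<in> points E" using E_nonempty by blast
  \<comment> \<open>Both sides are squares of s h; the first coefficient equation makes the
    derivative vanish.\<close>
  have "s\<^sup>2 * (D s + s\<^sup>2) = s\<^sub>0\<^sup>2 * (D s\<^sub>0 + s\<^sub>0\<^sup>2)"
  proof (rule constant_on_I[OF _ s s0_in])
    fix s assume s: "s \<in> I"
    have "((\<lambda>s. s\<^sup>2 * (D s + s\<^sup>2)) has_real_derivative 2 * s * (D s + s\<^sup>2) + (deriv D s + 2 * s) * s\<^sup>2) (at s)"
      using g_derivative(4)[OF s] by (auto intro!: derivative_eq_intros)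
    moreover have "2 * s * (D s + s\<^sup>2) + (deriv D s + 2 * s) * s\<^sup>2 = 0"
    proof -
      have "2 * s * (D s + s\<^sup>2) + (deriv D s + 2 * s) * s\<^sup>2 = s * (2 * D s + 2 * s\<^sup>2 + s * deriv D s + 2 * s\<^sup>2)"
        by (simp add: algebra_simps power2_eq_square)
      then show ?thesis using coefficient_equations(1)[OF p s] by simp
    qed
    ultimately show "((\<lambda>s. s\<^sup>2 * (D s + s\<^sup>2)) has_real_derivative 0) (at s)" by simp
  qed
  then have "(s * h s)\<^sup>2 = C\<^sup>2" by (simp add: D C_def power_mult_distrib)
  moreover have "s * h s \<ge> 0" "C \<ge> 0" using s_pos[OF s] s_pos[OF s0_in] h(1)[OF s] h(1)[OF s0_in] by (simp_all add: C_def)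
  ultimately show ?thesis by (rule power2_eq_imp_eq)
qed

lemma C_pos: "C > 0"
  using s_pos[OF s0_in] h(1)[OF s0_in] by (simp add: C_def)

lemma D_eq: "s \<in> I \<Longrightarrow> D s = Q s / s\<^sup>2"
  using s_pos[of s] h_eq[of s] unfolding D Q_def by (auto simp: field_simps power2_eq_square power4_eq_xxxx)

lemma Q_pos: "s \<in> I \<Longrightarrow> Q s > 0"
  using D_pos[of s] s_pos[of s] by (simp add: D_eq zero_less_divide_iff)

text \<open>As D = Q / s^2 and Q' = -4 s^3, the equation says f' = (k / 3) (Q' / Q) f, so f times
  the power -k / 3 of Q is constant. It is applied with k = 1 for \<alpha>0 and with k = 2 for
  \<alpha>1 and \<alpha>2.\<close>

lemma scaling:
  assumes f: "\<And>s. s \<in> I \<Longrightarrow> (f has_real_derivative f' s) (at s)" "\<And>s. s \<in> I \<Longrightarrow> 3 * D s * f' s = - 4 * k * s * f s"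
    and s: "s \<in> I"
  shows "f s = (Q s / Q s\<^sub>0) powr (k / 3) * f s\<^sub>0"
proof -
  have "f s * Q s powr (- k / 3) = f s\<^sub>0 * Q s\<^sub>0 powr (- k / 3)"
  proof (rule constant_on_I[OF _ s s0_in])
    fix s assume s: "s \<in> I"
    note Q = Q_pos[OF s]
    have "(Q has_real_derivative - 4 * s ^ 3) (at s)"
      unfolding Q_def by (auto intro!: derivative_eq_intros)
    from DERIV_mult[OF f(1)[OF s] DERIV_chain2[OF has_real_derivative_powr[OF Q, of "- k / 3"] this]]
    have "((\<lambda>s. f s * Q s powr (- k / 3)) has_real_derivative
      f' s * Q s powr (- k / 3) + - k / 3 * Q s powr (- k / 3 - 1) * (- 4 * s ^ 3) * f s) (at s)" .
    moreover have "f' s = - 4 * k * s ^ 3 * f s / (3 * Q s)"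
      using f(2)[OF s] Q s_pos[OF s] by (simp add: D_eq[OF s] field_simps power2_eq_square power3_eq_cube)
    then have "f' s * Q s powr (- k / 3) + - k / 3 * Q s powr (- k / 3 - 1) * (- 4 * s ^ 3) * f s = 0"
      using Q by (simp add: powr_diff)
    ultimately show "((\<lambda>s. f s * Q s powr (- k / 3)) has_real_derivative 0) (at s)" by simp
  qed
  then show ?thesis
    using Q_pos[OF s] Q_pos[OF s0_in] by (simp add: powr_minus powr_divide field_simps)
qed

abbreviation r where "r s \<equiv> (Q s / Q s\<^sub>0) powr (1/3)"

lemma r_pos: "s \<in> I \<Longrightarrow> r s > 0"
  using Q_pos[of s] Q_pos[OF s0_in] by simp

lemma powr_two_thirds: "(x::real) powr (2/3) = (x powr (1/3))\<^sup>2"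
  by (simp add: power2_eq_square powr_add[symmetric])

lemma Q_r: "s \<in> I \<Longrightarrow> Q s = Q s\<^sub>0 * r s ^ 3"
proof -
  assume s: "s \<in> I"
  have "r s ^ 3 = (Q s / Q s\<^sub>0) powr 1"
    by (simp add: power3_eq_cube powr_add[symmetric])
  then show ?thesis using Q_pos[OF s] Q_pos[OF s0_in] by simp
qed

lemma comb_scaling:
  assumes s: "s \<in> I"
  shows "comb \<alpha>0 s p X = r s * comb \<alpha>0 s\<^sub>0 p X" "comb \<alpha>1 s p X = (r s)\<^sup>2 * comb \<alpha>1 s\<^sub>0 p X" "comb \<alpha>2 s p X = (r s)\<^sup>2 * comb \<alpha>2 s\<^sub>0 p X"
proof -
  obtain p0 where p0: "p0 \<in> points E" using E_nonempty by blast
  note ce = coefficient_equations[OF p0]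
  have 0: "lc1 (\<alpha>0 s) = r s * lc1 (\<alpha>0 s\<^sub>0)" "lc2 (\<alpha>0 s) = r s * lc2 (\<alpha>0 s\<^sub>0)" "lc3 (\<alpha>0 s) = r s * lc3 (\<alpha>0 s\<^sub>0)"
    using scaling[OF coefficient_derivative(1)[OF alpha_smooth(1)] _ s, of 1] scaling[OF coefficient_derivative(2)[OF alpha_smooth(1)] _ s, of 1]
      scaling[OF coefficient_derivative(3)[OF alpha_smooth(1)] _ s, of 1] ce(2-4) by simp_all
  have 1: "lc1 (\<alpha>1 s) = (r s)\<^sup>2 * lc1 (\<alpha>1 s\<^sub>0)" "lc2 (\<alpha>1 s) = (r s)\<^sup>2 * lc2 (\<alpha>1 s\<^sub>0)"
    using scaling[OF coefficient_derivative(1)[OF alpha_smooth(2)] _ s, of 2] scaling[OF coefficient_derivative(2)[OF alpha_smooth(2)] _ s, of 2]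
      ce(5,6) by (simp_all add: powr_two_thirds)
  have 2: "lc1 (\<alpha>2 s) = (r s)\<^sup>2 * lc1 (\<alpha>2 s\<^sub>0)" "lc2 (\<alpha>2 s) = (r s)\<^sup>2 * lc2 (\<alpha>2 s\<^sub>0)"
    using scaling[OF coefficient_derivative(1)[OF alpha_smooth(3)] _ s, of 2] scaling[OF coefficient_derivative(2)[OF alpha_smooth(3)] _ s, of 2]
      ce(7,8) by (simp_all add: powr_two_thirds)
  show "comb \<alpha>0 s p X = r s * comb \<alpha>0 s\<^sub>0 p X" "comb \<alpha>1 s p X = (r s)\<^sup>2 * comb \<alpha>1 s\<^sub>0 p X" "comb \<alpha>2 s p X = (r s)\<^sup>2 * comb \<alpha>2 s\<^sub>0 p X"
    unfolding comb_def 0 1 2 lc3_zero(1,2)[OF p0 s] lc3_zero(1,2)[OF p0 s0_in] by (simp_all only: algebra_simps)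
qed

text \<open>In \<open>curvature\<close> the factor s D is Q / s, hence proportional to r^3 / s, and
  the wedge products of \<alpha>1 or \<alpha>2 with \<alpha>0 are proportional to r^3 as well. These
  powers cancel, so s times the metric coefficients satisfies a linear system with constant entries
  and constant right side.\<close>

lemma g_scaling:
  assumes s: "s \<in> I"
  shows "s * gUU s = s\<^sub>0 * gUU s\<^sub>0" "s * gUV s = s\<^sub>0 * gUV s\<^sub>0" "s * gVV s = s\<^sub>0 * gVV s\<^sub>0"
proof -
  obtain p where p: "p \<in> points E" using E_nonempty by blast
  obtain v1 v2 v3 where v: "v1 \<in> tangent_space E p" "v2 \<in> tangent_space E p" "v3 \<in> tangent_space E p"
    "eta1 \<pi> p v1 = 1" "eta1 \<pi> p v2 = 0" "eta1 \<pi> p v3 = 0"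
    "eta2 \<pi> p v1 = 0" "eta2 \<pi> p v2 = 1" "eta2 \<pi> p v3 = 0"
    "eta3 \<pi> p v1 = 0" "eta3 \<pi> p v2 = 0" "eta3 \<pi> p v3 = 1"
    using frame[OF p s0_in] by metis
  define c0 where "c0 = lc3 (\<alpha>0 s\<^sub>0)"
  define a1 where "a1 = lc1 (\<alpha>1 s\<^sub>0)" define a2 where "a2 = lc2 (\<alpha>1 s\<^sub>0)"
  define b1 where "b1 = lc1 (\<alpha>2 s\<^sub>0)" define b2 where "b2 = lc2 (\<alpha>2 s\<^sub>0)"
  have nz: "c0 \<noteq> 0" "a1 * b2 - a2 * b1 \<noteq> 0"
    using lc3_zero(4,5)[OF p s0_in] by (simp_all add: c0_def a1_def a2_def b1_def b2_def)
  have W: "W2 (comb \<alpha>1 s p) (comb \<alpha>0 s p) v1 v3 = r s ^ 3 * (a1 * c0)" "W2 (comb \<alpha>1 s p) (comb \<alpha>0 s p) v2 v3 = r s ^ 3 * (a2 * c0)"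
    "W2 (comb \<alpha>2 s p) (comb \<alpha>0 s p) v1 v3 = r s ^ 3 * (b1 * c0)" "W2 (comb \<alpha>2 s p) (comb \<alpha>0 s p) v2 v3 = r s ^ 3 * (b2 * c0)"
    if s: "s \<in> I" for s
    unfolding W2_def comb_scaling[OF s]
    by (simp_all add: comb_def v lc3_zero(1,2)[OF p s0_in] c0_def a1_def a2_def b1_def b2_def power2_eq_square power3_eq_cube)
  define e1 where "e1 v = ext_deriv E (\<theta>1 s\<^sub>0) p [v, v3]" for v
  define e2 where "e2 v = ext_deriv E (\<theta>2 s\<^sub>0) p [v, v3]" for v
  have sD: "s * D s * s = Q s\<^sub>0 * r s ^ 3" if s: "s \<in> I" for s
    using D_eq[OF s] Q_r[OF s] s_pos[OF s] by (simp add: power2_eq_square)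
  have *: "Q s\<^sub>0 * e = k * (s * g1 * (a * c0) + s * g2 * (b * c0))" if s: "s \<in> I" and e: "s * D s * e = k * (g1 * (r s ^ 3 * (a * c0)) + g2 * (r s ^ 3 * (b * c0)))"
    for s e g1 g2 a b k
  proof -
    have "r s ^ 3 * (Q s\<^sub>0 * e) = s * (s * D s * e)" using sD[OF s] by (simp add: algebra_simps)
    also have "\<dots> = r s ^ 3 * (k * (s * g1 * (a * c0) + s * g2 * (b * c0)))" unfolding e by (simp only: algebra_simps)
    finally show ?thesis using r_pos[OF s] by simp
  qed
  have eq: "Q s\<^sub>0 * e1 v1 = - 3 * (s * gUV s * (a1 * c0) + s * gVV s * (b1 * c0))" "Q s\<^sub>0 * e1 v2 = - 3 * (s * gUV s * (a2 * c0) + s * gVV s * (b2 * c0))"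
    "Q s\<^sub>0 * e2 v1 = 3 * (s * gUU s * (a1 * c0) + s * gUV s * (b1 * c0))" "Q s\<^sub>0 * e2 v2 = 3 * (s * gUU s * (a2 * c0) + s * gUV s * (b2 * c0))"
    if s: "s \<in> I" for s
    using *[OF s curvature(1)[OF p s v(1) v(3), unfolded W[OF s], folded e1_def]] *[OF s curvature(1)[OF p s v(2) v(3), unfolded W[OF s], folded e1_def]]
      *[OF s curvature(2)[OF p s v(1) v(3), unfolded W[OF s], folded e2_def]] *[OF s curvature(2)[OF p s v(2) v(3), unfolded W[OF s], folded e2_def]]
    by simp_all
  \<comment> \<open>The determinant of this homogeneous system is c0^2 times a minor, and both are
    nonzero by \<open>lc3_zero\<close>.\<close>
  have solve: "x = 0" "y = 0" if "x * (a1 * c0) + y * (b1 * c0) = 0" "x * (a2 * c0) + y * (b2 * c0) = 0" for x y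
  proof -
    have "(x * a1 + y * b1) * c0 = 0" "(x * a2 + y * b2) * c0 = 0" using that by (simp_all add: algebra_simps)
    then have l: "x * a1 + y * b1 = 0" "x * a2 + y * b2 = 0" using nz(1) by auto
    have "x * (a1 * b2 - a2 * b1) = 0" "y * (a1 * b2 - a2 * b1) = 0" using l by algebra+
    then show "x = 0" "y = 0" using nz(2) by auto
  qed
  let ?dUU = "s * gUU s - s\<^sub>0 * gUU s\<^sub>0" and ?dUV = "s * gUV s - s\<^sub>0 * gUV s\<^sub>0" and ?dVV = "s * gVV s - s\<^sub>0 * gVV s\<^sub>0"
  have 1: "?dUV * (a1 * c0) + ?dVV * (b1 * c0) = 0" using eq(1)[OF s] eq(1)[OF s0_in] by algebra
  have 2: "?dUV * (a2 * c0) + ?dVV * (b2 * c0) = 0" using eq(2)[OF s] eq(2)[OF s0_in] by algebra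
  have 3: "?dUU * (a1 * c0) + ?dUV * (b1 * c0) = 0" using eq(3)[OF s] eq(3)[OF s0_in] by algebra
  have 4: "?dUU * (a2 * c0) + ?dUV * (b2 * c0) = 0" using eq(4)[OF s] eq(4)[OF s0_in] by algebra
  from solve[OF 1 2] solve[OF 3 4]
  show "s * gUU s = s\<^sub>0 * gUU s\<^sub>0" "s * gUV s = s\<^sub>0 * gUV s\<^sub>0" "s * gVV s = s\<^sub>0 * gVV s\<^sub>0" by simp_all
qed

end

section \<open>The normal form\<close>

text \<open>The wedge product of a one-form a with a two-form w. Since w has even degree, it serves
  for both orders of the factors.\<close>

definition V :: "('v \<Rightarrow> real) \<Rightarrow> ('v \<Rightarrow> 'v \<Rightarrow> real) \<Rightarrow> 'v \<Rightarrow> 'v \<Rightarrow> 'v \<Rightarrow> real" where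
  "V a w X Y Z = a X * w Y Z - a Y * w X Z + a Z * w X Y"

text \<open>With x z = 1 the forms z u1 - y u2 and x u2 invert the change u1 = x t1 + y t2, u2 = z
  t2; the invariant forms change likewise, up to the factor c. The first three combinations are
  invariant under such unimodular changes. In the last one the matrix with entries x^2, x y, y^2 +
  z^2 is the transpose of the change of frame times the change itself, so it becomes the
  identity.\<close>

lemma W2_frame:
  assumes xz: "x * z = (1::real)"
  shows "W2 (\<lambda>v. z * u1 v - y * u2 v) (\<lambda>v. x * u2 v) X Y = W2 u1 u2 X Y"
    and "W2 (\<lambda>v. z * u1 v - y * u2 v) (\<lambda>v. c * (x * b2 v)) X Y - W2 (\<lambda>v. x * u2 v) (\<lambda>v. c * (z * b1 v - y * b2 v)) X Y
      = c * (W2 u1 b2 X Y - W2 u2 b1 X Y)"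
    and "W2 (\<lambda>v. c * (z * b1 v - y * b2 v)) (\<lambda>v. c * (x * b2 v)) X Y = c\<^sup>2 * W2 b1 b2 X Y"
    and "k * x\<^sup>2 * W2 (\<lambda>v. z * u1 v - y * u2 v) (\<lambda>v. c * (z * b1 v - y * b2 v)) X Y
      + k * (x * y) * W2 (\<lambda>v. z * u1 v - y * u2 v) (\<lambda>v. c * (x * b2 v)) X Y
      + k * (x * y) * W2 (\<lambda>v. x * u2 v) (\<lambda>v. c * (z * b1 v - y * b2 v)) X Y
      + k * (y\<^sup>2 + z\<^sup>2) * W2 (\<lambda>v. x * u2 v) (\<lambda>v. c * (x * b2 v)) X Y = k * c * (W2 u1 b1 X Y + W2 u2 b2 X Y)"
  unfolding W2_def using xz by algebra+

lemma W3_V: "W3 a b c X Y Z = V a (W2 b c) X Y Z"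
  by (simp add: W3_def V_def)

lemma W3_V': "W3 a b c X Y Z = V c (W2 a b) X Y Z"
  by (simp add: W3_def V_def W2_def algebra_simps)

lemma sig_frame:
  assumes xz: "x * z = (1::real)"
  shows "sig s D S (\<lambda>v. z * u1 v - y * u2 v) (\<lambda>v. x * u2 v) (\<lambda>v. d * b0 v) (\<lambda>v. c * (z * b1 v - y * b2 v)) (\<lambda>v. c * (x * b2 v)) X Y =
    d / (3 * D) * W2 S b0 X Y + s * W2 u1 u2 X Y + c * (W2 u2 b1 X Y - W2 u1 b2 X Y) - s * c\<^sup>2 / D * W2 b1 b2 X Y"
proof -
  let ?t1 = "\<lambda>v. z * u1 v - y * u2 v" and ?t2 = "\<lambda>v. x * u2 v" and ?a1 = "\<lambda>v. c * (z * b1 v - y * b2 v)" and ?a2 = "\<lambda>v. c * (x * b2 v)"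
  have "sig s D S ?t1 ?t2 (\<lambda>v. d * b0 v) ?a1 ?a2 X Y = 1 / (3 * D) * W2 S (\<lambda>v. d * b0 v) X Y + s * W2 ?t1 ?t2 X Y
    - (W2 ?t1 ?a2 X Y - W2 ?t2 ?a1 X Y) - s / D * W2 ?a1 ?a2 X Y"
    unfolding sig_def by simp
  also have "W2 S (\<lambda>v. d * b0 v) X Y = d * W2 S b0 X Y" by (simp add: W2_def algebra_simps)
  finally show ?thesis unfolding W2_frame[OF xz] by (simp add: algebra_simps)
qed

lemma psip_V:
  "psip s D gUU gUV gVV S t1 t2 a0 a1 a2 X Y Z =
    1 / (3 * D) * V S (\<lambda>v w. D * W2 t1 t2 v w + s * (W2 t1 a2 v w - W2 t2 a1 v w) - W2 a1 a2 v w) X Y Z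
    - 1 / D * V a0 (\<lambda>v w. gUU * W2 t1 a1 v w + gUV * W2 t1 a2 v w + gUV * W2 t2 a1 v w + gVV * W2 t2 a2 v w) X Y Z"
  unfolding psip_def W3_V[of S] W3_V'[of _ _ a0] V_def by (simp add: algebra_simps)

lemma psim_V:
  "psim s D gUU gUV gVV S t1 t2 a0 a1 a2 X Y Z =
    1 / (3 * D) * V S (\<lambda>v w. gUU * W2 t1 a1 v w + gUV * W2 t1 a2 v w + gUV * W2 t2 a1 v w + gVV * W2 t2 a2 v w) X Y Z
    + 1 / D * V a0 (\<lambda>v w. D * W2 t1 t2 v w + s * (W2 t1 a2 v w - W2 t2 a1 v w) - W2 a1 a2 v w) X Y Z"
  unfolding psim_def W3_V[of S] W3_V'[of _ _ a0] V_def by (simp add: algebra_simps)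

lemma psi_frame:
  assumes xz: "x * z = (1::real)" and D: "D \<noteq> 0"
  shows "psip s D (k * x\<^sup>2) (k * (x * y)) (k * (y\<^sup>2 + z\<^sup>2)) S (\<lambda>v. z * u1 v - y * u2 v) (\<lambda>v. x * u2 v) (\<lambda>v. d * b0 v)
      (\<lambda>v. c * (z * b1 v - y * b2 v)) (\<lambda>v. c * (x * b2 v)) X Y Z =
    1 / 3 * V S (W2 u1 u2) X Y Z + s * c / (3 * D) * (V S (W2 u1 b2) X Y Z - V S (W2 u2 b1) X Y Z)
    - c\<^sup>2 / (3 * D) * V S (W2 b1 b2) X Y Z - k * c * d / D * (V b0 (W2 u1 b1) X Y Z + V b0 (W2 u2 b2) X Y Z)"
   and "psim s D (k * x\<^sup>2) (k * (x * y)) (k * (y\<^sup>2 + z\<^sup>2)) S (\<lambda>v. z * u1 v - y * u2 v) (\<lambda>v. x * u2 v) (\<lambda>v. d * b0 v)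
      (\<lambda>v. c * (z * b1 v - y * b2 v)) (\<lambda>v. c * (x * b2 v)) X Y Z =
    k * c / (3 * D) * (V S (W2 u1 b1) X Y Z + V S (W2 u2 b2) X Y Z) + d * V b0 (W2 u1 u2) X Y Z
    + s * c * d / D * (V b0 (W2 u1 b2) X Y Z - V b0 (W2 u2 b1) X Y Z) - c\<^sup>2 * d / D * V b0 (W2 b1 b2) X Y Z"
  unfolding psip_V psim_V W2_frame[OF xz] V_def using D
  by (simp_all add: divide_simps) (simp_all add: algebra_simps)

lemma metric_frame:
  fixes u1 u2 :: "'v \<Rightarrow> real" and x y z k :: real
  assumes xz: "x * z = (1::real)"
  defines "t1 \<equiv> \<lambda>v. z * u1 v - y * u2 v" and "t2 \<equiv> \<lambda>v. x * u2 v"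
  shows "k * x\<^sup>2 * (t1 X * t1 Y) + k * (y\<^sup>2 + z\<^sup>2) * (t2 X * t2 Y) + k * (x * y) * (t1 X * t2 Y + t2 X * t1 Y)
    = k * (u1 X * u1 Y + u2 X * u2 Y)"
  unfolding t1_def t2_def using xz by algebra

lemma wedge_V:
  assumes "of_degree T 1 a" "of_degree T 2 b" "X \<in> T" "Y \<in> T" "Z \<in> T"
  shows "(a \<^bold>\<and> b) [X, Y, Z] = V (\<lambda>X. a [X]) (\<lambda>X Y. b [X, Y]) X Y Z"
    "(b \<^bold>\<and> a) [X, Y, Z] = V (\<lambda>X. a [X]) (\<lambda>X Y. b [X, Y]) X Y Z"
  unfolding wedge_3_12[OF assms] wedge_3_21[OF assms(2,1,3-)] V_def by (simp_all add: algebra_simps)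

lemma wedge_W2:
  assumes "of_degree T 1 a" "of_degree T 1 b" "X \<in> T" "Y \<in> T"
  shows "(a \<^bold>\<and> b) [X, Y] = W2 (\<lambda>X. a [X]) (\<lambda>X. b [X]) X Y"
  unfolding wedge_2[OF assms] W2_def by simp

lemma of_degree_products:
  assumes "of_degree T 1 a" "of_degree T 1 b"
  shows "of_degree T 2 (a \<^bold>\<and> b)" "of_degree T 2 (a \<otimes> b)"
  using of_degree_wedge[OF assms] of_degree_tensor_prod[OF assms] by (simp_all add: numeral_2_eq_2)

lemma of_degree_products3:
  assumes "of_degree T 1 a" "of_degree T 2 b"
  shows "of_degree T 3 (a \<^bold>\<and> b)" "of_degree T 3 (b \<^bold>\<and> a)"
  using of_degree_wedge[OF assms] of_degree_wedge[OF assms(2,1)] by (simp_all add: numeral_3_eq_3)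

context nearly_Kaehler_over_H3
begin

text \<open>By \<open>g_scaling\<close> the matrix (s / C) g is constant, and its determinant s^2
  h^2 / C^2 is 1. Its triangular factor with rows (x, y) and (0, z) therefore has determinant one,
  that is, z = 1 / x.\<close>

lemma metric_normal_form:
  obtains x y z where "x * z = 1" "\<And>s. s \<in> I \<Longrightarrow> gUU s = C / s * x\<^sup>2" "\<And>s. s \<in> I \<Longrightarrow> gUV s = C / s * (x * y)"
    "\<And>s. s \<in> I \<Longrightarrow> gVV s = C / s * (y\<^sup>2 + z\<^sup>2)"
proof -
  let ?h = "h s\<^sub>0"
  have h0: "?h > 0" using h(1)[OF s0_in] .
  have U: "gUU s\<^sub>0 > 0" using g_pos_def[OF s0_in, of 1 0] by simp
  define x where "x = sqrt (gUU s\<^sub>0 / ?h)"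
  define y where "y = gUV s\<^sub>0 / (?h * x)"
  have x: "x > 0" "x\<^sup>2 = gUU s\<^sub>0 / ?h" using U h0 by (simp_all add: x_def)
  have xy: "x * y = gUV s\<^sub>0 / ?h" using x(1) by (simp add: y_def)
  \<comment> \<open>The last entry is forced by the determinant h^2 of the metric coefficients; the
    comparison is made after multiplication by x^2.\<close>
  have "(y\<^sup>2 + (1 / x)\<^sup>2) * x\<^sup>2 = (x * y)\<^sup>2 + 1" using x(1) by (simp add: field_simps)
  also have "\<dots> = gUU s\<^sub>0 * gVV s\<^sub>0 / ?h\<^sup>2"
    using h(2)[OF s0_in] h0 unfolding xy by (simp add: power_divide field_simps)
  also have "\<dots> = gVV s\<^sub>0 / ?h * x\<^sup>2" unfolding x(2) by (simp add: power2_eq_square)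
  finally have "(y\<^sup>2 + (1 / x)\<^sup>2) * x\<^sup>2 = gVV s\<^sub>0 / ?h * x\<^sup>2" .
  then have z: "y\<^sup>2 + (1 / x)\<^sup>2 = gVV s\<^sub>0 / ?h"
    by (rule mult_right_cancel[THEN iffD1, rotated]) (use x(1) in simp)
  have *: "g' s = C / s * m" if "s \<in> I" "s * g' s = s\<^sub>0 * g' s\<^sub>0" "m = g' s\<^sub>0 / ?h" for g' :: "real \<Rightarrow> real" and s m
    using s_pos[OF that(1)] h0 that(2,3) by (simp add: C_def field_simps)
  show ?thesis
  proof (rule that[of x "1 / x" y])
    show "x * (1 / x) = 1" using x(1) by simp
    fix s assume s: "s \<in> I"
    show "gUU s = C / s * x\<^sup>2" by (rule *[OF s g_scaling(1)[OF s] x(2)])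
    show "gUV s = C / s * (x * y)" by (rule *[OF s g_scaling(2)[OF s] xy])
    show "gVV s = C / s * (y\<^sup>2 + (1 / x)\<^sup>2)" by (rule *[OF s g_scaling(3)[OF s] z])
  qed
qed

text \<open>In the application \<alpha>0 is d times \<sigma>0, \<alpha>1 and \<alpha>2 are c times
  unimodular combinations of \<sigma>1 and \<sigma>2, and k is the factor of the fibre metric. The
  right sides are the coefficients that this substitution produces, the left sides those of the
  normal form.\<close>

lemma coefficient_identities:
  assumes s: "s \<in> I"
  defines "K \<equiv> 4 * C\<^sup>2 / Q s\<^sub>0" and "k \<equiv> C / s"
  defines "d \<equiv> r s / K" and "c \<equiv> (r s)\<^sup>2 / K"
  shows "s\<^sup>2 / (9 * Q s) = 1 / (9 * D s)"
    "s\<^sup>2 * Q s\<^sub>0 / (16 * C^4) * (Q s\<^sub>0 / Q s) powr (1/3) = d\<^sup>2 / D s"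
    "s\<^sup>2 * Q s\<^sub>0 / (16 * C^4) * (C / s * (Q s / Q s\<^sub>0) powr (1/3)) = k * c\<^sup>2 / D s"
    "s\<^sup>2 / (12 * C\<^sup>2) * (Q s\<^sub>0 / Q s) powr (2/3) = d / (3 * D s)"
    "Q s\<^sub>0 / (4 * C\<^sup>2) * (Q s / Q s\<^sub>0) powr (2/3) = c"
    "s^3 * Q s\<^sub>0 / (16 * C^4) * (Q s / Q s\<^sub>0) powr (1/3) = s * c\<^sup>2 / D s"
    "1 / 3 * (s^3 / (4 * C\<^sup>2) * (Q s\<^sub>0 / Q s) powr (1/3)) = s * c / (3 * D s)"
    "Q s\<^sub>0 / (16 * C^4) * (s\<^sup>2 / 3 * (Q s / Q s\<^sub>0) powr (1/3)) = c\<^sup>2 / (3 * D s)"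
    "Q s\<^sub>0 / (16 * C^4) * (C * s) = k * c * d / D s"
    "s / (12 * C) * (Q s\<^sub>0 / Q s) powr (1/3) = k * c / (3 * D s)"
    "Q s\<^sub>0 / (4 * C\<^sup>2) * (Q s / Q s\<^sub>0) powr (1/3) = d"
    "s\<^sup>2 * Q s\<^sub>0 / (16 * C^4) * s = s * c * d / D s"
    "s\<^sup>2 * Q s\<^sub>0 / (16 * C^4) * (Q s\<^sub>0 powr (1/3) * Q s powr (2/3) / (4 * C\<^sup>2)) = c\<^sup>2 * d / D s"
proof -
  \<comment> \<open>With Q = q R^3 and D = q R^3 / s^2 every coefficient becomes a rational
    expression in R, q, C and s.\<close>
  define R where "R = r s"
  define q where "q = Q s\<^sub>0"
  have pos: "R > 0" "q > 0" "C > 0" "s > 0"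
    using r_pos[OF s] Q_pos[OF s0_in] C_pos s_pos[OF s] by (simp_all add: R_def q_def)
  have Qs: "Q s = q * R ^ 3" using Q_r[OF s] by (simp add: R_def q_def)
  have Ds: "D s = q * R ^ 3 / s\<^sup>2" using D_eq[OF s] by (simp add: Qs)
  have inv: "Q s\<^sub>0 / Q s = inverse (Q s / Q s\<^sub>0)" by simp
  have p1: "(Q s / Q s\<^sub>0) powr (1/3) = R" by (simp add: R_def)
  have p2: "(Q s / Q s\<^sub>0) powr (2/3) = R\<^sup>2" by (simp add: R_def powr_two_thirds)
  have p3: "(Q s\<^sub>0 / Q s) powr (1/3) = 1 / R"
    unfolding inv using Q_pos[OF s] Q_pos[OF s0_in] by (simp add: R_def powr_divide)
  have p4: "(Q s\<^sub>0 / Q s) powr (2/3) = 1 / R\<^sup>2"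
    unfolding powr_two_thirds[of "Q s\<^sub>0 / Q s"] p3 by (simp add: power_divide)
  have p5: "Q s\<^sub>0 powr (1/3) * Q s powr (2/3) = q * R\<^sup>2"
  proof -
    have "Q s powr (2/3) = (Q s / Q s\<^sub>0) powr (2/3) * Q s\<^sub>0 powr (2/3)"
      using Q_pos[OF s] Q_pos[OF s0_in] by (simp add: powr_divide)
    moreover have "Q s\<^sub>0 powr (1/3) * Q s\<^sub>0 powr (2/3) = q"
      using Q_pos[OF s0_in] by (simp add: powr_add[symmetric] q_def)
    ultimately show ?thesis unfolding p2 by (simp add: ac_simps)
  qed
  show "s\<^sup>2 / (9 * Q s) = 1 / (9 * D s)" using pos by (simp add: Ds Qs)
  show "s\<^sup>2 * Q s\<^sub>0 / (16 * C^4) * (Q s\<^sub>0 / Q s) powr (1/3) = d\<^sup>2 / D s"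
    "s\<^sup>2 * Q s\<^sub>0 / (16 * C^4) * (C / s * (Q s / Q s\<^sub>0) powr (1/3)) = k * c\<^sup>2 / D s"
    "s\<^sup>2 / (12 * C\<^sup>2) * (Q s\<^sub>0 / Q s) powr (2/3) = d / (3 * D s)"
    "Q s\<^sub>0 / (4 * C\<^sup>2) * (Q s / Q s\<^sub>0) powr (2/3) = c"
    "s^3 * Q s\<^sub>0 / (16 * C^4) * (Q s / Q s\<^sub>0) powr (1/3) = s * c\<^sup>2 / D s"
    "1 / 3 * (s^3 / (4 * C\<^sup>2) * (Q s\<^sub>0 / Q s) powr (1/3)) = s * c / (3 * D s)"
    "Q s\<^sub>0 / (16 * C^4) * (s\<^sup>2 / 3 * (Q s / Q s\<^sub>0) powr (1/3)) = c\<^sup>2 / (3 * D s)"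
    "Q s\<^sub>0 / (16 * C^4) * (C * s) = k * c * d / D s"
    "s / (12 * C) * (Q s\<^sub>0 / Q s) powr (1/3) = k * c / (3 * D s)"
    "Q s\<^sub>0 / (4 * C\<^sup>2) * (Q s / Q s\<^sub>0) powr (1/3) = d"
    "s\<^sup>2 * Q s\<^sub>0 / (16 * C^4) * s = s * c * d / D s"
    "s\<^sup>2 * Q s\<^sub>0 / (16 * C^4) * (Q s\<^sub>0 powr (1/3) * Q s powr (2/3) / (4 * C\<^sup>2)) = c\<^sup>2 * d / D s"
    unfolding d_def c_def k_def K_def Ds unfolding p1 p2 p3 p4 p5 unfolding q_def[symmetric]
    using pos by (simp_all add: field_simps power2_eq_square power3_eq_cube power4_eq_xxxx)
qed


section \<open>Assembling the normal form of the four tensors\<close>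

lemma field_eq_M_by_degree:
  assumes "\<And>p s. p \<in> points E \<Longrightarrow> s \<in> I \<Longrightarrow> of_degree (tangent_space M (p, s)) k (\<omega> (p, s))"
    and "\<And>p s. p \<in> points E \<Longrightarrow> s \<in> I \<Longrightarrow> of_degree (tangent_space M (p, s)) k (\<eta> (p, s))"
    and "\<And>p s Xs. p \<in> points E \<Longrightarrow> s \<in> I \<Longrightarrow> Xs \<in> lists (tangent_space M (p, s)) \<Longrightarrow> length Xs = k \<Longrightarrow> \<omega> (p, s) Xs = \<eta> (p, s) Xs"
  shows "field_eq M \<omega> \<eta>"
proof (rule field_eq_by_degree[where k=k])
  fix q assume "q \<in> points M"
  then obtain p s where q: "q = (p, s)" "p \<in> points E" "s \<in> I" by (auto simp: points_M)
  show "of_degree (tangent_space M q) k (\<omega> q)" "of_degree (tangent_space M q) k (\<eta> q)"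
    unfolding q(1) by (rule assms(1,2)[OF q(2,3)])+
  show "\<omega> q Xs = \<eta> q Xs" if "Xs \<in> lists (tangent_space M q)" "length Xs = k" for Xs
    using assms(3)[OF q(2,3)] that unfolding q(1) by blast
qed

lemma given_degrees:
  assumes "p \<in> points E" "s \<in> I"
  shows "of_degree (tangent_space M (p, s)) 2 (g (p, s))" "of_degree (tangent_space M (p, s)) 2 (\<sigma> (p, s))"
    "of_degree (tangent_space M (p, s)) 3 (\<psi>p (p, s))" "of_degree (tangent_space M (p, s)) 3 (\<psi>m (p, s))"
proof -
  have q: "(p, s) \<in> points M" using assms by (simp add: points_M)
  have "tensor_field M 2 g" "tensor_field M 2 \<sigma>" "tensor_field M 3 \<psi>p" "tensor_field M 3 \<psi>m"
    using nearly_Kaehler by (auto simp: nearly_Kaehler_def SU3_structure_def riemannian_metric_def diff_form_def)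
  then show "of_degree (tangent_space M (p, s)) 2 (g (p, s))" "of_degree (tangent_space M (p, s)) 2 (\<sigma> (p, s))"
    "of_degree (tangent_space M (p, s)) 3 (\<psi>p (p, s))" "of_degree (tangent_space M (p, s)) 3 (\<psi>m (p, s))"
    using q by (auto simp: tensor_field_def intro: multilinear_on_of_degree)
qed

lemma g_value_general:
  assumes p: "p \<in> points E" "s \<in> I" and X: "X \<in> tangent_space M (p, s)" "Y \<in> tangent_space M (p, s)"
  shows "g (p, s) [X, Y] = 1 / (9 * D s) * (ds (p, s) [X] * ds (p, s) [Y])
    + (gUU s * (t1 (p, s) [X] * t1 (p, s) [Y]) + gVV s * (t2 (p, s) [X] * t2 (p, s) [Y])
       + gUV s * (t1 (p, s) [X] * t2 (p, s) [Y] + t2 (p, s) [X] * t1 (p, s) [Y]))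
    + 1 / D s * (a0 (p, s) [X] * a0 (p, s) [Y] + (gUU s * (a1 (p, s) [X] * a1 (p, s) [Y]) + gVV s * (a2 (p, s) [X] * a2 (p, s) [Y])
       + gUV s * (a1 (p, s) [X] * a2 (p, s) [Y] + a2 (p, s) [X] * a1 (p, s) [Y])))"
proof -
  have q: "(p, s) \<in> points M" using p by (simp add: points_M)
  note o = of_degree_1[OF p]
  have l: "[X, Y] \<in> lists (tangent_space M (p, s))" using X by simp
  show ?thesis
    unfolding g_eq[unfolded field_eq_def, rule_format, OF q l]
    by (simp add: Let_def scale_apply tensor_prod_2[OF o(1) o(1) X] tensor_prod_2[OF o(2) o(2) X] tensor_prod_2[OF o(3) o(3) X]
        tensor_prod_2[OF o(4) o(4) X] tensor_prod_2[OF o(5) o(5) X] tensor_prod_2[OF o(6) o(6) X]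
        tensor_prod_2[OF o(2) o(3) X] tensor_prod_2[OF o(3) o(2) X] tensor_prod_2[OF o(5) o(6) X] tensor_prod_2[OF o(6) o(5) X])
qed

lemma standard_form:
  shows "\<exists>\<sigma>0 \<sigma>1 \<sigma>2. \<exists>A::real^2^2.
    left_invariant_basis \<sigma>0 \<sigma>1 \<sigma>2 \<and>
    field_eq H3 (ext_deriv H3 \<sigma>0) (\<lambda>p. \<sigma>1 p \<^bold>\<and> \<sigma>2 p) \<and>
    field_eq H3 (ext_deriv H3 \<sigma>1) (\<lambda>p. 0) \<and>
    field_eq H3 (ext_deriv H3 \<sigma>2) (\<lambda>p. 0) \<and>
    det A = 1 \<and>
    (let u1 = pullback_family E fst (\<lambda>s p. A$1$1 \<odot> \<theta>1 s p + A$1$2 \<odot> \<theta>2 s p);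
         u2 = pullback_family E fst (\<lambda>s p. A$2$1 \<odot> \<theta>1 s p + A$2$2 \<odot> \<theta>2 s p);
         b0 = pullback H3 (\<pi> \<circ> fst) \<sigma>0; b1 = pullback H3 (\<pi> \<circ> fst) \<sigma>1; b2 = pullback H3 (\<pi> \<circ> fst) \<sigma>2;
         Q = (\<lambda>s. C\<^sup>2 - s^4); Q0 = C\<^sup>2 - s\<^sub>0^4
     in
       field_eq M g (\<lambda>q. let s = snd q in
         (s\<^sup>2 / (9 * Q s)) \<odot> tsquare (ds q)
         + (C / s) \<odot> (tsquare (u1 q) + tsquare (u2 q))
         + (s\<^sup>2 * Q0 / (16 * C^4)) \<odot>
             ((Q0 / Q s) powr (1/3) \<odot> tsquare (b0 q)
              + (C / s * (Q s / Q0) powr (1/3)) \<odot> (tsquare (b1 q) + tsquare (b2 q)))) \<and>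
       field_eq M \<sigma> (\<lambda>q. let s = snd q in
         (s\<^sup>2 / (12 * C\<^sup>2) * (Q0 / Q s) powr (2/3)) \<odot> (ds q \<^bold>\<and> b0 q)
         + s \<odot> (u1 q \<^bold>\<and> u2 q)
         + (Q0 / (4 * C\<^sup>2) * (Q s / Q0) powr (2/3)) \<odot> (u2 q \<^bold>\<and> b1 q - u1 q \<^bold>\<and> b2 q)
         - (s^3 * Q0 / (16 * C^4) * (Q s / Q0) powr (1/3)) \<odot> (b1 q \<^bold>\<and> b2 q)) \<and>
       field_eq M \<psi>p (\<lambda>q. let s = snd q in
         (1/3) \<odot> (ds q \<^bold>\<and> (u1 q \<^bold>\<and> u2 q
           + (s^3 / (4 * C\<^sup>2) * (Q0 / Q s) powr (1/3)) \<odot> (u1 q \<^bold>\<and> b2 q - u2 q \<^bold>\<and> b1 q)))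
         - (Q0 / (16 * C^4)) \<odot>
             ((s\<^sup>2 / 3 * (Q s / Q0) powr (1/3)) \<odot> (ds q \<^bold>\<and> b1 q \<^bold>\<and> b2 q)
              + (C * s) \<odot> ((u1 q \<^bold>\<and> b1 q + u2 q \<^bold>\<and> b2 q) \<^bold>\<and> b0 q))) \<and>
       field_eq M \<psi>m (\<lambda>q. let s = snd q in
         (s / (12 * C) * (Q0 / Q s) powr (1/3)) \<odot> (ds q \<^bold>\<and> (u1 q \<^bold>\<and> b1 q + u2 q \<^bold>\<and> b2 q))
         + (Q0 / (4 * C\<^sup>2) * (Q s / Q0) powr (1/3)) \<odot> (u1 q \<^bold>\<and> u2 q \<^bold>\<and> b0 q)
         + (s\<^sup>2 * Q0 / (16 * C^4)) \<odot>
             ((s \<odot> (u1 q \<^bold>\<and> b2 q - u2 q \<^bold>\<and> b1 q)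
               - (Q0 powr (1/3) * Q s powr (2/3) / (4 * C\<^sup>2)) \<odot> (b1 q \<^bold>\<and> b2 q)) \<^bold>\<and> b0 q)))"
proof -
  obtain x y z where xz: "x * z = 1" and G: "\<And>s. s \<in> I \<Longrightarrow> gUU s = C / s * x\<^sup>2" "\<And>s. s \<in> I \<Longrightarrow> gUV s = C / s * (x * y)"
    "\<And>s. s \<in> I \<Longrightarrow> gVV s = C / s * (y\<^sup>2 + z\<^sup>2)"
    using metric_normal_form by metis
  obtain p0 where p0: "p0 \<in> points E" using E_nonempty by blast
  \<comment> \<open>The factor 4 h^2 / (h^2 - s^2) in d\<alpha>0 at \<open>s\<^sub>0\<close>,
    expressed by C. Multiplying all three forms by K turns d\<alpha>0 = K \<alpha>1 \<and> \<alpha>2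
    into the equation without a factor.\<close>
  define K where "K = 4 * C\<^sup>2 / Q s\<^sub>0"
  have K: "K > 0" using C_pos Q_pos[OF s0_in] by (simp add: K_def)
  \<comment> \<open>The same matrix acts on the connection forms and, up to the factor K, on
    \<alpha>1 and \<alpha>2; this preserves their mixed term in \<sigma>.\<close>
  define A :: "real^2^2" where "A = vector [vector [x, y], vector [0, z]]"
  have A: "A$1$1 = x" "A$1$2 = y" "A$2$1 = 0" "A$2$2 = z" by (simp_all add: A_def)
  have detA: "det A = 1" using xz by (simp add: det_2 A)
  define \<sigma>0 where "\<sigma>0 = (\<lambda>p. K \<odot> \<alpha>0 s\<^sub>0 p)"
  define \<sigma>1 where "\<sigma>1 = (\<lambda>p. (K * x) \<odot> \<alpha>1 s\<^sub>0 p + (K * y) \<odot> \<alpha>2 s\<^sub>0 p)"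
  define \<sigma>2 where "\<sigma>2 = (\<lambda>p. (K * z) \<odot> \<alpha>2 s\<^sub>0 p)"
  have basis: "left_invariant_basis \<sigma>0 \<sigma>1 \<sigma>2"
    unfolding \<sigma>0_def \<sigma>1_def \<sigma>2_def by (rule left_invariant_basis_transform[OF alpha_basis[OF s0_in] _ xz]) (use K in simp)
  have li: "left_invariant \<sigma>0" "left_invariant \<sigma>1" "left_invariant \<sigma>2"
    using basis by (auto simp: left_invariant_basis_def)
  have lc: "lc3 \<sigma>0 = K * lc3 (\<alpha>0 s\<^sub>0)" "lc1 \<sigma>1 = K * (x * lc1 (\<alpha>1 s\<^sub>0) + y * lc1 (\<alpha>2 s\<^sub>0))" "lc2 \<sigma>1 = K * (x * lc2 (\<alpha>1 s\<^sub>0) + y * lc2 (\<alpha>2 s\<^sub>0))"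
    "lc3 \<sigma>1 = 0" "lc1 \<sigma>2 = K * z * lc1 (\<alpha>2 s\<^sub>0)" "lc2 \<sigma>2 = K * z * lc2 (\<alpha>2 s\<^sub>0)" "lc3 \<sigma>2 = 0"
    using lc3_zero(1,2)[OF p0 s0_in]
    by (simp_all add: lc1_def lc2_def lc3_def \<sigma>0_def \<sigma>1_def \<sigma>2_def scale_apply algebra_simps)
  \<comment> \<open>This is the relation for d\<alpha>0 at \<open>s\<^sub>0\<close>, rewritten with
    K D = 4 h^2. The change of \<alpha>1 and \<alpha>2 contributes the determinant x z = 1.\<close>
  have lc3: "lc3 \<sigma>0 = - (lc1 \<sigma>1 * lc2 \<sigma>2 - lc2 \<sigma>1 * lc1 \<sigma>2)"
  proof -
    have "D s\<^sub>0 * s\<^sub>0\<^sup>2 = Q s\<^sub>0" using D_eq[OF s0_in] s_pos[OF s0_in] by simp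
    moreover have "(D s\<^sub>0 + s\<^sub>0\<^sup>2) * s\<^sub>0\<^sup>2 = C\<^sup>2" by (simp add: D C_def power_mult_distrib)
    moreover have "K * Q s\<^sub>0 = 4 * C\<^sup>2" using Q_pos[OF s0_in] by (simp add: K_def)
    ultimately have "K * (D s\<^sub>0 * s\<^sub>0\<^sup>2) = 4 * ((D s\<^sub>0 + s\<^sub>0\<^sup>2) * s\<^sub>0\<^sup>2)" by (simp only:)
    then have "K * D s\<^sub>0 * s\<^sub>0\<^sup>2 = 4 * (D s\<^sub>0 + s\<^sub>0\<^sup>2) * s\<^sub>0\<^sup>2" by (simp only: mult.assoc)
    then have "K * D s\<^sub>0 = 4 * (D s\<^sub>0 + s\<^sub>0\<^sup>2)"
      by (rule mult_right_cancel[THEN iffD1, rotated]) (use s_pos[OF s0_in] in simp)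
    then have "D s\<^sub>0 * lc3 (\<alpha>0 s\<^sub>0) = D s\<^sub>0 * (- K * (lc1 (\<alpha>1 s\<^sub>0) * lc2 (\<alpha>2 s\<^sub>0) - lc2 (\<alpha>1 s\<^sub>0) * lc1 (\<alpha>2 s\<^sub>0)))"
      using lc3_zero(3)[OF p0 s0_in] by algebra
    then have "lc3 (\<alpha>0 s\<^sub>0) = - K * (lc1 (\<alpha>1 s\<^sub>0) * lc2 (\<alpha>2 s\<^sub>0) - lc2 (\<alpha>1 s\<^sub>0) * lc1 (\<alpha>2 s\<^sub>0))"
      by (rule mult_left_cancel[THEN iffD1, rotated]) (use D_pos[OF s0_in] in simp)
    then show ?thesis unfolding lc using xz by algebra
  qed
  note st = structure_equations[OF li lc(4,7) lc3]
  let ?u1 = "pullback_family E fst (\<lambda>s p. A$1$1 \<odot> \<theta>1 s p + A$1$2 \<odot> \<theta>2 s p)"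
  let ?u2 = "pullback_family E fst (\<lambda>s p. A$2$1 \<odot> \<theta>1 s p + A$2$2 \<odot> \<theta>2 s p)"
  let ?b0 = "pullback H3 (\<pi> \<circ> fst) \<sigma>0" and ?b1 = "pullback H3 (\<pi> \<circ> fst) \<sigma>1" and ?b2 = "pullback H3 (\<pi> \<circ> fst) \<sigma>2"
  let ?T = "\<lambda>p s. tangent_space M (p, s)"
  have u: "?u1 (p, s) = x \<odot> t1 (p, s) + y \<odot> t2 (p, s)" "?u2 (p, s) = 0 \<odot> t1 (p, s) + z \<odot> t2 (p, s)" for p s
    by (auto simp: fun_eq_iff pullback_family_def pullback_def t A scale_apply)
  \<comment> \<open>Inverts A by means of x z = 1.\<close>
  have tu: "t1 (p, s) [X] = z * ?u1 (p, s) [X] - y * ?u2 (p, s) [X]" "t2 (p, s) [X] = x * ?u2 (p, s) [X]" for p s X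
    unfolding u using xz by (simp_all add: scale_apply) algebra+
  \<comment> \<open>At s the invariant forms are r or r^2 times those at \<open>s\<^sub>0\<close>,
    from which \<sigma>0, \<sigma>1, \<sigma>2 are built. Division by K undoes the normalisation,
    and z, -y, x are the entries of the inverse of A.\<close>
  have ab: "a0 (p, s) [X] = r s / K * ?b0 (p, s) [X]" "a1 (p, s) [X] = (r s)\<^sup>2 / K * (z * ?b1 (p, s) [X] - y * ?b2 (p, s) [X])"
    "a2 (p, s) [X] = (r s)\<^sup>2 / K * (x * ?b2 (p, s) [X])"
    if p: "p \<in> points E" and s: "s \<in> I" and X: "X \<in> ?T p s" for p s X
  proof -
    have "(p, s) \<in> points M" using p s by (simp add: points_M)
    from pushforward_in_tangent_space[OF charted_M charted_E smooth_fst this X]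
    have Y: "pushforward E fst (p, s) X \<in> tangent_space E p" by simp
    note e = left_invariant_eta[OF charted_E smooth_pi _ p Y]
    have b: "?b0 (p, s) [X] = K * comb \<alpha>0 s\<^sub>0 p (pushforward E fst (p, s) X)"
      "?b1 (p, s) [X] = K * (x * comb \<alpha>1 s\<^sub>0 p (pushforward E fst (p, s) X) + y * comb \<alpha>2 s\<^sub>0 p (pushforward E fst (p, s) X))"
      "?b2 (p, s) [X] = K * z * comb \<alpha>2 s\<^sub>0 p (pushforward E fst (p, s) X)"
      using e[OF alpha_invariant(1)[OF s0_in]] e[OF alpha_invariant(2)[OF s0_in]] e[OF alpha_invariant(3)[OF s0_in]]
      by (simp_all add: pullback_def pushforward_pi_fst[OF p] \<sigma>0_def \<sigma>1_def \<sigma>2_def scale_apply comb_def algebra_simps)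
    show "a0 (p, s) [X] = r s / K * ?b0 (p, s) [X]"
      using K unfolding b a_value[OF p s X] comb_scaling[OF s] by simp
    have "x * z * v = v" for v using xz by simp
    then show "a1 (p, s) [X] = (r s)\<^sup>2 / K * (z * ?b1 (p, s) [X] - y * ?b2 (p, s) [X])" "a2 (p, s) [X] = (r s)\<^sup>2 / K * (x * ?b2 (p, s) [X])"
      using K unfolding b a_value[OF p s X] comb_scaling[OF s] by (simp_all add: field_simps)
  qed
  have o: "of_degree (?T p s) 1 (ds (p, s))" "of_degree (?T p s) 1 (?u1 (p, s))" "of_degree (?T p s) 1 (?u2 (p, s))"
    "of_degree (?T p s) 1 (?b0 (p, s))" "of_degree (?T p s) 1 (?b1 (p, s))" "of_degree (?T p s) 1 (?b2 (p, s))"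
    if p: "p \<in> points E" and s: "s \<in> I" for p s
  proof -
    show "of_degree (?T p s) 1 (ds (p, s))" by (rule of_degree_1[OF p s])
    show "of_degree (?T p s) 1 (?u1 (p, s))" "of_degree (?T p s) 1 (?u2 (p, s))"
      unfolding u by (intro of_degree_add of_degree_scale of_degree_1[OF p s])+
    have q: "(p, s) \<in> points M" using p s by (simp add: points_M)
    have "pushforward H3 (\<pi> \<circ> fst) (p, s) X \<in> tangent_space H3 (\<pi> p)" if "X \<in> ?T p s" for X
      unfolding pushforward_pi_fst[OF p]
      by (rule pushforward_in_tangent_space[OF charted_E charted_H3 smooth_pi p])
        (use pushforward_in_tangent_space[OF charted_M charted_E smooth_fst q that] in simp)
    note H = of_degree_pullback[OF multilinear_on_of_degree[OF diff_form_multilinear[OF left_invariant_diff_form smooth_map_in_points[OF smooth_pi p]]] this]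
    show "of_degree (?T p s) 1 (?b0 (p, s))" "of_degree (?T p s) 1 (?b1 (p, s))" "of_degree (?T p s) 1 (?b2 (p, s))"
      using H[OF li(1)] H[OF li(2)] H[OF li(3)] by (simp_all add: pullback_def)
  qed
  have metric: "field_eq M g (\<lambda>q. let s = snd q in
         (s\<^sup>2 / (9 * (C\<^sup>2 - s^4))) \<odot> tsquare (ds q)
         + (C / s) \<odot> (tsquare (?u1 q) + tsquare (?u2 q))
         + (s\<^sup>2 * (C\<^sup>2 - s\<^sub>0^4) / (16 * C^4)) \<odot>
             (((C\<^sup>2 - s\<^sub>0^4) / (C\<^sup>2 - s^4)) powr (1/3) \<odot> tsquare (?b0 q)
              + (C / s * ((C\<^sup>2 - s^4) / (C\<^sup>2 - s\<^sub>0^4)) powr (1/3)) \<odot> (tsquare (?b1 q) + tsquare (?b2 q))))"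
  proof (rule field_eq_M_by_degree[where k=2], goal_cases)
    case (1 p s) then show ?case by (rule given_degrees)
  next
    case (2 p s) show ?case unfolding Let_def snd_conv
      by (intro of_degree_add of_degree_scale of_degree_products(2) o 2)
  next
    case (3 p s Xs)
    then obtain X Y where Xs: "Xs = [X, Y]" and X: "X \<in> ?T p s" "Y \<in> ?T p s"
      by (auto simp: numeral_2_eq_2 length_Suc_conv)
    note ps = 3(1,2)
    define c d where "c = (r s)\<^sup>2 / K" and "d = r s / K"
    note co = coefficient_identities[OF ps(2), folded K_def, folded c_def d_def, unfolded Q_def]
    note tp = tensor_prod_2[OF o(1)[OF ps] o(1)[OF ps] X] tensor_prod_2[OF o(2)[OF ps] o(2)[OF ps] X] tensor_prod_2[OF o(3)[OF ps] o(3)[OF ps] X]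
      tensor_prod_2[OF o(4)[OF ps] o(4)[OF ps] X] tensor_prod_2[OF o(5)[OF ps] o(5)[OF ps] X] tensor_prod_2[OF o(6)[OF ps] o(6)[OF ps] X]
    have "g (p, s) [X, Y] = 1 / (9 * D s) * (ds (p, s) [X] * ds (p, s) [Y]) + C / s * (?u1 (p, s) [X] * ?u1 (p, s) [Y] + ?u2 (p, s) [X] * ?u2 (p, s) [Y])
      + (d\<^sup>2 / D s * (?b0 (p, s) [X] * ?b0 (p, s) [Y]) + (C / s) * c\<^sup>2 / D s * (?b1 (p, s) [X] * ?b1 (p, s) [Y] + ?b2 (p, s) [X] * ?b2 (p, s) [Y]))"
    proof -
      have 1: "gUU s * (a1 (p, s) [X] * a1 (p, s) [Y]) + gVV s * (a2 (p, s) [X] * a2 (p, s) [Y])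
       + gUV s * (a1 (p, s) [X] * a2 (p, s) [Y] + a2 (p, s) [X] * a1 (p, s) [Y]) = C / s * c\<^sup>2 * (?b1 (p, s) [X] * ?b1 (p, s) [Y] + ?b2 (p, s) [X] * ?b2 (p, s) [Y])"
        using metric_frame[OF xz, where k="C / s" and ?u1.0="\<lambda>X. ?b1 (p, s) [X]" and ?u2.0="\<lambda>X. ?b2 (p, s) [X]" and X=X and Y=Y and y=y]
        unfolding G[OF ps(2)] ab[OF ps X(1), folded c_def] ab[OF ps X(2), folded c_def] by algebra
      have 2: "gUU s * (t1 (p, s) [X] * t1 (p, s) [Y]) + gVV s * (t2 (p, s) [X] * t2 (p, s) [Y])
       + gUV s * (t1 (p, s) [X] * t2 (p, s) [Y] + t2 (p, s) [X] * t1 (p, s) [Y]) = C / s * (?u1 (p, s) [X] * ?u1 (p, s) [Y] + ?u2 (p, s) [X] * ?u2 (p, s) [Y])"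
        unfolding G[OF ps(2)] tu by (rule metric_frame[OF xz])
      have 3: "a0 (p, s) [X] * a0 (p, s) [Y] = d\<^sup>2 * (?b0 (p, s) [X] * ?b0 (p, s) [Y])"
        unfolding ab(1)[OF ps X(1), folded d_def] ab(1)[OF ps X(2), folded d_def] by (simp add: power2_eq_square)
      show ?thesis
        unfolding g_value_general[OF ps X] 1 2 3 by (simp add: algebra_simps add_divide_distrib)
    qed
    then show ?case
      unfolding Xs Let_def snd_conv
      by (simp only: plus_fun_apply scale_apply tp distrib_left mult.assoc[symmetric] add.assoc[symmetric]
          co(1,2) co(3)[unfolded mult.assoc[symmetric]])
  qed
  have W: "(\<lambda>X. t1 (p, s) [X]) = (\<lambda>X. z * ?u1 (p, s) [X] - y * ?u2 (p, s) [X])" "(\<lambda>X. t2 (p, s) [X]) = (\<lambda>X. x * ?u2 (p, s) [X])" for p s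
    using tu by auto
  have sigma: "field_eq M \<sigma> (\<lambda>q. let s = snd q in
         (s\<^sup>2 / (12 * C\<^sup>2) * ((C\<^sup>2 - s\<^sub>0^4) / (C\<^sup>2 - s^4)) powr (2/3)) \<odot> (ds q \<^bold>\<and> ?b0 q)
         + s \<odot> (?u1 q \<^bold>\<and> ?u2 q)
         + ((C\<^sup>2 - s\<^sub>0^4) / (4 * C\<^sup>2) * ((C\<^sup>2 - s^4) / (C\<^sup>2 - s\<^sub>0^4)) powr (2/3)) \<odot> (?u2 q \<^bold>\<and> ?b1 q - ?u1 q \<^bold>\<and> ?b2 q)
         - (s^3 * (C\<^sup>2 - s\<^sub>0^4) / (16 * C^4) * ((C\<^sup>2 - s^4) / (C\<^sup>2 - s\<^sub>0^4)) powr (1/3)) \<odot> (?b1 q \<^bold>\<and> ?b2 q))"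
  proof (rule field_eq_M_by_degree[where k=2], goal_cases)
    case (1 p s) then show ?case by (rule given_degrees)
  next
    case (2 p s) show ?case unfolding Let_def snd_conv
      by (intro of_degree_add of_degree_diff of_degree_scale of_degree_products(1) o 2)
  next
    case (3 p s Xs)
    then obtain X Y where Xs: "Xs = [X, Y]" and X: "X \<in> ?T p s" "Y \<in> ?T p s"
      by (auto simp: numeral_2_eq_2 length_Suc_conv)
    note ps = 3(1,2) note o = o[OF ps]
    define c d where "c = (r s)\<^sup>2 / K" and "d = r s / K"
    note co = coefficient_identities[OF ps(2), folded K_def, folded c_def d_def, unfolded Q_def]
    note tp = wedge_W2[OF o(1) o(4) X] wedge_W2[OF o(2) o(3) X] wedge_W2[OF o(3) o(5) X] wedge_W2[OF o(2) o(6) X] wedge_W2[OF o(5) o(6) X]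
    have "\<sigma> (p, s) [X, Y] = sig s (D s) (\<lambda>X. ds (p, s) [X]) (\<lambda>X. z * ?u1 (p, s) [X] - y * ?u2 (p, s) [X]) (\<lambda>X. x * ?u2 (p, s) [X])
      (\<lambda>X. d * ?b0 (p, s) [X]) (\<lambda>X. c * (z * ?b1 (p, s) [X] - y * ?b2 (p, s) [X])) (\<lambda>X. c * (x * ?b2 (p, s) [X])) X Y"
      \<comment> \<open>The formulas in \<open>ab\<close> hold on tangent vectors only, so they are
        applied after expansion into values on X and Y.\<close>
      unfolding sigma_value[OF ps X] W unfolding sig_def W2_def c_def d_def by (simp only: ab[OF ps X(1)] ab[OF ps X(2)])
    then show ?case
      unfolding Xs Let_def snd_conv co(4,5,6) sig_frame[OF xz]
      by (simp add: scale_apply tp)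
  qed
  have psiv: "\<psi>p (p, s) [X, Y, Z] = psip s (D s) (C / s * x\<^sup>2) (C / s * (x * y)) (C / s * (y\<^sup>2 + z\<^sup>2)) (\<lambda>X. ds (p, s) [X]) (\<lambda>X. z * ?u1 (p, s) [X] - y * ?u2 (p, s) [X]) (\<lambda>X. x * ?u2 (p, s) [X])
      (\<lambda>X. r s / K * ?b0 (p, s) [X]) (\<lambda>X. (r s)\<^sup>2 / K * (z * ?b1 (p, s) [X] - y * ?b2 (p, s) [X])) (\<lambda>X. (r s)\<^sup>2 / K * (x * ?b2 (p, s) [X])) X Y Z"
    "\<psi>m (p, s) [X, Y, Z] = psim s (D s) (C / s * x\<^sup>2) (C / s * (x * y)) (C / s * (y\<^sup>2 + z\<^sup>2)) (\<lambda>X. ds (p, s) [X]) (\<lambda>X. z * ?u1 (p, s) [X] - y * ?u2 (p, s) [X]) (\<lambda>X. x * ?u2 (p, s) [X])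
      (\<lambda>X. r s / K * ?b0 (p, s) [X]) (\<lambda>X. (r s)\<^sup>2 / K * (z * ?b1 (p, s) [X] - y * ?b2 (p, s) [X])) (\<lambda>X. (r s)\<^sup>2 / K * (x * ?b2 (p, s) [X])) X Y Z"
    if ps: "p \<in> points E" "s \<in> I" and X: "X \<in> ?T p s" "Y \<in> ?T p s" "Z \<in> ?T p s" for p s X Y Z
    unfolding psi_value[OF ps X] W G[OF ps(2)]
    unfolding psip_def psim_def W3_def W2_def by (simp_all only: ab[OF ps X(1)] ab[OF ps X(2)] ab[OF ps X(3)])
  have psip: "field_eq M \<psi>p (\<lambda>q. let s = snd q in
         (1/3) \<odot> (ds q \<^bold>\<and> (?u1 q \<^bold>\<and> ?u2 q
           + (s^3 / (4 * C\<^sup>2) * ((C\<^sup>2 - s\<^sub>0^4) / (C\<^sup>2 - s^4)) powr (1/3)) \<odot> (?u1 q \<^bold>\<and> ?b2 q - ?u2 q \<^bold>\<and> ?b1 q)))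
         - ((C\<^sup>2 - s\<^sub>0^4) / (16 * C^4)) \<odot>
             ((s\<^sup>2 / 3 * ((C\<^sup>2 - s^4) / (C\<^sup>2 - s\<^sub>0^4)) powr (1/3)) \<odot> (ds q \<^bold>\<and> ?b1 q \<^bold>\<and> ?b2 q)
              + (C * s) \<odot> ((?u1 q \<^bold>\<and> ?b1 q + ?u2 q \<^bold>\<and> ?b2 q) \<^bold>\<and> ?b0 q)))"
  proof (rule field_eq_M_by_degree[where k=3], goal_cases)
    case (1 p s) then show ?case by (rule given_degrees)
  next
    case (2 p s) note o = o[OF 2]
    show ?case unfolding Let_def snd_conv
      by (intro of_degree_diff[OF of_degree_scale of_degree_scale] of_degree_products3(1)[OF o(1)] of_degree_add[OF of_degree_scale of_degree_scale]
        of_degree_products3(2)[OF o(6)] of_degree_products3(2)[OF o(4)] of_degree_add of_degree_diff of_degree_scale of_degree_products(1) o)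
  next
    case (3 p s Xs)
    then obtain X Y Z where Xs: "Xs = [X, Y, Z]" and X: "X \<in> ?T p s" "Y \<in> ?T p s" "Z \<in> ?T p s"
      by (auto simp: numeral_3_eq_3 length_Suc_conv)
    note ps = 3(1,2) note o = o[OF ps]
    define c d where "c = (r s)\<^sup>2 / K" and "d = r s / K"
    note co = coefficient_identities[OF ps(2), folded K_def, folded c_def d_def, unfolded Q_def]
    note f2 = of_degree_add of_degree_diff of_degree_scale of_degree_products(1) o
    note w2 = wedge_W2[OF o(2) o(3)] wedge_W2[OF o(2) o(6)] wedge_W2[OF o(3) o(5)] wedge_W2[OF o(1) o(5)] wedge_W2[OF o(2) o(5)] wedge_W2[OF o(3) o(6)]
    have D0: "D s \<noteq> 0" using D_pos[OF ps(2)] by simp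
    have w3: "(ds (p, s) \<^bold>\<and> (?u1 (p, s) \<^bold>\<and> ?u2 (p, s) + k \<odot> (?u1 (p, s) \<^bold>\<and> ?b2 (p, s) - ?u2 (p, s) \<^bold>\<and> ?b1 (p, s)))) [X, Y, Z] =
        V (\<lambda>X. ds (p, s) [X]) (W2 (\<lambda>X. ?u1 (p, s) [X]) (\<lambda>X. ?u2 (p, s) [X])) X Y Z
        + k * (V (\<lambda>X. ds (p, s) [X]) (W2 (\<lambda>X. ?u1 (p, s) [X]) (\<lambda>X. ?b2 (p, s) [X])) X Y Z - V (\<lambda>X. ds (p, s) [X]) (W2 (\<lambda>X. ?u2 (p, s) [X]) (\<lambda>X. ?b1 (p, s) [X])) X Y Z)" for k
    proof -
      have "of_degree (?T p s) 2 (?u1 (p, s) \<^bold>\<and> ?u2 (p, s) + k \<odot> (?u1 (p, s) \<^bold>\<and> ?b2 (p, s) - ?u2 (p, s) \<^bold>\<and> ?b1 (p, s)))" by (intro f2)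
      from wedge_V(1)[OF o(1) this X] show ?thesis by (simp add: V_def scale_apply w2 X) (simp add: algebra_simps)
    qed
    \<comment> \<open>The product associates to the left, so its two-form factor is ds \<and> b1.
      Passing through \<open>W3\<close> regroups the factors with ds in front.\<close>
    have w4: "(ds (p, s) \<^bold>\<and> ?b1 (p, s) \<^bold>\<and> ?b2 (p, s)) [X, Y, Z] = V (\<lambda>X. ds (p, s) [X]) (W2 (\<lambda>X. ?b1 (p, s) [X]) (\<lambda>X. ?b2 (p, s) [X])) X Y Z"
    proof -
      have "of_degree (?T p s) 2 (ds (p, s) \<^bold>\<and> ?b1 (p, s))" by (intro f2)
      from wedge_V(2)[OF o(6) this X] show ?thesis
        unfolding trans[OF W3_V[symmetric, of "\<lambda>X. ds (p, s) [X]"] W3_V'] by (simp add: V_def w2 X)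
    qed
    have w5: "((?u1 (p, s) \<^bold>\<and> ?b1 (p, s) + ?u2 (p, s) \<^bold>\<and> ?b2 (p, s)) \<^bold>\<and> ?b0 (p, s)) [X, Y, Z] =
       V (\<lambda>X. ?b0 (p, s) [X]) (W2 (\<lambda>X. ?u1 (p, s) [X]) (\<lambda>X. ?b1 (p, s) [X])) X Y Z + V (\<lambda>X. ?b0 (p, s) [X]) (W2 (\<lambda>X. ?u2 (p, s) [X]) (\<lambda>X. ?b2 (p, s) [X])) X Y Z"
    proof -
      have "of_degree (?T p s) 2 (?u1 (p, s) \<^bold>\<and> ?b1 (p, s) + ?u2 (p, s) \<^bold>\<and> ?b2 (p, s))" by (intro f2)
      from wedge_V(2)[OF o(4) this X] show ?thesis by (simp add: V_def w2 X) (simp add: algebra_simps)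
    qed
    show ?case
      unfolding Xs psiv(1)[OF ps X, folded c_def d_def] psi_frame(1)[OF xz D0] Let_def snd_conv co(7,8,9)[symmetric]
      by (simp only: plus_fun_apply minus_apply scale_apply w3 w4 w5) (simp only: algebra_simps)
  qed
  have psim: "field_eq M \<psi>m (\<lambda>q. let s = snd q in
         (s / (12 * C) * ((C\<^sup>2 - s\<^sub>0^4) / (C\<^sup>2 - s^4)) powr (1/3)) \<odot> (ds q \<^bold>\<and> (?u1 q \<^bold>\<and> ?b1 q + ?u2 q \<^bold>\<and> ?b2 q))
         + ((C\<^sup>2 - s\<^sub>0^4) / (4 * C\<^sup>2) * ((C\<^sup>2 - s^4) / (C\<^sup>2 - s\<^sub>0^4)) powr (1/3)) \<odot> (?u1 q \<^bold>\<and> ?u2 q \<^bold>\<and> ?b0 q)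
         + (s\<^sup>2 * (C\<^sup>2 - s\<^sub>0^4) / (16 * C^4)) \<odot>
             ((s \<odot> (?u1 q \<^bold>\<and> ?b2 q - ?u2 q \<^bold>\<and> ?b1 q)
               - ((C\<^sup>2 - s\<^sub>0^4) powr (1/3) * (C\<^sup>2 - s^4) powr (2/3) / (4 * C\<^sup>2)) \<odot> (?b1 q \<^bold>\<and> ?b2 q)) \<^bold>\<and> ?b0 q))"
  proof (rule field_eq_M_by_degree[where k=3], goal_cases)
    case (1 p s) then show ?case by (rule given_degrees)
  next
    case (2 p s) note o = o[OF 2]
    show ?case unfolding Let_def snd_conv
      by (intro of_degree_add[OF of_degree_add[OF of_degree_scale of_degree_scale] of_degree_scale] of_degree_products3(1)[OF o(1)]
        of_degree_products3(2)[OF o(4)] of_degree_add of_degree_diff of_degree_scale of_degree_products(1) o)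
  next
    case (3 p s Xs)
    then obtain X Y Z where Xs: "Xs = [X, Y, Z]" and X: "X \<in> ?T p s" "Y \<in> ?T p s" "Z \<in> ?T p s"
      by (auto simp: numeral_3_eq_3 length_Suc_conv)
    note ps = 3(1,2) note o = o[OF ps]
    define c d where "c = (r s)\<^sup>2 / K" and "d = r s / K"
    note co = coefficient_identities[OF ps(2), folded K_def, folded c_def d_def, unfolded Q_def]
    note f2 = of_degree_add of_degree_diff of_degree_scale of_degree_products(1) o
    note w2 = wedge_W2[OF o(2) o(3)] wedge_W2[OF o(2) o(6)] wedge_W2[OF o(3) o(5)] wedge_W2[OF o(5) o(6)] wedge_W2[OF o(2) o(5)] wedge_W2[OF o(3) o(6)]
    have D0: "D s \<noteq> 0" using D_pos[OF ps(2)] by simp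
    have w3: "(ds (p, s) \<^bold>\<and> (?u1 (p, s) \<^bold>\<and> ?b1 (p, s) + ?u2 (p, s) \<^bold>\<and> ?b2 (p, s))) [X, Y, Z] =
       V (\<lambda>X. ds (p, s) [X]) (W2 (\<lambda>X. ?u1 (p, s) [X]) (\<lambda>X. ?b1 (p, s) [X])) X Y Z + V (\<lambda>X. ds (p, s) [X]) (W2 (\<lambda>X. ?u2 (p, s) [X]) (\<lambda>X. ?b2 (p, s) [X])) X Y Z"
    proof -
      have "of_degree (?T p s) 2 (?u1 (p, s) \<^bold>\<and> ?b1 (p, s) + ?u2 (p, s) \<^bold>\<and> ?b2 (p, s))" by (intro f2)
      from wedge_V(1)[OF o(1) this X] show ?thesis by (simp add: V_def w2 X) (simp add: algebra_simps)
    qed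
    have w4: "(?u1 (p, s) \<^bold>\<and> ?u2 (p, s) \<^bold>\<and> ?b0 (p, s)) [X, Y, Z] = V (\<lambda>X. ?b0 (p, s) [X]) (W2 (\<lambda>X. ?u1 (p, s) [X]) (\<lambda>X. ?u2 (p, s) [X])) X Y Z"
    proof -
      have "of_degree (?T p s) 2 (?u1 (p, s) \<^bold>\<and> ?u2 (p, s))" by (intro f2)
      from wedge_V(2)[OF o(4) this X] show ?thesis by (simp add: V_def w2 X)
    qed
    have w5: "((a \<odot> (?u1 (p, s) \<^bold>\<and> ?b2 (p, s) - ?u2 (p, s) \<^bold>\<and> ?b1 (p, s)) - b \<odot> (?b1 (p, s) \<^bold>\<and> ?b2 (p, s))) \<^bold>\<and> ?b0 (p, s)) [X, Y, Z] =
        a * (V (\<lambda>X. ?b0 (p, s) [X]) (W2 (\<lambda>X. ?u1 (p, s) [X]) (\<lambda>X. ?b2 (p, s) [X])) X Y Z - V (\<lambda>X. ?b0 (p, s) [X]) (W2 (\<lambda>X. ?u2 (p, s) [X]) (\<lambda>X. ?b1 (p, s) [X])) X Y Z)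
        - b * V (\<lambda>X. ?b0 (p, s) [X]) (W2 (\<lambda>X. ?b1 (p, s) [X]) (\<lambda>X. ?b2 (p, s) [X])) X Y Z" for a b
    proof -
      have "of_degree (?T p s) 2 (a \<odot> (?u1 (p, s) \<^bold>\<and> ?b2 (p, s) - ?u2 (p, s) \<^bold>\<and> ?b1 (p, s)) - b \<odot> (?b1 (p, s) \<^bold>\<and> ?b2 (p, s)))" by (intro f2)
      from wedge_V(2)[OF o(4) this X] show ?thesis by (simp add: V_def scale_apply w2 X) (simp add: algebra_simps)
    qed
    have "\<psi>m (p, s) [X, Y, Z] = s / (12 * C) * ((C\<^sup>2 - s\<^sub>0^4) / (C\<^sup>2 - s^4)) powr (1/3) *
        (V (\<lambda>X. ds (p, s) [X]) (W2 (\<lambda>X. ?u1 (p, s) [X]) (\<lambda>X. ?b1 (p, s) [X])) X Y Z + V (\<lambda>X. ds (p, s) [X]) (W2 (\<lambda>X. ?u2 (p, s) [X]) (\<lambda>X. ?b2 (p, s) [X])) X Y Z)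
      + (C\<^sup>2 - s\<^sub>0^4) / (4 * C\<^sup>2) * ((C\<^sup>2 - s^4) / (C\<^sup>2 - s\<^sub>0^4)) powr (1/3) * V (\<lambda>X. ?b0 (p, s) [X]) (W2 (\<lambda>X. ?u1 (p, s) [X]) (\<lambda>X. ?u2 (p, s) [X])) X Y Z
      + s\<^sup>2 * (C\<^sup>2 - s\<^sub>0^4) / (16 * C^4) * s * (V (\<lambda>X. ?b0 (p, s) [X]) (W2 (\<lambda>X. ?u1 (p, s) [X]) (\<lambda>X. ?b2 (p, s) [X])) X Y Z - V (\<lambda>X. ?b0 (p, s) [X]) (W2 (\<lambda>X. ?u2 (p, s) [X]) (\<lambda>X. ?b1 (p, s) [X])) X Y Z)
      - s\<^sup>2 * (C\<^sup>2 - s\<^sub>0^4) / (16 * C^4) * ((C\<^sup>2 - s\<^sub>0^4) powr (1/3) * (C\<^sup>2 - s^4) powr (2/3) / (4 * C\<^sup>2)) * V (\<lambda>X. ?b0 (p, s) [X]) (W2 (\<lambda>X. ?b1 (p, s) [X]) (\<lambda>X. ?b2 (p, s) [X])) X Y Z"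
      unfolding psiv(2)[OF ps X, folded c_def d_def] psi_frame(2)[OF xz D0] co(10,11,12,13) ..
    then show ?case
      unfolding Xs Let_def snd_conv
      by (simp only: plus_fun_apply minus_apply scale_apply w3 w4 w5) (simp only: algebra_simps)
  qed
  show ?thesis
    by (rule exI[of _ \<sigma>0], rule exI[of _ \<sigma>1], rule exI[of _ \<sigma>2], rule exI[of _ A], unfold Let_def,
        intro conjI basis st detA metric[unfolded Let_def] sigma[unfolded Let_def] psip[unfolded Let_def] psim[unfolded Let_def])
qed

end

theorem proposition6p2:
  fixes E :: "('e, real^5) manifold"
    and \<pi> :: "'e \<Rightarrow> real^3^3"
    and act :: "'e \<Rightarrow> complex \<times> complex \<Rightarrow> 'e"
    and f s\<^sub>0 \<epsilon> C :: real
    and \<alpha>0 \<alpha>1 \<alpha>2 :: "real \<Rightarrow> (real^3^3) field"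
    and gUU gUV gVV h :: "real \<Rightarrow> real"
    and \<theta>1 \<theta>2 :: "real \<Rightarrow> 'e field"
    and g \<sigma> \<psi>p \<psi>m :: "('e \<times> real) field"
    and M :: "('e \<times> real, (real^5) \<times> real) manifold"
    and D :: "real \<Rightarrow> real"
    and ds t1 t2 a0 a1 a2 :: "('e \<times> real) field"
    and J :: "'e \<times> real \<Rightarrow> ('e \<times> real) tvec \<Rightarrow> ('e \<times> real) tvec"
  assumes principal: "principal_T2_bundle E \<pi> act"
    and eps: "0 < \<epsilon>" "\<epsilon> < s\<^sub>0"
    and f: "f > 4"
    and alpha_basis: "\<And>s. s \<in> {s\<^sub>0-\<epsilon><..<s\<^sub>0+\<epsilon>} \<Longrightarrow> left_invariant_basis (\<alpha>0 s) (\<alpha>1 s) (\<alpha>2 s)"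
    and alpha_smooth: "smooth_family H3 (s\<^sub>0-\<epsilon>) (s\<^sub>0+\<epsilon>) 1 \<alpha>0"
      "smooth_family H3 (s\<^sub>0-\<epsilon>) (s\<^sub>0+\<epsilon>) 1 \<alpha>1"
      "smooth_family H3 (s\<^sub>0-\<epsilon>) (s\<^sub>0+\<epsilon>) 1 \<alpha>2"
    and g_smooth: "smooth_on {s\<^sub>0-\<epsilon><..<s\<^sub>0+\<epsilon>} gUU" "smooth_on {s\<^sub>0-\<epsilon><..<s\<^sub>0+\<epsilon>} gUV"
      "smooth_on {s\<^sub>0-\<epsilon><..<s\<^sub>0+\<epsilon>} gVV"
    and g_pos_def: "\<And>s x y. s \<in> {s\<^sub>0-\<epsilon><..<s\<^sub>0+\<epsilon>} \<Longrightarrow> (x, y) \<noteq> (0, 0) \<Longrightarrow>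
      gUU s * x\<^sup>2 + 2 * gUV s * x * y + gVV s * y\<^sup>2 > 0"
    and h: "\<And>s. s \<in> {s\<^sub>0-\<epsilon><..<s\<^sub>0+\<epsilon>} \<Longrightarrow> h s > 0"
      "\<And>s. s \<in> {s\<^sub>0-\<epsilon><..<s\<^sub>0+\<epsilon>} \<Longrightarrow> (h s)\<^sup>2 = gUU s * gVV s - (gUV s)\<^sup>2"
      "\<And>s. s \<in> {s\<^sub>0-\<epsilon><..<s\<^sub>0+\<epsilon>} \<Longrightarrow> (h s)\<^sup>2 > s\<^sup>2"
    and theta_connection: "\<And>s. s \<in> {s\<^sub>0-\<epsilon><..<s\<^sub>0+\<epsilon>} \<Longrightarrow> connection_form E act (\<theta>1 s) (\<theta>2 s)"
    and theta_smooth: "smooth_family E (s\<^sub>0-\<epsilon>) (s\<^sub>0+\<epsilon>) 1 \<theta>1"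
      "smooth_family E (s\<^sub>0-\<epsilon>) (s\<^sub>0+\<epsilon>) 1 \<theta>2"
    and initial_alpha:
      "field_eq H3 (ext_deriv H3 (\<alpha>0 s\<^sub>0)) (\<lambda>p. f \<odot> (\<alpha>1 s\<^sub>0 p \<^bold>\<and> \<alpha>2 s\<^sub>0 p))"
      "field_eq H3 (\<lambda>p. ext_deriv H3 (\<alpha>1 s\<^sub>0) p \<^bold>\<and> \<alpha>0 s\<^sub>0 p) (\<lambda>p. 0)"
      "field_eq H3 (\<lambda>p. ext_deriv H3 (\<alpha>2 s\<^sub>0) p \<^bold>\<and> \<alpha>0 s\<^sub>0 p) (\<lambda>p. 0)"
    and initial_s: "s\<^sub>0 = (1 - 4 / f) powr (1/2) * h s\<^sub>0"
    and initial_theta: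
      "field_eq E (\<lambda>p. s\<^sub>0 \<odot> ext_deriv E (\<theta>1 s\<^sub>0) p)
        (pullback H3 \<pi> (\<lambda>x. ext_deriv H3 (\<alpha>1 s\<^sub>0) x
           - (3 / ((h s\<^sub>0)\<^sup>2 - s\<^sub>0\<^sup>2)) \<odot> ((gUV s\<^sub>0 \<odot> \<alpha>1 s\<^sub>0 x + gVV s\<^sub>0 \<odot> \<alpha>2 s\<^sub>0 x) \<^bold>\<and> \<alpha>0 s\<^sub>0 x)))"
      "field_eq E (\<lambda>p. s\<^sub>0 \<odot> ext_deriv E (\<theta>2 s\<^sub>0) p)
        (pullback H3 \<pi> (\<lambda>x. ext_deriv H3 (\<alpha>2 s\<^sub>0) x
           + (3 / ((h s\<^sub>0)\<^sup>2 - s\<^sub>0\<^sup>2)) \<odot> ((gUU s\<^sub>0 \<odot> \<alpha>1 s\<^sub>0 x + gUV s\<^sub>0 \<odot> \<alpha>2 s\<^sub>0 x) \<^bold>\<and> \<alpha>0 s\<^sub>0 x)))"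
    and M: "M = E \<times>\<^sub>M\<^sub>f interval (s\<^sub>0-\<epsilon>) (s\<^sub>0+\<epsilon>)"
    and D: "D = (\<lambda>s. (h s)\<^sup>2 - s\<^sup>2)"
    and ds: "ds = differential snd"
    and t: "t1 = pullback_family E fst \<theta>1" "t2 = pullback_family E fst \<theta>2"
    and a: "a0 = pullback_family H3 (\<pi> \<circ> fst) \<alpha>0"
      "a1 = pullback_family H3 (\<pi> \<circ> fst) \<alpha>1"
      "a2 = pullback_family H3 (\<pi> \<circ> fst) \<alpha>2"
    and nearly_Kaehler: "nearly_Kaehler M g J \<sigma> \<psi>p \<psi>m"
    and g_eq: "field_eq M g (\<lambda>q. let s = snd q in
      (1 / (9 * D s)) \<odot> tsquare (ds q)
      + gUU s \<odot> tsquare (t1 q) + gVV s \<odot> tsquare (t2 q) + gUV s \<odot> (t1 q \<otimes> t2 q + t2 q \<otimes> t1 q)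
      + (1 / D s) \<odot> (tsquare (a0 q) + gUU s \<odot> tsquare (a1 q) + gVV s \<odot> tsquare (a2 q)
                    + gUV s \<odot> (a1 q \<otimes> a2 q + a2 q \<otimes> a1 q)))"
    and sigma_eq: "field_eq M \<sigma> (\<lambda>q. let s = snd q in
      (1 / (3 * D s)) \<odot> (ds q \<^bold>\<and> a0 q) + s \<odot> (t1 q \<^bold>\<and> t2 q) - t1 q \<^bold>\<and> a2 q + t2 q \<^bold>\<and> a1 q - (s / D s) \<odot> (a1 q \<^bold>\<and> a2 q))"
    and psip_eq: "field_eq M \<psi>p (\<lambda>q. let s = snd q in
      (1 / (3 * D s)) \<odot> (ds q \<^bold>\<and> (D s \<odot> (t1 q \<^bold>\<and> t2 q) + s \<odot> (t1 q \<^bold>\<and> a2 q - t2 q \<^bold>\<and> a1 q) - a1 q \<^bold>\<and> a2 q))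
      - (1 / D s) \<odot> ((t1 q \<^bold>\<and> (gUU s \<odot> a1 q + gUV s \<odot> a2 q) + t2 q \<^bold>\<and> (gUV s \<odot> a1 q + gVV s \<odot> a2 q)) \<^bold>\<and> a0 q))"
    and psim_eq: "field_eq M \<psi>m (\<lambda>q. let s = snd q in
      (1 / (3 * D s)) \<odot> (ds q \<^bold>\<and> (t1 q \<^bold>\<and> (gUU s \<odot> a1 q + gUV s \<odot> a2 q) + t2 q \<^bold>\<and> (gUV s \<odot> a1 q + gVV s \<odot> a2 q)))
      + (1 / D s) \<odot> ((D s \<odot> (t1 q \<^bold>\<and> t2 q) + s \<odot> (t1 q \<^bold>\<and> a2 q - t2 q \<^bold>\<and> a1 q) - a1 q \<^bold>\<and> a2 q) \<^bold>\<and> a0 q))"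
    and C: "C = s\<^sub>0 * h s\<^sub>0"
  shows "\<exists>\<sigma>0 \<sigma>1 \<sigma>2. \<exists>A::real^2^2.
    left_invariant_basis \<sigma>0 \<sigma>1 \<sigma>2 \<and>
    field_eq H3 (ext_deriv H3 \<sigma>0) (\<lambda>p. \<sigma>1 p \<^bold>\<and> \<sigma>2 p) \<and>
    field_eq H3 (ext_deriv H3 \<sigma>1) (\<lambda>p. 0) \<and>
    field_eq H3 (ext_deriv H3 \<sigma>2) (\<lambda>p. 0) \<and>
    det A = 1 \<and>
    (let u1 = pullback_family E fst (\<lambda>s p. A$1$1 \<odot> \<theta>1 s p + A$1$2 \<odot> \<theta>2 s p);
         u2 = pullback_family E fst (\<lambda>s p. A$2$1 \<odot> \<theta>1 s p + A$2$2 \<odot> \<theta>2 s p);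
         b0 = pullback H3 (\<pi> \<circ> fst) \<sigma>0; b1 = pullback H3 (\<pi> \<circ> fst) \<sigma>1; b2 = pullback H3 (\<pi> \<circ> fst) \<sigma>2;
         Q = (\<lambda>s. C\<^sup>2 - s^4); Q0 = C\<^sup>2 - s\<^sub>0^4
     in
       field_eq M g (\<lambda>q. let s = snd q in
         (s\<^sup>2 / (9 * Q s)) \<odot> tsquare (ds q)
         + (C / s) \<odot> (tsquare (u1 q) + tsquare (u2 q))
         + (s\<^sup>2 * Q0 / (16 * C^4)) \<odot>
             ((Q0 / Q s) powr (1/3) \<odot> tsquare (b0 q)
              + (C / s * (Q s / Q0) powr (1/3)) \<odot> (tsquare (b1 q) + tsquare (b2 q)))) \<and>
       field_eq M \<sigma> (\<lambda>q. let s = snd q in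
         (s\<^sup>2 / (12 * C\<^sup>2) * (Q0 / Q s) powr (2/3)) \<odot> (ds q \<^bold>\<and> b0 q)
         + s \<odot> (u1 q \<^bold>\<and> u2 q)
         + (Q0 / (4 * C\<^sup>2) * (Q s / Q0) powr (2/3)) \<odot> (u2 q \<^bold>\<and> b1 q - u1 q \<^bold>\<and> b2 q)
         - (s^3 * Q0 / (16 * C^4) * (Q s / Q0) powr (1/3)) \<odot> (b1 q \<^bold>\<and> b2 q)) \<and>
       field_eq M \<psi>p (\<lambda>q. let s = snd q in
         (1/3) \<odot> (ds q \<^bold>\<and> (u1 q \<^bold>\<and> u2 q
           + (s^3 / (4 * C\<^sup>2) * (Q0 / Q s) powr (1/3)) \<odot> (u1 q \<^bold>\<and> b2 q - u2 q \<^bold>\<and> b1 q)))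
         - (Q0 / (16 * C^4)) \<odot>
             ((s\<^sup>2 / 3 * (Q s / Q0) powr (1/3)) \<odot> (ds q \<^bold>\<and> b1 q \<^bold>\<and> b2 q)
              + (C * s) \<odot> ((u1 q \<^bold>\<and> b1 q + u2 q \<^bold>\<and> b2 q) \<^bold>\<and> b0 q))) \<and>
       field_eq M \<psi>m (\<lambda>q. let s = snd q in
         (s / (12 * C) * (Q0 / Q s) powr (1/3)) \<odot> (ds q \<^bold>\<and> (u1 q \<^bold>\<and> b1 q + u2 q \<^bold>\<and> b2 q))
         + (Q0 / (4 * C\<^sup>2) * (Q s / Q0) powr (1/3)) \<odot> (u1 q \<^bold>\<and> u2 q \<^bold>\<and> b0 q)
         + (s\<^sup>2 * Q0 / (16 * C^4)) \<odot>
             ((s \<odot> (u1 q \<^bold>\<and> b2 q - u2 q \<^bold>\<and> b1 q)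
               - (Q0 powr (1/3) * Q s powr (2/3) / (4 * C\<^sup>2)) \<odot> (b1 q \<^bold>\<and> b2 q)) \<^bold>\<and> b0 q)))"
proof -
  interpret nk: nearly_Kaehler_over_H3 E \<pi> act s\<^sub>0 \<epsilon> \<alpha>0 \<alpha>1 \<alpha>2 gUU gUV gVV h \<theta>1 \<theta>2 g \<sigma> \<psi>p \<psi>m
    M D ds t1 t2 a0 a1 a2 J
    by (unfold_locales; fact principal eps alpha_basis alpha_smooth g_smooth g_pos_def h theta_connection theta_smooth
        initial_theta M D ds t a nearly_Kaehler g_eq sigma_eq psip_eq psim_eq)
  show ?thesis
    using nk.standard_form unfolding nk.C_def C[symmetric] .
qed

end
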